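(* Let $L,M,t\ge1$ be integers and let $\psi$, $\varrho$ be Dirichlet characters mod $L$ and $M$ respectively with $\psi(-1)\varrho(-1)=-1$. Put $$c_1^+(0,t,\psi,\varrho):=\begin{cases}2L'(1,\varrho), & \text{if } \psi=\mathbf{1}_1,\\ 2\pi i\big(\log(2tM)L(0,\overline{\psi})-L'(0,\overline{\psi})\big)\prod_{p\mid M}(1-p^{-1}), & \text{if } \varrho=\mathbf{1}_M,\\ 0, & \text{otherwise},\end{cases}$$ and for $n>0$ put $$c_1^+(n,t,\psi,\varrho):=-\frac{2\pi i}{M}W(\varrho^0)\Bigg(\sigma_0^{\overline{\psi},\overline{\varrho}}\!\left(\frac{n}{t}\right)\left(\log\!\left(\frac{\pi}{M^2}\right)+\gamma-\log(n)\right)+2\sum_{0<c\mid \frac{n}{t}}\overline{\psi}\!\left(\frac{n}{tc}\right)\log(c)\sum_{0<d\mid\gcd(\ell_\varrho,c)}d\,\mu\!\left(\frac{\ell_\varrho}{d}\right)\varrho^0\!\left(\frac{\ell_\varrho}{d}\right)\overline{\varrho^0}\!\left(\frac{c}{d}\right)\Bigg),$$ where the last sum is zero if $t\nmid n$. Then the series $G_1^{\psi,\varrho,t}(z):=\sum_{n=0}^\infty c_1^+(n,t,\psi,\varrho)q^n$ is a mock modular form of weight $1$, level $tLM$ and character $\overline{\psi\varrho}$ with shadow $E_1^{\psi,\varrho,t}(z)$.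
   Context: Notation: $\mathbb{H}$ upper half-plane, $z=x+iy$, $q=e^{2\pi iz}$, $\gamma$ is Euler's constant, $\mu$ the Möbius function, $\Gamma_0(N)=\{\pm\left(\begin{smallmatrix}a&b\\c&d\end{smallmatrix}\right)\in\mathrm{PSL}_2(\mathbb{Z}):N\mid c\}$. A function $f$ on $\mathbb{H}$ transforms with weight $1$, level $N$, character $\chi$ if $f(\gamma z)=\chi(d)(cz+d)f(z)$ for all $\gamma\in\Gamma_0(N)$. $H_1(N,\chi)$ is the space of real-analytic $F:\mathbb{H}\to\mathbb{C}$ transforming with weight $1$, level $N$, character $\chi$, with $\Delta_1F=0$ where $\Delta_1=y^2(\partial_x^2+\partial_y^2)-iy(\partial_x+i\partial_y)$, at most linear exponential growth at cusps, and $\xi_1F$ holomorphic at every cusp, where $\xi_1=2iy\overline{\partial_{\bar z}}$. Each such $F$ has expansion $F=\sum_{n\ge n_0}c^+(n)q^n-\sum_{n\ge0}\overline{c(n)}\beta_1(n,y)q^{-n}$ with $\beta_1(n,y)=\int_y^\infty e^{-4\pi nu}u^{-1}du$ ($n>0$), $\beta_1(0,y)=-\log y$, and $\xi_1F=\sum c(n)q^n$. A series $g$ is a mock modular form of weight $1$, level $N$, character $\chi$ with shadow $f$ if $g=\sum_{n\ge n_0}c^+(n)q^n$ is the holomorphic part of some $F\in H_1(N,\chi)$ with $\xi_1F=f$. Characters: $\mathbf{1}_N$ trivial mod $N$; for $\chi$ mod $N$, $\chi^0$ the primitive character inducing $\chi$, $m_\chi$ its conductor, $\ell_\chi=N/m_\chi$,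 $W(\chi^0)=\sum_{n=1}^{m_\chi}\chi^0(n)e^{2\pi in/m_\chi}$, $L(s,\chi)$ the (continued) Dirichlet $L$-function. Arithmetic functions vanish at arguments that are not positive integers. For $\psi$ mod $L$, $\varrho$ mod $M$, $$\sigma_0^{\psi,\varrho}(n):=\sum_{0<c\mid n}\psi\!\left(\tfrac nc\right)\sum_{0<d\mid\gcd(\ell_\varrho,c)}d\,\mu\!\left(\tfrac{\ell_\varrho}{d}\right)\overline{\varrho^0}\!\left(\tfrac{\ell_\varrho}{d}\right)\varrho^0\!\left(\tfrac cd\right).$$ Let $C_1(\psi,\varrho):=L(1,\overline\varrho)$ if $\psi=\mathbf{1}_1$ and $0$ otherwise; $D(\psi,\varrho):=-\pi iL(0,\psi)\prod_{p\mid M}(1-p^{-1})$ if $\varrho=\mathbf{1}_M$ and $0$ otherwise. Define $E_1^{\psi,\varrho}(z):=C_1(\psi,\varrho)+D(\psi,\varrho)-\frac{2\pi i}{M}W(\overline{\varrho^0})\sum_{n\ge1}\sigma_0^{\psi,\varrho}(n)q^n$ and $E_1^{\psi,\varrho,t}(z):=E_1^{\psi,\varrho}(tz)$, a holomorphic modular form of weight $1$, level $tLM$, character $\psi\varrho$. *)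

theory Defs
  imports
    "HOL-Complex_Analysis.Complex_Analysis"
    "HOL-Computational_Algebra.Computational_Algebra"
begin

section \<open>Dirichlet characters\<close>

text \<open>A Dirichlet character mod \<open>N \<ge> 1\<close> is viewed as a function on all integers that vanishes
  exactly at the integers not coprime to \<open>N\<close>.\<close>

definition dirichlet_character :: "nat \<Rightarrow> (int \<Rightarrow> complex) \<Rightarrow> bool" where
  "dirichlet_character N chi \<longleftrightarrow>
     (\<forall>a b. chi (a * b) = chi a * chi b) \<and>
     (\<forall>a. chi (a + int N) = chi a) \<and>
     (\<forall>a. chi a \<noteq> 0 \<longleftrightarrow> coprime a (int N))"

definition trivial_character :: "nat \<Rightarrow> int \<Rightarrow> complex" where
  "trivial_character N a = (if coprime a (int N) then 1 else 0)"

definition conj_character :: "(int \<Rightarrow> complex) \<Rightarrow> int \<Rightarrow> complex" where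
  "conj_character chi a = cnj (chi a)"

definition induces :: "nat \<Rightarrow> (int \<Rightarrow> complex) \<Rightarrow> nat \<Rightarrow> (int \<Rightarrow> complex) \<Rightarrow> bool" where
  "induces m chi1 N chi \<longleftrightarrow>
     m dvd N \<and> dirichlet_character m chi1 \<and> (\<forall>a. coprime a (int N) \<longrightarrow> chi a = chi1 a)"

definition conductor :: "nat \<Rightarrow> (int \<Rightarrow> complex) \<Rightarrow> nat" where
  "conductor N chi = (LEAST m. \<exists>chi1. induces m chi1 N chi)"

definition primitive_character :: "nat \<Rightarrow> (int \<Rightarrow> complex) \<Rightarrow> bool" where
  "primitive_character m chi \<longleftrightarrow> dirichlet_character m chi \<and> conductor m chi = m"

definition inducing_primitive :: "nat \<Rightarrow> (int \<Rightarrow> complex) \<Rightarrow> int \<Rightarrow> complex" where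
  "inducing_primitive N chi =
     (THE chi1. primitive_character (conductor N chi) chi1 \<and> induces (conductor N chi) chi1 N chi)"

definition conductor_index :: "nat \<Rightarrow> (int \<Rightarrow> complex) \<Rightarrow> nat" where
  "conductor_index N chi = N div conductor N chi"

definition gauss_sum :: "nat \<Rightarrow> (int \<Rightarrow> complex) \<Rightarrow> complex" where
  "gauss_sum m chi = (\<Sum>n = 1..m. chi (int n) * exp (2 * of_real pi * \<i> * of_nat n / of_nat m))"

text \<open>The continued Dirichlet \<open>L\<close>-function. By the identity theorem there is at most one function
  as below: \<open>nicely_meromorphic_on\<close> fixes the values at removable singularities, and at poles
  (only \<open>s = 1\<close> for principal \<open>chi\<close>) it prescribes the value \<open>0\<close>.\<close>

definition dirichlet_L :: "(int \<Rightarrow> complex) \<Rightarrow> complex \<Rightarrow> complex" where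
  "dirichlet_L chi =
     (THE f. f nicely_meromorphic_on UNIV \<and>
        (\<forall>s. Re s > 1 \<longrightarrow> (\<lambda>n. chi (int (Suc n)) * of_nat (Suc n) powr (- s)) sums f s))"

definition moebius_mu :: "nat \<Rightarrow> int" where
  "moebius_mu n = (if squarefree n then (- 1) ^ card (prime_factors n) else 0)"


section \<open>Harmonic Maass forms and mock modular forms of weight 1\<close>

definition upper_half_plane :: "complex set" where
  "upper_half_plane = {z. Im z > 0}"

definition qpow :: "int \<Rightarrow> complex \<Rightarrow> complex" where
  "qpow n z = exp (2 * of_real pi * \<i> * of_int n * z)"

definition slash1 :: "int \<Rightarrow> int \<Rightarrow> int \<Rightarrow> int \<Rightarrow> (complex \<Rightarrow> complex) \<Rightarrow> complex \<Rightarrow> complex" where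
  "slash1 a b c d f z =
     f ((of_int a * z + of_int b) / (of_int c * z + of_int d)) / (of_int c * z + of_int d)"

text \<open>The condition is required of all matrices in \<open>SL\<^sub>2\<close> with \<open>N\<close> dividing \<open>c\<close>, that is, of both
  representatives of each element of \<open>\<Gamma>\<^sub>0(N)\<close> in \<open>PSL\<^sub>2\<close>; they impose the same condition if
  \<open>chi(-1) = -1\<close>.\<close>

definition transforms_weight1 :: "nat \<Rightarrow> (int \<Rightarrow> complex) \<Rightarrow> (complex \<Rightarrow> complex) \<Rightarrow> bool" where
  "transforms_weight1 N chi f \<longleftrightarrow>
     (\<forall>a b c d. a * d - b * c = 1 \<and> int N dvd c \<longrightarrow>
        (\<forall>z\<in>upper_half_plane.
           f ((of_int a * z + of_int b) / (of_int c * z + of_int d)) =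
             chi d * (of_int c * z + of_int d) * f z))"

definition real_analytic_on :: "(complex \<Rightarrow> complex) \<Rightarrow> complex set \<Rightarrow> bool" where
  "real_analytic_on F U \<longleftrightarrow>
     (\<forall>w\<in>U. \<exists>r>0. \<exists>a :: nat \<Rightarrow> nat \<Rightarrow> complex. \<forall>z\<in>ball w r.
        ((\<lambda>(j, k). a j k * of_real (Re z - Re w) ^ j * of_real (Im z - Im w) ^ k) has_sum F z) UNIV)"

definition partial_x :: "(complex \<Rightarrow> complex) \<Rightarrow> complex \<Rightarrow> complex" where
  "partial_x F z = vector_derivative (\<lambda>x. F (Complex x (Im z))) (at (Re z))"

definition partial_y :: "(complex \<Rightarrow> complex) \<Rightarrow> complex \<Rightarrow> complex" where
  "partial_y F z = vector_derivative (\<lambda>y. F (Complex (Re z) y)) (at (Im z))"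

definition partial_zbar :: "(complex \<Rightarrow> complex) \<Rightarrow> complex \<Rightarrow> complex" where
  "partial_zbar F z = (partial_x F z + \<i> * partial_y F z) / 2"

definition Delta1 :: "(complex \<Rightarrow> complex) \<Rightarrow> complex \<Rightarrow> complex" where
  "Delta1 F z =
     of_real (Im z) ^ 2 * (partial_x (partial_x F) z + partial_y (partial_y F) z)
     - \<i> * of_real (Im z) * (partial_x F z + \<i> * partial_y F z)"

definition xi1 :: "(complex \<Rightarrow> complex) \<Rightarrow> complex \<Rightarrow> complex" where
  "xi1 F z = 2 * \<i> * of_real (Im z) * cnj (partial_zbar F z)"

text \<open>The cusps are the images of \<open>\<infinity>\<close> under \<open>SL\<^sub>2\<close> over the integers; growth at a cusp is
  uniform in the real part.\<close>

definition linear_exponential_growth_at_cusps :: "(complex \<Rightarrow> complex) \<Rightarrow> bool" where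
  "linear_exponential_growth_at_cusps F \<longleftrightarrow>
     (\<forall>a b c d. a * d - b * c = 1 \<longrightarrow>
        (\<exists>A B y0 :: real. \<forall>z\<in>upper_half_plane. Im z \<ge> y0 \<longrightarrow>
           norm (slash1 a b c d F z) \<le> A * exp (B * Im z)))"

definition holomorphic_at_cusps :: "(complex \<Rightarrow> complex) \<Rightarrow> bool" where
  "holomorphic_at_cusps f \<longleftrightarrow>
     (\<forall>a b c d. a * d - b * c = 1 \<longrightarrow>
        (\<exists>h :: nat. h > 0 \<and> (\<exists>\<alpha> :: nat \<Rightarrow> complex. \<forall>z\<in>upper_half_plane.
           ((\<lambda>n. \<alpha> n * exp (2 * of_real pi * \<i> * of_nat n * z / of_nat h))
              has_sum slash1 a b c d f z) UNIV)))"

definition H1 :: "nat \<Rightarrow> (int \<Rightarrow> complex) \<Rightarrow> (complex \<Rightarrow> complex) set" where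
  "H1 N chi =
     {F. real_analytic_on F upper_half_plane \<and>
         transforms_weight1 N chi F \<and>
         (\<forall>z\<in>upper_half_plane. Delta1 F z = 0) \<and>
         linear_exponential_growth_at_cusps F \<and>
         holomorphic_at_cusps (xi1 F)}"

definition beta1 :: "nat \<Rightarrow> real \<Rightarrow> real" where
  "beta1 n y =
     (if n = 0 then - ln y else integral {y..} (\<lambda>u. exp (- 4 * pi * real n * u) / u))"

text \<open>\<open>g\<close> is the holomorphic part \<open>\<Sum>c\<^sup>+(n)q\<^sup>n\<close> in the expansion of \<open>F\<close>; the series in the second
  conjunct is \<open>g - F\<close>.\<close>

definition holomorphic_part :: "(complex \<Rightarrow> complex) \<Rightarrow> (complex \<Rightarrow> complex) \<Rightarrow> bool" where
  "holomorphic_part F g \<longleftrightarrow>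
     (\<exists>(n0 :: int) (cp :: int \<Rightarrow> complex) (c :: nat \<Rightarrow> complex). \<forall>z\<in>upper_half_plane.
        ((\<lambda>n. cp n * qpow n z) has_sum g z) {n0..} \<and>
        ((\<lambda>n. cnj (c n) * of_real (beta1 n (Im z)) * qpow (- int n) z) has_sum (g z - F z)) UNIV \<and>
        ((\<lambda>n. c n * qpow (int n) z) has_sum xi1 F z) UNIV)"

text \<open>\<open>g\<close> is a mock modular form of weight 1, level \<open>N\<close> and character \<open>chi\<close> with shadow \<open>f\<close>.\<close>

definition mock_modular_form1 ::
  "nat \<Rightarrow> (int \<Rightarrow> complex) \<Rightarrow> (complex \<Rightarrow> complex) \<Rightarrow> (complex \<Rightarrow> complex) \<Rightarrow> bool" where
  "mock_modular_form1 N chi f g \<longleftrightarrow>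
     (\<exists>F\<in>H1 N chi. holomorphic_part F g \<and> (\<forall>z\<in>upper_half_plane. xi1 F z = f z))"


section \<open>The Eisenstein series and the mock modular candidate\<close>

text \<open>Throughout, \<open>\<psi>\<close> is a character mod \<open>L\<close> and \<open>\<rho>\<close> a character mod \<open>M\<close>. The modulus \<open>L\<close> does not
  enter the formulas; for a character \<open>\<psi>\<close> mod \<open>L\<close>, equality with \<open>trivial_character 1\<close> as functions
  on the integers forces \<open>L = 1\<close>. At \<open>n = 0\<close> the divisor sum is over an infinite set, so the
  value is \<open>0\<close>.\<close>

definition sigma0 :: "(int \<Rightarrow> complex) \<Rightarrow> nat \<Rightarrow> (int \<Rightarrow> complex) \<Rightarrow> nat \<Rightarrow> complex" where
  "sigma0 \<psi> M \<rho> n =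
     (let l = conductor_index M \<rho>; \<rho>0 = inducing_primitive M \<rho> in
      \<Sum>c | c dvd n. \<psi> (int (n div c)) *
        (\<Sum>d | d dvd gcd l c. of_nat d * of_int (moebius_mu (l div d)) *
           cnj (\<rho>0 (int (l div d))) * \<rho>0 (int (c div d))))"

text \<open>The value of an arithmetic function at the rational number \<open>n / t\<close>.\<close>

definition at_quotient :: "(nat \<Rightarrow> complex) \<Rightarrow> nat \<Rightarrow> nat \<Rightarrow> complex" where
  "at_quotient f n t = (if t dvd n then f (n div t) else 0)"

definition euler_product_at :: "nat \<Rightarrow> complex" where
  "euler_product_at M = (\<Prod>p\<in>prime_factors M. 1 - 1 / of_nat p)"

definition eis_C1 :: "(int \<Rightarrow> complex) \<Rightarrow> (int \<Rightarrow> complex) \<Rightarrow> complex" where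
  "eis_C1 \<psi> \<rho> =
     (if \<psi> = trivial_character 1 then dirichlet_L (conj_character \<rho>) 1 else 0)"

definition eis_D :: "(int \<Rightarrow> complex) \<Rightarrow> nat \<Rightarrow> (int \<Rightarrow> complex) \<Rightarrow> complex" where
  "eis_D \<psi> M \<rho> =
     (if \<rho> = trivial_character M
      then - of_real pi * \<i> * dirichlet_L \<psi> 0 * euler_product_at M else 0)"

definition E1 :: "(int \<Rightarrow> complex) \<Rightarrow> nat \<Rightarrow> (int \<Rightarrow> complex) \<Rightarrow> complex \<Rightarrow> complex" where
  "E1 \<psi> M \<rho> z =
     eis_C1 \<psi> \<rho> + eis_D \<psi> M \<rho>
     - 2 * of_real pi * \<i> / of_nat M
       * gauss_sum (conductor M \<rho>) (conj_character (inducing_primitive M \<rho>))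
       * (\<Sum>n. sigma0 \<psi> M \<rho> (Suc n) * qpow (int (Suc n)) z)"

definition E1t :: "nat \<Rightarrow> (int \<Rightarrow> complex) \<Rightarrow> nat \<Rightarrow> (int \<Rightarrow> complex) \<Rightarrow> complex \<Rightarrow> complex" where
  "E1t t \<psi> M \<rho> z = E1 \<psi> M \<rho> (of_nat t * z)"

definition sigma0_log :: "(int \<Rightarrow> complex) \<Rightarrow> nat \<Rightarrow> (int \<Rightarrow> complex) \<Rightarrow> nat \<Rightarrow> complex" where
  "sigma0_log \<psi> M \<rho> m =
     (let l = conductor_index M \<rho>; \<rho>0 = inducing_primitive M \<rho> in
      \<Sum>c | c dvd m. cnj (\<psi> (int (m div c))) * of_real (ln (real c)) *
        (\<Sum>d | d dvd gcd l c. of_nat d * of_int (moebius_mu (l div d)) *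
           \<rho>0 (int (l div d)) * cnj (\<rho>0 (int (c div d)))))"

definition c1_plus :: "nat \<Rightarrow> nat \<Rightarrow> (int \<Rightarrow> complex) \<Rightarrow> nat \<Rightarrow> (int \<Rightarrow> complex) \<Rightarrow> complex" where
  "c1_plus n t \<psi> M \<rho> =
     (if n = 0 then
        (if \<psi> = trivial_character 1 then 2 * deriv (dirichlet_L \<rho>) 1
         else if \<rho> = trivial_character M then
           2 * of_real pi * \<i> *
             (of_real (ln (2 * real t * real M)) * dirichlet_L (conj_character \<psi>) 0
              - deriv (dirichlet_L (conj_character \<psi>)) 0) * euler_product_at M
         else 0)
      else
        - 2 * of_real pi * \<i> / of_nat M
        * gauss_sum (conductor M \<rho>) (inducing_primitive M \<rho>)
        * (at_quotient (sigma0 (conj_character \<psi>) M (conj_character \<rho>)) n t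
             * of_real (ln (pi / real M ^ 2) + euler_mascheroni - ln (real n))
           + 2 * at_quotient (sigma0_log \<psi> M \<rho>) n t))"

definition G1 :: "nat \<Rightarrow> (int \<Rightarrow> complex) \<Rightarrow> nat \<Rightarrow> (int \<Rightarrow> complex) \<Rightarrow> complex \<Rightarrow> complex" where
  "G1 t \<psi> M \<rho> z = (\<Sum>n. c1_plus n t \<psi> M \<rho> * qpow (int n) z)"

end

theory Submission
  imports
    Defs
    "HOL-Number_Theory.Number_Theory"
    "HOL-Probability.Probability"
    "HOL-Real_Asymp.Real_Asymp"
begin

text \<open>Hecke's trick, with the Mellin variable made explicit. For a biperiodic function \<open>\<phi>\<close> the
  regularised lattice sum of \<open>\<phi>(m,n) (mz+n)^{-1} |mz+n|^{-2s}\<close> is the Mellin transform of a theta series with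
  linear coefficient. The action of \<open>SL\<^sub>2\<close> on this theta series is a substitution in the lattice, so every
  Mellin moment transforms with weight 1. For \<open>\<phi>\<close> built from \<open>\<psi>\<close> and the conjugate of \<open>\<rho>\<close> the value at
  \<open>s = 0\<close> is the Eisenstein series. The Maass form is the first derivative at \<open>s = 0\<close> for the conjugate
  function, corrected by \<open>log \<pi> + \<gamma>\<close> times the value. Poisson summation in \<open>n\<close> yields the Fourier expansions: the
  Mellin moments of the transformed Gaussians are elementary except for one exponential integral, which produces the
  nonholomorphic part. The constant terms are values and derivatives of completed Dirichlet L-functions of odd
  characters at 0 and 1. Harmonicity, the shadow and real-analyticity are read off from the expansion.\<close>

section \<open>Dirichlet characters and Gauss sums\<close>

text \<open>The series of \<open>\<phi> m n\<close> / (mz+n) is not absolutely convergent, so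
  lattice sum and Mellin integral cannot be exchanged at s = 0. The linear factor of the theta
  series makes analytic continuation unnecessary: it kills the term at the origin of the lattice and
  of its dual, so the theta series decays at both ends and every moment exists. Modularity is proved
  for the moments themselves; the exchange comes only after Poisson summation, over pairs with mk
  nonzero, where the terms decay in |mk|. A Gaussian has the moment Gamma(1+s) (pi/y)^(-1-s)
  |mz+n|^(-2-2s). Hence the prefactor pi/(2y) makes the value at s = 0 half of the formal sum of
  \<open>\<phi> m n\<close> / (mz+n), half because (m,n) and (-m,-n) contribute equally for odd
  \<open>\<phi>\<close>. Adding log pi + gamma times the value cancels the derivative of Gamma(1+s)
  pi^(-s). The logarithm of the Mellin variable turns scaling into translation and inversion into
  reflection. All of SL_2 acts on the functions \<open>\<phi>\<close>, so growth and holomorphy at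
  every cusp are instances of the expansion at infinity.\<close>

lemma dchar_mult: "dirichlet_character N chi \<Longrightarrow> chi (a * b) = chi a * chi b"
  by (auto simp: dirichlet_character_def)

lemma dchar_nonzero_iff: "dirichlet_character N chi \<Longrightarrow> chi a \<noteq> 0 \<longleftrightarrow> coprime a (int N)"
  by (auto simp: dirichlet_character_def)

lemma dchar_eq_0: "dirichlet_character N chi \<Longrightarrow> \<not> coprime a (int N) \<Longrightarrow> chi a = 0"
  by (auto simp: dirichlet_character_def)

lemma periodic_int_multiple:
  fixes f :: "int \<Rightarrow> 'a"
  assumes "\<And>a. f (a + int N) = f a"
  shows "f (a + int N * k) = f a"
proof (induction k rule: int_induct[where k=0])
  case (step1 i)
  have "f (a + int N * (i + 1)) = f ((a + int N * i) + int N)" by (simp add: algebra_simps)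
  then show ?case using step1 assms by simp
next
  case (step2 i)
  have "f (a + int N * (i - 1)) = f ((a + int N * (i - 1)) + int N)" using assms by simp
  also have "\<dots> = f (a + int N * i)" by (simp add: algebra_simps)
  finally show ?case using step2 by simp
qed simp

lemma periodic_cong:
  fixes f :: "int \<Rightarrow> 'a"
  assumes "\<And>a. f (a + int N) = f a" "[a = b] (mod int N)"
  shows "f a = f b"
proof -
  obtain k where "b = a + int N * k"
    using assms(2) by (metis cong_iff_lin)
  then show ?thesis using periodic_int_multiple[of f N a k, OF assms(1)] by simp
qed

lemma dchar_periodic: "dirichlet_character N chi \<Longrightarrow> chi (a + int N) = chi a"
  by (auto simp: dirichlet_character_def)

lemma dchar_cong: "dirichlet_character N chi \<Longrightarrow> [a = b] (mod int N) \<Longrightarrow> chi a = chi b"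
  using periodic_cong[of chi N a b] dchar_periodic by blast

lemma dchar_1: assumes "dirichlet_character N chi" shows "chi 1 = 1"
proof -
  have "chi 1 \<noteq> 0" using dchar_nonzero_iff[OF assms] by simp
  moreover have "chi 1 * chi 1 = chi 1" using dchar_mult[OF assms, of 1 1] by simp
  ultimately show ?thesis by simp
qed

lemma dchar_power: assumes "dirichlet_character N chi" shows "chi (a ^ n) = chi a ^ n"
  by (induction n) (simp_all add: dchar_1[OF assms] dchar_mult[OF assms])

text \<open>Values at units are roots of unity: Euler's theorem gives
  \<open>chi a ^ totient N = 1\<close>. The residue of a is taken first so that the theorem for
  naturals applies.\<close>

lemma dchar_norm:
  assumes "dirichlet_character N chi" "N \<ge> 1" "coprime a (int N)"
  shows "norm (chi a) = 1"
proof -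
  define b where "b = nat (a mod int N)"
  have b: "int b = a mod int N" using assms by (simp add: b_def)
  have "coprime (int b) (int N)" unfolding b using assms by simp
  then have "coprime b N" by simp
  then have "[b ^ totient N = 1] (mod N)" by (rule euler_theorem)
  then have "[int b ^ totient N = 1] (mod int N)" by (metis cong_int_iff of_nat_1 of_nat_power)
  then have "chi (int b ^ totient N) = chi 1" by (rule dchar_cong[OF assms(1)])
  then have "chi (int b) ^ totient N = 1" by (simp only: dchar_power[OF assms(1)] dchar_1[OF assms(1)])
  moreover have "chi (int b) = chi a" unfolding b using dchar_cong[OF assms(1)] by simp
  ultimately have "chi a ^ totient N = 1" by simp
  moreover have "totient N > 0" using assms(2) by simp
  ultimately show ?thesis using power_eq_1_iff by fastforce
qed

lemma dchar_mult_cnj: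
  "dirichlet_character N chi \<Longrightarrow> N \<ge> 1 \<Longrightarrow> coprime a (int N) \<Longrightarrow> chi a * cnj (chi a) = 1"
  using dchar_norm[of N chi a] complex_norm_square[of "chi a"] by simp

lemma dchar_conj: "dirichlet_character N chi \<Longrightarrow> dirichlet_character N (conj_character chi)"
  by (simp add: dirichlet_character_def conj_character_def)

lemma conj_character_conj [simp]: "conj_character (conj_character chi) = chi"
  by (simp add: conj_character_def fun_eq_iff)

lemma dchar_eqI:
  assumes "dirichlet_character N chi" "dirichlet_character N chi'"
    and "\<And>a. coprime a (int N) \<Longrightarrow> chi a = chi' a"
  shows "chi = chi'"
proof
  fix a show "chi a = chi' a"
    using assms(3)[of a] dchar_eq_0[OF assms(1), of a] dchar_eq_0[OF assms(2), of a]
    by (cases "coprime a (int N)") auto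
qed

text \<open>The witness is a plus m times the product of those primes of N that do not divide a:
  every prime of N then divides exactly one of the two summands.\<close>

lemma coprime_lift:
  fixes a :: int
  assumes "coprime a (int m)" "N \<ge> 1"
  obtains a' where "[a' = a] (mod int m)" "coprime a' (int N)"
proof -
  define P where "P = {p \<in> prime_factors (int N). \<not> p dvd a}"
  have fin: "finite P" by (simp add: P_def)
  define a' where "a' = a + int m * \<Prod>P"
  have prP: "prime p" if "p \<in> P" for p using that by (auto simp: P_def)
  have "coprime a' (int N)"
  proof (rule ccontr)
    assume "\<not> coprime a' (int N)"
    then have "\<not> is_unit (gcd a' (int N))" using coprime_iff_gcd_eq_1 by auto
    moreover have "gcd a' (int N) \<noteq> 0" using assms(2) by simp
    ultimately obtain p where "p dvd gcd a' (int N)" "prime p" using prime_divisor_exists by blast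
    then have p: "prime p" "p dvd a'" "p dvd int N" by auto
    then have pf: "p \<in> prime_factors (int N)" using assms(2) by (simp add: prime_factors_dvd)
    show False
    proof (cases "p dvd a")
      case True
      then have "p dvd int m * \<Prod>P" using p(2) by (simp add: a'_def dvd_add_right_iff)
      moreover have "\<not> p dvd int m" using True assms(1) p(1)
        by (meson coprime_common_divisor not_prime_unit)
      ultimately have "p dvd \<Prod>P" using p(1) by (simp add: prime_dvd_mult_iff)
      then obtain q where "q \<in> P" "p dvd q" using prime_dvd_prod_iff[OF fin p(1), of "\<lambda>x. x"] by auto
      then have "p = q" using prP p(1) primes_dvd_imp_eq by blast
      then show False using \<open>q \<in> P\<close> True by (simp add: P_def)
    next
      case False
      then have "p \<in> P" using pf by (simp add: P_def)
      then have "p dvd int m * \<Prod>P" using dvd_prodI[OF fin, of p "\<lambda>x. x"] by simp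
      then show False using False p(2) by (simp add: a'_def dvd_add_left_iff)
    qed
  qed
  moreover have "[a' = a] (mod int m)" by (simp add: a'_def cong_def)
  ultimately show ?thesis using that by blast
qed

section \<open>Inducing characters and conductors\<close>

lemma induces_refl: "dirichlet_character N chi \<Longrightarrow> induces N chi N chi"
  by (simp add: induces_def)

lemma induces_trans:
  assumes "induces k chi0 m chi1" "induces m chi1 N chi" shows "induces k chi0 N chi"
proof -
  have "coprime a (int m)" if "coprime a (int N)" for a
    using assms(2) that by (meson coprime_divisors dvd_refl induces_def int_dvd_int_iff)
  then show ?thesis using assms by (auto simp: induces_def intro: dvd_trans)
qed

text \<open>Makes the definite description in \<open>inducing_primitive\<close> legitimate: a unit
  modulo m has a representative that is also a unit modulo N, and there both characters equal
  \<open>chi\<close>.\<close>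

lemma induces_unique:
  assumes "induces m chi1 N chi" "induces m chi2 N chi" "N \<ge> 1"
  shows "chi1 = chi2"
proof (rule dchar_eqI)
  show c: "dirichlet_character m chi1" "dirichlet_character m chi2" using assms by (auto simp: induces_def)
  fix a :: int assume "coprime a (int m)"
  then obtain a' where a': "[a' = a] (mod int m)" "coprime a' (int N)" using coprime_lift assms(3) by metis
  then have "chi1 a' = chi2 a'" using assms by (simp add: induces_def)
  then show "chi1 a = chi2 a" using dchar_cong[OF c(1) a'(1)] dchar_cong[OF c(2) a'(1)] by simp
qed

lemma conductor_le: "induces m chi1 N chi \<Longrightarrow> conductor N chi \<le> m"
  unfolding conductor_def by (rule Least_le) blast

text \<open>Primitivity is minimality: whatever induces the character found at the conductor also
  induces \<open>chi\<close> by transitivity, so its modulus cannot be smaller.\<close>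

lemma inducing_primitive:
  assumes "dirichlet_character N chi" "N \<ge> 1"
  shows "induces (conductor N chi) (inducing_primitive N chi) N chi"
    and "primitive_character (conductor N chi) (inducing_primitive N chi)"
proof -
  define m where "m = conductor N chi"
  have "\<exists>chi1. induces m chi1 N chi" unfolding m_def conductor_def
    by (rule LeastI[of "\<lambda>m. \<exists>chi1. induces m chi1 N chi" N]) (use assms induces_refl in blast)
  then obtain chi1 where chi1: "induces m chi1 N chi" by blast
  have dm: "dirichlet_character m chi1" using chi1 by (simp add: induces_def)
  have "conductor m chi1 = m"
  proof (rule antisym)
    show "conductor m chi1 \<le> m" using conductor_le[OF induces_refl[OF dm]] .
    have "\<exists>chi0. induces (conductor m chi1) chi0 m chi1" unfolding conductor_def
      by (rule LeastI[of "\<lambda>k. \<exists>chi0. induces k chi0 m chi1" m]) (use dm induces_refl in blast)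
    then show "m \<le> conductor m chi1" using induces_trans[OF _ chi1] conductor_le m_def by blast
  qed
  then have prim: "primitive_character m chi1" using dm by (simp add: primitive_character_def)
  have "inducing_primitive N chi = chi1" unfolding inducing_primitive_def m_def[symmetric]
  proof (rule the_equality)
    fix chi2 assume "primitive_character m chi2 \<and> induces m chi2 N chi"
    then show "chi2 = chi1" using induces_unique[OF _ chi1 assms(2), of chi2] by blast
  qed (use prim chi1 in blast)
  then show "induces (conductor N chi) (inducing_primitive N chi) N chi"
    and "primitive_character (conductor N chi) (inducing_primitive N chi)"
    using chi1 prim by (simp_all add: m_def)
qed

lemma induces_conj: "induces m chi1 N chi \<Longrightarrow> induces m (conj_character chi1) N (conj_character chi)"
  using dchar_conj[of m chi1] unfolding induces_def by (auto simp: conj_character_def)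

lemma conductor_conj: "conductor N (conj_character chi) = conductor N chi"
proof -
  have "(\<exists>chi1. induces m chi1 N (conj_character chi)) \<longleftrightarrow> (\<exists>chi1. induces m chi1 N chi)" for m
    using induces_conj[of m _ N chi] induces_conj[of m _ N "conj_character chi"] by auto
  then show ?thesis by (simp add: conductor_def)
qed

lemma inducing_primitive_conj:
  assumes "dirichlet_character N chi" "N \<ge> 1"
  shows "inducing_primitive N (conj_character chi) = conj_character (inducing_primitive N chi)"
proof -
  note a = inducing_primitive(1)[OF dchar_conj[OF assms(1)] assms(2)]
  show ?thesis by (rule induces_unique[OF a _ assms(2)])
     (unfold conductor_conj, rule induces_conj, rule inducing_primitive(1)[OF assms])
qed

lemma conductor_pos:
  assumes "dirichlet_character N chi" "N \<ge> 1" shows "conductor N chi \<ge> 1" "conductor N chi dvd N"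
proof -
  show d: "conductor N chi dvd N" using inducing_primitive(1)[OF assms] by (simp add: induces_def)
  then show "conductor N chi \<ge> 1" using assms(2) by (cases "conductor N chi = 0") auto
qed

section \<open>Additive characters and finite Fourier transforms\<close>

definition ee :: "real \<Rightarrow> complex" where "ee x = cis (2 * pi * x)"

lemma ee_add: "ee (x + y) = ee x * ee y"
  by (simp add: ee_def cis_mult ring_distribs)

lemma ee_0 [simp]: "ee 0 = 1"
  by (simp add: ee_def)

lemma ee_of_int [simp]: "ee (of_int k) = 1"
  unfolding ee_def by (metis cis_multiple_2pi Ints_of_int)

lemma ee_add_int [simp]: "ee (x + of_int k) = ee x"
  by (simp add: ee_add)

lemma norm_ee [simp]: "norm (ee x) = 1"
  by (simp add: ee_def)

lemma ee_uminus: "ee (- x) = cnj (ee x)"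
  by (simp add: ee_def cis_cnj)

lemma ee_exp: "ee x = exp (2 * of_real pi * \<i> * of_real x)"
  by (simp add: ee_def cis_conv_exp algebra_simps)

lemma ee_eq_1_iff: "ee x = 1 \<longleftrightarrow> x \<in> \<int>"
proof
  assume "ee x = 1"
  then have "cos (2 * pi * x) = 1" by (simp add: ee_def complex_eq_iff)
  then obtain n :: int where "2 * pi * x = of_int n * 2 * pi" using cos_one_2pi_int by auto
  then show "x \<in> \<int>" by simp
qed (metis Ints_cases ee_of_int)

text \<open>Finite Fourier transform, not normalised, with positive sign in the exponent. The
  frequency ranges over all integers because Poisson summation will supply it; at frequency 1 it is
  the Gauss sum.\<close>

definition fhat :: "nat \<Rightarrow> (int \<Rightarrow> complex) \<Rightarrow> int \<Rightarrow> complex" where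
  "fhat M f k = (\<Sum>b\<in>{0..<int M}. f b * ee (of_int (k * b) / of_nat M))"

lemma ee_frac_cong:
  assumes "[a = b] (mod int M)" "M \<ge> 1"
  shows "ee (of_int a / of_nat M) = ee (of_int b / of_nat M)"
proof -
  obtain k where "b = a + int M * k" using assms(1) by (metis cong_iff_lin)
  then have "of_int b / real M = of_int a / of_nat M + of_int k" using assms(2) by (simp add: field_simps)
  then show ?thesis by (metis ee_add_int)
qed

lemma sum_residues_mult:
  fixes f :: "int \<Rightarrow> complex"
  assumes per: "\<And>a. f (a + int M) = f a" and "M \<ge> 1" "coprime k (int M)"
  shows "(\<Sum>b\<in>{0..<int M}. f (k * b)) = (\<Sum>b\<in>{0..<int M}. f b)"
proof -
  have inj: "inj_on (\<lambda>b. (k * b) mod int M) {0..<int M}"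
  proof (rule inj_onI)
    fix x y assume xy: "x \<in> {0..<int M}" "y \<in> {0..<int M}" "k * x mod int M = k * y mod int M"
    then have "[x = y] (mod int M)" using cong_mult_lcancel[OF assms(3)] by (simp add: cong_def)
    then show "x = y" using xy by (simp add: cong_def)
  qed
  moreover have "(\<lambda>b. (k * b) mod int M) ` {0..<int M} \<subseteq> {0..<int M}" using assms(2) by auto
  ultimately have bij: "bij_betw (\<lambda>b. (k * b) mod int M) {0..<int M} {0..<int M}"
    by (simp add: bij_betw_def endo_inj_surj)
  have "(\<Sum>b\<in>{0..<int M}. f (k * b)) = (\<Sum>b\<in>{0..<int M}. f ((k * b) mod int M))"
    by (rule sum.cong[OF refl], rule periodic_cong[of f M, OF per]) (simp add: cong_def)
  also have "\<dots> = (\<Sum>b\<in>{0..<int M}. f b)" by (rule sum.reindex_bij_betw[OF bij])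
  finally show ?thesis .
qed

lemma gauss_sum_fhat:
  assumes "\<And>a. chi (a + int m) = chi a" "m \<ge> 1"
  shows "gauss_sum m chi = fhat m chi 1"
proof -
  have e: "exp (2 * of_real pi * \<i> * of_nat n / of_nat m) = ee (of_int (int n) / of_nat m)" for n :: nat
    by (simp add: ee_exp)
  have "gauss_sum m chi = (\<Sum>n=1..m. chi (int n) * ee (of_int (int n) / of_nat m))"
    unfolding gauss_sum_def e ..
  also have "\<dots> = (\<Sum>n\<in>{1..<m}. chi (int n) * ee (of_int (int n) / of_nat m)) + chi (int m) * ee 1"
  proof -
    have "{1..m} = insert m {1..<m}" using assms(2) by auto
    then show ?thesis using assms(2) by simp
  qed
  \<comment> \<open>The range of \<open>gauss_sum\<close> ends at m and that of \<open>fhat\<close>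
    starts at 0; periodicity moves the last term to the front.\<close>
  also have "chi (int m) * ee 1 = chi (int 0) * ee (of_int (int 0) / of_nat m)"
    using assms(1)[of 0] ee_of_int[of 1] by simp
  also have "(\<Sum>n\<in>{1..<m}. chi (int n) * ee (of_int (int n) / of_nat m)) + \<dots> =
      (\<Sum>n\<in>{0..<m}. chi (int n) * ee (of_int (int n) / of_nat m))"
  proof -
    have "{0..<m} = insert 0 {1..<m}" using assms(2) by auto
    then show ?thesis by simp
  qed
  also have "\<dots> = (\<Sum>n\<in>int ` {0..<m}. chi n * ee (of_int n / of_nat m))"
    by (subst sum.reindex) (auto simp: inj_on_def)
  also have "int ` {0..<m} = {0..<int m}" by (simp add: image_int_atLeastLessThan)
  finally show ?thesis by (simp add: fhat_def)
qed

text \<open>If the character were 1 on all units congruent to 1 modulo k, it would factor through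
  the units modulo k and be induced from there, against the minimality of the conductor m.\<close>

lemma primitive_nontrivial_fibre:
  assumes prim: "primitive_character m chi" and m: "m \<ge> 1" and k: "k dvd m" "k < m"
  obtains c where "[c = 1] (mod int k)" "coprime c (int m)" "chi c \<noteq> 1"
proof (rule ccontr)
  note t = that
  assume contra: "\<not> thesis"
  have one: "chi c = 1" if "[c = 1] (mod int k)" "coprime c (int m)" for c
    using t contra that by blast
  have d: "dirichlet_character m chi" using prim by (simp add: primitive_character_def)
  have k1: "k \<ge> 1" using k m by (cases "k = 0") auto
  \<comment> \<open>Multiplying by an inverse of b moves the pair a, b into the fibre over
    1.\<close>
  have fib: "chi a = chi b" if h: "[a = b] (mod int k)" "coprime a (int m)" "coprime b (int m)" for a b
  proof -
    obtain c where c: "[b * c = 1] (mod int m)" using h(3) cong_solve_coprime_int by blast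
    then have cop: "coprime c (int m)" by (metis coprime_iff_invertible_int mult.commute)
    have "[b * c = 1] (mod int k)" using c k(1) by (meson cong_dvd_modulus int_dvd_int_iff)
    then have "[a * c = 1] (mod int k)" using h(1) by (meson cong_scalar_right cong_trans)
    then have "chi (a * c) = 1" using one h(2) cop by simp
    moreover have "chi (b * c) = 1" using dchar_cong[OF d c] dchar_1[OF d] by simp
    ultimately have "chi a * chi c = chi b * chi c" by (simp add: dchar_mult[OF d])
    then show ?thesis using cop dchar_nonzero_iff[OF d, of c] by simp
  qed
  define lift where "lift a = (SOME a'. [a' = a] (mod int k) \<and> coprime a' (int m))" for a
  have lift: "[lift a = a] (mod int k) \<and> coprime (lift a) (int m)" if "coprime a (int k)" for a
    unfolding lift_def by (rule someI_ex) (use coprime_lift[OF that m] in blast)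
  \<comment> \<open>The candidate inducing character: at a unit modulo k it takes the value of
    \<open>chi\<close> at any lift to a unit modulo m.\<close>
  define chi1 where "chi1 a = (if coprime a (int k) then chi (lift a) else 0)" for a
  have chi1: "chi1 a = chi a'" if "coprime a (int k)" "[a' = a] (mod int k)" "coprime a' (int m)" for a a'
    unfolding chi1_def using that lift[OF that(1)] fib by (simp add: cong_def)
  have "induces k chi1 m chi"
    unfolding induces_def dirichlet_character_def
  proof (intro conjI allI impI)
    fix a b :: int
    show "chi1 (a * b) = chi1 a * chi1 b"
    proof (cases "coprime a (int k) \<and> coprime b (int k)")
      case True
      then have "chi1 (a * b) = chi (lift a * lift b)"
        using lift by (intro chi1) (auto intro: cong_mult)
      also have "\<dots> = chi1 a * chi1 b" using True by (simp add: dchar_mult[OF d] chi1_def)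
      finally show ?thesis .
    next
      case False
      then show ?thesis by (auto simp: chi1_def)
    qed
  next
    fix a :: int
    have eq: "coprime (a + int k) (int k) \<longleftrightarrow> coprime a (int k)"
      by (simp add: coprime_iff_gcd_eq_1)
    show "chi1 (a + int k) = chi1 a"
    proof (cases "coprime a (int k)")
      case True
      then show ?thesis using lift[OF True] eq
        by (subst chi1[of _ "lift a"]) (auto simp: cong_def chi1_def)
    qed (simp add: chi1_def eq)
    show "chi1 a \<noteq> 0 \<longleftrightarrow> coprime a (int k)"
      using lift[of a] dchar_nonzero_iff[OF d, of "lift a"] by (auto simp: chi1_def)
    assume a: "coprime a (int m)"
    then have "coprime a (int k)" using k(1) by (meson coprime_divisors dvd_refl int_dvd_int_iff)
    then show "chi a = chi1 a" using chi1[of a a] a by simp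
  qed (fact k(1))
  then show False using conductor_le prim k(2) by (force simp: primitive_character_def)
qed

text \<open>Separability of primitive Gauss sums. For k coprime to m substitute kb for b. Otherwise
  some c congruent to 1 modulo m/gcd(k,m) has \<open>chi c\<close> different from 1, while kc = k
  modulo m; the substitution cb for b multiplies the sum by \<open>chi c\<close> without changing
  it, so it vanishes.\<close>

lemma fhat_primitive:
  assumes prim: "primitive_character m chi" and m: "m \<ge> 1"
  shows "fhat m chi k = cnj (chi k) * gauss_sum m chi"
proof -
  have d: "dirichlet_character m chi" using prim by (simp add: primitive_character_def)
  have gs: "gauss_sum m chi = fhat m chi 1" by (rule gauss_sum_fhat) (use dchar_periodic[OF d] m in auto)
  have per: "chi (a + int m) * ee (of_int (j * (a + int m)) / of_nat m) = chi a * ee (of_int (j * a) / of_nat m)" for a j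
  proof -
    have "[j * (a + int m) = j * a] (mod int m)" by (simp add: cong_def ring_distribs)
    from ee_frac_cong[OF this m] show ?thesis by (simp only: dchar_periodic[OF d])
  qed
  show ?thesis
  proof (cases "coprime k (int m)")
    case True
    have "chi k * fhat m chi k = (\<Sum>b\<in>{0..<int m}. chi (k * b) * ee (of_int (1 * (k * b)) / of_nat m))"
      unfolding fhat_def sum_distrib_left by (simp add: dchar_mult[OF d] mult_ac)
    also have "\<dots> = (\<Sum>b\<in>{0..<int m}. chi b * ee (of_int (1 * b) / of_nat m))"
      by (rule sum_residues_mult[where f = "\<lambda>b. chi b * ee (of_int (1 * b) / of_nat m)", OF per m True])
    finally have "chi k * fhat m chi k = gauss_sum m chi" unfolding gs fhat_def by simp
    then have "cnj (chi k) * gauss_sum m chi = (chi k * cnj (chi k)) * fhat m chi k" by simp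
    then show ?thesis using dchar_mult_cnj[OF d m True] by simp
  next
    case False
    define g where "g = nat (gcd k (int m))"
    have g: "int g = gcd k (int m)" by (simp add: g_def)
    then have "int g dvd int m" by simp
    then have gm: "g dvd m" by (simp only: int_dvd_int_iff)
    have "gcd k (int m) \<noteq> 1" using False coprime_iff_gcd_eq_1 by blast
    moreover have "gcd k (int m) > 0" using m by simp
    ultimately have g1: "g > 1" unfolding g_def by linarith
    obtain c where c: "[c = 1] (mod int (m div g))" "coprime c (int m)" "chi c \<noteq> 1"
    proof (rule primitive_nontrivial_fibre[OF prim m, of "m div g"])
      show "m div g dvd m" using gm by (metis dvd_div_mult_self dvd_triv_left)
      show "m div g < m" using g1 m by simp
    qed blast
    obtain q where q: "c - 1 = int (m div g) * q" using c(1) by (meson cong_iff_dvd_diff dvdE)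
    obtain r where r: "k = int g * r" using g by (metis dvdE gcd_dvd1)
    have "k * c - k = k * (c - 1)" by (simp add: algebra_simps)
    also have "\<dots> = (int g * int (m div g)) * (q * r)" using q r by (simp add: mult_ac)
    also have "int g * int (m div g) = int m" using gm by (metis dvd_mult_div_cancel of_nat_mult)
    finally have kc: "k * c = k + int m * (q * r)" by simp
    have "fhat m chi k = (\<Sum>b\<in>{0..<int m}. chi (c * b) * ee (of_int (k * (c * b)) / of_nat m))"
      unfolding fhat_def
      by (rule sum_residues_mult[where f = "\<lambda>b. chi b * ee (of_int (k * b) / of_nat m)", OF per m c(2), symmetric])
    also have "\<dots> = (\<Sum>b\<in>{0..<int m}. chi c * (chi b * ee (of_int (k * b) / of_nat m)))"
    proof (rule sum.cong[OF refl])
      fix b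
      have "k * (c * b) = k * b + int m * (q * r * b)"
        using kc by (simp add: ring_distribs mult.assoc[symmetric])
      then have "[k * (c * b) = k * b] (mod int m)" by (simp add: cong_def)
      from ee_frac_cong[OF this m]
      show "chi (c * b) * ee (of_int (k * (c * b)) / of_nat m) = chi c * (chi b * ee (of_int (k * b) / of_nat m))"
        by (simp only: dchar_mult[OF d] mult.assoc)
    qed
    also have "\<dots> = chi c * fhat m chi k" by (simp add: fhat_def sum_distrib_left)
    finally have "(1 - chi c) * fhat m chi k = 0" by (simp add: algebra_simps)
    then have "fhat m chi k = 0" using c(3) by simp
    then show ?thesis using dchar_eq_0[OF d False] by simp
  qed
qed

text \<open>For a prime p dividing n the squarefree divisors of n come in pairs e and pe with e
  prime to p, and the two members have opposite signs.\<close>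

lemma sum_moebius_mu:
  assumes "n \<ge> 1"
  shows "(\<Sum>e | e dvd n. of_int (moebius_mu e)) = (if n = 1 then 1 else (0::complex))"
proof (cases "n = 1")
  case True
  have "{e. e dvd (1::nat)} = {1}" by auto
  then show ?thesis using True by (simp add: moebius_mu_def)
next
  case False
  then obtain p where p: "prime p" "p dvd n" using prime_factor_nat by blast
  have fin: "finite {e. e dvd n}" using assms by simp
  define A where "A = {e. e dvd n \<and> squarefree e \<and> \<not> p dvd e}"
  have finA: "finite A" using fin by (simp add: A_def)
  have cop: "coprime p e" if "e \<in> A" for e
    using that p(1) by (auto simp: A_def intro: prime_imp_coprime)
  have pe: "p * e dvd n" if "e \<in> A" for e
    using that p(2) cop[OF that] by (auto simp: A_def intro: divides_mult)
  have sq: "squarefree (p * e)" if "e \<in> A" for e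
    using that p(1) cop[OF that] by (auto simp: A_def intro: squarefree_mult_coprime squarefree_prime)
  have mu: "moebius_mu (p * e) = - moebius_mu e" if "e \<in> A" for e
  proof -
    have e0: "e \<noteq> 0" using that assms by (auto simp: A_def)
    have p0: "p \<noteq> 0" using p(1) by auto
    have "prime_factors (p * e) = insert p (prime_factors e)"
      using e0 p(1) p0 by (simp add: prime_factors_product prime_prime_factors)
    moreover have "p \<notin> prime_factors e" using that by (auto simp: A_def)
    ultimately have "card (prime_factors (p * e)) = Suc (card (prime_factors e))" by simp
    then show ?thesis using sq[OF that] that by (simp add: moebius_mu_def A_def)
  qed
  have split: "{e. e dvd n \<and> squarefree e} = A \<union> (\<lambda>e. p * e) ` A" (is "?L = ?R")
  proof
    show "?R \<subseteq> ?L" using pe sq by (auto simp: A_def)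
    show "?L \<subseteq> ?R"
    proof
      fix e assume e: "e \<in> ?L"
      show "e \<in> ?R"
      proof (cases "p dvd e")
        case True
        then obtain f where f: "e = p * f" by auto
        have sf: "squarefree f" using e f squarefree_multD[of p f] by simp
        have "\<not> p dvd f"
        proof
          assume "p dvd f"
          then have "p ^ 2 dvd e" using f by (simp add: power2_eq_square)
          then have "is_unit p" using e by (auto simp: squarefree_def)
          then show False using p(1) by auto
        qed
        then have "f \<in> A" using e f sf by (auto simp: A_def intro: dvd_trans[OF dvd_triv_right])
        then show ?thesis using f by blast
      qed (use e in \<open>auto simp: A_def\<close>)
    qed
  qed
  have "(\<Sum>e | e dvd n. of_int (moebius_mu e) :: complex) = (\<Sum>e | e dvd n \<and> squarefree e. of_int (moebius_mu e))"
    by (rule sum.mono_neutral_right) (use fin in \<open>auto simp: moebius_mu_def\<close>)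
  also have "\<dots> = (\<Sum>e\<in>A. of_int (moebius_mu e)) + (\<Sum>e\<in>(\<lambda>e. p * e) ` A. of_int (moebius_mu e))"
    unfolding split by (rule sum.union_disjoint) (use finA in \<open>auto simp: A_def\<close>)
  also have "(\<Sum>e\<in>(\<lambda>e. p * e) ` A. of_int (moebius_mu e) :: complex) = (\<Sum>e\<in>A. - of_int (moebius_mu e))"
    using p(1) by (subst sum.reindex) (auto simp: inj_on_def mu)
  finally show ?thesis using False by (simp add: sum_negf)
qed

lemma sum_ee_residues:
  assumes "d \<ge> 1"
  shows "(\<Sum>j\<in>{0..<int d}. ee (of_int (k * j) / of_nat d)) = (if int d dvd k then of_nat d else 0)"
proof (cases "int d dvd k")
  case True
  then obtain q where "k = int d * q" by auto
  then have "of_int (k * j) / real d = of_int (q * j)" for j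
    using assms by (simp add: field_simps)
  then have "ee (of_int (k * j) / of_nat d) = 1" for j
    by (simp only: ee_of_int)
  then show ?thesis using True by simp
next
  case False
  define S where "S = (\<Sum>j\<in>{0..<int d}. ee (of_int (k * j) / of_nat d))"
  define z where "z = ee (of_int k / of_nat d)"
  have "z \<noteq> 1"
  proof
    assume "z = 1"
    then obtain q where "of_int k / real d = of_int q" by (auto simp: z_def ee_eq_1_iff elim: Ints_cases)
    then have "of_int k = (of_int (q * int d) :: real)" using assms by (simp add: field_simps)
    then have "k = q * int d" by (simp only: of_int_eq_iff)
    then show False using False by simp
  qed
  have "z * S = (\<Sum>j\<in>{0..<int d}. ee (of_int (k * (j + 1)) / of_nat d))"
    unfolding S_def z_def sum_distrib_left by (simp add: ee_add[symmetric] add_divide_distrib[symmetric] algebra_simps)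
  also have "\<dots> = (\<Sum>j\<in>{1..<int d + 1}. ee (of_int (k * j) / of_nat d))"
    by (rule sum.reindex_bij_witness[of _ "\<lambda>j. j - 1" "\<lambda>j. j + 1"]) auto
  also have "\<dots> = S - ee (of_int (k * 0) / of_nat d) + ee (of_int (k * int d) / of_nat d)"
  proof -
    have a: "{1..<int d + 1} = insert (int d) {1..<int d}" using assms by auto
    have b: "{0..<int d} = insert 0 {1..<int d}" using assms by auto
    show ?thesis unfolding S_def a b by simp
  qed
  also have "\<dots> = S" using assms by simp
  finally have "(z - 1) * S = 0" by (simp add: algebra_simps)
  then have "S = 0" using \<open>z \<noteq> 1\<close> by simp
  then show ?thesis using False unfolding S_def by simp
qed

lemma sum_int_product_range:
  fixes f :: "int \<Rightarrow> complex"
  assumes "m \<ge> 1"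
  shows "(\<Sum>b\<in>{0..<int (m * d)}. f b) = (\<Sum>r\<in>{0..<int m}. \<Sum>j\<in>{0..<int d}. f (r + int m * j))"
proof -
  have "(\<Sum>r\<in>{0..<int m}. \<Sum>j\<in>{0..<int d}. f (r + int m * j)) = (\<Sum>(r, j)\<in>{0..<int m} \<times> {0..<int d}. f (r + int m * j))"
    by (simp add: sum.cartesian_product)
  also have "\<dots> = (\<Sum>b\<in>{0..<int (m * d)}. f b)"
  proof (rule sum.reindex_bij_witness[of _ "\<lambda>b. (b mod int m, b div int m)" "\<lambda>(r, j). r + int m * j"], goal_cases)
    case (1 a)
    then show ?case by auto
  next
    case (2 a)
    then obtain r j where a: "a = (r, j)" "0 \<le> r" "r < int m" "0 \<le> j" "j < int d" by auto
    have "r + int m * j < int m * (j + 1)" using a by (simp add: ring_distribs)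
    also have "\<dots> \<le> int m * int d" using a by (intro mult_left_mono) auto
    finally show ?case using a by simp
  next
    case (4 b)
    have "int m * (b div int m) \<le> b"
      using mult_div_mod_eq[of "int m" b] pos_mod_sign[of "int m" b] assms by linarith
    also have "b < int m * int d" using 4 by simp
    finally have "b div int m < int d" using assms by simp
    then show ?case using 4 assms by (auto simp: pos_imp_zdiv_nonneg_iff)
  qed (use assms in auto)
  finally show ?thesis ..
qed

text \<open>Gauss sums of imprimitive characters; this is the origin of the inner divisor sum of
  \<open>sigma0\<close>. The character is its primitive character times a Moebius sum that detects
  coprimality to l = M/m. For each e the multiples of e leave a sum modulo m(l/e), which
  separability evaluates.\<close>

lemma fhat_induced:
  assumes d: "dirichlet_character M chi" and M: "M \<ge> 1"
  defines "m \<equiv> conductor M chi" and "l \<equiv> conductor_index M chi" and "chi0 \<equiv> inducing_primitive M chi"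
  shows "fhat M chi k = gauss_sum m chi0 *
     (\<Sum>d | d dvd l \<and> int d dvd k. of_nat d * of_int (moebius_mu (l div d)) * chi0 (int (l div d)) * cnj (chi0 (k div int d)))"
proof -
  note ind = inducing_primitive(1)[OF d M, folded m_def chi0_def]
  note prim = inducing_primitive(2)[OF d M, folded m_def chi0_def]
  have d0: "dirichlet_character m chi0" using prim by (simp add: primitive_character_def)
  have m: "m \<ge> 1" "m dvd M" using conductor_pos[OF d M] by (simp_all add: m_def)
  have Mml: "M = m * l" using m(2) by (simp add: l_def conductor_index_def m_def)
  have l: "l \<ge> 1" using Mml M by (cases l) auto
  \<comment> \<open>The Moebius sum is 1 if gcd(b, l) = 1 and 0 otherwise, and coprimality to M = ml
    means coprimality to both factors.\<close>
  have chi: "chi b = chi0 b * (\<Sum>e | e dvd l \<and> int e dvd b. of_int (moebius_mu e))" for b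
  proof -
    define g where "g = nat (gcd b (int l))"
    have g: "int g = gcd b (int l)" by (simp add: g_def)
    have "gcd b (int l) > 0" using l by simp
    then have g1: "g \<ge> 1" unfolding g_def by linarith
    have "{e. e dvd l \<and> int e dvd b} = {e. e dvd g}"
    proof (intro Collect_cong)
      fix e
      have "e dvd g \<longleftrightarrow> int e dvd gcd b (int l)" using g by (metis int_dvd_int_iff)
      then show "e dvd l \<and> int e dvd b \<longleftrightarrow> e dvd g" by auto
    qed
    then have s: "(\<Sum>e | e dvd l \<and> int e dvd b. of_int (moebius_mu e)) = (if g = 1 then 1 else (0::complex))"
      using sum_moebius_mu[OF g1] by simp
    have g1': "g = 1 \<longleftrightarrow> coprime b (int l)" using g by (metis coprime_iff_gcd_eq_1 of_nat_1 of_nat_eq_iff)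
    have cM: "coprime b (int M) \<longleftrightarrow> coprime b (int m) \<and> coprime b (int l)" by (simp add: Mml)
    show ?thesis
    proof (cases "coprime b (int M)")
      case True
      then show ?thesis using s g1' cM ind by (simp add: induces_def)
    next
      case False
      then show ?thesis using dchar_eq_0[OF d False] dchar_eq_0[OF d0, of b] s g1' cM by auto
    qed
  qed
  have finl: "finite {e. e dvd l}" using l by simp
  define X where "X n = (\<Sum>b\<in>{0..<int (m * n)}. chi0 b * ee (of_int (k * b) / of_nat (m * n)))" for n
  \<comment> \<open>With b = r + mj the sum over j vanishes unless n divides k; the sum over r is
    then a primitive Gauss sum at frequency k/n.\<close>
  have X: "X n = (if int n dvd k then of_nat n * cnj (chi0 (k div int n)) * gauss_sum m chi0 else 0)" if n: "n \<ge> 1" for n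
  proof -
    have "X n = (\<Sum>r\<in>{0..<int m}. \<Sum>j\<in>{0..<int n}. chi0 (r + int m * j) * ee (of_int (k * (r + int m * j)) / of_nat (m * n)))"
      unfolding X_def by (rule sum_int_product_range[OF m(1)])
    also have "\<dots> = (\<Sum>r\<in>{0..<int m}. \<Sum>j\<in>{0..<int n}. chi0 r * ee (of_int (k * r) / of_nat (m * n)) * ee (of_int (k * j) / of_nat n))"
    proof (intro sum.cong refl)
      fix r j
      have "of_int (k * (r + int m * j)) / real (m * n) = of_int (k * r) / of_nat (m * n) + of_int (k * j) / of_nat n"
        using m n by (simp add: field_simps)
      then show "chi0 (r + int m * j) * ee (of_int (k * (r + int m * j)) / of_nat (m * n)) =
          chi0 r * ee (of_int (k * r) / of_nat (m * n)) * ee (of_int (k * j) / of_nat n)"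
        by (simp only: ee_add periodic_int_multiple[of chi0 m, OF dchar_periodic[OF d0]] mult.assoc)
    qed
    also have "\<dots> = (\<Sum>r\<in>{0..<int m}. chi0 r * ee (of_int (k * r) / of_nat (m * n))) * (if int n dvd k then of_nat n else 0)"
      unfolding sum_distrib_left[symmetric] sum_distrib_right[symmetric] sum_ee_residues[OF n] ..
    also have "\<dots> = (if int n dvd k then of_nat n * fhat m chi0 (k div int n) else 0)"
    proof (cases "int n dvd k")
      case True
      then obtain q where q: "k = int n * q" by auto
      have "of_int (k * r) / real (m * n) = of_int (q * r) / of_nat m" for r using q n m by (simp add: field_simps)
      then show ?thesis using True q n by (simp add: fhat_def mult.commute)
    qed simp
    finally show ?thesis by (simp add: fhat_primitive[OF prim m(1)])
  qed
  have "fhat M chi k = (\<Sum>b\<in>{0..<int M}. \<Sum>e | e dvd l \<and> int e dvd b. of_int (moebius_mu e) * chi0 b * ee (of_int (k * b) / of_nat M))"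
    unfolding fhat_def by (subst chi) (simp add: sum_distrib_left sum_distrib_right mult_ac)
  also have "\<dots> = (\<Sum>b\<in>{0..<int M}. \<Sum>e | e dvd l. if int e dvd b then of_int (moebius_mu e) * chi0 b * ee (of_int (k * b) / of_nat M) else 0)"
    by (rule sum.cong[OF refl], subst sum.inter_filter[OF finl, symmetric]) simp
  also have "\<dots> = (\<Sum>e | e dvd l. \<Sum>b\<in>{0..<int M}. if int e dvd b then of_int (moebius_mu e) * chi0 b * ee (of_int (k * b) / of_nat M) else 0)"
    by (rule sum.swap)
  also have "\<dots> = (\<Sum>e | e dvd l. of_int (moebius_mu e) * chi0 (int e) * X (l div e))"
  proof (rule sum.cong[OF refl])
    fix e assume "e \<in> {e. e dvd l}"
    then have e: "e dvd l" by simp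
    then have e1: "e \<ge> 1" using l by (cases e) auto
    have Me: "M = e * (m * (l div e))" using Mml e by auto
    have "(\<Sum>b\<in>{0..<int M}. if int e dvd b then of_int (moebius_mu e) * chi0 b * ee (of_int (k * b) / of_nat M) else 0) =
      (\<Sum>b | b \<in> {0..<int M} \<and> int e dvd b. of_int (moebius_mu e) * chi0 b * ee (of_int (k * b) / of_nat M))"
      by (subst sum.inter_filter[symmetric]) auto
    \<comment> \<open>Only multiples of e survive; their quotients by e run through the residues
      modulo M/e = m(l/e).\<close>
    also have "\<dots> = (\<Sum>b\<in>{0..<int (m * (l div e))}. of_int (moebius_mu e) * chi0 (int e * b) * ee (of_int (k * (int e * b)) / of_nat M))"
    proof (rule sum.reindex_bij_witness[of _ "\<lambda>b. int e * b" "\<lambda>b. b div int e"], goal_cases)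
      case (2 b)
      then obtain q where q: "b = int e * q" by auto
      have "int e * q < int e * int (m * (l div e))" using 2 q Me by (metis atLeastLessThan_iff mem_Collect_eq of_nat_mult)
      then have "q < int (m * (l div e))" using e1 by simp
      then show ?case using 2 q e1 by (auto simp: zero_le_mult_iff)
    next
      case (4 b)
      then have "int e * b < int e * int (m * (l div e))" using e1 by simp
      also have "\<dots> = int M" using Me by (metis of_nat_mult)
      finally show ?case using 4 by simp
    qed (use e1 in auto)
    also have "\<dots> = of_int (moebius_mu e) * chi0 (int e) * X (l div e)"
      unfolding X_def sum_distrib_left
    proof (intro sum.cong refl)
      fix b
      have "of_int (k * (int e * b)) / real M = of_int (k * b) / of_nat (m * (l div e))"
        using e1 by (subst Me) (simp add: field_simps)
      then show "of_int (moebius_mu e) * chi0 (int e * b) * ee (of_int (k * (int e * b)) / of_nat M) =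
         of_int (moebius_mu e) * chi0 (int e) * (chi0 b * ee (of_int (k * b) / of_nat (m * (l div e))))"
        by (simp only: dchar_mult[OF d0] mult_ac)
    qed
    finally show "(\<Sum>b\<in>{0..<int M}. if int e dvd b then of_int (moebius_mu e) * chi0 b * ee (of_int (k * b) / of_nat M) else 0) =
      of_int (moebius_mu e) * chi0 (int e) * X (l div e)" .
  qed
  \<comment> \<open>The complementary divisor d = l/e is the one that occurs in
    \<open>sigma0\<close>.\<close>
  also have "\<dots> = (\<Sum>d | d dvd l. of_int (moebius_mu (l div d)) * chi0 (int (l div d)) * X d)"
    using l by (intro sum.reindex_bij_witness[of _ "\<lambda>d. l div d" "\<lambda>d. l div d"]) (auto elim!: dvdE)
  also have "\<dots> = (\<Sum>d | d dvd l. if int d dvd k then gauss_sum m chi0 * (of_nat d * of_int (moebius_mu (l div d)) * chi0 (int (l div d)) * cnj (chi0 (k div int d))) else 0)"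
  proof (rule sum.cong[OF refl])
    fix n assume "n \<in> {d. d dvd l}"
    then have "n \<ge> 1" using l by (cases n) auto
    then show "of_int (moebius_mu (l div n)) * chi0 (int (l div n)) * X n =
      (if int n dvd k then gauss_sum m chi0 * (of_nat n * of_int (moebius_mu (l div n)) * chi0 (int (l div n)) * cnj (chi0 (k div int n))) else 0)"
      by (simp add: X)
  qed
  also have "\<dots> = gauss_sum m chi0 *
     (\<Sum>d | d dvd l \<and> int d dvd k. of_nat d * of_int (moebius_mu (l div d)) * chi0 (int (l div d)) * cnj (chi0 (k div int d)))"
    by (subst sum.inter_filter[OF finl, symmetric]) (simp add: sum_distrib_left)
  finally show ?thesis .
qed

text \<open>Frequency 0 governs one of the two sources of the constant term. A nontrivial character
  sums to 0 over the residues; for the trivial one the sum is the totient of M, which brings in the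
  Euler product.\<close>

lemma fhat_0:
  assumes d: "dirichlet_character M chi" and M: "M \<ge> 1"
  shows "fhat M chi 0 = (if chi = trivial_character M then of_nat M * euler_product_at M else 0)"
proof (cases "chi = trivial_character M")
  case True
  have "fhat M chi 0 = (\<Sum>b\<in>{0..<int M}. if coprime b (int M) then 1 else 0)"
    unfolding fhat_def True by (simp add: trivial_character_def)
  also have "\<dots> = of_nat (card {b\<in>{0..<int M}. coprime b (int M)})"
    by (simp add: sum.If_cases Int_def)
  also have "card {b\<in>{0..<int M}. coprime b (int M)} = totient M"
  proof -
    have "{b\<in>{0..<int M}. coprime b (int M)} = int ` {b\<in>{0..<M}. coprime b M}"
    proof (intro equalityI subsetI)
      fix b assume b: "b \<in> {b\<in>{0..<int M}. coprime b (int M)}"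
      then have "b = int (nat b)" by simp
      then have "nat b \<in> {b\<in>{0..<M}. coprime b M}" using b by (auto simp: coprime_int_iff[symmetric] simp del: coprime_int_iff)
      then show "b \<in> int ` {b\<in>{0..<M}. coprime b M}" using \<open>b = int (nat b)\<close> by blast
    qed auto
    then have "card {b\<in>{0..<int M}. coprime b (int M)} = card {b\<in>{0..<M}. coprime b M}"
      by (simp add: card_image)
    also have "\<dots> = totient M"
    \<comment> \<open>M = 1 is separate because \<open>totatives\<close> takes its representatives
      from 1 to M and not from 0 to M - 1.\<close>
    proof (cases "M = 1")
      case True
      then have "{b\<in>{0..<M}. coprime b M} = {0}" by auto
      then show ?thesis using True by simp
    next
      case False
      have "{b\<in>{0..<M}. coprime b M} = totatives M"
        using False M by (auto simp: totatives_def coprime_commute intro!: Suc_leI intro: gr0I order.not_eq_order_implies_strict)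
      then show ?thesis by (simp add: totient_def)
    qed
    finally show ?thesis .
  qed
  also have "complex_of_nat (totient M) = of_real (real (totient M))" by simp
  also have "real (totient M) = real M * (\<Prod>p\<in>prime_factors M. 1 - 1 / real p)" by (rule totient_formula2)
  finally show ?thesis using True by (simp add: euler_product_at_def)
next
  case False
  obtain c where c: "coprime c (int M)" "chi c \<noteq> 1"
  proof (rule ccontr)
    assume "\<not> thesis"
    then have "chi a = trivial_character M a" for a
      using that dchar_eq_0[OF d, of a] by (auto simp: trivial_character_def)
    then show False using False by blast
  qed
  have "fhat M chi 0 = (\<Sum>b\<in>{0..<int M}. chi b)" by (simp add: fhat_def)
  moreover have "(\<Sum>b\<in>{0..<int M}. chi (c * b)) = (\<Sum>b\<in>{0..<int M}. chi b)"
    using sum_residues_mult[of chi M c] dchar_periodic[OF d] M c(1) by blast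
  ultimately have "chi c * fhat M chi 0 = fhat M chi 0"
    by (simp add: dchar_mult[OF d] sum_distrib_left)
  then have "(chi c - 1) * fhat M chi 0 = 0" by (simp add: algebra_simps)
  then show ?thesis using c(2) False by simp
qed

section \<open>Poisson summation for Gaussians\<close>

lemma power_le_fact_exp: "0 \<le> x \<Longrightarrow> x ^ K \<le> fact K * exp (x :: real)"
proof -
  assume x: "0 \<le> x"
  have s: "(\<lambda>n. x ^ n /\<^sub>R fact n) sums exp x" by (rule exp_converges)
  have "(\<Sum>n\<in>{K}. x ^ n /\<^sub>R fact n) \<le> suminf (\<lambda>n. x ^ n /\<^sub>R fact n)"
    by (rule sum_le_suminf) (use s x in \<open>auto simp: sums_iff\<close>)
  also have "\<dots> = exp x" using s by (simp add: sums_iff)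
  finally have "x ^ K / fact K \<le> exp x" by (simp add: field_simps)
  then show "x ^ K \<le> fact K * exp x" by (simp add: field_simps)
qed

text \<open>Half of the exponent pays for the power. Polynomial factors are absorbed in this way
  throughout.\<close>

lemma power_exp_le:
  assumes "c > 0" "0 \<le> (x::real)"
  shows "x ^ K * exp (- c * x) \<le> fact K * (2 / c) ^ K * exp (- (c / 2) * x)"
proof -
  have "(c / 2 * x) ^ K \<le> fact K * exp (c / 2 * x)" by (rule power_le_fact_exp) (use assms in simp)
  then have "x ^ K \<le> fact K * (2 / c) ^ K * exp (c / 2 * x)"
    using assms by (simp add: field_simps power_mult_distrib power_divide)
  then have "x ^ K * exp (- c * x) \<le> (fact K * (2 / c) ^ K * exp (c / 2 * x)) * exp (- c * x)"
    by (rule mult_right_mono) simp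
  also have "\<dots> = fact K * (2 / c) ^ K * exp (- (c / 2) * x)"
    by (simp add: mult.assoc exp_add[symmetric])
  finally show ?thesis .
qed

lemma summable_nat_poly_exp:
  assumes "c > 0" shows "summable (\<lambda>n. real n ^ K * exp (- c * real n))"
proof (rule summable_comparison_test')
  have "summable (\<lambda>n. exp (- (c / 2)) ^ n)" using assms by (intro summable_geometric) simp
  then show "summable (\<lambda>n. fact K * (2 / c) ^ K * exp (- (c / 2) * real n))"
    by (intro summable_mult) (simp add: exp_of_nat_mult[symmetric] mult.commute)
  show "norm (real n ^ K * exp (- c * real n)) \<le> fact K * (2 / c) ^ K * exp (- (c / 2) * real n)" for n
    using power_exp_le[OF assms, of "real n" K] by simp
qed

lemma summable_on_int_abs:
  fixes f :: "nat \<Rightarrow> real"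
  assumes "summable f" "\<And>n. f n \<ge> 0"
  shows "(\<lambda>n::int. f (nat \<bar>n\<bar>)) summable_on UNIV"
proof -
  have s: "f summable_on UNIV" using assms by (simp add: summable_on_UNIV_nonneg_real_iff)
  have "(\<lambda>n::int. f (nat \<bar>n\<bar>)) summable_on range int"
    by (subst summable_on_reindex) (use s in \<open>auto simp: o_def\<close>)
  moreover have "(\<lambda>n::int. f (nat \<bar>n\<bar>)) summable_on range (\<lambda>n. - int n)"
    by (subst summable_on_reindex) (use s in \<open>auto simp: o_def inj_on_def\<close>)
  ultimately have "(\<lambda>n::int. f (nat \<bar>n\<bar>)) summable_on (range int \<union> range (\<lambda>n. - int n))"
    by (rule summable_on_union)
  moreover have "n \<in> range int \<union> range (\<lambda>n. - int n)" for n by (cases n rule: int_cases2) auto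
  then have "range int \<union> range (\<lambda>n. - int n) = UNIV" by blast
  ultimately show ?thesis by simp
qed

lemma summable_int_poly_exp:
  assumes "c > 0" shows "(\<lambda>n::int. \<bar>of_int n\<bar> ^ K * exp (- c * \<bar>of_int n\<bar>) :: real) summable_on UNIV"
proof -
  have e: "real (nat \<bar>n\<bar>) = \<bar>of_int n\<bar>" for n :: int by linarith
  have "\<And>n. real n ^ K * exp (- c * real n) \<ge> 0" by simp
  from summable_on_int_abs[OF summable_nat_poly_exp[OF assms] this] show ?thesis unfolding e .
qed

section \<open>Uniqueness of Fourier coefficients of continuous periodic functions\<close>

inductive trigpoly :: "(real \<Rightarrow> complex) \<Rightarrow> bool" where
  trigpoly_ee: "trigpoly (\<lambda>x. c * ee (of_int k * x))"
| trigpoly_add: "trigpoly f \<Longrightarrow> trigpoly g \<Longrightarrow> trigpoly (\<lambda>x. f x + g x)"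

lemma trigpoly_mult_ee: "trigpoly f \<Longrightarrow> trigpoly (\<lambda>x. c * ee (of_int k * x) * f x)"
proof (induction f rule: trigpoly.induct)
  case (trigpoly_ee d j)
  have eq: "(\<lambda>x. c * ee (of_int k * x) * (d * ee (of_int j * x))) = (\<lambda>x. (c * d) * ee (of_int (k + j) * x))"
    by (rule ext) (simp add: ee_add ring_distribs)
  show ?case unfolding eq by (rule trigpoly.trigpoly_ee)
qed (simp add: ring_distribs trigpoly_add)

lemma trigpoly_mult: "trigpoly f \<Longrightarrow> trigpoly g \<Longrightarrow> trigpoly (\<lambda>x. f x * g x)"
  by (induction f rule: trigpoly.induct) (simp_all add: trigpoly_mult_ee ring_distribs trigpoly_add)

lemma trigpoly_const: "trigpoly (\<lambda>x. c)"
  using trigpoly_ee[of c 0] by simp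

lemma continuous_ee [continuous_intros]: "continuous_on S f \<Longrightarrow> continuous_on S (\<lambda>x. ee (f x))"
  unfolding ee_def by (intro continuous_intros)

lemma trigpoly_continuous: "trigpoly f \<Longrightarrow> continuous_on S f"
  by (induction f rule: trigpoly.induct) (auto intro!: continuous_intros)

text \<open>A real linear functional on the plane is a combination of z and its conjugate, and on
  the unit circle the conjugate of e(x) is e(-x); sums and products follow by induction.\<close>

lemma trigpoly_real_polynomial:
  assumes "real_polynomial_function p"
  shows "trigpoly (\<lambda>x. of_real (p (ee x)))"
  using assms
proof (induction p rule: real_polynomial_function.induct)
  case (linear f)
  have f: "f z = Re z * f 1 + Im z * f \<i>" for z
  proof -
    have z: "Re z *\<^sub>R 1 + Im z *\<^sub>R \<i> = z" by (simp add: complex_eq_iff)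
    interpret f: bounded_linear f by (rule linear)
    have "f (Re z *\<^sub>R 1 + Im z *\<^sub>R \<i>) = Re z * f 1 + Im z * f \<i>" by (simp only: f.add f.scaleR real_scaleR_def)
    then show ?thesis by (simp only: z)
  qed
  have eq: "(\<lambda>x. of_real (f (ee x))) = (\<lambda>x. (of_real (f 1) / 2 - \<i> * of_real (f \<i>) / 2) * ee (of_int 1 * x)
      + (of_real (f 1) / 2 + \<i> * of_real (f \<i>) / 2) * ee (of_int (-1) * x))"
    by (rule ext, subst f) (simp add: ee_uminus complex_eq_iff field_simps)
  show ?case unfolding eq by (rule trigpoly_add[OF trigpoly_ee trigpoly_ee])
next
  case (const c)
  show ?case by (rule trigpoly_const)
qed (simp_all add: trigpoly_add trigpoly_mult)

text \<open>Stone-Weierstrass on the unit circle: the 1-periodic function is transported there by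
  the argument, and polynomials on the circle pull back to trigonometric polynomials.\<close>

lemma trigpoly_dense:
  assumes f: "continuous_on UNIV f" "\<And>x. f (x + 1) = f x" and e: "e > 0"
  obtains q where "trigpoly q" "\<And>x. norm (f x - q x) < e"
proof -
  have per: "f (x + of_int k) = f x" for x k
  proof (induction k rule: int_induct[where k=0])
    case (step1 i)
    then show ?case using f(2)[of "x + of_int i"] by (simp add: add.assoc)
  next
    case (step2 i)
    then show ?case using f(2)[of "x + of_int (i - 1)"] by (simp add: add.assoc)
  qed simp
  define g where "g z = f (Arg z / (2 * pi))" for z
  have g_ee: "g (ee x) = f x" for x
  proof -
    have "ee (Arg (ee x) / (2 * pi)) = ee x"
      using cis_Arg[of "ee x"] by (simp add: ee_def sgn_div_norm)
    then have "ee (Arg (ee x) / (2 * pi) - x) = 1"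
      using ee_add[of "Arg (ee x) / (2 * pi)" "- x"] by (simp add: ee_uminus complex_norm_square[symmetric])
    then obtain k where "Arg (ee x) / (2 * pi) - x = of_int k" by (auto simp: ee_eq_1_iff elim: Ints_cases)
    then have "Arg (ee x) / (2 * pi) = x + of_int k" by simp
    then show ?thesis by (simp add: g_def per)
  qed
  have fc: "isCont f x" for x using f(1) by (simp add: continuous_on_eq_continuous_at)
  have cg: "continuous_on (sphere 0 1) g"
  proof (intro continuous_at_imp_continuous_on ballI)
    fix z :: complex assume "z \<in> sphere 0 1"
    then have z0: "z \<noteq> 0" by auto
    show "isCont g z"
    proof (cases "z \<in> \<real>\<^sub>\<le>\<^sub>0")
      case False
      have "isCont (\<lambda>w. Arg w / (2 * pi)) z" using continuous_at_Arg[OF False] by (intro continuous_intros) auto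
      then show ?thesis unfolding g_def by (rule isCont_o2) (rule fc)
    next
      \<comment> \<open>On the branch cut the argument of -w is continuous. It differs from that of
        w by half a turn up to full turns, and the periodicity of f absorbs the full turns.\<close>
      case True
      have nz: "- z \<notin> \<real>\<^sub>\<le>\<^sub>0" using True z0 by (auto simp: complex_nonpos_Reals_iff complex_eq_iff)
      have "isCont Arg (- z)" using continuous_at_Arg[OF nz] .
      then have "isCont (\<lambda>w. Arg (- w)) z" 
        by (rule isCont_o2[OF isCont_minus[OF continuous_ident]])
      then have "isCont (\<lambda>w. Arg (- w) / (2 * pi) + 1/2) z" by (intro continuous_intros) auto
      then have "isCont (\<lambda>w. f (Arg (- w) / (2 * pi) + 1/2)) z" by (rule isCont_o2) (rule fc)
      moreover have "\<forall>\<^sub>F w in nhds z. g w = f (Arg (- w) / (2 * pi) + 1/2)"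
      proof -
        have "\<forall>\<^sub>F w in nhds z. w \<noteq> 0" by (rule t1_space_nhds) (rule z0)
        then show ?thesis
        proof eventually_elim
          case (elim w)
          have "Arg (- w) / (2 * pi) + 1/2 = Arg w / (2 * pi) + of_int (if Arg w \<le> 0 then 1 else 0)"
            using Arg_minus[OF elim] by (simp add: field_simps)
          then show ?case unfolding g_def by (simp only: per)
        qed
      qed
      ultimately show ?thesis by (subst isCont_cong) auto
    qed
  qed
  obtain p where p: "polynomial_function p" "\<And>z. z \<in> sphere 0 1 \<Longrightarrow> norm (g z - p z) < e"
    using Stone_Weierstrass_polynomial_function[OF _ cg e] by auto
  have rp: "real_polynomial_function (\<lambda>z. Re (p z))" "real_polynomial_function (\<lambda>z. Im (p z))"
    using p(1) bounded_linear_Re bounded_linear_Im by (auto simp: polynomial_function_def o_def)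
  define q where "q x = of_real (Re (p (ee x))) + \<i> * of_real (Im (p (ee x)))" for x
  have "trigpoly q" unfolding q_def
    by (intro trigpoly_add trigpoly_mult trigpoly_const trigpoly_real_polynomial rp)
  moreover have "norm (f x - q x) < e" for x
  proof -
    have "q x = p (ee x)" unfolding q_def by (metis complex_eq)
    then show ?thesis using p(2)[of "ee x"] g_ee[of x] by simp
  qed
  ultimately show ?thesis using that by blast
qed

text \<open>The integral of |f|^2 equals the integral of f times (cnj f - q) for every trigonometric
  polynomial q, hence is arbitrarily small by density.\<close>

lemma fourier_unique:
  assumes f: "continuous_on UNIV f" "\<And>x. f (x + 1) = f x"
    and z: "\<And>k::int. integral {0..1} (\<lambda>x. f x * ee (of_int k * x)) = 0"
  shows "f x = 0"
proof -
  have cf: "continuous_on S f" for S using f(1) continuous_on_subset by blast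
  have tp: "integral {0..1} (\<lambda>x. f x * q x) = 0" if "trigpoly q" for q
    using that
  proof (induction q rule: trigpoly.induct)
    case (trigpoly_ee c k)
    have "integral {0..1} (\<lambda>x. f x * (c * ee (of_int k * x))) = integral {0..1} (\<lambda>x. c * (f x * ee (of_int k * x)))"
      by (simp add: mult_ac)
    then show ?case using z by simp
  next
    case (trigpoly_add p q)
    have "integral {0..1} (\<lambda>x. f x * (p x + q x)) = integral {0..1} (\<lambda>x. f x * p x) + integral {0..1} (\<lambda>x. f x * q x)"
      unfolding distrib_left
      by (intro integral_add integrable_continuous_real continuous_intros cf trigpoly_continuous trigpoly_add)
    then show ?case using trigpoly_add by simp
  qed
  define I where "I = integral {0..1} (\<lambda>x. f x * cnj (f x))"
  have "bounded (f ` {0..1})" by (intro compact_imp_bounded compact_continuous_image cf) simp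
  then obtain B where B: "\<And>x. x \<in> {0..1} \<Longrightarrow> norm (f x) \<le> B" unfolding bounded_iff by blast
  have B0: "B \<ge> 0" using order_trans[OF norm_ge_zero B[of 0]] by simp
  have "norm I \<le> e" if e: "e > 0" for e
  proof -
    \<comment> \<open>B + 1 instead of B keeps the tolerance meaningful when the bound B is
      0.\<close>
    have e': "e / (B + 1) > 0" using e B0 by simp
    obtain q where q: "trigpoly q" "\<And>x. norm (cnj (f x) - q x) < e / (B + 1)"
      using trigpoly_dense[of "\<lambda>x. cnj (f x)", OF _ _ e'] f by (metis continuous_on_cnj)
    have "I = integral {0..1} (\<lambda>x. f x * cnj (f x)) - integral {0..1} (\<lambda>x. f x * q x)"
      using tp[OF q(1)] by (simp add: I_def)
    also have "\<dots> = integral {0..1} (\<lambda>x. f x * cnj (f x) - f x * q x)"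
      by (intro integral_diff[symmetric] integrable_continuous_real continuous_intros cf trigpoly_continuous q)
    finally have I: "I = integral {0..1} (\<lambda>x. f x * cnj (f x) - f x * q x)" .
    have "norm I \<le> integral {0..1} (\<lambda>x::real. e)" unfolding I
    proof (rule integral_norm_bound_integral)
      show "(\<lambda>x. f x * cnj (f x) - f x * q x) integrable_on {0..1}"
        by (intro integrable_continuous_real continuous_intros cf trigpoly_continuous q)
      fix x :: real assume "x \<in> {0..1}"
      have "norm (f x * cnj (f x) - f x * q x) = norm (f x) * norm (cnj (f x) - q x)"
        by (simp add: norm_mult[symmetric] right_diff_distrib)
      also have "\<dots> \<le> B * (e / (B + 1))" using B[OF \<open>x \<in> {0..1}\<close>] q(2)[of x] B0
        by (intro mult_mono) auto
      also have "\<dots> \<le> e" using B0 e by (simp add: field_simps)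
      finally show "norm (f x * cnj (f x) - f x * q x) \<le> e" .
    qed (intro integrable_continuous_real continuous_intros)
    then show ?thesis by simp
  qed
  then have "norm I \<le> 0" using field_le_epsilon[of "norm I" 0] by (metis add_0)
  then have "I = 0" by simp
  moreover have "I = of_real (integral {0..1} (\<lambda>x. (norm (f x))\<^sup>2))"
    unfolding I_def complex_norm_square[symmetric]
    using integral_linear[OF _ bounded_linear_of_real, of "\<lambda>x. (norm (f x))\<^sup>2" "{0..1}"]
    by (simp add: o_def integrable_continuous_real continuous_intros cf)
  ultimately have "integral {0..1} (\<lambda>x. (norm (f x))\<^sup>2) = 0" by simp
  then have z: "\<forall>x\<in>{0..1}. (norm (f x))\<^sup>2 = 0"
    by (subst (asm) integral_eq_0_iff) (auto intro!: continuous_intros cf)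
  have per: "f (x + of_int k) = f x" for x k
  proof (induction k rule: int_induct[where k=0])
    case (step1 i)
    then show ?case using f(2)[of "x + of_int i"] by (simp add: add.assoc)
  next
    case (step2 i)
    then show ?case using f(2)[of "x + of_int (i - 1)"] by (simp add: add.assoc)
  qed simp
  have "f x = f (frac x)" using per[of "frac x" "\<lfloor>x\<rfloor>"] by (simp add: frac_def)
  also have "\<dots> = 0" using z frac_ge_0[of x] frac_lt_1[of x] by (auto simp: less_imp_le)
  finally show ?thesis .
qed

section \<open>The Poisson summation formula\<close>

lemma lborel_integral_tendsto:
  fixes h :: "real \<Rightarrow> complex"
  assumes "integrable lborel h"
  shows "(\<lambda>N. integral {- real N..real N} h) \<longlonglongrightarrow> integral\<^sup>L lborel h"
proof -
  have "(\<lambda>N. LINT x|lborel. indicator {- real N..real N} x *\<^sub>R h x) \<longlonglongrightarrow> integral\<^sup>L lborel h"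
  proof (rule integral_dominated_convergence[where w = "\<lambda>x. norm (h x)"])
    show "AE x in lborel. (\<lambda>N. indicator {- real N..real N} x *\<^sub>R h x) \<longlonglongrightarrow> h x"
    proof (intro always_eventually allI)
      fix x :: real
      have "\<forall>\<^sub>F N in sequentially. indicator {- real N..real N} x *\<^sub>R h x = h x"
        using eventually_ge_at_top[of "nat \<lceil>\<bar>x\<bar>\<rceil>"]
      proof eventually_elim
        case (elim N)
        then have "\<bar>x\<bar> \<le> real N" by linarith
        then show ?case by (simp add: indicator_def) linarith
      qed
      then show "(\<lambda>N. indicator {- real N..real N} x *\<^sub>R h x) \<longlonglongrightarrow> h x"
        by (rule tendsto_eventually)
    qed
  qed (use assms in \<open>auto simp: indicator_def\<close>)
  moreover have "(LINT x|lborel. indicator {- real N..real N} x *\<^sub>R h x) = integral {- real N..real N} h" for N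
  proof -
    have "set_integrable lborel {- real N..real N} h"
      using assms by (simp add: integrable_mult_indicator set_integrable_def)
    from set_borel_integral_eq_integral(2)[OF this] show ?thesis by (simp add: set_lebesgue_integral_def)
  qed
  ultimately show ?thesis by simp
qed

text \<open>The unordered sum is evaluated along the exhaustion by the unit intervals inside
  [-N, N], where it telescopes to one integral.\<close>

lemma has_sum_int_intervals:
  fixes h :: "real \<Rightarrow> complex"
  assumes "integrable lborel h" "continuous_on UNIV h"
    and "((\<lambda>n::int. integral {of_int n..of_int n + 1} h) has_sum J) UNIV"
  shows "J = integral\<^sup>L lborel h"
proof -
  have "filterlim (\<lambda>N. {- int N..<int N}) (finite_subsets_at_top UNIV) sequentially"
    unfolding filterlim_finite_subsets_at_top
  proof (intro allI impI)
    fix X :: "int set" assume "finite X \<and> X \<subseteq> UNIV"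
    then have fin: "finite (abs ` X)" by simp
    obtain b where b: "\<And>y. y \<in> X \<Longrightarrow> \<bar>y\<bar> \<le> b" using fin bdd_above_finite[OF fin] by (auto simp: bdd_above_def)
    show "\<forall>\<^sub>F N in sequentially. finite {- int N..<int N} \<and> X \<subseteq> {- int N..<int N} \<and> {- int N..<int N} \<subseteq> UNIV"
      using eventually_ge_at_top[of "nat (b + 1)"]
    proof eventually_elim
      case (elim N)
      have "y \<in> {- int N..<int N}" if "y \<in> X" for y using b[OF that] elim by auto
      then show ?case by auto
    qed
  qed
  from filterlim_compose[OF assms(3)[unfolded has_sum_def] this]
  have "(\<lambda>N. \<Sum>n\<in>{- int N..<int N}. integral {of_int n..of_int n + 1} h) \<longlonglongrightarrow> J" .
  moreover have "(\<Sum>n\<in>{- int N..<int N}. integral {of_int n..of_int n + 1} h) = integral {- real N..real N} h" for N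
  proof (induction N)
    case (Suc N)
    have c: "h integrable_on S" if "S = {a..b}" for S a b
      unfolding that using assms(2) by (intro integrable_continuous_real) (rule continuous_on_subset, auto)
    have "{- int (Suc N)..<int (Suc N)} = insert (- int N - 1) (insert (int N) {- int N..<int N})" by auto
    then have "(\<Sum>n\<in>{- int (Suc N)..<int (Suc N)}. integral {of_int n..of_int n + 1} h) =
        integral {- real N - 1..- real N} h + (integral {- real N..real N} h + integral {real N..real N + 1} h)"
      using Suc by simp
    also have "integral {- real N..real N} h + integral {real N..real N + 1} h = integral {- real N..real N + 1} h"
      by (rule Henstock_Kurzweil_Integration.integral_combine) (auto intro: c)
    also have "integral {- real N - 1..- real N} h + \<dots> = integral {- real N - 1..real N + 1} h"
      by (rule Henstock_Kurzweil_Integration.integral_combine) (auto intro: c)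
    finally have i: "(\<Sum>n\<in>{- int (Suc N)..<int (Suc N)}. integral {of_int n..of_int n + 1} h) = integral {- real N - 1..real N + 1} h" .
    have "{- real (Suc N)..real (Suc N)} = {- real N - 1..real N + 1}" by auto
    then show ?case using i by (simp only:)
  qed simp
  ultimately show ?thesis using lborel_integral_tendsto[OF assms(1)] by (simp add: LIMSEQ_unique)
qed

lemma integral_ee: "integral {0..1} (\<lambda>x. ee (of_int k * x)) = (if k = 0 then 1 else 0)"
proof (cases "k = 0")
  case False
  define F where "F x = ee (of_int k * x) / (2 * of_real pi * \<i> * of_int k)" for x :: real
  have "((\<lambda>x. ee (of_int k * x)) has_integral (F 1 - F 0)) {0..1}"
  proof (rule fundamental_theorem_of_calculus)
    fix x :: real assume "x \<in> {0..1}"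
    show "(F has_vector_derivative ee (of_int k * x)) (at x within {0..1})"
      unfolding F_def ee_exp using False
      by (auto intro!: derivative_eq_intros has_vector_derivative_real_field simp: field_simps)
  qed simp
  moreover have "F 1 - F 0 = 0" using ee_of_int[of k] by (simp add: F_def)
  ultimately show ?thesis using False by (simp add: integral_unique)
qed simp

text \<open>The periodisation of g and the series with coefficients \<open>gh\<close> are
  continuous, 1-periodic and have the same Fourier coefficients, so they agree. A majorant on a
  bounded window of x suffices because the periodisation repeats.\<close>

lemma poisson_summation:
  fixes g :: "real \<Rightarrow> complex" and gh :: "int \<Rightarrow> complex"
  assumes cont: "continuous_on UNIV g"
    and bd: "\<And>n x. \<bar>x\<bar> \<le> 2 \<Longrightarrow> norm (g (x + of_int n)) \<le> B n" and B: "B summable_on UNIV"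
    and gh: "\<And>k. has_bochner_integral lborel (\<lambda>u. g u * ee (- (of_int k * u))) (gh k)"
    and gs: "(\<lambda>k. norm (gh k)) summable_on UNIV"
  shows "(\<Sum>\<^sub>\<infinity>n. g (x + of_int n)) = (\<Sum>\<^sub>\<infinity>k. gh k * ee (of_int k * x))"
proof -
  define P where "P x = (\<Sum>\<^sub>\<infinity>n. g (x + of_int n))" for x
  define Q where "Q x = (\<Sum>\<^sub>\<infinity>k. gh k * ee (of_int k * x))" for x
  have cg: "continuous_on S (\<lambda>x. g (x + of_int n))" for S n
    by (rule continuous_on_compose2[OF cont]) (auto intro!: continuous_intros)
  have cP2: "continuous_on {-2..2} P" unfolding P_def
  proof (rule uniform_limit_theorem)
    show "uniform_limit {-2..2} (\<lambda>X y. \<Sum>n\<in>X. g (y + of_int n)) (\<lambda>y. \<Sum>\<^sub>\<infinity>n. g (y + of_int n)) (finite_subsets_at_top UNIV)"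
      by (rule Weierstrass_m_test_general[OF _ B]) (rule bd, auto)
  qed (auto intro!: always_eventually continuous_on_sum cg)
  have perP: "P (x + of_int j) = P x" for x j
    unfolding P_def by (rule infsum_reindex_bij_witness[of _ "\<lambda>n. n - j" "\<lambda>n. n + j"]) (auto simp: algebra_simps)
  have cP: "isCont P x" for x
  proof -
    have "isCont P (frac x)"
    proof (rule continuous_on_interior[OF cP2])
      have "- 2 < frac x" "frac x < 2" using frac_ge_0[of x] frac_lt_1[of x] by linarith+
      then show "frac x \<in> interior {-2..2}" by simp
    qed
    then have "isCont P (x + of_int (- \<lfloor>x\<rfloor>))" by (simp add: frac_def)
    then have "isCont (\<lambda>y. P (y + of_int (- \<lfloor>x\<rfloor>))) x"
      by (rule isCont_o2[rotated]) (intro continuous_intros)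
    then show ?thesis unfolding perP .
  qed
  have cQ: "continuous_on UNIV Q" unfolding Q_def
  proof (rule uniform_limit_theorem)
    show "uniform_limit UNIV (\<lambda>X y. \<Sum>k\<in>X. gh k * ee (of_int k * y)) (\<lambda>y. \<Sum>\<^sub>\<infinity>k. gh k * ee (of_int k * y)) (finite_subsets_at_top UNIV)"
      by (rule Weierstrass_m_test_general[OF _ gs]) (simp add: norm_mult)
  qed (auto intro!: always_eventually continuous_intros)
  \<comment> \<open>Unfolding: the pieces over [0,1] of all translates of g make up the integral
    over the line. Testing against e(jx) picks out the coefficient of index -j.\<close>
  have intP: "integral {0..1} (\<lambda>x. P x * ee (of_int j * x)) = gh (- j)" for j
  proof -
    have "uniform_limit {0..1} (\<lambda>X x. \<Sum>n\<in>X. g (x + of_int n) * ee (of_int j * x))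
        (\<lambda>x. \<Sum>\<^sub>\<infinity>n. g (x + of_int n) * ee (of_int j * x)) (finite_subsets_at_top UNIV)"
      by (rule Weierstrass_m_test_general[OF _ B]) (use bd in \<open>auto simp: norm_mult\<close>)
    then have ul: "uniform_limit {0..1} (\<lambda>X x. \<Sum>n\<in>X. g (x + of_int n) * ee (of_int j * x))
        (\<lambda>x. P x * ee (of_int j * x)) (finite_subsets_at_top UNIV)"
      by (simp add: P_def infsum_cmult_left')
    obtain I J where IJ: "\<And>X. ((\<lambda>x. \<Sum>n\<in>X. g (x + of_int n) * ee (of_int j * x)) has_integral I X) {0..1}"
       "((\<lambda>x. P x * ee (of_int j * x)) has_integral J) {0..1}" "(I \<longlongrightarrow> J) (finite_subsets_at_top UNIV)"
      by (rule uniform_limit_integral[OF ul]) (auto intro!: continuous_intros cg)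
    define h where "h u = g u * ee (of_int j * u)" for u
    have h: "integrable lborel h" "integral\<^sup>L lborel h = gh (- j)"
      using gh[of "- j"] by (simp_all add: h_def[abs_def] has_bochner_integral_iff)
    have ch: "continuous_on UNIV h" unfolding h_def by (intro continuous_intros cont)
    have "I X = (\<Sum>n\<in>X. integral {of_int n..of_int n + 1} h)" if "finite X" for X
    proof -
      have "I X = integral {0..1} (\<lambda>x. \<Sum>n\<in>X. g (x + of_int n) * ee (of_int j * x))"
        by (rule integral_unique[OF IJ(1), symmetric])
      also have "\<dots> = (\<Sum>n\<in>X. integral {0..1} (\<lambda>x. g (x + of_int n) * ee (of_int j * x)))"
        by (intro integral_sum that integrable_continuous_real continuous_intros cg)
      also have "\<dots> = (\<Sum>n\<in>X. integral {of_int n..of_int n + 1} h)"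
      proof (rule sum.cong[OF refl])
        fix n
        have "(\<lambda>x. g (x + of_int n) * ee (of_int j * x)) = h \<circ> ((+) (of_int n))"
          using ee_add_int[of _ "j * n"] by (simp add: h_def fun_eq_iff ring_distribs add.commute)
        then show "integral {0..1} (\<lambda>x. g (x + of_int n) * ee (of_int j * x)) = integral {of_int n..of_int n + 1} h"
          by (simp add: integral_shift_Icc_real add.commute)
      qed
      finally show ?thesis .
    qed
    then have "((\<lambda>n. integral {of_int n..of_int n + 1} h) has_sum J) UNIV"
      unfolding has_sum_def using IJ(3)
      by (rule_tac Lim_transform_eventually[of I]) (auto intro!: eventually_finite_subsets_at_top_weakI)
    from has_sum_int_intervals[OF h(1) ch this] have "J = gh (- j)" using h(2) by simp
    then show ?thesis using IJ(2) by (simp add: integral_unique)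
  qed
  have intQ: "integral {0..1} (\<lambda>x. Q x * ee (of_int j * x)) = gh (- j)" for j
  proof -
    have "uniform_limit {0..1} (\<lambda>X x. \<Sum>k\<in>X. gh k * ee (of_int k * x) * ee (of_int j * x))
        (\<lambda>x. \<Sum>\<^sub>\<infinity>k. gh k * ee (of_int k * x) * ee (of_int j * x)) (finite_subsets_at_top UNIV)"
      by (rule Weierstrass_m_test_general[OF _ gs]) (auto simp: norm_mult)
    then have ul: "uniform_limit {0..1} (\<lambda>X x. \<Sum>k\<in>X. gh k * ee (of_int k * x) * ee (of_int j * x))
        (\<lambda>x. Q x * ee (of_int j * x)) (finite_subsets_at_top UNIV)"
      by (simp add: Q_def infsum_cmult_left')
    obtain I J where IJ: "\<And>X. ((\<lambda>x. \<Sum>k\<in>X. gh k * ee (of_int k * x) * ee (of_int j * x)) has_integral I X) {0..1}"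
       "((\<lambda>x. Q x * ee (of_int j * x)) has_integral J) {0..1}" "(I \<longlongrightarrow> J) (finite_subsets_at_top UNIV)"
      by (rule uniform_limit_integral[OF ul]) (auto intro!: continuous_intros)
    have "I X = (\<Sum>k\<in>X. if k = - j then gh (- j) else 0)" if "finite X" for X
    proof -
      have "I X = integral {0..1} (\<lambda>x. \<Sum>k\<in>X. gh k * ee (of_int (k + j) * x))"
        using integral_unique[OF IJ(1)[of X]] by (simp add: ee_add ring_distribs mult.assoc)
      also have "\<dots> = (\<Sum>k\<in>X. integral {0..1} (\<lambda>x. gh k * ee (of_int (k + j) * x)))"
        by (intro integral_sum that integrable_continuous_real continuous_intros)
      also have "\<dots> = (\<Sum>k\<in>X. if k = - j then gh (- j) else 0)"
        by (intro sum.cong refl) (simp only: integral_mult_right integral_ee, auto simp: add_eq_0_iff2)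
      finally show ?thesis .
    qed
    then have "((\<lambda>k. if k = - j then gh (- j) else 0) has_sum J) UNIV"
      unfolding has_sum_def using IJ(3)
      by (rule_tac Lim_transform_eventually[of I]) (auto intro!: eventually_finite_subsets_at_top_weakI)
    moreover have "((\<lambda>k. if k = - j then gh (- j) else 0) has_sum gh (- j)) UNIV"
      by (rule has_sum_finite_neutralI[of "{- j}"]) auto
    ultimately have "J = gh (- j)" by (rule has_sum_unique)
    then show ?thesis using IJ(2) by (simp add: integral_unique)
  qed
  have cPU: "continuous_on S P" for S using cP by (simp add: continuous_at_imp_continuous_on)
  have cQU: "continuous_on S Q" for S using cQ continuous_on_subset by blast
  have "P x - Q x = 0"
  proof (rule fourier_unique[of "\<lambda>x. P x - Q x"])
    show "continuous_on UNIV (\<lambda>x. P x - Q x)" by (intro continuous_intros cPU cQU)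
    have "Q (x + 1) = Q x" for x
    proof -
      have "ee (of_int k * (x + 1)) = ee (of_int k * x)" for k
        using ee_add_int[of "of_int k * x" k] by (simp add: ring_distribs)
      then show ?thesis by (simp add: Q_def)
    qed
    then show "P (x + 1) - Q (x + 1) = P x - Q x" for x using perP[of x 1] by simp
    show "integral {0..1} (\<lambda>x. (P x - Q x) * ee (of_int k * x)) = 0" for k
      unfolding left_diff_distrib
      by (subst integral_diff) (auto simp: intP intQ intro!: integrable_continuous_real continuous_intros cPU cQU)
  qed
  then show ?thesis by (simp add: P_def Q_def)
qed

text \<open>The characteristic function of the standard normal law, with the variable rescaled by c
  = sqrt(2 pi a).\<close>

lemma gauss_fourier:
  fixes a k :: real
  assumes a: "a > 0"
  shows "has_bochner_integral lborel (\<lambda>u. of_real (exp (- pi * a * u\<^sup>2)) * ee (- (k * u)))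
     (of_real (exp (- pi * k\<^sup>2 / a) / sqrt a))"
proof -
  define c where "c = sqrt (2 * pi * a)"
  have c: "c > 0" "c\<^sup>2 = 2 * pi * a" using a by (simp_all add: c_def)
  define t where "t = - (2 * pi * k) / c"
  interpret real_distribution std_normal_distribution by (rule real_dist_normal_dist)
  have "integrable std_normal_distribution (\<lambda>x. iexp (t * x))"
    by (rule integrable_const_bound[of _ 1]) auto
  then have i: "integrable lborel (\<lambda>x. std_normal_density x *\<^sub>R iexp (t * x))"
    by (subst (asm) integrable_density) auto
  have "char std_normal_distribution t = (LINT x|lborel. std_normal_density x *\<^sub>R iexp (t * x))"
    unfolding char_def by (subst integral_density) auto
  then have "has_bochner_integral lborel (\<lambda>x. std_normal_density x *\<^sub>R iexp (t * x)) (of_real (exp (- (t\<^sup>2) / 2)))"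
    using i by (simp add: has_bochner_integral_iff char_std_normal_distribution)
  then have "has_bochner_integral lborel (\<lambda>x. std_normal_density (0 + c * x) *\<^sub>R iexp (t * (0 + c * x)))
      (of_real (exp (- (t\<^sup>2) / 2)) /\<^sub>R \<bar>c\<bar>)"
    using c by (subst (asm) lborel_has_bochner_integral_real_affine_iff[of c _ _ 0]) auto
  then have "has_bochner_integral lborel (\<lambda>x. sqrt (2 * pi) *\<^sub>R (std_normal_density (c * x) *\<^sub>R iexp (t * (c * x))))
      (sqrt (2 * pi) *\<^sub>R (of_real (exp (- (t\<^sup>2) / 2)) /\<^sub>R c))"
    using c by (intro has_bochner_integral_scaleR_right) auto
  moreover have "sqrt (2 * pi) *\<^sub>R (std_normal_density (c * x) *\<^sub>R iexp (t * (c * x))) = of_real (exp (- pi * a * x\<^sup>2)) * ee (- (k * x))" for x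
  proof -
    have "sqrt (2 * pi) * std_normal_density (c * x) = exp (- pi * a * x\<^sup>2)"
      using c(2) by (simp add: std_normal_density_def power_mult_distrib)
    moreover have "iexp (t * (c * x)) = ee (- (k * x))"
      using c(1) by (simp add: t_def ee_exp field_simps)
    ultimately show ?thesis by (simp add: scaleR_conv_of_real mult.assoc[symmetric] flip: of_real_mult)
  qed
  moreover have "sqrt (2 * pi) *\<^sub>R (of_real (exp (- (t\<^sup>2) / 2)) /\<^sub>R c) = complex_of_real (exp (- pi * k\<^sup>2 / a) / sqrt a)"
  proof -
    have "t\<^sup>2 / 2 = pi * k\<^sup>2 / a" using a
      by (simp add: t_def power_divide c(2) power_mult_distrib) (simp add: power2_eq_square)
    then have "exp (- (t\<^sup>2) / 2) = exp (- pi * k\<^sup>2 / a)" by simp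
    moreover have "sqrt (2 * pi) / c = 1 / sqrt a" by (simp add: c_def real_sqrt_mult)
    moreover have "sqrt (2 * pi) *\<^sub>R (complex_of_real E /\<^sub>R c) = of_real (E * (sqrt (2 * pi) / c))" for E
      by (simp add: scaleR_conv_of_real divide_inverse)
    ultimately show ?thesis by (simp only: mult_1_right times_divide_eq_right)
  qed
  ultimately show ?thesis by (simp only:)
qed

text \<open>The integrand G without linear factor decays, so its derivative (-2 pi a u - 2 pi i k)
  G(u) integrates to 0, which expresses the first moment by the zeroth. The shift
  \<open>\<beta>\<close> will carry the imaginary part of m times the conjugate of z.\<close>

lemma gauss_fourier_linear:
  fixes a k :: real and \<beta> :: complex
  assumes a: "a > 0"
  shows "has_bochner_integral lborel (\<lambda>u. (of_real u + \<beta>) * of_real (exp (- pi * a * u\<^sup>2)) * ee (- (k * u)))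
     ((\<beta> - \<i> * of_real (k / a)) * of_real (exp (- pi * k\<^sup>2 / a) / sqrt a))"
proof -
  define G where "G u = complex_of_real (exp (- pi * a * u\<^sup>2)) * ee (- (k * u))" for u
  have G: "has_bochner_integral lborel G (of_real (exp (- pi * k\<^sup>2 / a) / sqrt a))"
    unfolding G_def[abs_def] by (rule gauss_fourier[OF a])
  have cG: "continuous_on S G" for S unfolding G_def by (intro continuous_intros)
  have uG: "integrable lborel (\<lambda>u. of_real u * G u)"
  proof (rule Bochner_Integration.integrable_bound)
    have "integrable lborel (\<lambda>u. norm (of_real (exp (- pi * (a / 2) * u\<^sup>2)) * ee (- (0 * u))))"
      using gauss_fourier[of "a / 2" 0] a by (intro integrable_norm) (auto simp: has_bochner_integral_iff)
    then show "integrable lborel (\<lambda>u. (1 + 2 / (pi * a)) * exp (- (pi * a / 2) * u\<^sup>2))"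
      by (intro integrable_mult_right) simp
    have "continuous_on UNIV (\<lambda>u. of_real u * G u)" by (intro continuous_intros cG)
    then show "(\<lambda>u. of_real u * G u) \<in> borel_measurable lborel"
      by (simp add: borel_measurable_continuous_onI)
    show "AE u in lborel. norm (of_real u * G u) \<le> norm ((1 + 2 / (pi * a)) * exp (- (pi * a / 2) * u\<^sup>2))"
    proof (intro always_eventually allI)
      fix u :: real
      have "\<bar>u\<bar> \<le> 1 + u\<^sup>2" using sum_squares_bound[of "\<bar>u\<bar>" 1] by simp
      then have "\<bar>u\<bar> * exp (- (pi * a) * u\<^sup>2) \<le> (1 + u\<^sup>2) * exp (- (pi * a) * u\<^sup>2)" by (intro mult_right_mono) auto
      also have "\<dots> = exp (- (pi * a) * u\<^sup>2) + u\<^sup>2 ^ 1 * exp (- (pi * a) * u\<^sup>2)" by (simp add: ring_distribs)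
      also have "\<dots> \<le> exp (- (pi * a / 2) * u\<^sup>2) + fact 1 * (2 / (pi * a)) ^ 1 * exp (- (pi * a / 2) * u\<^sup>2)"
        using a by (intro add_mono power_exp_le) auto
      also have "\<dots> = (1 + 2 / (pi * a)) * exp (- (pi * a / 2) * u\<^sup>2)" by (simp add: ring_distribs)
      finally show "norm (of_real u * G u) \<le> norm ((1 + 2 / (pi * a)) * exp (- (pi * a / 2) * u\<^sup>2))"
        using a by (simp add: G_def norm_mult)
    qed
  qed
  define D where "D u = (of_real (- 2 * pi * a * u) - 2 * of_real (pi * k) * \<i>) * G u" for u
  have D: "D u = of_real (- 2 * pi * a) * (of_real u * G u) - 2 * of_real (pi * k) * \<i> * G u" for u
    by (simp add: D_def algebra_simps)
  have iD: "integrable lborel D" unfolding D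
    using uG G by (intro Bochner_Integration.integrable_diff integrable_mult_right) (auto simp: has_bochner_integral_iff)
  have "(\<lambda>N. integral {- real N..real N} D) \<longlonglongrightarrow> 0"
  proof -
    have "integral {- real N..real N} D = G (real N) - G (- real N)" for N
    proof (rule integral_unique, rule fundamental_theorem_of_calculus)
      fix u :: real
      have "(G has_vector_derivative D u) (at u)"
      proof -
        have "((\<lambda>u. exp (- of_real pi * of_real a * u\<^sup>2 - 2 * of_real pi * \<i> * of_real k * u)) has_field_derivative
           (- 2 * of_real pi * of_real a * of_real u - 2 * of_real pi * \<i> * of_real k) *
            exp (- of_real pi * of_real a * (of_real u)\<^sup>2 - 2 * of_real pi * \<i> * of_real k * of_real u)) (at (of_real u :: complex))"
          by (auto intro!: derivative_eq_intros)
        from has_vector_derivative_real_field[OF this]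
        show ?thesis
          by (rule has_vector_derivative_eq_rhs[OF has_vector_derivative_transform_within[OF _ zero_less_one]])
             (auto simp: G_def D_def ee_exp exp_of_real[symmetric] exp_add[symmetric] algebra_simps)
      qed
      then show "(G has_vector_derivative D u) (at u within {- real N..real N})"
        by (rule has_vector_derivative_at_within)
    qed simp
    moreover have "(\<lambda>N. G (real N) - G (- real N)) \<longlonglongrightarrow> 0 - 0"
    proof (intro tendsto_diff)
      have e: "(\<lambda>N. exp (- (pi * a) * real N)) \<longlonglongrightarrow> 0"
        using a by real_asymp
      have b: "norm (G (real N)) \<le> exp (- (pi * a) * real N)" "norm (G (- real N)) \<le> exp (- (pi * a) * real N)" for N
      proof -
        have "real N \<le> (real N)\<^sup>2" by (cases N) (auto simp: power2_eq_square)
        then have "pi * a * real N \<le> pi * a * (real N)\<^sup>2" using a by (intro mult_left_mono) auto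
        then show "norm (G (real N)) \<le> exp (- (pi * a) * real N)" "norm (G (- real N)) \<le> exp (- (pi * a) * real N)"
          by (simp_all add: G_def norm_mult)
      qed
      show "(\<lambda>N. G (real N)) \<longlonglongrightarrow> 0" "(\<lambda>N. G (- real N)) \<longlonglongrightarrow> 0"
        using b by (auto intro!: Lim_null_comparison[OF _ e] always_eventually)
    qed
    ultimately show ?thesis by simp
  qed
  then have "integral\<^sup>L lborel D = 0" using lborel_integral_tendsto[OF iD] LIMSEQ_unique by blast
  define J where "J = integral\<^sup>L lborel (\<lambda>u. of_real u * G u)"
  define K where "K = integral\<^sup>L lborel G"
  have "integral\<^sup>L lborel D = of_real (- 2 * pi * a) * J - 2 * of_real (pi * k) * \<i> * K"
    unfolding D J_def K_def using uG G
    by (subst Bochner_Integration.integral_diff) (auto simp: has_bochner_integral_iff)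
  then have "of_real (- 2 * pi * a) * J = 2 * of_real (pi * k) * \<i> * K"
    using \<open>integral\<^sup>L lborel D = 0\<close> by (metis eq_iff_diff_eq_0)
  moreover have "of_real (- 2 * pi * a) \<noteq> (0 :: complex)" using a by simp
  ultimately have "J = 2 * of_real (pi * k) * \<i> * K / of_real (- 2 * pi * a)"
    by (metis nonzero_mult_div_cancel_left)
  also have "\<dots> = - \<i> * of_real (k / a) * K"
    using a by (simp add: divide_simps)
  finally have "J = - \<i> * of_real (k / a) * K" .
  moreover have "K = of_real (exp (- pi * k\<^sup>2 / a) / sqrt a)"
    using G unfolding K_def by (simp only: has_bochner_integral_iff)
  ultimately have "has_bochner_integral lborel (\<lambda>u. of_real u * G u) (- \<i> * of_real (k / a) * of_real (exp (- pi * k\<^sup>2 / a) / sqrt a))"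
    using uG by (simp only: has_bochner_integral_iff J_def)
  from has_bochner_integral_add[OF this has_bochner_integral_mult_right[OF G, of \<beta>]]
  show ?thesis unfolding G_def by (simp only: ring_distribs mult.assoc add.commute) (simp add: algebra_simps)
qed

lemma summable_linear_exp:
  assumes "d > 0"
  shows "(\<lambda>n::int. (\<bar>of_int n\<bar> + c) * C * exp (- d * \<bar>of_int n\<bar>) :: real) summable_on UNIV"
proof -
  have "(\<lambda>n::int. C * (\<bar>of_int n\<bar> ^ 1 * exp (- d * \<bar>of_int n\<bar>)) + c * C * (\<bar>of_int n\<bar> ^ 0 * exp (- d * \<bar>of_int n\<bar>)) :: real) summable_on UNIV"
    by (intro summable_on_add summable_on_cmult_right summable_int_poly_exp assms)
  then show ?thesis by (simp add: algebra_simps)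
qed

lemma gauss_term_bound:
  fixes x a R :: real and n :: int and \<beta> :: complex
  assumes "a > 0" "\<bar>x\<bar> \<le> R"
  shows "norm ((of_real (x + of_int n) + \<beta>) * of_real (exp (- pi * a * (x + of_int n)\<^sup>2)))
     \<le> (\<bar>of_int n\<bar> + (R + norm \<beta>)) * exp (pi * a * (2 * R + 1)) * exp (- (2 * pi * a) * \<bar>of_int n\<bar>)"
proof -
  define y where "y = x + of_int n"
  have y: "\<bar>y\<bar> \<ge> \<bar>of_int n\<bar> - R" "\<bar>y\<bar> \<le> \<bar>of_int n\<bar> + R" using assms(2) by (auto simp: y_def)
  \<comment> \<open>The tangent to the parabola replaces the quadratic exponent by a linear one,
    uniformly for |x| at most R.\<close>
  have "y\<^sup>2 \<ge> 2 * \<bar>y\<bar> - 1" using sum_squares_bound[of "\<bar>y\<bar>" 1] by simp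
  then have "y\<^sup>2 \<ge> 2 * \<bar>of_int n\<bar> - (2 * R + 1)" using y by linarith
  then have "pi * a * y\<^sup>2 \<ge> pi * a * (2 * \<bar>of_int n\<bar> - (2 * R + 1))" using assms by (intro mult_left_mono) auto
  then have e: "exp (- pi * a * y\<^sup>2) \<le> exp (pi * a * (2 * R + 1)) * exp (- (2 * pi * a) * \<bar>of_int n\<bar>)"
    by (simp add: exp_add[symmetric] algebra_simps)
  have ny: "norm (complex_of_real y + \<beta>) \<le> \<bar>of_int n\<bar> + (R + norm \<beta>)"
    using norm_triangle_ineq[of "of_real y" \<beta>] y by simp
  have "norm (complex_of_real y + \<beta>) * exp (- pi * a * y\<^sup>2) \<le>
     (\<bar>of_int n\<bar> + (R + norm \<beta>)) * (exp (pi * a * (2 * R + 1)) * exp (- (2 * pi * a) * \<bar>of_int n\<bar>))"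
    using e ny order_trans[OF norm_ge_zero ny] by (intro mult_mono) auto
  then show ?thesis unfolding y_def[symmetric] by (simp add: norm_mult mult.assoc)
qed

lemma gauss_summable:
  fixes x a :: real and \<beta> :: complex
  assumes "a > 0"
  shows "(\<lambda>n::int. norm ((of_real (x + of_int n) + \<beta>) * of_real (exp (- pi * a * (x + of_int n)\<^sup>2)))) summable_on UNIV"
proof (rule Infinite_Sum.abs_summable_on_comparison_test')
  show "(\<lambda>n::int. (\<bar>of_int n\<bar> + (\<bar>x\<bar> + norm \<beta>)) * exp (pi * a * (2 * \<bar>x\<bar> + 1)) * exp (- (2 * pi * a) * \<bar>of_int n\<bar>)) summable_on UNIV"
    by (rule summable_linear_exp) (use assms in simp)
qed (rule gauss_term_bound[OF assms order_refl])

lemma dual_gauss_summable: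
  fixes a :: real and \<beta> :: complex
  assumes "a > 0"
  shows "(\<lambda>k::int. norm ((\<beta> - \<i> * of_real (of_int k / a)) * of_real (exp (- pi * (of_int k)\<^sup>2 / a) / sqrt a))) summable_on UNIV"
proof (rule Infinite_Sum.abs_summable_on_comparison_test')
  show "(\<lambda>k::int. (\<bar>of_int k\<bar> + a * norm \<beta>) * (1 / (a * sqrt a)) * exp (- (pi / a) * \<bar>of_int k\<bar>) :: real) summable_on UNIV"
    by (rule summable_linear_exp) (use assms in simp)
  fix k :: int
  have "\<bar>k\<bar> \<le> \<bar>k\<bar>\<^sup>2" using self_le_power[of "\<bar>k\<bar>" 2] by (cases "k = 0") auto
  then have "of_int \<bar>k\<bar> \<le> (of_int (\<bar>k\<bar>\<^sup>2) :: real)" by (simp only: of_int_le_iff)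
  then have "\<bar>of_int k\<bar> \<le> (of_int k :: real)\<^sup>2" by simp
  then have "pi * \<bar>of_int k\<bar> / a \<le> pi * (of_int k)\<^sup>2 / a"
    using assms by (intro divide_right_mono mult_left_mono) auto
  then have e: "exp (- pi * (of_int k)\<^sup>2 / a) \<le> exp (- (pi / a) * \<bar>of_int k\<bar>)" by simp
  have "norm (\<beta> - \<i> * of_real (of_int k / a)) \<le> norm \<beta> + \<bar>of_int k\<bar> / a"
    using norm_triangle_ineq4[of \<beta> "\<i> * of_real (of_int k / a)"] assms by (simp add: norm_mult norm_divide)
  then have "norm (\<beta> - \<i> * of_real (of_int k / a)) * (exp (- pi * (of_int k)\<^sup>2 / a) / sqrt a)
     \<le> (norm \<beta> + \<bar>of_int k\<bar> / a) * (exp (- (pi / a) * \<bar>of_int k\<bar>) / sqrt a)"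
    using e assms by (intro mult_mono divide_right_mono) auto
  also have "\<dots> = (\<bar>of_int k\<bar> + a * norm \<beta>) * (1 / (a * sqrt a)) * exp (- (pi / a) * \<bar>of_int k\<bar>)"
    using assms by (simp add: field_simps)
  finally show "norm ((\<beta> - \<i> * of_real (of_int k / a)) * of_real (exp (- pi * (of_int k)\<^sup>2 / a) / sqrt a)) \<le> \<dots>"
    using assms by (simp add: norm_mult norm_divide)
qed

lemma gauss_poisson:
  fixes x a :: real and \<beta> :: complex
  assumes a: "a > 0"
  shows "(\<Sum>\<^sub>\<infinity>n::int. (of_real (x + of_int n) + \<beta>) * of_real (exp (- pi * a * (x + of_int n)\<^sup>2))) =
    (\<Sum>\<^sub>\<infinity>k::int. (\<beta> - \<i> * of_real (of_int k / a)) * of_real (exp (- pi * (of_int k)\<^sup>2 / a) / sqrt a) * ee (of_int k * x))"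
proof (rule poisson_summation)
  show "continuous_on UNIV (\<lambda>x. (of_real x + \<beta>) * of_real (exp (- pi * a * x\<^sup>2)))" by (intro continuous_intros)
  show "(\<lambda>n::int. (\<bar>of_int n\<bar> + (2 + norm \<beta>)) * exp (pi * a * (2 * 2 + 1)) * exp (- (2 * pi * a) * \<bar>of_int n\<bar>)) summable_on UNIV"
    by (rule summable_linear_exp) (use a in simp)
qed (rule gauss_term_bound[OF a], assumption, rule gauss_fourier_linear[OF a], rule dual_gauss_summable[OF a])

lemma has_sum_sum:
  fixes f :: "'b \<Rightarrow> 'a \<Rightarrow> 'c :: {topological_comm_monoid_add}"
  assumes "finite A" "\<And>b. b \<in> A \<Longrightarrow> (f b has_sum S b) X"
  shows "((\<lambda>x. \<Sum>b\<in>A. f b x) has_sum (\<Sum>b\<in>A. S b)) X"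
  using assms
proof (induction A rule: finite_induct)
  case (insert a A)
  have "(f a has_sum S a) X" using insert.prems by simp
  moreover have "((\<lambda>x. \<Sum>b\<in>A. f b x) has_sum (\<Sum>b\<in>A. S b)) X" using insert by simp
  ultimately have "((\<lambda>x. f a x + (\<Sum>b\<in>A. f b x)) has_sum (S a + (\<Sum>b\<in>A. S b))) X" by (rule has_sum_add)
  then show ?case using insert by simp
qed simp

text \<open>On each residue class b modulo M the coefficient f is constant. Poisson summation there
  has parameter aM^2 and offset (x+b)/M, and the phases e(kb/M) of the classes assemble into
  \<open>fhat\<close>.\<close>

lemma periodic_gauss_poisson:
  fixes x a :: real and \<beta> :: complex and f :: "int \<Rightarrow> complex"
  assumes a: "a > 0" and M: "M \<ge> 1" and per: "\<And>n. f (n + int M) = f n"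
  shows "((\<lambda>n::int. f n * ((of_real (x + of_int n) + \<beta>) * of_real (exp (- pi * a * (x + of_int n)\<^sup>2)))) has_sum
    (\<Sum>\<^sub>\<infinity>k::int. fhat M f k / of_nat M * ((\<beta> - \<i> * of_real (of_int k / (of_nat M * a))) *
       of_real (exp (- pi * (of_int k)\<^sup>2 / (a * (of_nat M)\<^sup>2)) / sqrt a) * ee (of_int k * x / of_nat M)))) UNIV"
    (is "(?g has_sum (\<Sum>\<^sub>\<infinity>k. ?d k)) UNIV")
proof -
  define a' where "a' = a * (of_nat M)\<^sup>2"
  have a': "a' > 0" using a M by (simp add: a'_def)
  define T where "T b n = (of_real ((x + of_int b) / of_nat M + of_int n) + \<beta> / of_nat M) *
      of_real (exp (- pi * a' * ((x + of_int b) / of_nat M + of_int n)\<^sup>2))" for b n :: int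
  define D where "D b k = (\<beta> / of_nat M - \<i> * of_real (of_int k / a')) * of_real (exp (- pi * (of_int k)\<^sup>2 / a') / sqrt a')
      * ee (of_int k * ((x + of_int b) / of_nat M))" for b k :: int
  have TD: "(T b has_sum (\<Sum>\<^sub>\<infinity>k. D b k)) UNIV" for b
  proof -
    have "T b summable_on UNIV" unfolding T_def
      by (rule Infinite_Sum.abs_summable_summable[OF gauss_summable[OF a']])
    moreover have "(\<Sum>\<^sub>\<infinity>n. T b n) = (\<Sum>\<^sub>\<infinity>k. D b k)" unfolding T_def D_def by (rule gauss_poisson[OF a'])
    ultimately show ?thesis using has_sum_infsum[of "T b" UNIV] by simp
  qed
  have Ds: "(D b has_sum (\<Sum>\<^sub>\<infinity>k. D b k)) UNIV" for b
  proof (rule has_sum_infsum, rule Infinite_Sum.abs_summable_summable)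
    show "(\<lambda>k. norm (D b k)) summable_on UNIV"
      using dual_gauss_summable[OF a', of "\<beta> / of_nat M"] unfolding D_def norm_mult norm_ee by simp
  qed
  define B where "B b = {n :: int. n mod int M = b}" for b
  have gB: "(?g has_sum (f b * of_nat M * (\<Sum>\<^sub>\<infinity>k. D b k))) (B b)" if b: "b \<in> {0..<int M}" for b
  proof -
    have "((\<lambda>j. f b * of_nat M * T b j) has_sum (f b * of_nat M * (\<Sum>\<^sub>\<infinity>k. D b k))) UNIV"
      by (rule has_sum_cmult_right[OF TD])
    also have "?this \<longleftrightarrow> (?g has_sum (f b * of_nat M * (\<Sum>\<^sub>\<infinity>k. D b k))) (B b)"
    proof (rule has_sum_reindex_bij_witness[of _ "\<lambda>n. n div int M" "\<lambda>j. b + int M * j"])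
      fix j :: int
      have e: "x + of_int (b + int M * j) = of_nat M * ((x + of_int b) / of_nat M + of_int j)"
        using M by (simp add: field_simps)
      have f: "f (b + int M * j) = f b" by (rule periodic_int_multiple[of f M, OF per])
      have "\<beta> = of_nat M * (\<beta> / of_nat M)" using M by simp
      then have g: "of_real (x + of_int (b + int M * j)) + \<beta> =
         of_nat M * (of_real ((x + of_int b) / of_nat M + of_int j) + \<beta> / of_nat M)"
        unfolding e by (metis distrib_left of_real_mult of_real_of_nat_eq)
      show "?g (b + int M * j) = f b * of_nat M * T b j"
        unfolding f g T_def unfolding e a'_def by (simp add: power_mult_distrib mult_ac)
    qed (use M b in \<open>auto simp: B_def\<close>)
    finally show ?thesis .
  qed
  have "(?g has_sum (\<Sum>b\<in>{0..<int M}. f b * of_nat M * (\<Sum>\<^sub>\<infinity>k. D b k))) (\<Union>b\<in>{0..<int M}. B b)"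
    by (rule sum_has_sum[OF _ gB]) (auto simp: B_def)
  also have "(\<Union>b\<in>{0..<int M}. B b) = UNIV" using M by (auto simp: B_def)
  also have "(\<Sum>b\<in>{0..<int M}. f b * of_nat M * (\<Sum>\<^sub>\<infinity>k. D b k)) = (\<Sum>\<^sub>\<infinity>k. ?d k)"
  proof (rule infsumI[symmetric])
    have "((\<lambda>k. \<Sum>b\<in>{0..<int M}. f b * of_nat M * D b k) has_sum (\<Sum>b\<in>{0..<int M}. f b * of_nat M * (\<Sum>\<^sub>\<infinity>k. D b k))) UNIV"
      by (intro has_sum_sum has_sum_cmult_right Ds) simp
    moreover have "(\<Sum>b\<in>{0..<int M}. f b * of_nat M * D b k) = ?d k" for k
    proof -
      have e1: "of_nat M * ((\<beta> / of_nat M - \<i> * of_real (of_int k / a')) * of_real (exp (- pi * (of_int k)\<^sup>2 / a') / sqrt a')) =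
        (\<beta> - \<i> * of_real (of_int k / (of_nat M * a))) * of_real (exp (- pi * (of_int k)\<^sup>2 / (a * (of_nat M)\<^sup>2)) / sqrt a) / of_nat M"
      proof -
        have "of_nat M * (\<beta> / of_nat M - \<i> * of_real (of_int k / a')) = \<beta> - \<i> * of_real (of_int k / (of_nat M * a))"
          using a M by (simp add: a'_def power2_eq_square divide_simps)
        moreover have "sqrt a' = sqrt a * of_nat M" by (simp add: a'_def real_sqrt_mult)
        moreover have "complex_of_real (E / (sqrt a * of_nat M)) = of_real (E / sqrt a) / of_nat M" for E by simp
        ultimately show ?thesis unfolding mult.assoc[symmetric] a'_def by (simp only: times_divide_eq_right)
      qed
      have e2: "ee (of_int k * ((x + of_int b) / of_nat M)) = ee (of_int (k * b) / of_nat M) * ee (of_int k * x / of_nat M)" for b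
        by (simp add: ee_add[symmetric] add_divide_distrib ring_distribs add.commute)
      have "(\<Sum>b\<in>{0..<int M}. f b * of_nat M * D b k) = (\<Sum>b\<in>{0..<int M}. (f b * ee (of_int (k * b) / of_nat M)) *
         ((of_nat M * ((\<beta> / of_nat M - \<i> * of_real (of_int k / a')) * of_real (exp (- pi * (of_int k)\<^sup>2 / a') / sqrt a'))) * ee (of_int k * x / of_nat M)))"
        unfolding D_def e2 by (intro sum.cong refl) (simp only: mult_ac)
      also have "\<dots> = ?d k" unfolding sum_distrib_right[symmetric] e1 fhat_def by simp
      finally show ?thesis .
    qed
    ultimately show "(?d has_sum (\<Sum>b\<in>{0..<int M}. f b * of_nat M * (\<Sum>\<^sub>\<infinity>k. D b k))) UNIV" by (simp only:)
  qed
  finally show ?thesis .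
qed

section \<open>Integrals over the multiplicative group in logarithmic coordinates\<close>

text \<open>This is 2 cosh x. In the logarithmic coordinate, powers of \<open>W\<close> times exp(-c
  W) serve as the common majorants: powers of \<open>W\<close> absorb both polynomials in x and
  exponentials exp(sx), and the decay is the same at both ends.\<close>

definition W :: "real \<Rightarrow> real" where "W x = exp x + exp (- x)"

lemma W_uminus [simp]: "W (- x) = W x"
  by (simp add: W_def)

lemma W_ge_2: "W x \<ge> 2"
proof -
  have "2 * exp (x / 2) * exp (- x / 2) \<le> (exp (x / 2))\<^sup>2 + (exp (- x / 2))\<^sup>2" by (rule sum_squares_bound)
  then show ?thesis by (simp add: W_def mult.assoc exp_add[symmetric] exp_double[symmetric])
qed

lemma W_pos [simp]: "W x > 0"
  using W_ge_2[of x] by linarith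

lemma W_nonneg [simp]: "0 \<le> W x"
  using W_pos[of x] by (rule less_imp_le)

lemma W_ge_exp: "exp x \<le> W x" "exp (- x) \<le> W x" "exp \<bar>x\<bar> \<le> W x"
  by (auto simp: W_def abs_if)

lemma W_ge_abs: "\<bar>x\<bar> \<le> W x"
  using W_ge_exp(3)[of x] exp_ge_add_one_self[of "\<bar>x\<bar>"] by linarith

lemma W_ge_square: "x\<^sup>2 / 2 \<le> W x"
  using W_ge_exp(3)[of x] exp_lower_Taylor_quadratic[of "\<bar>x\<bar>"] by simp

lemma continuous_W [continuous_intros]: "continuous_on S f \<Longrightarrow> continuous_on S (\<lambda>x. W (f x))"
  unfolding W_def by (intro continuous_intros)

lemma exp_mult_le_W: "exp (s * x) \<le> W x ^ nat \<lceil>\<bar>s\<bar>\<rceil>"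
proof -
  have n: "\<bar>s\<bar> \<le> real (nat \<lceil>\<bar>s\<bar>\<rceil>)" by linarith
  have "s * x \<le> \<bar>s\<bar> * \<bar>x\<bar>" by (simp add: abs_mult[symmetric])
  also have "\<dots> \<le> real (nat \<lceil>\<bar>s\<bar>\<rceil>) * \<bar>x\<bar>" using n by (intro mult_right_mono) auto
  finally have "exp (s * x) \<le> exp (real (nat \<lceil>\<bar>s\<bar>\<rceil>) * \<bar>x\<bar>)" by simp
  also have "\<dots> = exp \<bar>x\<bar> ^ nat \<lceil>\<bar>s\<bar>\<rceil>" by (rule exp_of_nat_mult)
  also have "\<dots> \<le> W x ^ nat \<lceil>\<bar>s\<bar>\<rceil>" using W_ge_exp(3) by (intro power_mono) auto
  finally show ?thesis .
qed

text \<open>Since \<open>W x\<close> is at least x^2/2, the majorants lie below Gaussians, whose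
  integrability is already known.\<close>

lemma W_power_exp_le:
  assumes "c > 0" shows "W x ^ K * exp (- c * W x) \<le> fact K * (2 / c) ^ K * exp (- (c / 4) * x\<^sup>2)"
proof -
  have "W x ^ K * exp (- c * W x) \<le> fact K * (2 / c) ^ K * exp (- (c / 2) * W x)"
    by (rule power_exp_le) (use assms in auto)
  also have "(c / 2) * (x\<^sup>2 / 2) \<le> (c / 2) * W x" using W_ge_square[of x] assms by (intro mult_left_mono) auto
  then have "fact K * (2 / c) ^ K * exp (- (c / 2) * W x) \<le> fact K * (2 / c) ^ K * exp (- (c / 4) * x\<^sup>2)"
    using assms by (intro mult_left_mono) auto
  finally show ?thesis .
qed

lemma integrable_gauss: "(c :: real) > 0 \<Longrightarrow> integrable lborel (\<lambda>x. exp (- c * x\<^sup>2))"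
proof -
  assume c: "c > 0"
  have "integrable lborel (\<lambda>u. norm (of_real (exp (- pi * (c / pi) * u\<^sup>2)) * ee (- (0 * u))))"
    using gauss_fourier[of "c / pi" 0] c by (intro integrable_norm) (auto simp: has_bochner_integral_iff)
  then show ?thesis by simp
qed

lemma integrable_W:
  assumes "c > 0" shows "integrable lborel (\<lambda>x. W x ^ K * exp (- c * W x))"
proof (rule Bochner_Integration.integrable_bound)
  show "integrable lborel (\<lambda>x. fact K * (2 / c) ^ K * exp (- (c / 4) * x\<^sup>2))"
    by (intro integrable_mult_right integrable_gauss) (use assms in simp)
  have "continuous_on UNIV (\<lambda>x. W x ^ K * exp (- c * W x))" by (intro continuous_intros)
  then show "(\<lambda>x. W x ^ K * exp (- c * W x)) \<in> borel_measurable lborel" by (simp add: borel_measurable_continuous_onI)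
  have "norm (W x ^ K * exp (- c * W x)) \<le> norm (fact K * (2 / c) ^ K * exp (- (c / 4) * x\<^sup>2))" for x
  proof -
    have "norm (W x ^ K * exp (- c * W x)) = W x ^ K * exp (- c * W x)" by (simp add: abs_mult)
    also have "\<dots> \<le> fact K * (2 / c) ^ K * exp (- (c / 4) * x\<^sup>2)" by (rule W_power_exp_le[OF assms])
    also have "\<dots> \<le> norm \<dots>" by simp
    finally show ?thesis .
  qed
  then show "AE x in lborel. norm (W x ^ K * exp (- c * W x)) \<le> norm (fact K * (2 / c) ^ K * exp (- (c / 4) * x\<^sup>2))"
    by (intro always_eventually allI)
qed

lemma integrable_W_bound:
  fixes f :: "real \<Rightarrow> complex"
  assumes "continuous_on UNIV f" "c > 0" "\<And>x. norm (f x) \<le> C * (W x ^ K * exp (- c * W x))"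
  shows "integrable lborel f"
proof (rule Bochner_Integration.integrable_bound)
  show "integrable lborel (\<lambda>x. C * (W x ^ K * exp (- c * W x)))" by (intro integrable_mult_right integrable_W assms)
  show "f \<in> borel_measurable lborel" using assms(1) by (simp add: borel_measurable_continuous_onI)
  show "AE x in lborel. norm (f x) \<le> norm (C * (W x ^ K * exp (- c * W x)))"
    using assms(3) by (intro always_eventually allI) (simp add: order_trans[OF _ abs_ge_self])
qed

lemma lborel_integral_reflect:
  fixes f :: "real \<Rightarrow> complex"
  shows "integral\<^sup>L lborel (\<lambda>x. f (- x)) = integral\<^sup>L lborel f"
    and "integrable lborel f \<Longrightarrow> integrable lborel (\<lambda>x. f (- x))"
  using lborel_integral_real_affine[of "-1" f 0] lborel_integrable_real_affine[of f "-1" 0]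
  by simp_all

text \<open>The mean value inequality on the ball bounds the difference quotients by g, so dominated
  convergence applies along every sequence tending to the point.\<close>

lemma has_field_derivative_integral_param:
  fixes f f' :: "complex \<Rightarrow> real \<Rightarrow> complex"
  assumes r: "r > 0"
    and der: "\<And>s x. s \<in> ball s0 r \<Longrightarrow> ((\<lambda>s. f s x) has_field_derivative f' s x) (at s)"
    and bd: "\<And>s x. s \<in> ball s0 r \<Longrightarrow> norm (f' s x) \<le> g x"
    and g: "integrable lborel g"
    and int: "\<And>s. s \<in> ball s0 r \<Longrightarrow> integrable lborel (f s)"
    and meas: "f' s0 \<in> borel_measurable lborel"
  shows "((\<lambda>s. integral\<^sup>L lborel (f s)) has_field_derivative integral\<^sup>L lborel (f' s0)) (at s0)"
  unfolding has_field_derivative_iff tendsto_at_iff_sequentially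
proof (intro allI impI)
  fix X :: "nat \<Rightarrow> complex"
  assume X: "\<forall>i. X i \<in> UNIV - {s0}" "X \<longlonglongrightarrow> s0"
  have s0: "s0 \<in> ball s0 r" using r by simp
  obtain N where N: "\<And>n. n \<ge> N \<Longrightarrow> X n \<in> ball s0 r"
    using X(2) r unfolding LIMSEQ_def by (auto simp: dist_commute)
  define Y where "Y n = X (n + N)" for n
  have Y: "Y n \<in> ball s0 r" "Y n \<noteq> s0" for n using N X(1) by (auto simp: Y_def)
  have Ys: "Y \<longlonglongrightarrow> s0" unfolding Y_def by (rule LIMSEQ_ignore_initial_segment[OF X(2)])
  have "(\<lambda>n. integral\<^sup>L lborel (\<lambda>x. (f (Y n) x - f s0 x) / (Y n - s0))) \<longlonglongrightarrow> integral\<^sup>L lborel (f' s0)"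
  proof (rule integral_dominated_convergence[where w = g])
    show "AE x in lborel. (\<lambda>n. (f (Y n) x - f s0 x) / (Y n - s0)) \<longlonglongrightarrow> f' s0 x"
    proof (intro always_eventually allI)
      fix x
      have "((\<lambda>s. (f s x - f s0 x) / (s - s0)) \<longlongrightarrow> f' s0 x) (at s0)"
        using der[OF s0] by (simp add: has_field_derivative_iff)
      then show "(\<lambda>n. (f (Y n) x - f s0 x) / (Y n - s0)) \<longlonglongrightarrow> f' s0 x"
        by (rule filterlim_compose) (use Y(2) Ys in \<open>auto simp: filterlim_at intro: always_eventually\<close>)
    qed
    show "AE x in lborel. norm ((f (Y n) x - f s0 x) / (Y n - s0)) \<le> g x" for n
    proof (intro always_eventually allI)
      fix x
      have "norm (f (Y n) x - f s0 x) \<le> g x * norm (Y n - s0)"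
        by (rule field_differentiable_bound[of "ball s0 r" _ "\<lambda>s. f' s x"])
           (use der bd Y s0 in \<open>auto intro: has_field_derivative_at_within\<close>)
      then show "norm ((f (Y n) x - f s0 x) / (Y n - s0)) \<le> g x"
        using Y(2)[of n] by (simp add: norm_divide field_simps)
    qed
    show "(\<lambda>x. (f (Y n) x - f s0 x) / (Y n - s0)) \<in> borel_measurable lborel" for n
      using int[OF Y(1)[of n]] int[OF s0] by (intro borel_measurable_divide borel_measurable_diff) auto
  qed (use g meas in auto)
  moreover have "integral\<^sup>L lborel (\<lambda>x. (f (Y n) x - f s0 x) / (Y n - s0)) =
      (integral\<^sup>L lborel (f (Y n)) - integral\<^sup>L lborel (f s0)) / (Y n - s0)" for n
    using int[OF Y(1)[of n]] int[OF s0]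
    by (subst integral_divide_zero, subst Bochner_Integration.integral_diff) auto
  ultimately have "(\<lambda>n. (integral\<^sup>L lborel (f (Y n)) - integral\<^sup>L lborel (f s0)) / (Y n - s0)) \<longlonglongrightarrow> integral\<^sup>L lborel (f' s0)"
    by (simp only:)
  then show "((\<lambda>s. (integral\<^sup>L lborel (f s) - integral\<^sup>L lborel (f s0)) / (s - s0)) \<circ> X) \<longlonglongrightarrow> integral\<^sup>L lborel (f' s0)"
    unfolding Y_def by (rule_tac LIMSEQ_offset[of _ N]) (simp add: o_def)
qed

lemma lborel_integral_derivative_0:
  fixes F G :: "real \<Rightarrow> complex"
  assumes "\<And>x. (F has_vector_derivative G x) (at x)" "integrable lborel G"
    and "(\<lambda>N. F (real N)) \<longlonglongrightarrow> 0" "(\<lambda>N. F (- real N)) \<longlonglongrightarrow> 0"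
  shows "integral\<^sup>L lborel G = 0"
proof -
  have "integral {- real N..real N} G = F (real N) - F (- real N)" for N
    by (rule integral_unique, rule fundamental_theorem_of_calculus)
       (use assms(1) in \<open>auto intro: has_vector_derivative_at_within\<close>)
  moreover have "(\<lambda>N. F (real N) - F (- real N)) \<longlonglongrightarrow> 0 - 0"
    by (intro tendsto_diff assms)
  ultimately have "(\<lambda>N. integral {- real N..real N} G) \<longlonglongrightarrow> 0" by simp
  then show ?thesis using lborel_integral_tendsto[OF assms(2)] LIMSEQ_unique by blast
qed

lemma W_has_real_derivative [derivative_intros]:
  "(W has_field_derivative (exp x - exp (- x))) (at x within S)"
  unfolding W_def by (auto intro!: derivative_eq_intros)

text \<open>The exponential integral E_1(4 pi v), which is \<open>beta1 1 v\<close>; the functions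
  \<open>beta1 n\<close> with n positive are rescalings of it.\<close>

definition e1int :: "real \<Rightarrow> real" where
  "e1int v = integral {v..} (\<lambda>u. exp (- 4 * pi * u) / u)"

text \<open>A solution of K' = -exp(-4 pi v)/v that vanishes at infinity is the tail integral.
  Convergence of the improper integral is obtained together with its value.\<close>

lemma e1int_unique:
  fixes K :: "real \<Rightarrow> real"
  assumes "\<And>v. v > 0 \<Longrightarrow> (K has_field_derivative - exp (- 4 * pi * v) / v) (at v)" "(K \<longlongrightarrow> 0) at_top" "v > 0"
  shows "((\<lambda>u. exp (- 4 * pi * u) / u) has_integral K v) {v..}"
proof (rule has_integral_to_inf)
  have i: "((\<lambda>u. exp (- 4 * pi * u) / u) has_integral (K v - K y)) {v..y}" if "v \<le> y" for y
  proof -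
    have "((\<lambda>u. exp (- 4 * pi * u) / u) has_integral (- K y - - K v)) {v..y}"
    proof (rule fundamental_theorem_of_calculus[OF that])
      fix x assume "x \<in> {v..y}"
      then have "x > 0" using assms(3) by simp
      from DERIV_minus[OF assms(1)[OF this]]
      have "((\<lambda>x. - K x) has_real_derivative exp (- 4 * pi * x) / x) (at x)" by simp
      then have "((\<lambda>x. - K x) has_vector_derivative exp (- 4 * pi * x) / x) (at x)"
        by (simp only: has_real_derivative_iff_has_vector_derivative)
      then show "((\<lambda>x. - K x) has_vector_derivative exp (- 4 * pi * x) / x) (at x within {v..y})"
        by (rule has_vector_derivative_at_within)
    qed
    then show ?thesis by simp
  qed
  show "(\<lambda>u. exp (- 4 * pi * u) / u) integrable_on {v..y}" for y
    using i[of y] by (cases "v \<le> y") (auto simp: integrable_on_def)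
  have "((\<lambda>y. K v - K y) \<longlongrightarrow> K v - 0) at_top" by (intro tendsto_intros assms)
  moreover have "\<forall>\<^sub>F y in at_top. K v - K y = integral {v..y} (\<lambda>u. exp (- 4 * pi * u) / u)"
    using eventually_ge_at_top[of v] by eventually_elim (rule integral_unique[OF i, symmetric])
  ultimately have "((\<lambda>y. integral {v..y} (\<lambda>u. exp (- 4 * pi * u) / u)) \<longlongrightarrow> K v - 0) at_top"
    by (rule Lim_transform_eventually)
  then show "((\<lambda>y. integral {v..y} (\<lambda>u. exp (- 4 * pi * u) / u)) \<longlongrightarrow> K v) at_top" by simp
qed (use assms(3) in auto)

lemma kernel_bounds:
  assumes "v > 0"
  shows "norm (complex_of_real (exp (x / 2)) * of_real (exp (- pi * v * W x))) \<le> 1 * (W x ^ 1 * exp (- (pi * v) * W x))"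
    and "norm (complex_of_real (x * exp (x / 2)) * of_real (exp (- pi * v * W x))) \<le> 1 * (W x ^ 2 * exp (- (pi * v) * W x))"
proof -
  have "exp (x / 2) \<le> exp \<bar>x\<bar>" by simp
  then have e: "exp (x / 2) \<le> W x" using W_ge_exp(3)[of x] by linarith
  then show "norm (complex_of_real (exp (x / 2)) * of_real (exp (- pi * v * W x))) \<le> 1 * (W x ^ 1 * exp (- (pi * v) * W x))"
    by (simp add: norm_mult)
  have "\<bar>x\<bar> * exp (x / 2) \<le> W x * W x" using e W_ge_abs[of x] by (intro mult_mono) auto
  then show "norm (complex_of_real (x * exp (x / 2)) * of_real (exp (- pi * v * W x))) \<le> 1 * (W x ^ 2 * exp (- (pi * v) * W x))"
    by (simp add: norm_mult abs_mult power2_eq_square)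
qed

text \<open>Twice the Bessel function K of order 1/2 at 2 pi v, which is elementary: after
  symmetrising exp(x/2) to cosh(x/2), the substitution s = 2 sinh(x/2) satisfies s^2 + 2 =
  \<open>W x\<close> and leads to a Gaussian integral.\<close>

lemma has_bochner_integral_kernel:
  assumes v: "v > 0"
  shows "has_bochner_integral lborel (\<lambda>x. complex_of_real (exp (x / 2)) * of_real (exp (- pi * v * W x)))
     (of_real (exp (- 2 * pi * v) / sqrt v))"
proof -
  define k where "k x = exp (x / 2) * exp (- pi * v * W x)" for x
  have k: "complex_of_real (exp (x / 2)) * of_real (exp (- pi * v * W x)) = of_real (k x)" for x by (simp add: k_def)
  have ic: "integrable lborel (\<lambda>x. complex_of_real (k x))" unfolding k[symmetric]
    by (rule integrable_W_bound[OF _ _ kernel_bounds(1)[OF v]]) (use v in \<open>auto intro!: continuous_intros\<close>)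
  then have ik: "integrable lborel k" using integrable_Re by fastforce
  have ikr: "integrable lborel (\<lambda>x. k (- x))" "integral\<^sup>L lborel (\<lambda>x. k (- x)) = integral\<^sup>L lborel k"
    using lborel_integral_real_affine[of "-1" k 0] lborel_integrable_real_affine[OF ik, of "-1" 0] by simp_all
  define s where "s x = exp (x / 2) - exp (- x / 2)" for x :: real
  define h where "h u = exp (- 2 * pi * v) * exp (- pi * v * u\<^sup>2)" for u
  have s2: "(s x)\<^sup>2 + 2 = W x" for x
    by (simp add: s_def W_def power2_diff exp_double[symmetric] mult.assoc exp_add[symmetric])
  have hs: "h (s x) * ((exp (x / 2) + exp (- x / 2)) / 2) = (k x + k (- x)) / 2" for x
  proof -
    have "h (s x) = exp (- pi * v * W x)" unfolding h_def s2[of x, symmetric]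
      by (simp add: exp_add[symmetric] algebra_simps)
    then show ?thesis by (simp add: k_def algebra_simps)
  qed
  have top: "filterlim s at_top at_top" unfolding s_def by real_asymp
  have bot: "filterlim s at_bot at_bot" unfolding s_def by real_asymp
  have "(LBINT u=-\<infinity>..\<infinity>. h u) = (LBINT x=-\<infinity>..\<infinity>. h (s x) * ((exp (x / 2) + exp (- x / 2)) / 2))"
  proof (rule interval_integral_substitution_nonneg(2)[where g = s and g' = "\<lambda>x. (exp (x / 2) + exp (- x / 2)) / 2"])
    show "DERIV s x :> (exp (x / 2) + exp (- x / 2)) / 2" for x
      unfolding s_def by (auto intro!: derivative_eq_intros simp: field_simps)
    show "isCont h (s x)" for x unfolding h_def by (intro continuous_intros)
    show "isCont (\<lambda>x. (exp (x / 2) + exp (- x / 2)) / 2) x" for x :: real by (intro continuous_intros) auto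
    show "0 \<le> h (s x)" for x by (simp add: h_def)
    show "0 \<le> (exp (x / 2) + exp (- x / 2)) / (2::real)" for x by (simp add: add_nonneg_nonneg)
    show "((ereal \<circ> s \<circ> real_of_ereal) \<longlongrightarrow> - \<infinity>) (at_right (- \<infinity>))"
      using bot by (simp add: ereal_tendsto_simps)
    show "((ereal \<circ> s \<circ> real_of_ereal) \<longlongrightarrow> \<infinity>) (at_left \<infinity>)"
      using top by (simp add: ereal_tendsto_simps)
    show "set_integrable lborel (einterval (- \<infinity>) \<infinity>) (\<lambda>x. h (s x) * ((exp (x / 2) + exp (- x / 2)) / 2))"
      unfolding hs using ik ikr by (simp add: set_integrable_def einterval_def)
  qed simp_all
  then have "integral\<^sup>L lborel h = integral\<^sup>L lborel (\<lambda>x. (k x + k (- x)) / 2)"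
    unfolding hs by (simp add: interval_lebesgue_integral_def set_lebesgue_integral_def einterval_def)
  also have "\<dots> = integral\<^sup>L lborel k" using ik ikr by simp
  finally have kh: "integral\<^sup>L lborel k = integral\<^sup>L lborel h" ..
  have "integral\<^sup>L lborel (\<lambda>u. complex_of_real (h u)) = of_real (exp (- 2 * pi * v)) * integral\<^sup>L lborel (\<lambda>u. of_real (exp (- pi * v * u\<^sup>2)) * ee (- (0 * u)))"
    by (simp add: h_def)
  also have "\<dots> = of_real (exp (- 2 * pi * v)) * of_real (1 / sqrt v)"
    using gauss_fourier[OF v, of 0] by (simp add: has_bochner_integral_iff)
  finally have "complex_of_real (integral\<^sup>L lborel h) = of_real (exp (- 2 * pi * v) / sqrt v)" by simp
  then show ?thesis unfolding k using ic kh by (simp add: has_bochner_integral_iff)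
qed

lemma W_power_exp_tendsto:
  assumes "c > 0"
  shows "(\<lambda>N. W (real N) ^ K * exp (- c * W (real N))) \<longlonglongrightarrow> 0"
proof (rule tendsto_sandwich[where f = "\<lambda>_. 0" and h = "\<lambda>N. fact K * (2 / c) ^ K * exp (- (c / 4) * (real N)\<^sup>2)"])
  have "(\<lambda>N. exp (- (c / 4) * (real N)\<^sup>2)) \<longlonglongrightarrow> 0" using assms by real_asymp
  then show "(\<lambda>N. fact K * (2 / c) ^ K * exp (- (c / 4) * (real N)\<^sup>2)) \<longlonglongrightarrow> 0"
    by (rule tendsto_mult_right_zero)
qed (use W_power_exp_le[OF assms] in \<open>auto intro!: always_eventually\<close>)

text \<open>The derivative of the preceding Bessel integral in its order. As a function J of v it
  satisfies a first-order linear equation whose inhomogeneity is the elementary kernel integral;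
  sqrt(v) exp(-2 pi v) is an integrating factor, and decay at infinity identifies the solution with
  the exponential integral.\<close>

lemma has_bochner_integral_log_kernel:
  assumes v: "v > 0"
  shows "has_bochner_integral lborel (\<lambda>x. complex_of_real (x * exp (x / 2)) * of_real (exp (- pi * v * W x)))
     (of_real (exp (2 * pi * v) / sqrt v * e1int v))"
    and "((\<lambda>u. exp (- 4 * pi * u) / u) has_integral e1int v) {v..}"
proof -
  define E where "E s x = exp (- of_real pi * s * of_real (W x))" for s :: complex and x :: real
  define f where "f s x = of_real (x * exp (x / 2)) * E s x" for s x
  define f' where "f' s x = of_real (- pi * W x * (x * exp (x / 2))) * E s x" for s x
  define J where "J s = integral\<^sup>L lborel (f s)" for s
  define J' where "J' s = integral\<^sup>L lborel (f' s)" for s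
  have norm_E: "norm (E s x) = exp (- pi * Re s * W x)" for s x
    by (simp add: E_def norm_exp_eq_Re)
  have E_of_real: "E (of_real v) x = of_real (exp (- pi * v * W x))" for v x
    by (simp add: E_def exp_of_real[symmetric])
  have cE: "continuous_on S (E s)" for S s unfolding E_def by (intro continuous_intros)
  have xe: "\<bar>x\<bar> * exp (x / 2) \<le> W x ^ 2" for x
  proof -
    have "exp (x / 2) \<le> exp \<bar>x\<bar>" by simp
    then have "exp (x / 2) \<le> W x" using W_ge_exp(3)[of x] by linarith
    then have "\<bar>x\<bar> * exp (x / 2) \<le> W x * W x" using W_ge_abs[of x] by (intro mult_mono) auto
    then show ?thesis by (simp add: power2_eq_square)
  qed
  have f_int: "integrable lborel (f s)" if "Re s > 0" for s
  proof (rule integrable_W_bound[of _ "pi * Re s" 1 2])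
    show "continuous_on UNIV (f s)" unfolding f_def by (intro continuous_intros cE) auto
    show "norm (f s x) \<le> 1 * (W x ^ 2 * exp (- (pi * Re s) * W x))" for x
      using mult_right_mono[OF xe[of x], of "exp (- pi * Re s * W x)"] by (simp add: f_def norm_mult norm_E abs_mult)
  qed (use that in simp)
  have f'_bd: "norm (f' s x) \<le> pi * (W x ^ 3 * exp (- (pi * c) * W x))" if "Re s \<ge> c" for s x c
  proof -
    have "norm (f' s x) = pi * W x * (\<bar>x\<bar> * exp (x / 2)) * exp (- pi * Re s * W x)"
      by (simp add: f'_def norm_mult norm_E abs_mult)
    also have "\<dots> \<le> pi * W x * (W x ^ 2) * exp (- pi * c * W x)"
      using xe[of x] that by (intro mult_mono) (auto intro: mult_nonneg_nonneg mult_right_mono)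
    also have "\<dots> = pi * (W x ^ 3 * exp (- (pi * c) * W x))" by (simp add: power3_eq_cube power2_eq_square)
    finally show ?thesis .
  qed
  have cf': "continuous_on UNIV (f' s)" for s unfolding f'_def by (intro continuous_intros cE) auto
  have f'_int: "integrable lborel (f' s)" if "Re s > 0" for s
    by (rule integrable_W_bound[OF cf' _ f'_bd[of "Re s" s]]) (use that in auto)
  have derJ: "(J has_field_derivative J' (of_real v)) (at (of_real v))" if v: "v > 0" for v
    unfolding J_def[abs_def] J'_def
  proof (rule has_field_derivative_integral_param[where r = "v / 2" and g = "\<lambda>x. pi * (W x ^ 3 * exp (- (pi * (v / 2)) * W x))"])
    have re: "Re s \<ge> v / 2" if "s \<in> ball (of_real v) (v / 2)" for s
      using that abs_Re_le_cmod[of "of_real v - s"] by (simp add: dist_norm)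
    fix s x assume s: "s \<in> ball (complex_of_real v) (v / 2)"
    show "((\<lambda>s. f s x) has_field_derivative f' s x) (at s)"
      unfolding f_def f'_def E_def by (auto intro!: derivative_eq_intros)
    show "norm (f' s x) \<le> pi * (W x ^ 3 * exp (- (pi * (v / 2)) * W x))"
      by (rule f'_bd[OF re[OF s]])
    show "integrable lborel (f s)" using f_int[of s] re[OF s] v by simp
  next
    show "integrable lborel (\<lambda>x. pi * (W x ^ 3 * exp (- (pi * (v / 2)) * W x)))"
      by (intro integrable_mult_right integrable_W) (use v in simp)
    show "f' (of_real v) \<in> borel_measurable lborel" using cf' by (simp add: borel_measurable_continuous_onI)
  qed (use v in simp)
  define c where "c x = exp (x / 2) + exp (- x / 2)" for x :: real
  \<comment> \<open>Chosen so that g(x) + g(-x) is the derivative of 2x (exp(x/2) + exp(-x/2))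
    exp(-pi v W(x)) and hence integrates to 0. Written out by means of J and J' this is the
    differential equation.\<close>
  define g where "g v x = (2 * exp (x / 2) + x * exp (x / 2) * (1 - 2 * pi * v * (W x + 2))) * exp (- pi * v * W x)" for v x
  have F1: "integrable lborel (\<lambda>x. complex_of_real (exp (x / 2)) * of_real (exp (- pi * v * W x)))"
     "integral\<^sup>L lborel (\<lambda>x. complex_of_real (exp (x / 2)) * of_real (exp (- pi * v * W x))) = of_real (exp (- 2 * pi * v) / sqrt v)" if "v > 0" for v
    using has_bochner_integral_kernel[OF that] by (simp_all add: has_bochner_integral_iff)
  have g: "complex_of_real (g v x) = 2 * (of_real (exp (x / 2)) * of_real (exp (- pi * v * W x))) +
        of_real (1 - 4 * pi * v) * f (of_real v) x + of_real (2 * v) * f' (of_real v) x" for v x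
    unfolding f_def f'_def E_of_real g_def by (simp add: algebra_simps)
  have g_int: "integrable lborel (\<lambda>x. complex_of_real (g v x))" if "v > 0" for v
    unfolding g using F1(1)[OF that] f_int[of "of_real v"] f'_int[of "of_real v"] that
    by (intro Bochner_Integration.integrable_add integrable_mult_right) auto
  have g0: "integral\<^sup>L lborel (\<lambda>x. complex_of_real (g v x)) = 0" if v: "v > 0" for v
  proof -
    have r: "integrable lborel (\<lambda>x. complex_of_real (g v (- x)))" "integral\<^sup>L lborel (\<lambda>x. complex_of_real (g v (- x))) = integral\<^sup>L lborel (\<lambda>x. complex_of_real (g v x))"
      using lborel_integral_reflect[of "\<lambda>x. complex_of_real (g v x)"] g_int[OF v] by simp_all
    define F where "F x = 2 * x * c x * exp (- pi * v * W x)" for x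
    have W': "exp x - exp (- x) = c x * (exp (x / 2) - exp (- x / 2))" for x :: real
      by (simp add: c_def algebra_simps exp_add[symmetric])
    have W2: "W x + 2 = c x * c x" for x
      by (simp add: c_def W_def algebra_simps exp_add[symmetric])
    have sym: "g v x + g v (- x) = (2 * c x + 2 * x * ((exp (x / 2) - exp (- x / 2)) / 2) - 2 * x * c x * (pi * v * (exp x - exp (- x)))) * exp (- pi * v * W x)" for x
      unfolding g_def W' W_uminus W2 by (simp add: c_def field_simps)
    have "integral\<^sup>L lborel (\<lambda>x. complex_of_real (g v x + g v (- x))) = 0"
    proof (rule lborel_integral_derivative_0[where F = "\<lambda>x. of_real (F x)"])
      have "(F has_real_derivative (g v x + g v (- x))) (at x)" for x
        unfolding sym F_def c_def by (auto intro!: derivative_eq_intros simp: field_simps)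
      then show "((\<lambda>x. complex_of_real (F x)) has_vector_derivative complex_of_real (g v x + g v (- x))) (at x)" for x
        by (intro has_vector_derivative_of_real) (simp add: has_real_derivative_iff_has_vector_derivative)
      show "integrable lborel (\<lambda>x. complex_of_real (g v x + g v (- x)))"
        using g_int[OF v] r(1) by (simp add: Bochner_Integration.integrable_add)
      have bd: "norm (complex_of_real (F x)) \<le> 4 * (W x ^ 2 * exp (- (pi * v) * W x))" for x
      proof -
        have "exp (x / 2) \<le> exp \<bar>x\<bar>" "exp (- x / 2) \<le> exp \<bar>x\<bar>" by simp_all
        then have "c x \<le> 2 * W x" using W_ge_exp(3)[of x] unfolding c_def by linarith
        moreover have "c x \<ge> 0" by (simp add: c_def add_nonneg_nonneg)
        ultimately have "2 * \<bar>x\<bar> * c x \<le> 2 * W x * (2 * W x)" using W_ge_abs[of x] by (intro mult_mono) auto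
        then have "2 * \<bar>x\<bar> * c x * exp (- pi * v * W x) \<le> 2 * W x * (2 * W x) * exp (- pi * v * W x)" by (rule mult_right_mono) simp
        then show ?thesis using \<open>c x \<ge> 0\<close> by (simp add: F_def norm_mult abs_mult power2_eq_square)
      qed
      have l: "(\<lambda>N. 4 * (W (real N) ^ 2 * exp (- (pi * v) * W (real N)))) \<longlonglongrightarrow> 0"
        using v by (intro tendsto_mult_right_zero W_power_exp_tendsto) simp
      show "(\<lambda>N. complex_of_real (F (real N))) \<longlonglongrightarrow> 0" "(\<lambda>N. complex_of_real (F (- real N))) \<longlonglongrightarrow> 0"
        using bd bd[of "- real N" for N] by (auto intro!: Lim_null_comparison[OF _ l] always_eventually)
    qed
    moreover have "integral\<^sup>L lborel (\<lambda>x. complex_of_real (g v x + g v (- x))) = 2 * integral\<^sup>L lborel (\<lambda>x. complex_of_real (g v x))"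
      using g_int[OF v] r by simp
    ultimately show ?thesis by simp
  qed
  have ode: "2 * of_real (exp (- 2 * pi * v) / sqrt v) + of_real (1 - 4 * pi * v) * J (of_real v) + of_real (2 * v) * J' (of_real v) = 0" if v: "v > 0" for v
  proof -
    have "0 = integral\<^sup>L lborel (\<lambda>x. complex_of_real (g v x))" using g0[OF v] by simp
    also have "\<dots> = 2 * integral\<^sup>L lborel (\<lambda>x. complex_of_real (exp (x / 2)) * of_real (exp (- pi * v * W x)))
       + of_real (1 - 4 * pi * v) * J (of_real v) + of_real (2 * v) * J' (of_real v)"
      unfolding g J_def J'_def using F1(1)[OF v] f_int[of "of_real v"] f'_int[of "of_real v"] v
      by (subst Bochner_Integration.integral_add; (subst Bochner_Integration.integral_add)?; (intro Bochner_Integration.integrable_add integrable_mult_right)?; simp)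
    finally show ?thesis using F1(2)[OF v] by simp
  qed
  \<comment> \<open>With this integrating factor the equation for J becomes K' = -exp(-4 pi
    v)/v.\<close>
  define K where "K v = sqrt v * exp (- 2 * pi * v) * Re (J (of_real v))" for v
  have K: "(K has_field_derivative - exp (- 4 * pi * v) / v) (at v)" if v: "v > 0" for v
  proof -
    define R where "R x = Re (J (of_real x))" for x
    have hR: "(R has_real_derivative Re (J' (of_real v))) (at v)" unfolding R_def
      using bounded_linear.has_vector_derivative[OF bounded_linear_Re has_vector_derivative_real_field[OF derJ[OF v]]]
      by (simp add: has_real_derivative_iff_has_vector_derivative)
    have "(K has_field_derivative (exp (- 2 * pi * v) * (inverse (sqrt v) / 2) * R v - sqrt v * 2 * pi * exp (- 2 * pi * v) * R v
        + sqrt v * exp (- 2 * pi * v) * Re (J' (of_real v)))) (at v)"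
      unfolding K_def R_def[symmetric] using v by (auto intro!: derivative_eq_intros hR simp: field_simps)
    then have "(K has_field_derivative (exp (- 2 * pi * v) * (inverse (sqrt v) / 2) * Re (J (of_real v)) - sqrt v * 2 * pi * exp (- 2 * pi * v) * Re (J (of_real v))
        + sqrt v * exp (- 2 * pi * v) * Re (J' (of_real v)))) (at v)"
      unfolding R_def .
    moreover have "exp (- 2 * pi * v) * (inverse (sqrt v) / 2) * Re (J (of_real v)) - sqrt v * 2 * pi * exp (- 2 * pi * v) * Re (J (of_real v))
        + sqrt v * exp (- 2 * pi * v) * Re (J' (of_real v)) = - exp (- 4 * pi * v) / v"
    proof -
      have r: "2 * (exp (- 2 * pi * v) / sqrt v) + (1 - 4 * pi * v) * Re (J (of_real v)) + 2 * v * Re (J' (of_real v)) = 0"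
        using arg_cong[OF ode[OF v], of Re] by simp
      define j j' e w where "j = Re (J (of_real v))" and "j' = Re (J' (of_real v))" and "e = exp (- 2 * pi * v)" and "w = sqrt v"
      have w: "w > 0" "v = w * w" using v by (simp_all add: w_def)
      have ee: "exp (- 4 * pi * v) = e * e" by (simp add: e_def exp_add[symmetric])
      have r': "2 * (e / w) + (1 - 4 * pi * (w * w)) * j + 2 * (w * w) * j' = 0" 
        using r unfolding j_def[symmetric] j'_def[symmetric] e_def[symmetric] w_def[symmetric] by (simp only: w(2)[symmetric])
      have "e * (inverse w / 2) * j - w * 2 * pi * e * j + w * e * j' = (e / (2 * w)) * ((1 - 4 * pi * (w * w)) * j + 2 * (w * w) * j')"
        using w by (simp add: field_simps)
      also have "(1 - 4 * pi * (w * w)) * j + 2 * (w * w) * j' = - (2 * (e / w))" using r' by linarith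
      also have "(e / (2 * w)) * - (2 * (e / w)) = - (e * e) / (w * w)" using w by (simp add: field_simps)
      finally show ?thesis
        by (simp only: ee j_def[symmetric] j'_def[symmetric] e_def[symmetric] w_def[symmetric] w(2)[symmetric])
    qed
    ultimately show ?thesis by simp
  qed
  have Klim: "(K \<longlongrightarrow> 0) at_top"
  proof (rule Lim_null_comparison)
    define C where "C = integral\<^sup>L lborel (\<lambda>x. W x ^ 2 * exp (- pi * W x))"
    \<comment> \<open>For v at least 1 the integrands lie below one fixed integrable function, so J
      stays bounded and the factor exp(-2 pi v) forces K to 0.\<close>
    have bJ: "norm (J (of_real v)) \<le> C" if "v \<ge> 1" for v
    proof -
      have "norm (f (of_real v) x) \<le> W x ^ 2 * exp (- pi * W x)" for x
      proof -
        have "norm (f (of_real v) x) = (\<bar>x\<bar> * exp (x / 2)) * exp (- pi * v * W x)" by (simp add: f_def norm_mult norm_E abs_mult)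
        also have "\<dots> \<le> W x ^ 2 * exp (- pi * 1 * W x)" using xe[of x] that by (intro mult_mono) (auto intro: mult_right_mono)
        finally show ?thesis by simp
      qed
      then show ?thesis unfolding J_def C_def using f_int[of "of_real v"] that integrable_W[of pi 2]
        by (intro order_trans[OF integral_norm_bound] integral_mono integrable_norm) auto
    qed
    show "\<forall>\<^sub>F v in at_top. norm (K v) \<le> sqrt v * exp (- 2 * pi * v) * C"
      using eventually_ge_at_top[of 1]
    proof eventually_elim
      case (elim v)
      have "\<bar>Re (J (of_real v))\<bar> \<le> C" using bJ[OF elim] abs_Re_le_cmod order_trans by blast
      then show ?case using elim unfolding K_def by (simp add: abs_mult mult_left_mono)
    qed
    show "((\<lambda>v. sqrt v * exp (- 2 * pi * v) * C) \<longlongrightarrow> 0) at_top"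
      by (rule tendsto_mult_left_zero) real_asymp
  qed
  have KE: "((\<lambda>u. exp (- 4 * pi * u) / u) has_integral K v) {v..}" by (rule e1int_unique[OF K Klim v])
  then have e1: "e1int v = K v" by (simp add: e1int_def integral_unique)
  then show "((\<lambda>u. exp (- 4 * pi * u) / u) has_integral e1int v) {v..}" using KE by simp
  have fr: "f (of_real v) x = of_real (x * exp (x / 2) * exp (- pi * v * W x))" for x
    unfolding f_def E_of_real by simp
  have "J (of_real v) = of_real (integral\<^sup>L lborel (\<lambda>x. x * exp (x / 2) * exp (- pi * v * W x)))"
    unfolding J_def fr by (rule integral_complex_of_real)
  then have "J (of_real v) = of_real (Re (J (of_real v)))" by simp
  also have "Re (J (of_real v)) = exp (2 * pi * v) / sqrt v * e1int v"
    unfolding e1 K_def using v by (simp add: field_simps exp_add[symmetric])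
  finally have I: "integral\<^sup>L lborel (f (of_real v)) = of_real (exp (2 * pi * v) / sqrt v * e1int v)" unfolding J_def .
  have eq: "(\<lambda>x. complex_of_real (x * exp (x / 2)) * of_real (exp (- pi * v * W x))) = f (of_real v)"
    by (rule ext) (simp only: f_def E_of_real)
  have "integrable lborel (f (of_real v))" using f_int[of "of_real v"] v by simp
  then show "has_bochner_integral lborel (\<lambda>x. complex_of_real (x * exp (x / 2)) * of_real (exp (- pi * v * W x)))
     (of_real (exp (2 * pi * v) / sqrt v * e1int v))"
    unfolding eq using I by (simp only: has_bochner_integral_iff)
qed

text \<open>An enumeration of the index set reduces the exchange to series of integrable functions;
  absolute convergence leads back to unordered sums.\<close>

lemma has_sum_lborel_integral:
  fixes f :: "'i \<Rightarrow> real \<Rightarrow> complex"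
  assumes \<beta>: "bij_betw \<beta> (UNIV :: nat set) I"
    and int: "\<And>i. i \<in> I \<Longrightarrow> integrable lborel (f i)"
    and pt: "\<And>x. (\<lambda>i. norm (f i x)) summable_on I"
    and s: "(\<lambda>i. integral\<^sup>L lborel (\<lambda>x. norm (f i x))) summable_on I"
  shows "((\<lambda>i. integral\<^sup>L lborel (f i)) has_sum integral\<^sup>L lborel (\<lambda>x. \<Sum>\<^sub>\<infinity>i\<in>I. f i x)) I"
    and "integrable lborel (\<lambda>x. \<Sum>\<^sub>\<infinity>i\<in>I. f i x)"
proof -
  define g where "g n = f (\<beta> n)" for n
  have \<beta>I: "\<beta> n \<in> I" for n using \<beta> by (auto simp: bij_betw_def)
  have gi: "integrable lborel (g n)" for n unfolding g_def by (rule int[OF \<beta>I])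
  have pt': "(\<lambda>n. norm (g n x)) summable_on UNIV" for x
    using pt[of x] unfolding g_def by (subst summable_on_reindex_bij_betw[OF \<beta>, of "\<lambda>i. norm (f i x)"])
  have s': "(\<lambda>n. integral\<^sup>L lborel (\<lambda>x. norm (g n x))) summable_on UNIV"
    using s unfolding g_def by (subst summable_on_reindex_bij_betw[OF \<beta>, of "\<lambda>i. integral\<^sup>L lborel (\<lambda>x. norm (f i x))"])
  have sm: "AE x in lborel. summable (\<lambda>n. norm (g n x))"
    using pt' by (intro always_eventually allI summable_on_imp_summable)
  have sm': "summable (\<lambda>n. integral\<^sup>L lborel (\<lambda>x. norm (g n x)))" by (rule summable_on_imp_summable[OF s'])
  have eq: "(\<Sum>n. g n x) = (\<Sum>\<^sub>\<infinity>i\<in>I. f i x)" for x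
  proof -
    have "((\<lambda>n. g n x) has_sum (\<Sum>\<^sub>\<infinity>n. g n x)) UNIV"
      by (rule has_sum_infsum, rule Infinite_Sum.abs_summable_summable[OF pt'])
    then have "(\<Sum>n. g n x) = (\<Sum>\<^sub>\<infinity>n. g n x)" using has_sum_imp_sums sums_unique by metis
    also have "\<dots> = (\<Sum>\<^sub>\<infinity>i\<in>I. f i x)" unfolding g_def by (rule infsum_reindex_bij_betw[OF \<beta>])
    finally show ?thesis .
  qed
  show "integrable lborel (\<lambda>x. \<Sum>\<^sub>\<infinity>i\<in>I. f i x)"
    using integrable_suminf[OF gi sm sm'] unfolding eq .
  have sums: "(\<lambda>n. integral\<^sup>L lborel (g n)) sums integral\<^sup>L lborel (\<lambda>x. \<Sum>\<^sub>\<infinity>i\<in>I. f i x)"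
    using sums_integral[OF gi sm sm'] unfolding eq .
  have "(\<lambda>n. norm (integral\<^sup>L lborel (g n))) summable_on UNIV"
    by (rule Infinite_Sum.abs_summable_on_comparison_test'[OF s']) (rule integral_norm_bound)
  then have "((\<lambda>n. integral\<^sup>L lborel (g n)) has_sum (\<Sum>\<^sub>\<infinity>n. integral\<^sup>L lborel (g n))) UNIV"
    by (rule has_sum_infsum[OF Infinite_Sum.abs_summable_summable])
  moreover from this have "(\<Sum>\<^sub>\<infinity>n. integral\<^sup>L lborel (g n)) = integral\<^sup>L lborel (\<lambda>x. \<Sum>\<^sub>\<infinity>i\<in>I. f i x)"
    using has_sum_imp_sums sums sums_unique2 by blast
  ultimately have "((\<lambda>n. integral\<^sup>L lborel (g n)) has_sum integral\<^sup>L lborel (\<lambda>x. \<Sum>\<^sub>\<infinity>i\<in>I. f i x)) UNIV" by simp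
  then show "((\<lambda>i. integral\<^sup>L lborel (f i)) has_sum integral\<^sup>L lborel (\<lambda>x. \<Sum>\<^sub>\<infinity>i\<in>I. f i x)) I"
    unfolding g_def by (subst (asm) has_sum_reindex_bij_betw[OF \<beta>, of "\<lambda>i. integral\<^sup>L lborel (f i)"])
qed

text \<open>Euler's integral for Gamma in the variable t = exp x, translated by log a.\<close>

lemma has_bochner_integral_exp_exp:
  assumes u: "Re u > 0" and a: "a > 0"
  shows "has_bochner_integral lborel (\<lambda>x. exp (u * of_real x) * of_real (exp (- a * exp x))) (Gamma u * exp (- u * of_real (ln a)))"
proof -
  define f where "f t = of_real t powr (u - 1) / of_real (exp t)" for t :: real
  have fa: "f absolutely_integrable_on {0<..}" unfolding f_def by (rule absolutely_integrable_Gamma_integral'[OF u])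
  have fi: "integral {0<..} f = Gamma u" unfolding f_def by (rule integral_unique[OF Gamma_integral_complex'[OF u]])
  define k where "k x = exp (u * of_real x) * of_real (exp (- exp x))" for x :: real
  have kf: "of_real (exp x) * f (exp x) = k x" for x
  proof -
    have "(of_real (exp x) :: complex) powr (u - 1) = exp ((u - 1) * of_real x)"
      by (simp add: powr_def Ln_of_real)
    then have "of_real (exp x) * f (exp x) = exp (of_real x) * exp ((u - 1) * of_real x) / of_real (exp (exp x))"
      by (simp add: f_def exp_of_real)
    also have "\<dots> = exp (u * of_real x) * inverse (of_real (exp (exp x)))"
      by (simp add: exp_add[symmetric] algebra_simps divide_inverse)
    also have "inverse (of_real (exp (exp x))) = complex_of_real (exp (- exp x))" by (simp add: exp_minus)
    finally show ?thesis unfolding k_def .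
  qed
  have rg: "range exp = {0 :: real<..}" using exp_total by force
  \<comment> \<open>Real and imaginary parts are transformed separately, so that the substitution t
    = exp x is one between real functions.\<close>
  have cv: "(\<lambda>x. \<bar>exp x\<bar> * h (exp x)) absolutely_integrable_on UNIV \<and> integral UNIV (\<lambda>x. \<bar>exp x\<bar> * h (exp x)) = b
      \<longleftrightarrow> h absolutely_integrable_on {0<..} \<and> integral {0<..} h = b" for h :: "real \<Rightarrow> real" and b
    unfolding rg[symmetric] by (rule has_absolute_integral_change_of_variables_1')
      (auto simp: inj_on_def intro!: derivative_eq_intros)
  have re: "(\<lambda>x. Re (k x)) absolutely_integrable_on UNIV" "integral UNIV (\<lambda>x. Re (k x)) = Re (Gamma u)"
  proof -
    have "(\<lambda>t. Re (f t)) absolutely_integrable_on {0<..}" using absolutely_integrable_linear[OF fa bounded_linear_Re] by (simp add: o_def)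
    moreover have "integral {0<..} (\<lambda>t. Re (f t)) = Re (Gamma u)"
      using integral_linear[OF set_lebesgue_integral_eq_integral(1)[OF fa] bounded_linear_Re] fi by (simp add: o_def)
    ultimately show "(\<lambda>x. Re (k x)) absolutely_integrable_on UNIV" "integral UNIV (\<lambda>x. Re (k x)) = Re (Gamma u)"
      using cv[of "\<lambda>t. Re (f t)" "Re (Gamma u)"] kf[symmetric] by simp_all
  qed
  have im: "(\<lambda>x. Im (k x)) absolutely_integrable_on UNIV" "integral UNIV (\<lambda>x. Im (k x)) = Im (Gamma u)"
  proof -
    have "(\<lambda>t. Im (f t)) absolutely_integrable_on {0<..}" using absolutely_integrable_linear[OF fa bounded_linear_Im] by (simp add: o_def)
    moreover have "integral {0<..} (\<lambda>t. Im (f t)) = Im (Gamma u)"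
      using integral_linear[OF set_lebesgue_integral_eq_integral(1)[OF fa] bounded_linear_Im] fi by (simp add: o_def)
    ultimately show "(\<lambda>x. Im (k x)) absolutely_integrable_on UNIV" "integral UNIV (\<lambda>x. Im (k x)) = Im (Gamma u)"
      using cv[of "\<lambda>t. Im (f t)" "Im (Gamma u)"] kf[symmetric] by simp_all
  qed
  have ck: "continuous_on UNIV k" unfolding k_def by (intro continuous_intros)
  have borel: "integrable lborel h" "integral\<^sup>L lborel h = integral UNIV h"
    if "h absolutely_integrable_on UNIV" "continuous_on UNIV h" for h :: "real \<Rightarrow> real"
  proof -
    have "h \<in> borel_measurable borel" using that(2) by (rule borel_measurable_continuous_onI)
    then show i: "integrable lborel h" using that(1) by (simp add: set_integrable_def integrable_completion)
    show "integral\<^sup>L lborel h = integral UNIV h" using integral_lborel[OF i] by simp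
  qed
  have cr: "continuous_on UNIV (\<lambda>x. Re (k x))" "continuous_on UNIV (\<lambda>x. Im (k x))" by (intro continuous_intros ck)+
  have k: "k = (\<lambda>x. of_real (Re (k x)) + \<i> * of_real (Im (k x)))" by (rule ext) (rule complex_eq)
  have "has_bochner_integral lborel (\<lambda>x. of_real (Re (k x)) + \<i> * of_real (Im (k x))) (of_real (Re (Gamma u)) + \<i> * of_real (Im (Gamma u)))"
    using borel[OF re(1) cr(1)] borel[OF im(1) cr(2)] re(2) im(2)
    by (intro has_bochner_integral_add has_bochner_integral_mult_right has_bochner_integral_of_real) (simp_all add: has_bochner_integral_iff)
  then have hk: "has_bochner_integral lborel k (Gamma u)" unfolding k[symmetric] complex_eq[symmetric] .
  then have "has_bochner_integral lborel (\<lambda>x. k (x + ln a)) (Gamma u)"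
    using lborel_has_bochner_integral_real_affine_iff[of 1 k "Gamma u" "ln a"] by (simp add: add.commute)
  then have "has_bochner_integral lborel (\<lambda>x. k (x + ln a) * exp (- u * of_real (ln a))) (Gamma u * exp (- u * of_real (ln a)))"
    by (rule has_bochner_integral_mult_left)
  moreover have "k (x + ln a) * exp (- u * of_real (ln a)) = exp (u * of_real x) * of_real (exp (- a * exp x))" for x
    using a by (simp add: k_def exp_add ring_distribs exp_minus mult.commute)
  ultimately show ?thesis by simp
qed

section \<open>One-dimensional theta series and L-functions of odd characters\<close>

text \<open>The factor |n| removes the term n = 0, so the whole sum decays exponentially in a. Half
  of the exponent yields exp(-a/2); the other half keeps the series convergent, uniformly for a at
  least \<open>\<delta>\<close>.\<close>

lemma sum_abs_gauss_bound:
  fixes \<delta> :: real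
  assumes "\<delta> > 0"
  obtains C where "C \<ge> 0" "\<And>a. a \<ge> \<delta> \<Longrightarrow> (\<lambda>n::int. \<bar>of_int n\<bar> * exp (- a * (of_int n)\<^sup>2)) summable_on UNIV"
    "\<And>a. a \<ge> \<delta> \<Longrightarrow> (\<Sum>\<^sub>\<infinity>n::int. \<bar>of_int n\<bar> * exp (- a * (of_int n)\<^sup>2)) \<le> C * exp (- (a / 2))"
    "\<And>a n. a \<ge> \<delta> \<Longrightarrow> \<bar>of_int n\<bar> * exp (- a * (of_int n)\<^sup>2) \<le> \<bar>of_int (n::int)\<bar> ^ 1 * exp (- (\<delta> / 2) * \<bar>of_int n\<bar>)"
proof -
  define b :: "int \<Rightarrow> real" where "b n = \<bar>of_int n\<bar> ^ 1 * exp (- (\<delta> / 2) * \<bar>of_int n\<bar>)" for n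
  have b: "b summable_on UNIV" unfolding b_def by (rule summable_int_poly_exp) (use assms in simp)
  have key: "\<bar>of_int n\<bar> * exp (- a * (of_int n)\<^sup>2) \<le> exp (- (a / 2)) * b n" if a: "a \<ge> \<delta>" for a and n :: int
  proof (cases "n = 0")
    case False
    then have "1 \<le> \<bar>n\<bar>" by linarith
    then have n1: "1 \<le> \<bar>real_of_int n\<bar>" by linarith
    have n2: "\<bar>real_of_int n\<bar> \<le> (of_int n)\<^sup>2" using self_le_power[OF n1, of 2] by simp
    have "a / 2 * 1 \<le> a / 2 * (of_int n)\<^sup>2" using n1 n2 a assms by (intro mult_left_mono) auto
    moreover have "\<delta> / 2 * \<bar>of_int n\<bar> \<le> a / 2 * (of_int n)\<^sup>2" using n2 a assms by (intro mult_mono) auto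
    ultimately have "- a * (of_int n)\<^sup>2 \<le> - (a / 2) + - (\<delta> / 2) * \<bar>of_int n\<bar>" by simp
    then have "exp (- a * (of_int n)\<^sup>2) \<le> exp (- (a / 2)) * exp (- (\<delta> / 2) * \<bar>of_int n\<bar>)"
      by (simp add: exp_add[symmetric])
    then have "\<bar>of_int n\<bar> * exp (- a * (of_int n)\<^sup>2) \<le> \<bar>of_int n\<bar> * (exp (- (a / 2)) * exp (- (\<delta> / 2) * \<bar>of_int n\<bar>))"
      by (rule mult_left_mono) simp
    then show ?thesis by (simp add: b_def mult_ac)
  qed (simp add: b_def)
  have s: "(\<lambda>n::int. \<bar>of_int n\<bar> * exp (- a * (of_int n)\<^sup>2)) summable_on UNIV" if "a \<ge> \<delta>" for a
    by (rule summable_on_comparison_test[OF summable_on_cmult_right[OF b] key[OF that]]) simp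
  show ?thesis
  proof (rule that[of "infsum b UNIV"])
    show "infsum b UNIV \<ge> 0" by (rule infsum_nonneg) (simp add: b_def)
    show "(\<Sum>\<^sub>\<infinity>n::int. \<bar>of_int n\<bar> * exp (- a * (of_int n)\<^sup>2)) \<le> infsum b UNIV * exp (- (a / 2))" if "a \<ge> \<delta>" for a
    proof -
      have "(\<Sum>\<^sub>\<infinity>n::int. \<bar>of_int n\<bar> * exp (- a * (of_int n)\<^sup>2)) \<le> (\<Sum>\<^sub>\<infinity>n. exp (- (a / 2)) * b n)"
        by (rule infsum_mono[OF s[OF that] summable_on_cmult_right[OF b] key[OF that]])
      then show ?thesis unfolding infsum_cmult_right' by (simp only: mult.commute)
    qed
    show "\<bar>of_int n\<bar> * exp (- a * (of_int n)\<^sup>2) \<le> \<bar>of_int (n::int)\<bar> ^ 1 * exp (- (\<delta> / 2) * \<bar>of_int n\<bar>)" if "a \<ge> \<delta>" for a n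
    proof -
      have "exp (- (a / 2)) * b n \<le> 1 * b n" using that assms by (intro mult_right_mono) (auto simp: b_def)
      then show ?thesis using key[OF that, of n] by (simp add: b_def)
    qed
  qed (rule s)
qed

text \<open>Theta series of weight 3/2. The linear coefficient removes n = 0, so no constant term
  has to be subtracted at either end of the Mellin integral.\<close>

definition theta1 :: "(int \<Rightarrow> complex) \<Rightarrow> real \<Rightarrow> complex" where
  "theta1 f t = (\<Sum>\<^sub>\<infinity>n. f n * of_int n * of_real (exp (- pi * t * (of_int n)\<^sup>2)))"

lemma periodic_bounded:
  fixes f :: "int \<Rightarrow> complex"
  assumes "M \<ge> 1" "\<And>n. f (n + int M) = f n"
  obtains B where "B \<ge> 0" "\<And>n. norm (f n) \<le> B"
proof (rule that[of "\<Sum>b\<in>{0..<int M}. norm (f b)"])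
  fix n
  have "f n = f (n mod int M)" by (rule periodic_cong[of f M, OF assms(2)]) (simp add: cong_def)
  moreover have "n mod int M \<in> {0..<int M}" using assms(1) by simp
  ultimately show "norm (f n) \<le> (\<Sum>b\<in>{0..<int M}. norm (f b))"
    using member_le_sum[of "n mod int M" "{0..<int M}" "\<lambda>b. norm (f b)"] by simp
qed (simp add: sum_nonneg)

lemma fhat_periodic: assumes "M \<ge> 1" shows "fhat M f (k + int M) = fhat M f k"
  unfolding fhat_def
proof (rule sum.cong[OF refl])
  fix b
  have "[(k + int M) * b = k * b] (mod int M)" by (simp add: cong_def ring_distribs)
  from ee_frac_cong[OF this assms] show "f b * ee (of_int ((k + int M) * b) / of_nat M) = f b * ee (of_int (k * b) / of_nat M)"
    by simp
qed

lemma theta1_norm_summable: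
  assumes "\<And>n. norm (f n) \<le> B" "t > 0"
  shows "(\<lambda>n. norm (f n * of_int n * of_real (exp (- pi * t * (of_int n)\<^sup>2)))) summable_on UNIV"
    and "norm (theta1 f t) \<le> B * (\<Sum>\<^sub>\<infinity>n::int. \<bar>of_int n\<bar> * exp (- (pi * t) * (of_int n)\<^sup>2))"
proof -
  obtain C where C: "\<And>a. a \<ge> pi * t \<Longrightarrow> (\<lambda>n::int. \<bar>of_int n\<bar> * exp (- a * (of_int n)\<^sup>2)) summable_on UNIV"
    using sum_abs_gauss_bound[of "pi * t"] assms(2) by (metis mult_pos_pos pi_gt_zero)
  have B: "(\<lambda>n::int. B * (\<bar>of_int n\<bar> * exp (- (pi * t) * (of_int n)\<^sup>2))) summable_on UNIV"
    by (rule summable_on_cmult_right[OF C[OF order_refl]])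
  have b: "norm (f n * of_int n * of_real (exp (- pi * t * (of_int n)\<^sup>2))) \<le> B * (\<bar>of_int n\<bar> * exp (- (pi * t) * (of_int n)\<^sup>2))" for n
    using mult_right_mono[OF assms(1)[of n], of "\<bar>of_int n\<bar> * exp (- (pi * t) * (of_int n)\<^sup>2)"] by (simp add: norm_mult mult.assoc)
  show s: "(\<lambda>n. norm (f n * of_int n * of_real (exp (- pi * t * (of_int n)\<^sup>2)))) summable_on UNIV"
    by (rule Infinite_Sum.abs_summable_on_comparison_test'[OF B b])
  have "norm (theta1 f t) \<le> (\<Sum>\<^sub>\<infinity>n. norm (f n * of_int n * of_real (exp (- pi * t * (of_int n)\<^sup>2))))"
    unfolding theta1_def by (rule norm_infsum_bound[OF s])
  also have "\<dots> \<le> (\<Sum>\<^sub>\<infinity>n::int. B * (\<bar>of_int n\<bar> * exp (- (pi * t) * (of_int n)\<^sup>2)))"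
    by (rule infsum_mono[OF s B b])
  finally show "norm (theta1 f t) \<le> B * (\<Sum>\<^sub>\<infinity>n::int. \<bar>of_int n\<bar> * exp (- (pi * t) * (of_int n)\<^sup>2))"
    by (simp add: infsum_cmult_right')
qed

text \<open>Poisson summation with offset and shift 0: the linear coefficient reproduces itself on
  the dual side, which raises the weight from 1/2 to 3/2.\<close>

lemma theta1_dual:
  assumes M: "M \<ge> 1" and per: "\<And>n. f (n + int M) = f n" and t: "t > 0"
  shows "theta1 f t = - \<i> / (of_nat M * of_nat M * of_real (t * sqrt t)) * theta1 (fhat M f) (1 / (t * of_nat M * of_nat M))"
proof -
  have "theta1 f t = (\<Sum>\<^sub>\<infinity>k::int. fhat M f k / of_nat M * ((0 - \<i> * of_real (of_int k / (of_nat M * t))) *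
       of_real (exp (- pi * (of_int k)\<^sup>2 / (t * (of_nat M)\<^sup>2)) / sqrt t) * ee (of_int k * 0 / of_nat M)))"
    unfolding theta1_def using infsumI[OF periodic_gauss_poisson[where f = f, OF t M per, of 0 0]] by (simp add: mult.assoc)
  also have "\<dots> = (\<Sum>\<^sub>\<infinity>k::int. - \<i> / (of_nat M * of_nat M * of_real (t * sqrt t)) *
      (fhat M f k * of_int k * of_real (exp (- pi * (1 / (t * of_nat M * of_nat M)) * (of_int k)\<^sup>2))))"
  proof (rule infsum_cong)
    fix k :: int
    have e: "- pi * (of_int k)\<^sup>2 / (t * (of_nat M)\<^sup>2) = - pi * (1 / (t * of_nat M * of_nat M)) * (of_int k)\<^sup>2"
      by (simp add: power2_eq_square)
    show "fhat M f k / of_nat M * ((0 - \<i> * of_real (of_int k / (of_nat M * t))) *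
       of_real (exp (- pi * (of_int k)\<^sup>2 / (t * (of_nat M)\<^sup>2)) / sqrt t) * ee (of_int k * 0 / of_nat M)) =
      - \<i> / (of_nat M * of_nat M * of_real (t * sqrt t)) * (fhat M f k * of_int k * of_real (exp (- pi * (1 / (t * of_nat M * of_nat M)) * (of_int k)\<^sup>2)))"
      unfolding e by (simp add: mult_ac)
  qed
  also have "\<dots> = - \<i> / (of_nat M * of_nat M * of_real (t * sqrt t)) * theta1 (fhat M f) (1 / (t * of_nat M * of_nat M))"
    unfolding theta1_def by (rule infsum_cmult_right')
  finally show ?thesis .
qed

lemma continuous_theta1:
  assumes "\<And>n. norm (f n) \<le> B"
  shows "continuous_on UNIV (\<lambda>x. theta1 f (exp x))"
proof (intro continuous_at_imp_continuous_on ballI)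
  fix x0 :: real
  define \<delta> where "\<delta> = pi * exp (x0 - 1)"
  have "\<delta> > 0" by (simp add: \<delta>_def)
  then obtain C where C: "\<And>a n. a \<ge> \<delta> \<Longrightarrow> \<bar>of_int n\<bar> * exp (- a * (of_int n)\<^sup>2) \<le> \<bar>of_int (n::int)\<bar> ^ 1 * exp (- (\<delta> / 2) * \<bar>of_int n\<bar>)"
    using sum_abs_gauss_bound by metis
  have "uniform_limit {x0 - 1..} (\<lambda>X x. \<Sum>n\<in>X. f n * of_int n * of_real (exp (- pi * exp x * (of_int n)\<^sup>2)))
      (\<lambda>x. theta1 f (exp x)) (finite_subsets_at_top UNIV)"
    unfolding theta1_def
  proof (rule Weierstrass_m_test_general)
    show "(\<lambda>n::int. B * (\<bar>of_int n\<bar> ^ 1 * exp (- (\<delta> / 2) * \<bar>of_int n\<bar>))) summable_on UNIV"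
      using \<open>\<delta> > 0\<close> by (intro summable_on_cmult_right summable_int_poly_exp) simp
    fix n :: int and x assume "x \<in> {x0 - 1..}"
    then have a: "\<delta> \<le> pi * exp x" by (simp add: \<delta>_def)
    have "norm (f n) * (\<bar>of_int n\<bar> * exp (- (pi * exp x) * (of_int n)\<^sup>2)) \<le> B * (\<bar>of_int n\<bar> ^ 1 * exp (- (\<delta> / 2) * \<bar>of_int n\<bar>))"
      by (rule mult_mono[OF assms[of n] C[OF a, of n]]) (use order_trans[OF norm_ge_zero assms] in auto)
    then show "norm (f n * of_int n * of_real (exp (- pi * exp x * (of_int n)\<^sup>2))) \<le> B * (\<bar>of_int n\<bar> ^ 1 * exp (- (\<delta> / 2) * \<bar>of_int n\<bar>))"
      by (simp add: norm_mult mult.assoc)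
  qed
  then have "continuous_on {x0 - 1..} (\<lambda>x. theta1 f (exp x))"
    by (rule uniform_limit_theorem[rotated]) (auto intro!: always_eventually continuous_intros)
  then show "isCont (\<lambda>x. theta1 f (exp x)) x0"
    by (rule continuous_on_interior) (simp add: interior_Ici[of "x0 - 2"])
qed

text \<open>For x nonnegative the series decays directly. For negative x the transformation formula
  passes to exp(-x), and its factor t^(-3/2) is paid for by \<open>W x ^ 2\<close>. The rate
  \<open>\<delta>\<close> = pi/M^2, the smaller of the two, serves both sides.\<close>

lemma theta1_bound:
  assumes M: "M \<ge> 1" and per: "\<And>n. f (n + int M) = f n"
  obtains C c where "c > 0" "\<And>x. norm (theta1 f (exp x)) \<le> C * (W x ^ 2 * exp (- c * W x))"
proof -
  obtain B where B: "B \<ge> 0" "\<And>n. norm (f n) \<le> B" using periodic_bounded[where f = f, OF M per] by metis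
  obtain B' where B': "B' \<ge> 0" "\<And>n. norm (fhat M f n) \<le> B'"
    using periodic_bounded[where f = "fhat M f", OF M fhat_periodic[OF M]] by metis
  define M2 where "M2 = real M * real M"
  have M2: "M2 \<ge> 1" using mult_mono[of 1 "real M" 1 "real M"] M by (simp add: M2_def)
  define \<delta> where "\<delta> = pi / M2"
  have \<delta>: "\<delta> > 0" "\<delta> \<le> pi" using M2 by (simp_all add: \<delta>_def divide_le_eq)
  obtain C where C: "C \<ge> 0"
    "\<And>a. a \<ge> \<delta> \<Longrightarrow> (\<Sum>\<^sub>\<infinity>n::int. \<bar>of_int n\<bar> * exp (- a * (of_int n)\<^sup>2)) \<le> C * exp (- (a / 2))"
    using sum_abs_gauss_bound[OF \<delta>(1)] by metis
  have "norm (theta1 f (exp x)) \<le> ((B + B') * C) * (W x ^ 2 * exp (- (\<delta> / 4) * W x))" for x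
  proof (cases "x \<ge> 0")
    case True
    then have "exp (- x) \<le> exp x" by simp
    then have w: "W x \<le> 2 * exp x" unfolding W_def by linarith
    have "\<delta> * 1 \<le> pi * exp x" using True \<delta> by (intro mult_mono) auto
    then have a: "\<delta> \<le> pi * exp x" by simp
    have "norm (theta1 f (exp x)) \<le> B * (\<Sum>\<^sub>\<infinity>n::int. \<bar>of_int n\<bar> * exp (- (pi * exp x) * (of_int n)\<^sup>2))"
      by (rule theta1_norm_summable(2)[OF B(2)]) simp
    also have "\<dots> \<le> B * (C * exp (- (pi * exp x / 2)))" by (rule mult_left_mono[OF C(2)[OF a] B(1)])
    also have "\<dots> \<le> B * (C * exp (- (\<delta> / 4) * W x))"
    proof -
      have "\<delta> / 4 * W x \<le> pi / 4 * (2 * exp x)" using w \<delta> by (intro mult_mono) auto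
      then show ?thesis using B(1) C(1) by (intro mult_left_mono) auto
    qed
    also have "\<dots> \<le> ((B + B') * C) * (W x ^ 2 * exp (- (\<delta> / 4) * W x))"
    proof -
      have "1 \<le> W x ^ 2" using W_ge_2[of x] by (intro one_le_power) simp
      then have "1 * exp (- (\<delta> / 4) * W x) \<le> W x ^ 2 * exp (- (\<delta> / 4) * W x)" by (rule mult_right_mono) simp
      then have "(B * C) * exp (- (\<delta> / 4) * W x) \<le> ((B + B') * C) * (W x ^ 2 * exp (- (\<delta> / 4) * W x))"
        using B B' C(1) by (intro mult_mono) auto
      then show ?thesis by (simp add: mult.assoc)
    qed
    finally show ?thesis .
  next
    case False
    then have "exp x \<le> exp (- x)" by simp
    then have w: "W x \<le> 2 * exp (- x)" unfolding W_def by linarith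
    define t where "t = exp x"
    have t: "t > 0" "t \<le> 1" "1 / t = exp (- x)" using False by (simp_all add: t_def exp_minus divide_inverse)
    define a where "a = pi * (1 / (t * real M * real M))"
    have a_eq: "a = \<delta> * exp (- x)" unfolding a_def t(3)[symmetric] \<delta>_def M2_def by simp
    have "\<delta> * 1 \<le> \<delta> * exp (- x)" using False \<delta> by (intro mult_left_mono) auto
    then have a: "\<delta> \<le> a" by (simp add: a_eq)
    have "norm (theta1 f t) = norm (- \<i> / (of_nat M * of_nat M * of_real (t * sqrt t)) * theta1 (fhat M f) (1 / (t * of_nat M * of_nat M)))"
      using theta1_dual[where f = f, OF M per t(1)] by simp
    also have "\<dots> = 1 / (M2 * (t * sqrt t)) * norm (theta1 (fhat M f) (1 / (t * of_nat M * of_nat M)))"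
      using t by (simp add: norm_mult norm_divide M2_def)
    also have "\<dots> \<le> 1 / (M2 * (t * sqrt t)) * (B' * (\<Sum>\<^sub>\<infinity>n::int. \<bar>of_int n\<bar> * exp (- a * (of_int n)\<^sup>2)))"
      using t M2 M unfolding a_def by (intro mult_left_mono theta1_norm_summable(2)[OF B'(2)]) auto
    also have "\<dots> \<le> 1 / (M2 * (t * sqrt t)) * (B' * (C * exp (- (a / 2))))"
      using t M2 by (intro mult_left_mono C(2)[OF a] B'(1)) auto
    also have "\<dots> \<le> W x ^ 2 * ((B + B') * (C * exp (- (\<delta> / 4) * W x)))"
    proof (rule mult_mono)
      have "t * t \<le> M2 * (t * sqrt t)"
      proof -
        have "t \<le> sqrt t" using t real_le_rsqrt[of t t] by (simp add: power2_eq_square mult_left_le)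
        then have "1 * (t * t) \<le> M2 * (t * sqrt t)" using t M2 by (intro mult_mono mult_left_mono) auto
        then show ?thesis by simp
      qed
      then have "1 / (M2 * (t * sqrt t)) \<le> 1 / (t * t)" using t M2 by (intro divide_left_mono mult_pos_pos) auto
      also have "\<dots> = exp (- x) * exp (- x)" unfolding t(3)[symmetric] by simp
      also have "\<dots> \<le> W x * W x" using W_ge_exp(2)[of x] by (intro mult_mono) auto
      finally show "1 / (M2 * (t * sqrt t)) \<le> W x ^ 2" by (simp add: power2_eq_square)
      have "\<delta> / 4 * W x \<le> \<delta> / 4 * (2 * exp (- x))" using w \<delta> by (intro mult_left_mono) auto
      then have "exp (- (a / 2)) \<le> exp (- (\<delta> / 4) * W x)" by (simp add: a_eq)
      then show "B' * (C * exp (- (a / 2))) \<le> (B + B') * (C * exp (- (\<delta> / 4) * W x))"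
        using B B' C(1) by (intro mult_mono mult_left_mono) auto
    qed (use B' C(1) in auto)
    finally show ?thesis by (simp add: t_def mult_ac)
  qed
  moreover have "\<delta> / 4 > 0" using \<delta>(1) by simp
  ultimately show ?thesis by (rule that[rotated])
qed

lemma theta1_moment_integrable:
  assumes M: "M \<ge> 1" and per: "\<And>n. f (n + int M) = f n"
  shows "integrable lborel (\<lambda>x. theta1 f (exp x) * of_real x ^ j * exp (u * of_real x))"
proof -
  obtain C c where C: "c > 0" "\<And>x. norm (theta1 f (exp x)) \<le> C * (W x ^ 2 * exp (- c * W x))"
    using theta1_bound[where f = f, OF M per] by metis
  obtain B where B: "\<And>n. norm (f n) \<le> B" using periodic_bounded[where f = f, OF M per] by metis
  define k where "k = nat \<lceil>\<bar>Re u\<bar>\<rceil>"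
  show ?thesis
  proof (rule integrable_W_bound[OF _ C(1)])
    show "continuous_on UNIV (\<lambda>x. theta1 f (exp x) * of_real x ^ j * exp (u * of_real x))"
      by (intro continuous_intros continuous_theta1[OF B])
    fix x
    have "norm (theta1 f (exp x) * of_real x ^ j * exp (u * of_real x)) = norm (theta1 f (exp x)) * \<bar>x\<bar> ^ j * exp (Re u * x)"
      by (simp add: norm_mult norm_power norm_exp_eq_Re)
    also have "\<dots> \<le> C * (W x ^ 2 * exp (- c * W x)) * W x ^ j * W x ^ k"
      using C(2)[of x] order_trans[OF norm_ge_zero C(2)[of x]] W_ge_abs[of x] exp_mult_le_W[of "Re u" x]
      by (intro mult_mono power_mono) (auto simp: k_def)
    also have "\<dots> = C * (W x ^ (2 + j + k) * exp (- c * W x))" unfolding power_add by (simp only: mult_ac)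
    finally show "norm (theta1 f (exp x) * of_real x ^ j * exp (u * of_real x)) \<le> C * (W x ^ (2 + j + k) * exp (- c * W x))" .
  qed
qed

text \<open>For odd periodic f this is the completed L-function 2 pi^(-u) Gamma(u) L(2u-1, f), given
  by an integral that converges for all complex u; \<open>Lam'\<close> is its derivative.\<close>

definition Lam :: "(int \<Rightarrow> complex) \<Rightarrow> complex \<Rightarrow> complex" where
  "Lam f u = integral\<^sup>L lborel (\<lambda>x. theta1 f (exp x) * exp (u * of_real x))"

definition Lam' :: "(int \<Rightarrow> complex) \<Rightarrow> complex \<Rightarrow> complex" where
  "Lam' f u = integral\<^sup>L lborel (\<lambda>x. theta1 f (exp x) * of_real x * exp (u * of_real x))"

lemma Lam_has_field_derivative:
  assumes M: "M \<ge> 1" and per: "\<And>n. f (n + int M) = f n"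
  shows "(Lam f has_field_derivative Lam' f u) (at u)"
proof -
  obtain C c where C: "c > 0" "\<And>x. norm (theta1 f (exp x)) \<le> C * (W x ^ 2 * exp (- c * W x))"
    using theta1_bound[where f = f, OF M per] by metis
  \<comment> \<open>The extra 1 accounts for the ball of radius 1 in which the parameter
    moves.\<close>
  define k where "k = nat \<lceil>\<bar>Re u\<bar> + 1\<rceil>"
  have C0: "C * (W x ^ 2 * exp (- c * W x)) \<ge> 0" for x using order_trans[OF norm_ge_zero C(2)] .
  show ?thesis unfolding Lam_def[abs_def] Lam'_def
  proof (rule has_field_derivative_integral_param[where r = 1 and g = "\<lambda>x. C * (W x ^ (2 + 1 + k) * exp (- c * W x))"])
  show "integrable lborel (\<lambda>x. C * (W x ^ (2 + 1 + k) * exp (- c * W x)))"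
    by (intro integrable_mult_right integrable_W C)
  fix s x assume s: "s \<in> ball u 1"
  show "((\<lambda>s. theta1 f (exp x) * exp (s * of_real x)) has_field_derivative theta1 f (exp x) * of_real x * exp (s * of_real x)) (at s)"
    by (auto intro!: derivative_eq_intros)
  have "\<bar>Re s\<bar> \<le> \<bar>Re u\<bar> + 1" using s abs_Re_le_cmod[of "u - s"] by (simp add: dist_norm)
  then have "nat \<lceil>\<bar>Re s\<bar>\<rceil> \<le> k" unfolding k_def by (intro nat_mono ceiling_mono)
  then have "W x ^ nat \<lceil>\<bar>Re s\<bar>\<rceil> \<le> W x ^ k" using W_ge_2[of x] by (intro power_increasing) auto
  then have e: "exp (Re s * x) \<le> W x ^ k" using exp_mult_le_W[of "Re s" x] by linarith
  have "norm (theta1 f (exp x) * of_real x * exp (s * of_real x)) = norm (theta1 f (exp x)) * \<bar>x\<bar> * exp (Re s * x)"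
    by (simp add: norm_mult norm_exp_eq_Re)
  also have "\<dots> \<le> C * (W x ^ 2 * exp (- c * W x)) * W x * W x ^ k"
    using C(2)[of x] C0[of x] W_ge_abs[of x] e by (intro mult_mono) auto
  also have "\<dots> = C * (W x ^ (2 + 1 + k) * exp (- c * W x))" unfolding power_add by (simp only: mult_ac power_one_right)
  finally show "norm (theta1 f (exp x) * of_real x * exp (s * of_real x)) \<le> C * (W x ^ (2 + 1 + k) * exp (- c * W x))" .
  show "integrable lborel (\<lambda>x. theta1 f (exp x) * exp (s * of_real x))"
    using theta1_moment_integrable[where f = f and j = 0, OF M per] by simp
next
  show "(\<lambda>x. theta1 f (exp x) * of_real x * exp (u * of_real x)) \<in> borel_measurable lborel"
    using theta1_moment_integrable[where f = f and j = 1 and u = u, OF M per] by simp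
qed simp
qed

text \<open>Termwise Gamma integrals. The absolute integrals are bounded by a multiple of |n|^(1 - 2
  Re u), which is summable exactly for Re u > 1.\<close>

lemma Lam_series:
  assumes M: "M \<ge> 1" and per: "\<And>n. f (n + int M) = f n" and u: "Re u > 1"
  shows "((\<lambda>n. f n * of_int n * (Gamma u * exp (- u * of_real (ln (pi * (of_int n)\<^sup>2))))) has_sum Lam f u) (UNIV - {0})"
proof -
  obtain B where B: "B \<ge> 0" "\<And>n. norm (f n) \<le> B" using periodic_bounded[where f = f, OF M per] by metis
  define T where "T n x = f n * of_int n * (exp (u * of_real x) * of_real (exp (- (pi * (of_int n)\<^sup>2) * exp x)))" for n :: int and x :: real
  define \<sigma> where "\<sigma> = Re u"
  have inf: "infinite (UNIV - {0 :: int})" using infinite_UNIV_int by simp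
  have bij: "bij_betw (from_nat_into (UNIV - {0 :: int})) UNIV (UNIV - {0})"
    by (rule bij_betw_from_nat_into) (use inf in auto)
  have pos: "pi * (of_int n)\<^sup>2 > (0 :: real)" if "n \<in> UNIV - {0}" for n :: int using that by simp
  have K: "has_bochner_integral lborel (T n) (f n * of_int n * (Gamma u * exp (- u * of_real (ln (pi * (of_int n)\<^sup>2)))))" if "n \<in> UNIV - {0}" for n
    unfolding T_def by (intro has_bochner_integral_mult_right has_bochner_integral_exp_exp pos[OF that]) (use u in auto)
  have pt0: "norm (T n x) = exp (Re u * x) * norm (f n * of_int n * of_real (exp (- pi * exp x * (of_int n)\<^sup>2)))" for n x
    by (simp add: T_def norm_mult norm_exp_eq_Re mult_ac)
  have pt: "(\<lambda>n. norm (T n x)) summable_on UNIV" for x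
    unfolding pt0 by (intro summable_on_cmult_right theta1_norm_summable(1)[OF B(2)]) simp
  have nT: "integral\<^sup>L lborel (\<lambda>x. norm (T n x)) \<le> (B * norm (Gamma (of_real \<sigma> :: complex)) * exp (- \<sigma> * ln pi)) * real (nat \<bar>n\<bar>) powr (1 - 2 * \<sigma>)"
    if n: "n \<in> UNIV - {0}" for n
  proof -
    have e: "norm (T n x) = norm (f n * of_int n) * norm (exp (of_real \<sigma> * of_real x) * complex_of_real (exp (- (pi * (of_int n)\<^sup>2) * exp x)))" for x
      by (simp add: T_def norm_mult norm_exp_eq_Re \<sigma>_def)
    define k where "k x = exp (\<sigma> * x) * exp (- (pi * (of_int n)\<^sup>2) * exp x)" for x
    have kk: "exp (of_real \<sigma> * of_real x) * complex_of_real (exp (- (pi * (of_int n)\<^sup>2) * exp x)) = of_real (k x)" for x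
      by (simp add: k_def exp_of_real[symmetric])
    have "has_bochner_integral lborel (\<lambda>x. complex_of_real (k x)) (Gamma (of_real \<sigma>) * exp (- of_real \<sigma> * of_real (ln (pi * (of_int n)\<^sup>2))))"
      unfolding kk[symmetric] by (rule has_bochner_integral_exp_exp[OF _ pos[OF n]]) (use u in \<open>simp add: \<sigma>_def\<close>)
    then have "complex_of_real (integral\<^sup>L lborel k) = Gamma (of_real \<sigma>) * exp (- of_real \<sigma> * of_real (ln (pi * (of_int n)\<^sup>2)))"
      by (simp add: has_bochner_integral_iff)
    then have "\<bar>integral\<^sup>L lborel k\<bar> = norm (Gamma (of_real \<sigma> :: complex)) * exp (- \<sigma> * ln (pi * (of_int n)\<^sup>2))"
      by (metis (no_types, lifting) norm_of_real norm_mult norm_exp_eq_Re Re_complex_of_real of_real_minus of_real_mult)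
    also have "ln (pi * (of_int n)\<^sup>2) = ln pi + 2 * ln (real (nat \<bar>n\<bar>))"
    proof -
      have l: "ln (pi * r ^ 2) = ln pi + 2 * ln r" if "r > 0" for r :: real using that by (simp add: ln_mult ln_realpow)
      have "(of_int n)\<^sup>2 = (real (nat \<bar>n\<bar>))\<^sup>2" by simp
      moreover have "real (nat \<bar>n\<bar>) > 0" using n by simp
      ultimately show ?thesis using l by metis
    qed
    finally have k: "\<bar>integral\<^sup>L lborel k\<bar> = norm (Gamma (of_real \<sigma> :: complex)) * exp (- \<sigma> * ln pi) * exp (- 2 * \<sigma> * ln (real (nat \<bar>n\<bar>)))"
      by (simp add: exp_add[symmetric] algebra_simps)
    have "integral\<^sup>L lborel (\<lambda>x. norm (T n x)) = norm (f n * of_int n) * integral\<^sup>L lborel k"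
    proof -
      have nk: "norm (complex_of_real (k x)) = k x" for x by (simp add: k_def norm_mult)
      show ?thesis unfolding e kk nk by simp
    qed
    also have "\<dots> \<le> norm (f n) * real (nat \<bar>n\<bar>) * \<bar>integral\<^sup>L lborel k\<bar>"
      by (simp add: norm_mult mult_left_mono)
    also have "\<dots> \<le> B * real (nat \<bar>n\<bar>) * \<bar>integral\<^sup>L lborel k\<bar>" using B by (intro mult_right_mono) auto
    also have "\<dots> = (B * norm (Gamma (of_real \<sigma> :: complex)) * exp (- \<sigma> * ln pi)) * (real (nat \<bar>n\<bar>) * exp (- 2 * \<sigma> * ln (real (nat \<bar>n\<bar>))))"
      unfolding k by (simp add: mult_ac)
    also have "real (nat \<bar>n\<bar>) * exp (- 2 * \<sigma> * ln (real (nat \<bar>n\<bar>))) = real (nat \<bar>n\<bar>) powr (1 - 2 * \<sigma>)"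
    proof -
      have "real (nat \<bar>n\<bar>) > 0" using n by simp
      then show ?thesis using exp_ln[of "real (nat \<bar>n\<bar>)"]
        by (simp only: powr_def) (simp add: left_diff_distrib exp_diff exp_minus divide_inverse)
    qed
    finally show ?thesis .
  qed
  have s: "(\<lambda>n. integral\<^sup>L lborel (\<lambda>x. norm (T n x))) summable_on (UNIV - {0})"
  proof (rule summable_on_comparison_test[OF _ nT])
    have "summable (\<lambda>n. real n powr (1 - 2 * \<sigma>))" using u by (subst summable_real_powr_iff) (simp add: \<sigma>_def)
    then have "(\<lambda>n::int. real (nat \<bar>n\<bar>) powr (1 - 2 * \<sigma>)) summable_on UNIV" by (rule summable_on_int_abs) simp
    then have "(\<lambda>n::int. real (nat \<bar>n\<bar>) powr (1 - 2 * \<sigma>)) summable_on (UNIV - {0})" by (rule summable_on_subset_banach) simp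
    then show "(\<lambda>n. (B * norm (Gamma (of_real \<sigma> :: complex)) * exp (- \<sigma> * ln pi)) * real (nat \<bar>n\<bar>) powr (1 - 2 * \<sigma>)) summable_on (UNIV - {0})"
      by (rule summable_on_cmult_right)
  qed simp_all
  have pt1: "(\<lambda>n. norm (T n x)) summable_on (UNIV - {0})" for x
    by (rule summable_on_subset_banach[OF pt]) simp
  have int: "integrable lborel (T n)" if "n \<in> UNIV - {0}" for n using K[OF that] by (simp add: has_bochner_integral_iff)
  have "((\<lambda>n. integral\<^sup>L lborel (T n)) has_sum integral\<^sup>L lborel (\<lambda>x. \<Sum>\<^sub>\<infinity>n\<in>UNIV - {0}. T n x)) (UNIV - {0})"
    by (rule has_sum_lborel_integral(1)[OF bij int pt1 s])
  moreover have "(\<Sum>\<^sub>\<infinity>n\<in>UNIV - {0}. T n x) = theta1 f (exp x) * exp (u * of_real x)" for x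
  proof -
    have "(\<Sum>\<^sub>\<infinity>n\<in>UNIV - {0}. T n x) = (\<Sum>\<^sub>\<infinity>n. T n x)" by (rule infsum_cong_neutral) (auto simp: T_def)
    also have "\<dots> = (\<Sum>\<^sub>\<infinity>n. f n * of_int n * of_real (exp (- pi * exp x * (of_int n)\<^sup>2)) * exp (u * of_real x))"
      by (rule infsum_cong) (simp add: T_def mult_ac)
    also have "\<dots> = theta1 f (exp x) * exp (u * of_real x)" unfolding theta1_def by (rule infsum_cmult_left')
    finally show ?thesis .
  qed
  ultimately have "((\<lambda>n. integral\<^sup>L lborel (T n)) has_sum Lam f u) (UNIV - {0})" by (simp add: Lam_def)
  then show ?thesis using K by (subst (asm) has_sum_cong) (auto simp: has_bochner_integral_iff)
qed

text \<open>The identity theorem gives equality off a sparse set. The limit at an exceptional point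
  then excludes a pole, and niceness excludes a deviating value at a removable singularity.\<close>

lemma nicely_meromorphic_eq_entire:
  assumes f: "f nicely_meromorphic_on UNIV" and g: "g holomorphic_on UNIV" and eq: "\<And>s. Re s > 1 \<Longrightarrow> f s = g s"
  shows "f = g"
proof -
  have ga: "g analytic_on UNIV" using g by (simp add: analytic_on_open)
  have fm: "f meromorphic_on UNIV" using f by (simp add: nicely_meromorphic_on_def)
  have hm: "(\<lambda>z. f z - g z) meromorphic_on UNIV"
    by (intro meromorphic_intros fm analytic_on_imp_meromorphic_on ga)
  have ev: "\<forall>\<^sub>\<approx>x\<in>UNIV. f x - g x = 0"
  proof (rule ccontr)
    \<comment> \<open>The alternative for a meromorphic function that is not identically 0 is to
      avoid 0 off a sparse set, impossible near 2 where f and g agree.\<close>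
    assume "\<not> ?thesis"
    then have "\<forall>\<^sub>\<approx>x\<in>UNIV. f x - g x \<noteq> 0"
      using meromorphic_imp_constant_or_avoid[OF hm open_UNIV connected_UNIV, of 0] by blast
    then have "\<forall>\<^sub>F x in at (2 :: complex). f x - g x \<noteq> 0" by (simp add: eventually_cosparse_open_eq)
    moreover have "\<forall>\<^sub>F x in at (2 :: complex). x \<in> {x. Re x > 1}"
      by (rule eventually_at_in_open') (auto simp: open_halfspace_Re_gt)
    ultimately have "\<forall>\<^sub>F x in at (2 :: complex). False" by eventually_elim (use eq in auto)
    then show False by simp
  qed
  show ?thesis
  proof
    fix x
    have e: "\<forall>\<^sub>F z in at x. f z = g z" using ev by (simp add: eventually_cosparse_open_eq)
    have gx: "g \<midarrow>x\<rightarrow> g x" using ga by (intro isContD analytic_at_imp_isCont) (auto intro: analytic_on_subset)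
    then have fx: "f \<midarrow>x\<rightarrow> g x" by (subst tendsto_cong[OF e])
    then have "\<not> is_pole f x" using not_tendsto_and_filterlim_at_infinity[OF _ fx] by (auto simp: is_pole_def)
    then have "f analytic_on {x}" using nicely_meromorphic_on_imp_analytic_at[OF f] by simp
    then have "f \<midarrow>x\<rightarrow> f x" by (intro isContD analytic_at_imp_isCont)
    then show "f x = g x" using fx LIM_unique by blast
  qed
qed

text \<open>Undoes the gamma factor of odd characters, with s = 2u - 1. The reciprocal Gamma
  function is entire, so the formula needs no exceptional points.\<close>

definition oddL :: "(int \<Rightarrow> complex) \<Rightarrow> complex \<Rightarrow> complex" where
  "oddL f s = exp ((s + 1) / 2 * of_real (ln pi)) * rGamma ((s + 1) / 2) * Lam f ((s + 1) / 2) / 2"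

lemma oddL_has_field_derivative:
  assumes M: "M \<ge> 1" and per: "\<And>n. f (n + int M) = f n" and u: "(s + 1) / 2 \<notin> \<int>\<^sub>\<le>\<^sub>0"
  shows "(oddL f has_field_derivative
     exp ((s + 1) / 2 * of_real (ln pi)) * rGamma ((s + 1) / 2) *
      (Lam' f ((s + 1) / 2) + (of_real (ln pi) - Digamma ((s + 1) / 2)) * Lam f ((s + 1) / 2)) / 4) (at s)"
proof -
  have L: "((\<lambda>s. Lam f ((s + 1) / 2)) has_field_derivative Lam' f ((s + 1) / 2) * (1 / 2)) (at s)"
    by (rule DERIV_chain2[where f = "Lam f" and g = "\<lambda>s. (s + 1) / 2", OF Lam_has_field_derivative[where f = f, OF M per]]) (auto intro!: derivative_eq_intros)
  have G: "((\<lambda>s. rGamma ((s + 1) / 2)) has_field_derivative - rGamma ((s + 1) / 2) * Digamma ((s + 1) / 2) * (1 / 2)) (at s)"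
    by (rule DERIV_chain2[where f = rGamma and g = "\<lambda>s. (s + 1) / 2", OF has_field_derivative_rGamma_no_nonpos_int[OF u]]) (auto intro!: derivative_eq_intros)
  have E: "((\<lambda>s. exp ((s + 1) / 2 * complex_of_real (ln pi))) has_field_derivative exp ((s + 1) / 2 * of_real (ln pi)) * (1 / 2 * of_real (ln pi))) (at s)"
    by (auto intro!: derivative_eq_intros)
  from DERIV_cdivide[OF DERIV_mult[OF DERIV_mult[OF E G] L], of 2]
  show ?thesis unfolding oddL_def[abs_def] by (rule DERIV_cong) (simp add: field_simps)
qed

lemma oddL_holomorphic:
  assumes M: "M \<ge> 1" and per: "\<And>n. f (n + int M) = f n"
  shows "oddL f holomorphic_on UNIV"
proof -
  have "Lam f holomorphic_on UNIV"
    using Lam_has_field_derivative[where f = f, OF M per] by (auto simp: holomorphic_on_open)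
  then have L: "(\<lambda>s. Lam f ((s + 1) / 2)) holomorphic_on UNIV"
    by (intro holomorphic_on_compose_gen[of "\<lambda>s. (s + 1) / 2" UNIV "Lam f" UNIV, unfolded o_def] holomorphic_intros) auto
  show ?thesis unfolding oddL_def by (intro holomorphic_intros L) auto
qed

text \<open>For odd f the product f(n)n is even, so n and -n contribute equally to
  \<open>Lam\<close>, and half of it is the sum over positive n.\<close>

lemma oddL_sums:
  assumes M: "M \<ge> 1" and per: "\<And>n. f (n + int M) = f n" and odd: "\<And>n. f (- n) = - f n" and s: "Re s > 1"
  shows "(\<lambda>n. f (int (Suc n)) * of_nat (Suc n) powr (- s)) sums oddL f s"
proof -
  define u where "u = (s + 1) / 2"
  have u: "Re u > 1" using s by (simp add: u_def)
  define g where "g n = f n * of_int n * (Gamma u * exp (- u * of_real (ln (pi * (of_int n)\<^sup>2))))" for n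
  have g: "(g has_sum Lam f u) (UNIV - {0})" unfolding g_def by (rule Lam_series[where f = f, OF M per u])
  have ge: "g (- n) = g n" for n by (simp add: g_def odd)
  define P where "P = {n :: int. n > 0}" define Q where "Q = {n :: int. n < 0}"
  have "g summable_on P" by (rule summable_on_subset_banach[of g "UNIV - {0}"]) (use g in \<open>auto simp: has_sum_iff P_def\<close>)
  then have gP: "(g has_sum infsum g P) P" by simp
  have gQ: "(g has_sum infsum g P) Q"
    using gP by (rule has_sum_reindex_bij_witness[of Q uminus uminus P g g, THEN iffD2, rotated -1]) (auto simp: P_def Q_def ge)
  have "(g has_sum (infsum g P + infsum g P)) (P \<union> Q)" by (rule has_sum_Un_disjoint[OF gP gQ]) (auto simp: P_def Q_def)
  moreover have "P \<union> Q = UNIV - {0}" by (auto simp: P_def Q_def)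
  ultimately have "Lam f u = infsum g P + infsum g P" using g has_sum_unique by metis
  then have gP2: "(g has_sum (Lam f u / 2)) P" using gP by (simp add: field_simps)
  have "((\<lambda>n. g (int (Suc n))) has_sum (Lam f u / 2)) UNIV"
    using gP2 by (rule has_sum_reindex_bij_witness[of UNIV "\<lambda>n. nat n - 1" "\<lambda>n. int (Suc n)" P, THEN iffD2, rotated -1]) (auto simp: P_def)
  then have "(\<lambda>n. g (int (Suc n))) sums (Lam f u / 2)" by (rule has_sum_imp_sums)
  then have sm: "(\<lambda>n. exp (u * of_real (ln pi)) * rGamma u * g (int (Suc n))) sums (exp (u * of_real (ln pi)) * rGamma u * (Lam f u / 2))"
    by (rule sums_mult)
  have "u \<notin> \<int>\<^sub>\<le>\<^sub>0" using u by (auto simp: nonpos_Ints_def)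
  then have G: "rGamma u * Gamma u = 1" by (simp add: rGamma_inverse_Gamma Gamma_eq_zero_iff)
  have "exp (u * of_real (ln pi)) * rGamma u * g (int (Suc n)) = f (int (Suc n)) * of_nat (Suc n) powr (- s)" for n
  proof -
    define m where "m = real (Suc n)"
    have m: "m > 0" by (simp add: m_def)
    have "ln (pi * (of_int (int (Suc n)))\<^sup>2) = ln pi + 2 * ln m"
      using m by (simp add: ln_mult power2_eq_square m_def)
    then have e1: "exp (- u * of_real (ln (pi * (of_int (int (Suc n)))\<^sup>2))) = exp (- u * of_real (ln pi)) * exp (- 2 * u * of_real (ln m))"
      by (simp add: exp_add[symmetric] algebra_simps)
    have "of_nat (Suc n) powr (- s) = exp (- s * complex_of_real (ln m))"
      using m by (simp add: powr_def m_def Ln_of_nat del: of_nat_Suc)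
    also have "\<dots> = exp ((1 - 2 * u) * complex_of_real (ln m))" by (simp add: u_def add_divide_distrib)
    also have "\<dots> = of_real m * exp (- 2 * u * of_real (ln m))"
      using m by (simp add: left_diff_distrib exp_diff exp_minus divide_inverse exp_of_real)
    finally have e2: "of_nat (Suc n) powr (- s) = complex_of_real m * exp (- 2 * u * of_real (ln m))" .
    have "exp (u * of_real (ln pi)) * rGamma u * g (int (Suc n)) =
       (rGamma u * Gamma u) * (exp (u * of_real (ln pi)) * exp (- u * of_real (ln pi))) * (f (int (Suc n)) * (of_real m * exp (- 2 * u * of_real (ln m))))"
      unfolding g_def e1 by (simp add: m_def mult_ac)
    also have "\<dots> = f (int (Suc n)) * (of_real m * exp (- 2 * u * of_real (ln m)))"
      by (simp add: G exp_minus)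
    finally show ?thesis unfolding e2 .
  qed
  then show ?thesis using sm by (simp add: oddL_def u_def[symmetric])
qed

lemma dirichlet_L_odd:
  assumes M: "M \<ge> 1" and per: "\<And>n. f (n + int M) = f n" and odd: "\<And>n. f (- n) = - f n"
  shows "dirichlet_L f = oddL f"
  unfolding dirichlet_L_def
proof (rule the_equality)
  note hol = oddL_holomorphic[where f = f, OF M per]
  note sums = oddL_sums[where f = f, OF M per odd]
  show "oddL f nicely_meromorphic_on UNIV \<and> (\<forall>s. Re s > 1 \<longrightarrow> (\<lambda>n. f (int (Suc n)) * of_nat (Suc n) powr (- s)) sums oddL f s)"
    using sums hol by (auto intro!: analytic_on_imp_nicely_meromorphic_on simp: analytic_on_open)
  fix h assume h: "h nicely_meromorphic_on UNIV \<and> (\<forall>s. Re s > 1 \<longrightarrow> (\<lambda>n. f (int (Suc n)) * of_nat (Suc n) powr (- s)) sums h s)"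
  show "h = oddL f"
    by (rule nicely_meromorphic_eq_entire[OF _ hol]) (use h sums sums_unique2 in blast)+
qed

lemma exp_half_ln: "x > 0 \<Longrightarrow> exp (1 / 2 * complex_of_real (ln x)) = of_real (sqrt x)"
  by (simp add: powr_half_sqrt[symmetric] powr_def exp_of_real[symmetric])

text \<open>s = 1 and s = 0 correspond to u = 1 and u = 1/2. The constants come from the logarithmic
  derivative of the gamma factor, with Digamma(1) = -gamma and Digamma(1/2) = -gamma - 2 log 2; the
  latter is the source of log 2 in the constant term of the mock modular form.\<close>

lemma odd_L_values:
  assumes M: "M \<ge> 1" and per: "\<And>n. f (n + int M) = f n" and odd: "\<And>n. f (- n) = - f n"
  shows "dirichlet_L f 1 = of_real pi / 2 * Lam f 1"
    and "dirichlet_L f 0 = Lam f (1 / 2) / 2"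
    and "deriv (dirichlet_L f) 1 = of_real pi / 4 * (Lam' f 1 + of_real (ln pi + euler_mascheroni) * Lam f 1)"
    and "deriv (dirichlet_L f) 0 = (Lam' f (1 / 2) + of_real (ln pi + euler_mascheroni + 2 * ln 2) * Lam f (1 / 2)) / 4"
proof -
  have L: "dirichlet_L f = oddL f" by (rule dirichlet_L_odd[OF M per odd])
  have e1: "exp (complex_of_real (ln pi)) = of_real pi" by (simp add: exp_of_real)
  have "(1 / 2 :: complex) \<notin> \<int>\<^sub>\<le>\<^sub>0"
  proof
    assume "(1 / 2 :: complex) \<in> \<int>\<^sub>\<le>\<^sub>0"
    then obtain n where "(1 / 2 :: complex) = of_int n" "n \<le> 0" by (auto elim!: nonpos_Ints_cases)
    then have "(1 / 2 :: real) = of_int n" by (metis Re_complex_of_real of_real_1 of_real_divide of_real_numeral of_real_of_int_eq)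
    then show False using \<open>n \<le> 0\<close> by linarith
  qed
  have "Gamma (1 / 2 :: complex) = of_real (sqrt pi)" by (rule Gamma_one_half_complex)
  then have e2: "complex_of_real (sqrt pi) * rGamma (1 / 2) = 1" by (simp add: rGamma_inverse_Gamma)
  have e3: "exp (1 / 2 * complex_of_real (ln pi)) = of_real (sqrt pi)" by (rule exp_half_ln) simp
  show "dirichlet_L f 1 = of_real pi / 2 * Lam f 1" unfolding L oddL_def using e1 by simp
  show "dirichlet_L f 0 = Lam f (1 / 2) / 2" unfolding L oddL_def using e2 e3 by simp
  have "((1 :: complex) + 1) / 2 \<notin> \<int>\<^sub>\<le>\<^sub>0" by simp
  from DERIV_imp_deriv[OF oddL_has_field_derivative[where f = f, OF M per this]]
  show "deriv (dirichlet_L f) 1 = of_real pi / 4 * (Lam' f 1 + of_real (ln pi + euler_mascheroni) * Lam f 1)"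
    unfolding L using e1 by simp
  have "((0 :: complex) + 1) / 2 \<notin> \<int>\<^sub>\<le>\<^sub>0" using \<open>(1 / 2 :: complex) \<notin> \<int>\<^sub>\<le>\<^sub>0\<close> by simp
  note d0 = DERIV_imp_deriv[OF oddL_has_field_derivative[where f = f, OF M per this]]
  have z: "((0 :: complex) + 1) / 2 = 1 / 2" by simp
  show "deriv (dirichlet_L f) 0 = (Lam' f (1 / 2) + of_real (ln pi + euler_mascheroni + 2 * ln 2) * Lam f (1 / 2)) / 4"
    unfolding L d0 z e3 e2 Digamma_one_half by (simp add: algebra_simps)
qed

section \<open>Fourier coefficients of the Gaussian kernel\<close>

text \<open>The (m, k) term after Poisson summation in n, with \<open>\<xi>\<close> = k/M, in the
  logarithmic Mellin variable and stripped of constants and phases.\<close>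

definition kerB :: "real \<Rightarrow> real \<Rightarrow> real \<Rightarrow> real \<Rightarrow> real" where
  "kerB m \<xi> y x = (m * exp (x / 2) + \<xi> * exp (- x / 2)) * exp (- pi * y * (m\<^sup>2 * exp x + \<xi>\<^sup>2 * exp (- x)))"

lemma has_bochner_integral_reflect:
  fixes f :: "real \<Rightarrow> complex"
  shows "has_bochner_integral lborel f I \<Longrightarrow> has_bochner_integral lborel (\<lambda>x. f (- x)) I"
  using lborel_has_bochner_integral_real_affine_iff[of "-1" f I 0] by simp

lemma has_bochner_integral_shift_iff:
  fixes f :: "real \<Rightarrow> complex"
  shows "has_bochner_integral lborel (\<lambda>x. f (x + a)) I \<longleftrightarrow> has_bochner_integral lborel f I"
  using lborel_has_bochner_integral_real_affine_iff[of 1 f I a] by (simp add: add.commute)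

text \<open>Translating x by log(|\<xi>|/|m|) balances the two exponentials and leaves the kernel
  with exp(x/2) and its reflection, weighted by the signs of m and \<xi>. Reflection preserves the
  plain integral and negates the logarithmic moment, whence sgn m + sgn \<xi> and sgn m - sgn \<xi>:
  the exponential integral survives only for opposite signs.\<close>

lemma kerB_integrals:
  fixes m \<xi> y :: real
  assumes m: "m \<noteq> 0" and \<xi>: "\<xi> \<noteq> 0" and y: "y > 0"
  shows "has_bochner_integral lborel (\<lambda>x. complex_of_real (kerB m \<xi> y x))
      (of_real ((sgn m + sgn \<xi>) * exp (- 2 * pi * y * \<bar>m * \<xi>\<bar>) / sqrt y))"
    and "has_bochner_integral lborel (\<lambda>x. of_real x * complex_of_real (kerB m \<xi> y x))
      (of_real (((sgn m + sgn \<xi>) * ln (\<bar>\<xi>\<bar> / \<bar>m\<bar>) * exp (- 2 * pi * y * \<bar>m * \<xi>\<bar>) +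
         (sgn m - sgn \<xi>) * exp (2 * pi * y * \<bar>m * \<xi>\<bar>) * e1int (y * \<bar>m * \<xi>\<bar>)) / sqrt y))"
proof -
  define p where "p = sqrt \<bar>m\<bar>"
  define q where "q = sqrt \<bar>\<xi>\<bar>"
  have pq: "p > 0" "q > 0" using m \<xi> by (simp_all add: p_def q_def)
  have p2: "m = sgn m * (p * p)" "\<xi> = sgn \<xi> * (q * q)" by (simp_all add: p_def q_def sgn_mult_abs)
  have m2: "m\<^sup>2 = (p * p)\<^sup>2" "\<xi>\<^sup>2 = (q * q)\<^sup>2" by (simp_all add: p_def q_def)
  define a where "a = ln (\<bar>\<xi>\<bar> / \<bar>m\<bar>)"
  have mq: "\<bar>m * \<xi>\<bar> = (p * q) * (p * q)" by (simp add: p_def q_def abs_mult mult_ac real_sqrt_mult[symmetric])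
  have ea: "exp a = (q / p) * (q / p)" using m \<xi> by (simp add: a_def p_def q_def)
  have ea2: "exp (a / 2) = q / p"
  proof -
    have "exp (a / 2) * exp (a / 2) = (q / p) * (q / p)" unfolding ea[symmetric] by (simp add: exp_add[symmetric])
    then have "(exp (a / 2))\<^sup>2 = (q / p)\<^sup>2" by (simp only: power2_eq_square)
    then show ?thesis by (rule power2_eq_imp_eq) (use pq in auto)
  qed
  define v where "v = y * \<bar>m * \<xi>\<bar>"
  have v: "v > 0" using m \<xi> y by (simp add: v_def)
  have sv: "sqrt v = sqrt y * (p * q)" using pq by (simp add: v_def mq real_sqrt_mult)
  define k where "k x = exp (x / 2) * exp (- pi * v * W x)" for x
  have shift: "kerB m \<xi> y (x + a) = (p * q) * (sgn m * k x + sgn \<xi> * k (- x))" for x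
  proof -
    have e1: "m * exp ((x + a) / 2) = (p * q) * sgn m * exp (x / 2)"
    proof -
      have "m * exp ((x + a) / 2) = (sgn m * (p * p)) * (exp (x / 2) * (q / p))"
        unfolding ea2[symmetric] by (simp add: exp_add[symmetric] add_divide_distrib p2(1)[symmetric])
      then show ?thesis using pq by simp
    qed
    have e2: "\<xi> * exp (- (x + a) / 2) = (p * q) * sgn \<xi> * exp (- x / 2)"
    proof -
      have "exp (- (x + a) / 2) = exp (- x / 2) * inverse (q / p)"
        unfolding ea2[symmetric] exp_minus[symmetric] by (simp add: exp_add[symmetric] field_simps)
      then have "\<xi> * exp (- (x + a) / 2) = (sgn \<xi> * (q * q)) * (exp (- x / 2) * (p / q))"
        by (simp add: p2(2)[symmetric])
      then show ?thesis using pq by simp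
    qed
    have e3: "m\<^sup>2 * exp (x + a) + \<xi>\<^sup>2 * exp (- (x + a)) = \<bar>m * \<xi>\<bar> * W x"
    proof -
      have "exp (- (x + a)) = exp (- x) * inverse (exp a)" by (simp add: exp_add[symmetric] exp_minus[symmetric])
      then show ?thesis unfolding mq m2 exp_add ea W_def using pq by (simp add: power2_eq_square field_simps)
    qed
    show ?thesis unfolding kerB_def e1 e2 e3 k_def v_def W_uminus by (simp add: algebra_simps)
  qed
  have K0: "has_bochner_integral lborel (\<lambda>x. complex_of_real (k x)) (of_real (exp (- 2 * pi * v) / sqrt v))"
    using has_bochner_integral_kernel[OF v] by (simp add: k_def)
  have K1: "has_bochner_integral lborel (\<lambda>x. of_real x * complex_of_real (k x)) (of_real (exp (2 * pi * v) / sqrt v * e1int v))"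
    using has_bochner_integral_log_kernel(1)[OF v] by (simp add: k_def mult.assoc)
  note K0r = has_bochner_integral_reflect[OF K0]
  have K1r: "has_bochner_integral lborel (\<lambda>x. of_real x * complex_of_real (k (- x))) (- of_real (exp (2 * pi * v) / sqrt v * e1int v))"
    using has_bochner_integral_minus[OF has_bochner_integral_reflect[OF K1]] by simp
  have c: "(p * q) / sqrt v = 1 / sqrt y" using pq y by (simp add: sv)
  have S0: "has_bochner_integral lborel (\<lambda>x. of_real (p * q) * (of_real (sgn m) * complex_of_real (k x) + of_real (sgn \<xi>) * complex_of_real (k (- x))))
     (of_real (p * q) * (of_real (sgn m) * of_real (exp (- 2 * pi * v) / sqrt v) + of_real (sgn \<xi>) * of_real (exp (- 2 * pi * v) / sqrt v)))"
    by (intro has_bochner_integral_mult_right has_bochner_integral_add K0 K0r)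
  have v2: "2 * pi * y * \<bar>m * \<xi>\<bar> = 2 * pi * v" "- 2 * pi * y * \<bar>m * \<xi>\<bar> = - 2 * pi * v" by (simp_all add: v_def)
  have "of_real (p * q) * (of_real (sgn m) * of_real (exp (- 2 * pi * v) / sqrt v) + of_real (sgn \<xi>) * complex_of_real (exp (- 2 * pi * v) / sqrt v))
     = of_real ((sgn m + sgn \<xi>) * exp (- 2 * pi * v) * ((p * q) / sqrt v))"
    by (simp add: algebra_simps add_divide_distrib)
  also have "\<dots> = of_real ((sgn m + sgn \<xi>) * exp (- 2 * pi * y * \<bar>m * \<xi>\<bar>) / sqrt y)" unfolding c v2 by simp
  finally have r0: "of_real (p * q) * (of_real (sgn m) * of_real (exp (- 2 * pi * v) / sqrt v) + of_real (sgn \<xi>) * complex_of_real (exp (- 2 * pi * v) / sqrt v))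
     = of_real ((sgn m + sgn \<xi>) * exp (- 2 * pi * y * \<bar>m * \<xi>\<bar>) / sqrt y)" .
  show "has_bochner_integral lborel (\<lambda>x. complex_of_real (kerB m \<xi> y x))
      (of_real ((sgn m + sgn \<xi>) * exp (- 2 * pi * y * \<bar>m * \<xi>\<bar>) / sqrt y))"
    by (subst has_bochner_integral_shift_iff[of _ a, symmetric]) (use S0[unfolded r0] in \<open>simp add: shift\<close>)
  have S1: "has_bochner_integral lborel (\<lambda>x. of_real (p * q) * (of_real (sgn m) * (of_real x * complex_of_real (k x)) + of_real (sgn \<xi>) * (of_real x * complex_of_real (k (- x))))
      + of_real a * (of_real (p * q) * (of_real (sgn m) * complex_of_real (k x) + of_real (sgn \<xi>) * complex_of_real (k (- x)))))
     (of_real (p * q) * (of_real (sgn m) * of_real (exp (2 * pi * v) / sqrt v * e1int v) + of_real (sgn \<xi>) * (- of_real (exp (2 * pi * v) / sqrt v * e1int v)))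
      + of_real a * of_real ((sgn m + sgn \<xi>) * exp (- 2 * pi * y * \<bar>m * \<xi>\<bar>) / sqrt y))"
    unfolding r0[symmetric] by (intro has_bochner_integral_mult_right has_bochner_integral_add K0 K0r K1 K1r)
  have "of_real (p * q) * (of_real (sgn m) * of_real (exp (2 * pi * v) / sqrt v * e1int v) + of_real (sgn \<xi>) * (- complex_of_real (exp (2 * pi * v) / sqrt v * e1int v)))
      = of_real ((sgn m - sgn \<xi>) * exp (2 * pi * v) * e1int v * ((p * q) / sqrt v))"
    by (simp add: algebra_simps diff_divide_distrib)
  also have "\<dots> = of_real ((sgn m - sgn \<xi>) * exp (2 * pi * y * \<bar>m * \<xi>\<bar>) * e1int (y * \<bar>m * \<xi>\<bar>) / sqrt y)"
    unfolding c v2 v_def[symmetric] by simp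
  finally have "of_real (p * q) * (of_real (sgn m) * of_real (exp (2 * pi * v) / sqrt v * e1int v) + of_real (sgn \<xi>) * (- complex_of_real (exp (2 * pi * v) / sqrt v * e1int v)))
      + of_real a * of_real ((sgn m + sgn \<xi>) * exp (- 2 * pi * y * \<bar>m * \<xi>\<bar>) / sqrt y) =
     of_real (((sgn m + sgn \<xi>) * ln (\<bar>\<xi>\<bar> / \<bar>m\<bar>) * exp (- 2 * pi * y * \<bar>m * \<xi>\<bar>) +
         (sgn m - sgn \<xi>) * exp (2 * pi * y * \<bar>m * \<xi>\<bar>) * e1int (y * \<bar>m * \<xi>\<bar>)) / sqrt y)"
    by (simp add: a_def[symmetric] add_divide_distrib)
  from S1[unfolded this]
  show "has_bochner_integral lborel (\<lambda>x. of_real x * complex_of_real (kerB m \<xi> y x))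
      (of_real (((sgn m + sgn \<xi>) * ln (\<bar>\<xi>\<bar> / \<bar>m\<bar>) * exp (- 2 * pi * y * \<bar>m * \<xi>\<bar>) +
         (sgn m - sgn \<xi>) * exp (2 * pi * y * \<bar>m * \<xi>\<bar>) * e1int (y * \<bar>m * \<xi>\<bar>)) / sqrt y))"
    by (subst has_bochner_integral_shift_iff[of _ a, symmetric]) (simp add: shift algebra_simps)
qed

text \<open>One half of the quadratic form is at least |mk|/M by the inequality of arithmetic and
  geometric means, the other half at least a multiple of \<open>W x\<close>. This separates the
  summation over pairs from the integration over x.\<close>

lemma kerB_bound:
  fixes m k :: int
  assumes m: "m \<noteq> 0" and k: "k \<noteq> 0" and y: "y > 0" and M: "M \<ge> 1"
  shows "\<bar>kerB (of_int m) (of_int k / real M) y x\<bar> \<le>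
     (\<bar>of_int m\<bar> + \<bar>of_int k\<bar>) * exp (- (pi * y / M) * (\<bar>of_int m\<bar> * \<bar>of_int k\<bar>)) * (W x * exp (- (pi * y / (2 * (real M)\<^sup>2)) * W x))"
proof -
  define \<mu> where "\<mu> = \<bar>real_of_int m\<bar>"
  define \<kappa> where "\<kappa> = \<bar>real_of_int k\<bar>"
  have "1 \<le> \<bar>m\<bar>" "1 \<le> \<bar>k\<bar>" using m k by linarith+
  then have one: "\<mu> \<ge> 1" "\<kappa> \<ge> 1" unfolding \<mu>_def \<kappa>_def by linarith+
  have M1: "real M \<ge> 1" using M by simp
  define Q where "Q = (of_int m)\<^sup>2 * exp x + (of_int k / real M)\<^sup>2 * exp (- x)"
  have Q: "Q = \<mu>\<^sup>2 * exp x + (\<kappa> / M)\<^sup>2 * exp (- x)" by (simp add: Q_def \<mu>_def \<kappa>_def power_divide)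
  have q1: "Q \<ge> 2 * (\<mu> * (\<kappa> / M))"
  proof -
    have "2 * (\<mu> * exp (x / 2)) * (\<kappa> / M * exp (- x / 2)) \<le> (\<mu> * exp (x / 2))\<^sup>2 + (\<kappa> / M * exp (- x / 2))\<^sup>2"
      by (rule sum_squares_bound)
    moreover have "(\<mu> * exp (x / 2))\<^sup>2 + (\<kappa> / M * exp (- x / 2))\<^sup>2 = Q"
      unfolding Q power_mult_distrib by (simp add: exp_double[symmetric])
    moreover have "2 * (\<mu> * exp (x / 2)) * (\<kappa> / M * exp (- x / 2)) = 2 * (\<mu> * (\<kappa> / M))"
    proof -
      have "exp (x / 2) * exp (- x / 2) = 1" by (simp add: exp_add[symmetric])
      then have "2 * (\<mu> * (\<kappa> / M)) * (exp (x / 2) * exp (- x / 2)) = 2 * (\<mu> * (\<kappa> / M))" by (simp only: mult_1_right)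
      then show ?thesis by (simp only: mult_ac)
    qed
    ultimately show ?thesis by linarith
  qed
  have q2: "Q \<ge> W x / (real M)\<^sup>2"
  proof -
    have "1 / (real M)\<^sup>2 \<le> 1 * 1" using M1 by (simp add: divide_le_eq)
    also have "1 * 1 \<le> \<mu>\<^sup>2" using one by (simp add: one_le_power)
    finally have a: "1 / (real M)\<^sup>2 \<le> \<mu>\<^sup>2" .
    have b: "1 / (real M)\<^sup>2 \<le> (\<kappa> / M)\<^sup>2" unfolding power_divide using one M1 by (intro divide_right_mono one_le_power) auto
    have "W x / (real M)\<^sup>2 = 1 / (real M)\<^sup>2 * exp x + 1 / (real M)\<^sup>2 * exp (- x)" by (simp add: W_def add_divide_distrib)
    also have "\<dots> \<le> Q" unfolding Q using a b by (intro add_mono mult_right_mono) auto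
    finally show ?thesis .
  qed
  have "\<mu> * \<kappa> / M + W x / (2 * (real M)\<^sup>2) \<le> Q"
  proof -
    have "\<mu> * \<kappa> / M \<le> Q / 2" using q1 by (simp add: mult_ac)
    moreover have "W x / (2 * (real M)\<^sup>2) \<le> Q / 2" using q2 by simp
    ultimately show ?thesis by linarith
  qed
  then have "pi * y * (\<mu> * \<kappa> / M + W x / (2 * (real M)\<^sup>2)) \<le> pi * y * Q" using y by (intro mult_left_mono) auto
  then have e: "exp (- pi * y * Q) \<le> exp (- (pi * y / M) * (\<mu> * \<kappa>)) * exp (- (pi * y / (2 * (real M)\<^sup>2)) * W x)"
    by (simp add: exp_add[symmetric] algebra_simps)
  have "exp (x / 2) \<le> exp \<bar>x\<bar>" "exp (- x / 2) \<le> exp \<bar>x\<bar>" by simp_all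
  then have w: "exp (x / 2) \<le> W x" "exp (- x / 2) \<le> W x" using W_ge_exp(3)[of x] by linarith+
  have "\<bar>of_int m * exp (x / 2) + of_int k / real M * exp (- x / 2)\<bar> \<le> \<mu> * exp (x / 2) + \<kappa> / M * exp (- x / 2)"
    by (rule order_trans[OF abs_triangle_ineq]) (simp add: \<mu>_def \<kappa>_def abs_mult)
  also have "\<dots> \<le> \<mu> * W x + \<kappa> * W x"
  proof (intro add_mono mult_mono)
    show "\<kappa> / real M \<le> \<kappa>" using one M1 by (simp add: divide_le_eq mult_le_cancel_left1)
  qed (use w one in auto)
  finally have l: "\<bar>of_int m * exp (x / 2) + of_int k / real M * exp (- x / 2)\<bar> \<le> (\<mu> + \<kappa>) * W x" by (simp add: ring_distribs)
  have "\<bar>kerB (of_int m) (of_int k / real M) y x\<bar> = \<bar>of_int m * exp (x / 2) + of_int k / real M * exp (- x / 2)\<bar> * exp (- pi * y * Q)"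
    by (simp add: kerB_def Q_def abs_mult)
  also have "\<dots> \<le> ((\<mu> + \<kappa>) * W x) * (exp (- (pi * y / M) * (\<mu> * \<kappa>)) * exp (- (pi * y / (2 * (real M)\<^sup>2)) * W x))"
    using l e one by (intro mult_mono) auto
  finally show ?thesis unfolding \<mu>_def \<kappa>_def by (simp only: mult_ac)
qed

definition pairs :: "(int \<times> int) set" where "pairs = {(m, k). m \<noteq> 0 \<and> k \<noteq> 0}"

lemma summable_pair_exp:
  assumes "c > 0"
  shows "(\<lambda>(m::int, k::int). (\<bar>of_int m\<bar> + 1) * (\<bar>of_int k\<bar> + 1) * exp (- c * (\<bar>of_int m\<bar> + \<bar>of_int k\<bar>)) :: real) summable_on UNIV"
proof -
  define g :: "int \<Rightarrow> real" where "g n = (\<bar>of_int n\<bar> + 1) * exp (- c * \<bar>of_int n\<bar>)" for n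
  have g: "g summable_on UNIV" unfolding g_def using summable_linear_exp[OF assms, of 1 1] by simp
  have "(\<lambda>(m, k). g m * g k) summable_on (UNIV \<times> UNIV)"
  proof (rule summable_on_SigmaI)
    show "((\<lambda>k. case (m, k) of (m, k) \<Rightarrow> g m * g k) has_sum (g m * infsum g UNIV)) UNIV" for m
      using has_sum_cmult_right[OF has_sum_infsum[OF g]] by simp
    show "(\<lambda>m. g m * infsum g UNIV) summable_on UNIV" by (rule summable_on_cmult_left[OF g])
  qed (simp add: g_def)
  then show ?thesis by (simp add: g_def exp_add[symmetric] algebra_simps case_prod_unfold UNIV_Times_UNIV)
qed

lemma summable_pairs_exp_mult:
  assumes "c > 0"
  shows "(\<lambda>(m::int, k::int). (\<bar>of_int m\<bar> + \<bar>of_int k\<bar>) * exp (- c * (\<bar>of_int m\<bar> * \<bar>of_int k\<bar>)) :: real) summable_on pairs"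
proof (rule summable_on_comparison_test)
  show "(\<lambda>(m::int, k::int). (\<bar>of_int m\<bar> + 1) * (\<bar>of_int k\<bar> + 1) * exp (- (c / 2) * (\<bar>of_int m\<bar> + \<bar>of_int k\<bar>)) :: real) summable_on pairs"
    by (rule summable_on_subset_banach[OF summable_pair_exp]) (use assms in auto)
  fix x assume "x \<in> pairs"
  then obtain m k where x: "x = (m, k)" "m \<noteq> 0" "k \<noteq> 0" by (auto simp: pairs_def)
  define a where "a = \<bar>real_of_int m\<bar>" define b where "b = \<bar>real_of_int k\<bar>"
  have "1 \<le> \<bar>m\<bar>" "1 \<le> \<bar>k\<bar>" using x by linarith+
  then have one: "a \<ge> 1" "b \<ge> 1" unfolding a_def b_def by linarith+
  \<comment> \<open>For |m| and |k| at least 1 the product dominates half of the sum, so decay in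
    |mk| implies decay in both variables.\<close>
  then have "0 \<le> (a - 1) * (b - 1)" by simp
  then have "a + b - 1 \<le> a * b" by (simp add: algebra_simps)
  then have "a + b \<le> 2 * (a * b)" using one(1) one(2) by linarith
  then have "(a + b) / 2 \<le> a * b" by simp
  then have "c * ((a + b) / 2) \<le> c * (a * b)" using assms by (intro mult_left_mono) auto
  then have e: "exp (- c * (a * b)) \<le> exp (- (c / 2) * (a + b))" by simp
  have "a + b \<le> (a + 1) * (b + 1)" using one by (simp add: algebra_simps)
  then have "(a + b) * exp (- c * (a * b)) \<le> ((a + 1) * (b + 1)) * exp (- (c / 2) * (a + b))" using e one by (intro mult_mono) auto
  then show "(case x of (m, k) \<Rightarrow> (\<bar>of_int m\<bar> + \<bar>of_int k\<bar>) * exp (- c * (\<bar>of_int m\<bar> * \<bar>of_int k\<bar>))) \<le>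
    (case x of (m, k) \<Rightarrow> (\<bar>of_int m\<bar> + 1) * (\<bar>of_int k\<bar> + 1) * exp (- (c / 2) * (\<bar>of_int m\<bar> + \<bar>of_int k\<bar>)))"
    by (simp add: x(1) a_def b_def)
qed auto

section \<open>The two-dimensional theta series\<close>

text \<open>In \<open>eisI\<close> the Mellin variable is \<open>exp x\<close>; \<open>w0\<close> weights the value at \<open>s = 0\<close> and \<open>w1\<close> the
  derivative.\<close>

definition theta2 :: "(int \<Rightarrow> int \<Rightarrow> complex) \<Rightarrow> complex \<Rightarrow> real \<Rightarrow> complex" where
  "theta2 \<phi> z t = (\<Sum>\<^sub>\<infinity>(m, n). \<phi> m n * (of_int m * cnj z + of_int n) *
      of_real (exp (- pi * t * (norm (of_int m * z + of_int n))\<^sup>2 / Im z)))"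

definition eisI :: "complex \<Rightarrow> complex \<Rightarrow> (int \<Rightarrow> int \<Rightarrow> complex) \<Rightarrow> complex \<Rightarrow> complex" where
  "eisI w0 w1 \<phi> z = of_real pi / (2 * of_real (Im z)) *
     integral\<^sup>L lborel (\<lambda>x. of_real (exp x) * theta2 \<phi> z (exp x) * (w0 + w1 * of_real x))"

lemma norm_lattice: "(norm (of_int m * z + of_int n))\<^sup>2 = (of_int m * Re z + of_int n)\<^sup>2 + (of_int m * Im z)\<^sup>2"
  by (simp add: cmod_power2)

text \<open>Positive definiteness: m^2 + n^2 is at most C |mz+n|^2 with C depending on z, so the
  exponent dominates |m| + |n|.\<close>

lemma theta2_summable:
  assumes y: "Im z > 0" and t: "t > 0" and B: "\<And>m n. norm (\<phi> m n) \<le> B"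
  shows "(\<lambda>(m, n). \<phi> m n * (of_int m * cnj z + of_int n) *
      of_real (exp (- pi * t * (norm (of_int m * z + of_int n))\<^sup>2 / Im z))) summable_on UNIV"
proof (rule Infinite_Sum.abs_summable_summable, rule Infinite_Sum.abs_summable_on_comparison_test')
  \<comment> \<open>With x and y the real and imaginary part of z, C comes from n^2 <= 2 (mx+n)^2 +
    2 m^2 x^2 and m^2 = (my)^2 / y^2.\<close>
  define C where "C = 2 + (1 + 2 * (Re z)\<^sup>2) / (Im z)\<^sup>2"
  have C: "C > 0" using y by (simp add: C_def add_pos_nonneg)
  define c where "c = pi * t / (Im z * C)"
  have c: "c > 0" using C y t by (simp add: c_def)
  have B0: "B \<ge> 0" using order_trans[OF norm_ge_zero B] .
  show "(\<lambda>x. (B * (norm z + 1)) * (case x of (m::int, n::int) \<Rightarrow> (\<bar>of_int m\<bar> + 1) * (\<bar>of_int n\<bar> + 1) * exp (- c * (\<bar>of_int m\<bar> + \<bar>of_int n\<bar>)))) summable_on UNIV"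
    by (rule summable_on_cmult_right[OF summable_pair_exp[OF c]])
  fix x :: "int \<times> int"
  obtain m n where x: "x = (m, n)" by (cases x)
  define r2 where "r2 = (norm (of_int m * z + of_int n))\<^sup>2"
  define u where "u = of_int m * Re z + of_int n"
  have r2: "r2 = u\<^sup>2 + (of_int m * Im z)\<^sup>2" unfolding r2_def u_def by (rule norm_lattice)
  have n2: "(of_int n)\<^sup>2 \<le> 2 * u\<^sup>2 + 2 * (of_int m)\<^sup>2 * (Re z)\<^sup>2"
  proof -
    have "0 \<le> (u + of_int m * Re z)\<^sup>2" by simp
    then have "(u - of_int m * Re z)\<^sup>2 \<le> 2 * u\<^sup>2 + 2 * (of_int m * Re z)\<^sup>2" by (simp add: power2_sum power2_diff)
    then show ?thesis by (simp add: u_def power_mult_distrib)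
  qed
  have m2: "(of_int m)\<^sup>2 = (of_int m * Im z)\<^sup>2 / (Im z)\<^sup>2" using y by (simp add: power_mult_distrib)
  have "(of_int m)\<^sup>2 + (of_int n)\<^sup>2 \<le> 2 * u\<^sup>2 + (1 + 2 * (Re z)\<^sup>2) * (of_int m)\<^sup>2" using n2 by (simp add: algebra_simps)
  also have "\<dots> = 2 * u\<^sup>2 + (1 + 2 * (Re z)\<^sup>2) / (Im z)\<^sup>2 * (of_int m * Im z)\<^sup>2" by (subst m2) simp
  also have "\<dots> \<le> C * u\<^sup>2 + C * (of_int m * Im z)\<^sup>2" unfolding C_def using y by (intro add_mono mult_right_mono) auto
  also have "\<dots> = C * r2" by (simp add: r2 ring_distribs)
  finally have le: "(of_int m)\<^sup>2 + (of_int n)\<^sup>2 \<le> C * r2" .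
  have sq: "\<bar>real_of_int j\<bar> \<le> (of_int j)\<^sup>2" for j
  proof (cases "j = 0")
    case False
    then have "1 \<le> \<bar>j\<bar>" by linarith
    then have "1 \<le> \<bar>real_of_int j\<bar>" by linarith
    from self_le_power[OF this, of 2] show ?thesis by simp
  qed simp
  have "\<bar>of_int m\<bar> + \<bar>of_int n\<bar> \<le> C * r2" using le sq[of m] sq[of n] by linarith
  then have "c * (\<bar>of_int m\<bar> + \<bar>of_int n\<bar>) \<le> c * (C * r2)" using c by (intro mult_left_mono) auto
  also have "\<dots> = pi * t * r2 / Im z" using C y by (simp add: c_def)
  finally have e: "exp (- pi * t * r2 / Im z) \<le> exp (- c * (\<bar>of_int m\<bar> + \<bar>of_int n\<bar>))" by simp
  have "norm (of_int m * cnj z + of_int n) \<le> \<bar>of_int m\<bar> * norm z + \<bar>of_int n\<bar>"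
    by (rule order_trans[OF norm_triangle_ineq]) (simp add: norm_mult)
  also have "\<dots> \<le> (norm z + 1) * ((\<bar>of_int m\<bar> + 1) * (\<bar>of_int n\<bar> + 1))"
  proof -
    have "\<bar>of_int m\<bar> * norm z \<le> norm z * ((\<bar>of_int m\<bar> + 1) * (\<bar>of_int n\<bar> + 1))"
    proof -
      have "\<bar>of_int m\<bar> * 1 \<le> (\<bar>of_int m\<bar> + 1) * (\<bar>of_int n\<bar> + 1 :: real)" by (intro mult_mono) auto
      then show ?thesis by (simp add: mult.commute mult_left_mono)
    qed
    moreover have "\<bar>of_int n\<bar> \<le> (\<bar>of_int m\<bar> + 1) * (\<bar>of_int n\<bar> + 1 :: real)"
    proof -
      have "1 * \<bar>of_int n\<bar> \<le> (\<bar>of_int m\<bar> + 1) * (\<bar>of_int n\<bar> + 1 :: real)" by (intro mult_mono) auto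
      then show ?thesis by simp
    qed
    ultimately show ?thesis by (simp add: ring_distribs)
  qed
  finally have l: "norm (of_int m * cnj z + of_int n) \<le> (norm z + 1) * ((\<bar>of_int m\<bar> + 1) * (\<bar>of_int n\<bar> + 1))" .
  have "norm (\<phi> m n) * norm (of_int m * cnj z + of_int n) * exp (- pi * t * r2 / Im z) \<le>
     B * ((norm z + 1) * ((\<bar>of_int m\<bar> + 1) * (\<bar>of_int n\<bar> + 1))) * exp (- c * (\<bar>of_int m\<bar> + \<bar>of_int n\<bar>))"
    using l e B[of m n] B0 by (intro mult_mono) auto
  then show "norm (case x of (m, n) \<Rightarrow> \<phi> m n * (of_int m * cnj z + of_int n) *
      of_real (exp (- pi * t * (norm (of_int m * z + of_int n))\<^sup>2 / Im z))) \<le>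
    (B * (norm z + 1)) * (case x of (m::int, n::int) \<Rightarrow> (\<bar>of_int m\<bar> + 1) * (\<bar>of_int n\<bar> + 1) * exp (- c * (\<bar>of_int m\<bar> + \<bar>of_int n\<bar>)))"
    by (simp add: x r2_def norm_mult mult_ac)
qed

text \<open>The quadratic form |mz+n|^2 / Im z is invariant when the lattice vector is multiplied by
  the matrix. The linear factor contributes 1/\<open>cnj j\<close> and the prefactor 1/Im z
  contributes |j|^2, together weight 1. The Mellin variable is untouched, so all weights w0, w1 are
  treated at once.\<close>

lemma eisI_transform:
  fixes a b c d :: int
  assumes det: "a * d - b * c = 1" and z: "Im z > 0"
    and \<phi>: "\<And>m n. \<phi>' (m * a + n * c) (m * b + n * d) = \<phi> m n"
  shows "eisI w0 w1 \<phi> ((of_int a * z + of_int b) / (of_int c * z + of_int d)) = (of_int c * z + of_int d) * eisI w0 w1 \<phi>' z"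
proof -
  define j where "j = of_int c * z + of_int d"
  define z' where "z' = (of_int a * z + of_int b) / j"
  have j0: "j \<noteq> 0"
  proof
    assume "j = 0"
    then have "Im j = 0" "Re j = 0" by simp_all
    then have "c = 0" "d = 0" using z by (auto simp: j_def)
    then show False using det by simp
  qed
  have "of_int a * of_int d - of_int b * of_int c = (1 :: complex)" using det by (metis of_int_1 of_int_diff of_int_mult)
  have Im: "Im z' = Im z / (norm j)\<^sup>2"
  proof -
    have "Im z' = Im ((of_int a * z + of_int b) * cnj j) / (norm j)\<^sup>2"
      unfolding z'_def by (simp add: complex_div_cnj[of _ j] Im_divide_of_real flip: of_real_power)
    also have "Im ((of_int a * z + of_int b) * cnj j) = of_int (a * d - b * c) * Im z"
      by (simp add: j_def algebra_simps)
    finally show ?thesis using det by simp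
  qed
  have lin: "of_int m * z' + of_int n = (of_int (m * a + n * c) * z + of_int (m * b + n * d)) / j" for m n
    using j0 by (simp add: z'_def field_simps) (simp add: j_def algebra_simps)
  have linc: "of_int m * cnj z' + of_int n = (of_int (m * a + n * c) * cnj z + of_int (m * b + n * d)) / cnj j" for m n
    using arg_cong[OF lin[of m n], of cnj] by simp
  have th: "theta2 \<phi> z' t = theta2 \<phi>' z t / cnj j" for t
  proof -
    define g where "g = (\<lambda>(m', n'). \<phi>' m' n' * ((of_int m' * cnj z + of_int n') / cnj j) *
        of_real (exp (- pi * t * (norm (of_int m' * z + of_int n'))\<^sup>2 / Im z)))"
    have "theta2 \<phi> z' t = (\<Sum>\<^sub>\<infinity>(m, n). g (m * a + n * c, m * b + n * d))"
      unfolding theta2_def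
    proof (rule infsum_cong, clarify)
      fix m n
      have "- pi * t * (norm (of_int m * z' + of_int n))\<^sup>2 / Im z' =
         - pi * t * (norm (of_int (m * a + n * c) * z + of_int (m * b + n * d)))\<^sup>2 / Im z"
        unfolding lin Im norm_divide power_divide using j0 by simp
      then show "\<phi> m n * (of_int m * cnj z' + of_int n) * of_real (exp (- pi * t * (norm (of_int m * z' + of_int n))\<^sup>2 / Im z')) =
         g (m * a + n * c, m * b + n * d)"
        unfolding g_def linc by (simp add: \<phi>)
    qed
    also have "\<dots> = infsum g UNIV"
    proof (rule infsum_reindex_bij_witness[of UNIV "\<lambda>(m', n'). (m' * d - n' * c, n' * a - m' * b)" "\<lambda>(m, n). (m * a + n * c, m * b + n * d)" UNIV], goal_cases)
      case (1 x)
      obtain m n where x: "x = (m, n)" by (cases x)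
      have "(m * a + n * c) * d - (m * b + n * d) * c = m * (a * d - b * c)" "(m * b + n * d) * a - (m * a + n * c) * b = n * (a * d - b * c)"
        by (simp_all add: algebra_simps)
      then show ?case using det by (simp add: x)
    next
      case (3 x)
      obtain m n where x: "x = (m, n)" by (cases x)
      have "(m * d - n * c) * a + (n * a - m * b) * c = m * (a * d - b * c)" "(m * d - n * c) * b + (n * a - m * b) * d = n * (a * d - b * c)"
        by (simp_all add: algebra_simps)
      then show ?case using det by (simp add: x)
    qed auto
    also have "\<dots> = (\<Sum>\<^sub>\<infinity>x. (case x of (m', n') \<Rightarrow> \<phi>' m' n' * (of_int m' * cnj z + of_int n') *
        of_real (exp (- pi * t * (norm (of_int m' * z + of_int n'))\<^sup>2 / Im z))) * inverse (cnj j))"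
      by (rule infsum_cong) (simp add: g_def case_prod_unfold divide_inverse mult_ac)
    also have "\<dots> = theta2 \<phi>' z t * inverse (cnj j)" unfolding theta2_def by (rule infsum_cmult_left')
    finally show ?thesis by (simp add: divide_inverse)
  qed
  have "eisI w0 w1 \<phi> z' = of_real pi / (2 * of_real (Im z')) *
     integral\<^sup>L lborel (\<lambda>x. of_real (exp x) * theta2 \<phi>' z (exp x) * (w0 + w1 * of_real x) / cnj j)"
    unfolding eisI_def th by simp
  also have "\<dots> = of_real pi / (2 * of_real (Im z')) *
     (integral\<^sup>L lborel (\<lambda>x. of_real (exp x) * theta2 \<phi>' z (exp x) * (w0 + w1 * of_real x)) / cnj j)"
    by simp
  also have "\<dots> = j * eisI w0 w1 \<phi>' z"
  proof -
    have "complex_of_real ((norm j)\<^sup>2) = j * cnj j" by (rule complex_norm_square)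
    then show ?thesis unfolding eisI_def Im using j0 z by (simp add: field_simps)
  qed
  finally show ?thesis unfolding z'_def j_def .
qed

text \<open>At fixed x the pairs with m = 0 or k = 0 are included; the separated bound given earlier
  concerns nonzero pairs only.\<close>

lemma kerB_summable:
  assumes y: "y > 0" and M: "M \<ge> 1"
  shows "(\<lambda>(m, k). \<bar>kerB (of_int m) (of_int k / real M) y x\<bar>) summable_on UNIV"
proof (rule summable_on_comparison_test)
  define c where "c = pi * y * min (exp x) (exp (- x) / (real M)\<^sup>2)"
  have c: "c > 0" using y M by (simp add: c_def)
  show "(\<lambda>p. W x * (case p of (m::int, k::int) \<Rightarrow> (\<bar>of_int m\<bar> + 1) * (\<bar>of_int k\<bar> + 1) * exp (- c * (\<bar>of_int m\<bar> + \<bar>of_int k\<bar>)))) summable_on UNIV"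
    by (rule summable_on_cmult_right[OF summable_pair_exp[OF c]])
  fix p :: "int \<times> int"
  obtain m k where p: "p = (m, k)" by (cases p)
  have sq: "\<bar>real_of_int j\<bar> \<le> (of_int j)\<^sup>2" for j
  proof (cases "j = 0")
    case False
    then have "1 \<le> \<bar>j\<bar>" by linarith
    then have "1 \<le> \<bar>real_of_int j\<bar>" by linarith
    from self_le_power[OF this, of 2] show ?thesis by simp
  qed simp
  define Q where "Q = (of_int m)\<^sup>2 * exp x + (of_int k / real M)\<^sup>2 * exp (- x)"
  define \<epsilon> where "\<epsilon> = min (exp x) (exp (- x) / (real M)\<^sup>2)"
  have \<epsilon>0: "\<epsilon> \<ge> 0" by (simp add: \<epsilon>_def)
  have "\<epsilon> * (\<bar>of_int m\<bar> + \<bar>of_int k\<bar>) \<le> \<epsilon> * (of_int m)\<^sup>2 + \<epsilon> * (of_int k)\<^sup>2"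
    unfolding ring_distribs using sq[of m] sq[of k] \<epsilon>0 by (intro add_mono mult_left_mono) auto
  also have "\<dots> \<le> exp x * (of_int m)\<^sup>2 + (exp (- x) / (real M)\<^sup>2) * (of_int k)\<^sup>2"
    by (intro add_mono mult_right_mono) (auto simp: \<epsilon>_def)
  also have "\<dots> = Q" by (simp add: Q_def power_divide mult.commute)
  finally have "pi * y * (\<epsilon> * (\<bar>of_int m\<bar> + \<bar>of_int k\<bar>)) \<le> pi * y * Q" using y by (intro mult_left_mono) auto
  then have e: "exp (- pi * y * Q) \<le> exp (- c * (\<bar>of_int m\<bar> + \<bar>of_int k\<bar>))" by (simp add: c_def \<epsilon>_def mult.assoc)
  have "exp (x / 2) \<le> exp \<bar>x\<bar>" "exp (- x / 2) \<le> exp \<bar>x\<bar>" by simp_all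
  then have w: "exp (x / 2) \<le> W x" "exp (- x / 2) \<le> W x" using W_ge_exp(3)[of x] by linarith+
  have "\<bar>of_int m * exp (x / 2) + of_int k / real M * exp (- x / 2)\<bar> \<le> \<bar>of_int m\<bar> * exp (x / 2) + \<bar>of_int k\<bar> / M * exp (- x / 2)"
    by (rule order_trans[OF abs_triangle_ineq]) (simp add: abs_mult)
  also have "\<dots> \<le> \<bar>of_int m\<bar> * W x + \<bar>of_int k\<bar> * W x"
  proof (intro add_mono mult_mono)
    show "\<bar>real_of_int k\<bar> / real M \<le> \<bar>real_of_int k\<bar>" using M by (simp add: divide_le_eq mult_le_cancel_left1)
  qed (use w in auto)
  also have "\<dots> \<le> W x * ((\<bar>of_int m\<bar> + 1) * (\<bar>of_int k\<bar> + 1))"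
  proof -
    have "\<bar>of_int m\<bar> + \<bar>of_int k\<bar> \<le> (\<bar>of_int m\<bar> + 1) * (\<bar>of_int k\<bar> + 1 :: real)" by (simp add: algebra_simps)
    then have "W x * (\<bar>of_int m\<bar> + \<bar>of_int k\<bar>) \<le> W x * ((\<bar>of_int m\<bar> + 1) * (\<bar>of_int k\<bar> + 1))" by (intro mult_left_mono) auto
    then show ?thesis by (simp add: algebra_simps)
  qed
  finally have l: "\<bar>of_int m * exp (x / 2) + of_int k / real M * exp (- x / 2)\<bar> \<le> W x * ((\<bar>of_int m\<bar> + 1) * (\<bar>of_int k\<bar> + 1))" .
  have "\<bar>kerB (of_int m) (of_int k / real M) y x\<bar> = \<bar>of_int m * exp (x / 2) + of_int k / real M * exp (- x / 2)\<bar> * exp (- pi * y * Q)"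
    by (simp add: kerB_def Q_def abs_mult)
  also have "\<dots> \<le> (W x * ((\<bar>of_int m\<bar> + 1) * (\<bar>of_int k\<bar> + 1))) * exp (- c * (\<bar>of_int m\<bar> + \<bar>of_int k\<bar>))"
    using l e by (intro mult_mono) auto
  finally show "(case p of (m, k) \<Rightarrow> \<bar>kerB (of_int m) (of_int k / real M) y x\<bar>) \<le>
     W x * (case p of (m::int, k::int) \<Rightarrow> (\<bar>of_int m\<bar> + 1) * (\<bar>of_int k\<bar> + 1) * exp (- c * (\<bar>of_int m\<bar> + \<bar>of_int k\<bar>)))"
    by (simp add: p mult.assoc)
qed auto

section \<open>Poisson summation in the rows of the theta series\<close>

definition kerT :: "nat \<Rightarrow> (int \<Rightarrow> int \<Rightarrow> complex) \<Rightarrow> complex \<Rightarrow> int \<times> int \<Rightarrow> real \<Rightarrow> complex" where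
  "kerT M \<phi> z = (\<lambda>(m, k) x. fhat M (\<phi> m) k * ee (of_int k * (of_int m * Re z) / of_nat M) * of_real (kerB (of_int m) (of_int k / real M) (Im z) x))"

text \<open>For fixed m the exponent splits into (mx+n)^2, a Gaussian in n with parameter
  exp(\<tau>)/y that is transformed, and (my)^2, which is carried along as the factor E.\<close>

lemma theta2_row:
  assumes y: "Im z > 0" and M: "M \<ge> 1" and per: "\<And>m n. \<phi> m (n + int M) = \<phi> m n"
  shows "((\<lambda>n. \<phi> m n * (of_int m * cnj z + of_int n) *
      of_real (exp (- pi * exp \<tau> * (norm (of_int m * z + of_int n))\<^sup>2 / Im z))) has_sum
     (of_real (exp (- \<tau>)) * (- \<i> / of_nat M * of_real (Im z * sqrt (Im z))) * (\<Sum>\<^sub>\<infinity>k. kerT M \<phi> z (m, k) \<tau>))) UNIV"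
proof -
  define y where "y = Im z"
  have y0: "y > 0" using y by (simp add: y_def)
  define a where "a = exp \<tau> / y"
  have a: "a > 0" using y0 by (simp add: a_def)
  define X where "X = of_int m * Re z"
  \<comment> \<open>With this shift X + n + \<open>\<beta>\<close> equals m times the conjugate of
    z, plus n.\<close>
  define \<beta> where "\<beta> = - \<i> * of_real (of_int m * y)"
  define E where "E = exp (- pi * exp \<tau> * ((of_int m)\<^sup>2 * y))"
  define D where "D k = fhat M (\<phi> m) k / of_nat M * ((\<beta> - \<i> * of_real (of_int k / (of_nat M * a))) *
       of_real (exp (- pi * (of_int k)\<^sup>2 / (a * (of_nat M)\<^sup>2)) / sqrt a) * ee (of_int k * X / of_nat M))" for k
  have "((\<lambda>n. \<phi> m n * ((of_real (X + of_int n) + \<beta>) * of_real (exp (- pi * a * (X + of_int n)\<^sup>2))) * of_real E) has_sum ((\<Sum>\<^sub>\<infinity>k. D k) * of_real E)) UNIV"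
    unfolding D_def by (rule has_sum_cmult_left[OF periodic_gauss_poisson[where f = "\<phi> m", OF a M per]])
  moreover have "\<phi> m n * ((of_real (X + of_int n) + \<beta>) * of_real (exp (- pi * a * (X + of_int n)\<^sup>2))) * of_real E =
     \<phi> m n * (of_int m * cnj z + of_int n) * of_real (exp (- pi * exp \<tau> * (norm (of_int m * z + of_int n))\<^sup>2 / Im z))" for n
  proof -
    have "complex_of_real (X + of_int n) + \<beta> = of_int m * cnj z + of_int n"
      by (simp add: complex_eq_iff X_def \<beta>_def y_def)
    moreover have "exp (- pi * a * (X + of_int n)\<^sup>2) * E = exp (- pi * exp \<tau> * (norm (of_int m * z + of_int n))\<^sup>2 / Im z)"
      unfolding norm_lattice E_def a_def X_def y_def exp_add[symmetric]
      by (rule arg_cong[of _ _ exp]) (use y in \<open>simp add: field_simps power2_eq_square\<close>)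
    ultimately show ?thesis by (simp only: mult.assoc of_real_mult[symmetric])
  qed
  moreover have "D k * of_real E = of_real (exp (- \<tau>)) * (- \<i> / of_nat M * of_real (y * sqrt y)) * kerT M \<phi> z (m, k) \<tau>" for k
  proof -
    define \<xi> where "\<xi> = of_int k / real M"
    have e2: "exp (\<tau> / 2) * exp (\<tau> / 2) = exp \<tau>" by (simp add: exp_add[symmetric])
    have b: "\<beta> - \<i> * of_real (of_int k / (of_nat M * a)) = - \<i> * of_real (y * (of_int m + \<xi> * exp (- \<tau>)))"
      using y0 by (simp add: \<beta>_def a_def \<xi>_def exp_minus field_simps)
    have s: "1 / sqrt a = sqrt y * exp (- \<tau> / 2)"
    proof -
      have "sqrt (exp \<tau>) = exp (\<tau> / 2)" by (rule real_sqrt_unique) (simp_all add: power2_eq_square e2)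
      then have "1 / sqrt a = sqrt y / exp (\<tau> / 2)" by (simp add: a_def real_sqrt_divide)
      moreover have "exp (- \<tau> / 2) = inverse (exp (\<tau> / 2))" using exp_minus[of "\<tau> / 2"] by simp
      ultimately show ?thesis by (metis divide_inverse)
    qed
    have x: "exp (- pi * (of_int k)\<^sup>2 / (a * (of_nat M)\<^sup>2)) * E = exp (- pi * y * ((of_int m)\<^sup>2 * exp \<tau> + \<xi>\<^sup>2 * exp (- \<tau>)))"
      unfolding E_def exp_add[symmetric] a_def \<xi>_def
      by (rule arg_cong[of _ _ exp]) (use y0 M in \<open>simp add: field_simps power2_eq_square exp_minus\<close>)
    have kb: "(of_int m + \<xi> * exp (- \<tau>)) * exp (- \<tau> / 2) = exp (- \<tau>) * (of_int m * exp (\<tau> / 2) + \<xi> * exp (- \<tau> / 2))"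
    proof -
      have gen: "(a + b * e) * f = e * (a * g + b * f)" if "f = e * g" for a b e f g :: real
        using that by (simp add: algebra_simps)
      show ?thesis by (rule gen) (simp add: exp_add[symmetric])
    qed
    have "(\<beta> - \<i> * of_real (of_int k / (of_nat M * a))) * of_real (exp (- pi * (of_int k)\<^sup>2 / (a * (of_nat M)\<^sup>2)) / sqrt a) * of_real E
      = - \<i> * of_real (y * ((of_int m + \<xi> * exp (- \<tau>)) * (1 / sqrt a)) * (exp (- pi * (of_int k)\<^sup>2 / (a * (of_nat M)\<^sup>2)) * E))"
      unfolding b by simp
    also have "\<dots> = - \<i> * of_real (y * sqrt y * ((of_int m + \<xi> * exp (- \<tau>)) * exp (- \<tau> / 2)) * exp (- pi * y * ((of_int m)\<^sup>2 * exp \<tau> + \<xi>\<^sup>2 * exp (- \<tau>))))"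
      unfolding s x by simp
    also have "\<dots> = - \<i> * of_real (exp (- \<tau>) * (y * sqrt y) * kerB (of_int m) \<xi> y \<tau>)"
      unfolding kb kerB_def by (simp add: mult_ac)
    finally have "(\<beta> - \<i> * of_real (of_int k / (of_nat M * a))) * of_real (exp (- pi * (of_int k)\<^sup>2 / (a * (of_nat M)\<^sup>2)) / sqrt a) * of_real E
      = - \<i> * of_real (exp (- \<tau>) * (y * sqrt y) * kerB (of_int m) \<xi> y \<tau>)" .
    moreover have "F * (b * q * w) * e = F * (b * q * e * w)" for F b q w e :: complex by (simp only: mult_ac)
    ultimately have "D k * of_real E = fhat M (\<phi> m) k / of_nat M * (- \<i> * of_real (exp (- \<tau>) * (y * sqrt y) * kerB (of_int m) \<xi> y \<tau>) * ee (of_int k * X / of_nat M))"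
      unfolding D_def by (simp only:)
    moreover have "F / c * (- \<i> * of_real (e * Y * q) * w) = of_real e * (- \<i> / c * of_real Y) * (F * w * of_real q)" for F c w :: complex and e Y q :: real
      by (simp add: divide_inverse mult_ac)
    ultimately show ?thesis unfolding kerT_def prod.case X_def[symmetric] \<xi>_def[symmetric] y_def[symmetric] by (simp only:)
  qed
  moreover have "(\<Sum>\<^sub>\<infinity>k. D k) * of_real E = (\<Sum>\<^sub>\<infinity>k. D k * of_real E)" by (rule infsum_cmult_left'[symmetric])
  ultimately show ?thesis by (simp only: infsum_cmult_right' y_def)
qed

lemma fhat_bounded:
  assumes "\<And>n. norm (f n) \<le> B" shows "norm (fhat M f k) \<le> real M * B"
proof -
  have "norm (fhat M f k) \<le> (\<Sum>b\<in>{0..<int M}. B)" unfolding fhat_def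
    by (rule order_trans[OF norm_sum sum_mono]) (simp add: norm_mult assms)
  then show ?thesis by simp
qed

lemma kerT_summable:
  assumes y: "Im z > 0" and M: "M \<ge> 1" and B: "\<And>m n. norm (\<phi> m n) \<le> B"
  shows "(\<lambda>p. norm (kerT M \<phi> z p x)) summable_on UNIV"
proof (rule Infinite_Sum.abs_summable_on_comparison_test')
  show "(\<lambda>p. (real M * B) * (case p of (m, k) \<Rightarrow> \<bar>kerB (of_int m) (of_int k / real M) (Im z) x\<bar>)) summable_on UNIV"
    by (rule summable_on_cmult_right[OF kerB_summable[OF y M]])
  fix p :: "int \<times> int"
  obtain m k where p: "p = (m, k)" by (cases p)
  show "norm (kerT M \<phi> z p x) \<le> (real M * B) * (case p of (m, k) \<Rightarrow> \<bar>kerB (of_int m) (of_int k / real M) (Im z) x\<bar>)"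
    using mult_right_mono[OF fhat_bounded[of "\<phi> m" B M k, OF B], of "\<bar>kerB (of_int m) (of_int k / real M) (Im z) x\<bar>"]
    by (simp add: p kerT_def norm_mult)
qed

text \<open>The dual double sum is cut according to the vanishing of m and k. The row m = 0 is
  transformed back into a theta series and the column k = 0 is one already; these two yield the
  constant term, and only the nonzero pairs depend on Re z.\<close>

lemma theta2_split:
  assumes y: "Im z > 0" and M: "M \<ge> 1" and per: "\<And>m n. \<phi> m (n + int M) = \<phi> m n" and B: "\<And>m n. norm (\<phi> m n) \<le> B"
  shows "of_real (exp \<tau>) * theta2 \<phi> z (exp \<tau>) = of_real (exp \<tau>) * theta1 (\<phi> 0) (exp \<tau> / Im z)
     + (- \<i> / of_nat M * of_real (Im z * sqrt (Im z))) * (of_real (exp (\<tau> / 2)) * theta1 (\<lambda>m. fhat M (\<phi> m) 0) (Im z * exp \<tau>))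
     + (- \<i> / of_nat M * of_real (Im z * sqrt (Im z))) * (\<Sum>\<^sub>\<infinity>p\<in>pairs. kerT M \<phi> z p \<tau>)"
proof -
  define C where "C = - \<i> / of_nat M * complex_of_real (Im z * sqrt (Im z))"
  note row = theta2_row[where \<phi> = \<phi>, OF y M per, of _ \<tau>, folded C_def]
  have sT: "(\<lambda>p. kerT M \<phi> z p \<tau>) summable_on A" for A
    by (rule summable_on_subset_banach[OF Infinite_Sum.abs_summable_summable[OF kerT_summable[where \<phi> = \<phi>, OF y M B]]]) simp
  have sT': "(\<lambda>p. kerT M \<phi> z p \<tau>) summable_on (UNIV \<times> UNIV)" by (rule sT)
  have "((\<lambda>m. of_real (exp (- \<tau>)) * C * (\<Sum>\<^sub>\<infinity>k. kerT M \<phi> z (m, k) \<tau>)) has_sum theta2 \<phi> z (exp \<tau>)) UNIV"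
  proof (rule has_sum_SigmaD[where B = "\<lambda>_. UNIV"])
    show "((\<lambda>(m, n). \<phi> m n * (of_int m * cnj z + of_int n) * of_real (exp (- pi * exp \<tau> * (norm (of_int m * z + of_int n))\<^sup>2 / Im z)))
       has_sum theta2 \<phi> z (exp \<tau>)) (UNIV \<times> UNIV)"
      unfolding theta2_def UNIV_Times_UNIV by (rule has_sum_infsum[OF theta2_summable[OF y _ B]]) simp
  qed (use row in simp)
  then have "theta2 \<phi> z (exp \<tau>) = (\<Sum>\<^sub>\<infinity>m. of_real (exp (- \<tau>)) * C * (\<Sum>\<^sub>\<infinity>k. kerT M \<phi> z (m, k) \<tau>))"
    by (rule infsumI[symmetric])
  also have "\<dots> = of_real (exp (- \<tau>)) * C * (\<Sum>\<^sub>\<infinity>m. \<Sum>\<^sub>\<infinity>k. kerT M \<phi> z (m, k) \<tau>)" by (rule infsum_cmult_right')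
  also have "(\<Sum>\<^sub>\<infinity>m. \<Sum>\<^sub>\<infinity>k. kerT M \<phi> z (m, k) \<tau>) = (\<Sum>\<^sub>\<infinity>p. kerT M \<phi> z p \<tau>)"
    using infsum_Sigma_banach[OF sT'] by (simp add: UNIV_Times_UNIV)
  finally have th: "of_real (exp \<tau>) * theta2 \<phi> z (exp \<tau>) = C * (\<Sum>\<^sub>\<infinity>p. kerT M \<phi> z p \<tau>)"
    by (simp add: exp_minus field_simps)
  define R where "R = {0 :: int} \<times> (UNIV :: int set)"
  define Q where "Q = (UNIV - {0 :: int}) \<times> {0 :: int}"
  have "UNIV = (R \<union> Q) \<union> pairs" by (auto simp: R_def Q_def pairs_def)
  then have "(\<Sum>\<^sub>\<infinity>p. kerT M \<phi> z p \<tau>) = (\<Sum>\<^sub>\<infinity>p\<in>(R \<union> Q) \<union> pairs. kerT M \<phi> z p \<tau>)" by simp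
  also have "\<dots> = (\<Sum>\<^sub>\<infinity>p\<in>R \<union> Q. kerT M \<phi> z p \<tau>) + (\<Sum>\<^sub>\<infinity>p\<in>pairs. kerT M \<phi> z p \<tau>)"
    by (rule infsum_Un_disjoint[OF sT sT]) (auto simp: R_def Q_def pairs_def)
  also have "(\<Sum>\<^sub>\<infinity>p\<in>R \<union> Q. kerT M \<phi> z p \<tau>) = (\<Sum>\<^sub>\<infinity>p\<in>R. kerT M \<phi> z p \<tau>) + (\<Sum>\<^sub>\<infinity>p\<in>Q. kerT M \<phi> z p \<tau>)"
    by (rule infsum_Un_disjoint[OF sT sT]) (auto simp: R_def Q_def)
  finally have split: "(\<Sum>\<^sub>\<infinity>p. kerT M \<phi> z p \<tau>) = (\<Sum>\<^sub>\<infinity>p\<in>R. kerT M \<phi> z p \<tau>) + (\<Sum>\<^sub>\<infinity>p\<in>Q. kerT M \<phi> z p \<tau>) + (\<Sum>\<^sub>\<infinity>p\<in>pairs. kerT M \<phi> z p \<tau>)" .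
  \<comment> \<open>The row formula at m = 0, read from right to left.\<close>
  have R: "C * (\<Sum>\<^sub>\<infinity>p\<in>R. kerT M \<phi> z p \<tau>) = of_real (exp \<tau>) * theta1 (\<phi> 0) (exp \<tau> / Im z)"
  proof -
    have "(\<Sum>\<^sub>\<infinity>p\<in>R. kerT M \<phi> z p \<tau>) = (\<Sum>\<^sub>\<infinity>k. kerT M \<phi> z (0, k) \<tau>)"
      unfolding R_def by (rule infsum_reindex_bij_witness[of _ "\<lambda>k. (0, k)" snd]) auto
    moreover have "theta1 (\<phi> 0) (exp \<tau> / Im z) = of_real (exp (- \<tau>)) * C * (\<Sum>\<^sub>\<infinity>k. kerT M \<phi> z (0, k) \<tau>)"
      unfolding theta1_def using infsumI[OF row[of 0]] by simp
    ultimately show ?thesis by (simp add: exp_minus field_simps)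
  qed
  have Q: "(\<Sum>\<^sub>\<infinity>p\<in>Q. kerT M \<phi> z p \<tau>) = of_real (exp (\<tau> / 2)) * theta1 (\<lambda>m. fhat M (\<phi> m) 0) (Im z * exp \<tau>)"
  proof -
    have "(\<Sum>\<^sub>\<infinity>p\<in>Q. kerT M \<phi> z p \<tau>) = (\<Sum>\<^sub>\<infinity>m\<in>UNIV - {0}. kerT M \<phi> z (m, 0) \<tau>)"
      unfolding Q_def by (rule infsum_reindex_bij_witness[of _ "\<lambda>m. (m, 0)" fst]) auto
    \<comment> \<open>The term m = 0 may be added because \<open>kerB\<close> vanishes at m = k =
      0.\<close>
    also have "\<dots> = (\<Sum>\<^sub>\<infinity>m. kerT M \<phi> z (m, 0) \<tau>)" by (rule infsum_cong_neutral) (auto simp: kerT_def kerB_def)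
    also have "\<dots> = (\<Sum>\<^sub>\<infinity>m. of_real (exp (\<tau> / 2)) * (fhat M (\<phi> m) 0 * of_int m * of_real (exp (- pi * (Im z * exp \<tau>) * (of_int m)\<^sup>2))))"
      by (rule infsum_cong) (simp add: kerT_def kerB_def mult_ac)
    also have "\<dots> = of_real (exp (\<tau> / 2)) * theta1 (\<lambda>m. fhat M (\<phi> m) 0) (Im z * exp \<tau>)"
      unfolding theta1_def by (rule infsum_cmult_right')
    finally show ?thesis .
  qed
  show ?thesis unfolding th split C_def[symmetric] ring_distribs R Q ..
qed

lemma Lam_linear:
  assumes M: "M \<ge> 1" and per: "\<And>n. f (n + int M) = f n"
  shows "has_bochner_integral lborel (\<lambda>x. theta1 f (exp x) * exp (u * of_real x) * (c0 + c1 * of_real x)) (c0 * Lam f u + c1 * Lam' f u)"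
proof -
  have i0: "integrable lborel (\<lambda>x. theta1 f (exp x) * exp (u * of_real x))"
    using theta1_moment_integrable[where f = f and j = 0 and u = u, OF M per] by simp
  have i1: "integrable lborel (\<lambda>x. theta1 f (exp x) * of_real x * exp (u * of_real x))"
    using theta1_moment_integrable[where f = f and j = 1 and u = u, OF M per] by simp
  have "has_bochner_integral lborel (\<lambda>x. c0 * (theta1 f (exp x) * exp (u * of_real x)) + c1 * (theta1 f (exp x) * of_real x * exp (u * of_real x))) (c0 * Lam f u + c1 * Lam' f u)"
    unfolding Lam_def Lam'_def using i0 i1
    by (intro has_bochner_integral_add has_bochner_integral_mult_right has_bochner_integral_integrable)
  then show ?thesis by (simp add: algebra_simps)
qed

text \<open>The two boundary theta series integrated against w0 + w1 x. Translating their arguments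
  exp(x)/y and y exp(x) to exp(x) produces log y with opposite signs.\<close>

definition eis_const :: "complex \<Rightarrow> complex \<Rightarrow> nat \<Rightarrow> (int \<Rightarrow> int \<Rightarrow> complex) \<Rightarrow> real \<Rightarrow> complex" where
  "eis_const w0 w1 M \<phi> y =
     of_real pi / 2 * ((w0 + w1 * of_real (ln y)) * Lam (\<phi> 0) 1 + w1 * Lam' (\<phi> 0) 1)
     - of_real pi * \<i> / (2 * of_nat M) * ((w0 - w1 * of_real (ln y)) * Lam (\<lambda>m. fhat M (\<phi> m) 0) (1 / 2) + w1 * Lam' (\<lambda>m. fhat M (\<phi> m) 0) (1 / 2))"

definition eis_term :: "complex \<Rightarrow> complex \<Rightarrow> nat \<Rightarrow> (int \<Rightarrow> int \<Rightarrow> complex) \<Rightarrow> complex \<Rightarrow> int \<times> int \<Rightarrow> complex" where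
  "eis_term w0 w1 M \<phi> z = (\<lambda>(m, k). - (of_real pi * \<i> / (2 * of_nat M)) * fhat M (\<phi> m) k * ee (of_int k * (of_int m * Re z) / of_nat M) *
     (of_int (sgn m + sgn k) * (w0 + w1 * of_real (ln (\<bar>of_int k\<bar> / (of_nat M * \<bar>of_int m\<bar>)))) * of_real (exp (- 2 * pi * Im z * (\<bar>of_int m * of_int k\<bar> / of_nat M))) +
      of_int (sgn m - sgn k) * w1 * of_real (exp (2 * pi * Im z * (\<bar>of_int m * of_int k\<bar> / of_nat M)) * e1int (Im z * (\<bar>of_int m * of_int k\<bar> / of_nat M)))))"

text \<open>On nonzero pairs there is a majorant \<open>A p * h \<tau>\<close>, summable in p and
  integrable in \<tau>, so sum and integral are exchanged there; the two boundary theta series are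
  integrated as they stand.\<close>

lemma eisI_fourier:
  assumes y: "Im z > 0" and M: "M \<ge> 1" and K: "K \<ge> 1"
    and per: "\<And>m n. \<phi> m (n + int M) = \<phi> m n" and perK: "\<And>m n. \<phi> (m + int K) n = \<phi> m n"
  shows "(eis_term w0 w1 M \<phi> z has_sum (eisI w0 w1 \<phi> z - eis_const w0 w1 M \<phi> (Im z))) pairs"
proof -
  define y where "y = Im z"
  have y0: "y > 0" using y by (simp add: y_def)
  define B where "B = (\<Sum>m\<in>{0..<int K}. \<Sum>n\<in>{0..<int M}. norm (\<phi> m n))"
  have B: "norm (\<phi> m n) \<le> B" for m n
  proof -
    have "\<phi> m n = \<phi> m (n mod int M)" by (rule periodic_cong[of "\<phi> m" M, OF per]) (simp add: cong_def)
    also have "\<dots> = \<phi> (m mod int K) (n mod int M)"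
      by (rule periodic_cong[of "\<lambda>m. \<phi> m (n mod int M)" K, OF perK]) (simp add: cong_def)
    finally have e: "\<phi> m n = \<phi> (m mod int K) (n mod int M)" .
    have "norm (\<phi> (m mod int K) (n mod int M)) \<le> (\<Sum>n\<in>{0..<int M}. norm (\<phi> (m mod int K) n))"
      by (rule member_le_sum[of _ _ "\<lambda>n. norm (\<phi> (m mod int K) n)"]) (use M in auto)
    also have "\<dots> \<le> B" unfolding B_def
      by (rule member_le_sum[of _ _ "\<lambda>m. \<Sum>n\<in>{0..<int M}. norm (\<phi> m n)"]) (use K in \<open>auto intro: sum_nonneg\<close>)
    finally show ?thesis unfolding e .
  qed
  have B0: "B \<ge> 0" using order_trans[OF norm_ge_zero B] .
  define C where "C = - \<i> / of_nat M * complex_of_real (y * sqrt y)"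
  define g where "g m = fhat M (\<phi> m) 0" for m
  have perg: "g (m + int K) = g m" for m unfolding g_def fhat_def by (simp add: perK)
  define l where "l \<tau> = w0 + w1 * complex_of_real \<tau>" for \<tau>
  define f where "f p \<tau> = kerT M \<phi> z p \<tau> * l \<tau>" for p \<tau>
  have I1: "has_bochner_integral lborel (\<lambda>\<tau>. of_real (exp \<tau>) * theta1 (\<phi> 0) (exp \<tau> / y) * l \<tau>)
      (of_real y * ((w0 + w1 * of_real (ln y)) * Lam (\<phi> 0) 1 + w1 * Lam' (\<phi> 0) 1))"
  proof (subst has_bochner_integral_shift_iff[of _ "ln y", symmetric])
    have "of_real (exp (x + ln y)) * theta1 (\<phi> 0) (exp (x + ln y) / y) * l (x + ln y) =
      of_real y * (theta1 (\<phi> 0) (exp x) * exp (1 * of_real x) * ((w0 + w1 * of_real (ln y)) + w1 * of_real x))" for x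
    proof -
      have "exp (x + ln y) = exp x * y" using y0 by (simp add: exp_add)
      then show ?thesis using y0 by (simp add: l_def exp_of_real algebra_simps)
    qed
    then show "has_bochner_integral lborel (\<lambda>x. of_real (exp (x + ln y)) * theta1 (\<phi> 0) (exp (x + ln y) / y) * l (x + ln y))
       (of_real y * ((w0 + w1 * of_real (ln y)) * Lam (\<phi> 0) 1 + w1 * Lam' (\<phi> 0) 1))"
      using has_bochner_integral_mult_right[OF Lam_linear[where f = "\<phi> 0" and u = 1 and ?c0.0 = "w0 + w1 * of_real (ln y)" and ?c1.0 = w1, OF M per], of "of_real y"]
      by (simp only:)
  qed
  have I2: "has_bochner_integral lborel (\<lambda>\<tau>. of_real (exp (\<tau> / 2)) * theta1 g (y * exp \<tau>) * l \<tau>)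
      (of_real (1 / sqrt y) * ((w0 - w1 * of_real (ln y)) * Lam g (1 / 2) + w1 * Lam' g (1 / 2)))"
  proof (subst has_bochner_integral_shift_iff[of _ "- ln y", symmetric])
    have "of_real (exp ((x + - ln y) / 2)) * theta1 g (y * exp (x + - ln y)) * l (x + - ln y) =
      of_real (1 / sqrt y) * (theta1 g (exp x) * exp (1 / 2 * of_real x) * ((w0 - w1 * of_real (ln y)) + w1 * of_real x))" for x
    proof -
      have e1: "y * exp (x + - ln y) = exp x" using y0 by (simp add: exp_diff)
      have "exp (ln y / 2) = sqrt y" using y0 by (simp add: powr_half_sqrt[symmetric] powr_def)
      then have e2: "exp ((x + - ln y) / 2) = 1 / sqrt y * exp (x / 2)"
        by (simp add: diff_divide_distrib exp_diff)
      have e3: "complex_of_real (exp (x / 2)) = exp (1 / 2 * of_real x)" by (simp add: exp_of_real[symmetric])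
      have e4: "l (x + - ln y) = (w0 - w1 * of_real (ln y)) + w1 * of_real x" by (simp add: l_def algebra_simps)
      show ?thesis unfolding e1 e2 e4 of_real_mult e3 by (simp only: mult_ac)
    qed
    then show "has_bochner_integral lborel (\<lambda>x. of_real (exp ((x + - ln y) / 2)) * theta1 g (y * exp (x + - ln y)) * l (x + - ln y))
       (of_real (1 / sqrt y) * ((w0 - w1 * of_real (ln y)) * Lam g (1 / 2) + w1 * Lam' g (1 / 2)))"
      using has_bochner_integral_mult_right[OF Lam_linear[where f = g and u = "1 / 2" and ?c0.0 = "w0 - w1 * of_real (ln y)" and ?c1.0 = w1, OF K perg], of "of_real (1 / sqrt y)"]
      by (simp only:)
  qed
  have infP: "infinite pairs"
  proof
    assume "finite pairs"
    then have "finite ((\<lambda>n. (1 :: int, n)) ` (UNIV - {0 :: int}))" by (rule finite_subset[rotated]) (auto simp: pairs_def)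
    then have "finite (UNIV - {0 :: int})" by (rule finite_imageD) (simp add: inj_on_def)
    then show False using infinite_UNIV_int by simp
  qed
  have bij: "bij_betw (from_nat_into pairs) UNIV pairs"
    by (rule bij_betw_from_nat_into) (use infP in auto)
  define G where "G m k = fhat M (\<phi> m) k * ee (of_int k * (of_int m * Re z) / of_nat M)" for m k
  have fG: "f (m, k) = (\<lambda>\<tau>. G m k * (w0 * of_real (kerB (of_int m) (of_int k / real M) y \<tau>) + w1 * (of_real \<tau> * of_real (kerB (of_int m) (of_int k / real M) y \<tau>))))" for m k
    by (rule ext) (simp add: f_def kerT_def G_def l_def y_def algebra_simps)
  \<comment> \<open>\<open>eis_term\<close> already contains the prefactor pi/(2y) of
    \<open>eisI\<close> and the factor C of the row formula; dividing by both leaves the bare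
    integral.\<close>
  have fI: "has_bochner_integral lborel (f p) (eis_term w0 w1 M \<phi> z p * (2 * of_real y / of_real pi / C))" if p: "p \<in> pairs" for p
  proof -
    obtain m k where mk: "p = (m, k)" "m \<noteq> 0" "k \<noteq> 0" using p by (auto simp: pairs_def)
    define \<xi> where "\<xi> = of_int k / real M"
    have \<xi>: "\<xi> \<noteq> 0" using mk M by (simp add: \<xi>_def)
    have mr: "real_of_int m \<noteq> 0" using mk by simp
    have ab: "\<bar>of_int m * \<xi>\<bar> = \<bar>of_int m * of_int k\<bar> / of_nat M" by (simp add: \<xi>_def abs_mult)
    have si: "sgn (real_of_int j) = of_int (sgn j)" for j by (simp add: sgn_if)
    have sg: "sgn \<xi> = of_int (sgn k)" using M si[of k] by (simp add: \<xi>_def sgn_divide)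
    note sm = si[of m]
    have rt: "\<bar>\<xi>\<bar> / \<bar>of_int m\<bar> = \<bar>of_int k\<bar> / (of_nat M * \<bar>of_int m\<bar>)" by (simp add: \<xi>_def)
    note k0 = kerB_integrals(1)[OF mr \<xi> y0] and k1 = kerB_integrals(2)[OF mr \<xi> y0]
    define J0 where "J0 = of_int (sgn m + sgn k) * exp (- 2 * pi * y * (\<bar>of_int m * of_int k\<bar> / of_nat M))"
    define J1 where "J1 = of_int (sgn m - sgn k) * exp (2 * pi * y * (\<bar>of_int m * of_int k\<bar> / of_nat M)) * e1int (y * (\<bar>of_int m * of_int k\<bar> / of_nat M))"
    define lr :: real where "lr = ln (\<bar>of_int k\<bar> / (of_nat M * \<bar>of_int m\<bar>))"
    have k0': "has_bochner_integral lborel (\<lambda>x. complex_of_real (kerB (of_int m) \<xi> y x)) (of_real (J0 / sqrt y))"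
      using k0 unfolding ab sg sm J0_def of_int_add[symmetric] .
    have k1': "has_bochner_integral lborel (\<lambda>x. of_real x * complex_of_real (kerB (of_int m) \<xi> y x)) (of_real ((J0 * lr + J1) / sqrt y))"
    proof -
      have "(sgn (real_of_int m) + sgn \<xi>) * ln (\<bar>\<xi>\<bar> / \<bar>of_int m\<bar>) * exp (- 2 * pi * y * \<bar>of_int m * \<xi>\<bar>) +
         (sgn (of_int m) - sgn \<xi>) * exp (2 * pi * y * \<bar>of_int m * \<xi>\<bar>) * e1int (y * \<bar>of_int m * \<xi>\<bar>) = J0 * lr + J1"
        unfolding ab sg sm rt lr_def[symmetric] J0_def J1_def of_int_add[symmetric] of_int_diff[symmetric] by (simp only: mult_ac)
      then show ?thesis using k1 by (simp only:)
    qed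
    have H: "has_bochner_integral lborel (f p) (G m k * (w0 * of_real (J0 / sqrt y) + w1 * of_real ((J0 * lr + J1) / sqrt y)))"
      unfolding mk(1) fG \<xi>_def[symmetric]
      by (intro has_bochner_integral_mult_right has_bochner_integral_add k0' k1')
    have "C \<noteq> 0" using M y0 by (simp add: C_def)
    define P where "P = - (of_real pi * \<i> / (2 * complex_of_nat M))"
    define Z where "Z = G m k * (w0 * of_real J0 + w1 * of_real (J0 * lr + J1))"
    have t: "eis_term w0 w1 M \<phi> z p = P * Z"
      unfolding mk(1) eis_term_def G_def J0_def J1_def lr_def y_def P_def Z_def by (simp add: algebra_simps)
    have pq: "P * (2 * of_real y / of_real pi / C) = 1 / complex_of_real (sqrt y)"
      using M y0 by (simp add: C_def P_def field_simps)
    have "eis_term w0 w1 M \<phi> z p * (2 * of_real y / of_real pi / C) = (P * (2 * of_real y / of_real pi / C)) * Z"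
      unfolding t by (simp only: mult_ac)
    also have "\<dots> = (1 / complex_of_real (sqrt y)) * Z" unfolding pq ..
    also have "\<dots> = G m k * (w0 * of_real (J0 / sqrt y) + w1 * of_real ((J0 * lr + J1) / sqrt y))"
      unfolding Z_def by (simp add: divide_inverse algebra_simps)
    finally show ?thesis using H by (simp only:)
  qed
  define A :: "int \<times> int \<Rightarrow> real"
    where "A p = (case p of (m, k) \<Rightarrow> (\<bar>of_int m\<bar> + \<bar>of_int k\<bar>) * exp (- (pi * y / M) * (\<bar>of_int m\<bar> * \<bar>of_int k\<bar>)))" for p
  have A: "A summable_on pairs" unfolding A_def using summable_pairs_exp_mult[of "pi * y / M"] y0 M by simp
  define h where "h \<tau> = (real M * B) * ((norm w0 + norm w1) * (W \<tau> ^ 2 * exp (- (pi * y / (2 * (real M)\<^sup>2)) * W \<tau>)))" for \<tau>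
  have h: "integrable lborel h" unfolding h_def
    by (intro integrable_mult_right integrable_W) (use y0 M in simp)
  have bd: "norm (f p \<tau>) \<le> A p * h \<tau>" if p: "p \<in> pairs" for p \<tau>
  proof -
    obtain m k where mk: "p = (m, k)" "m \<noteq> 0" "k \<noteq> 0" using p by (auto simp: pairs_def)
    have l: "norm (l \<tau>) \<le> (norm w0 + norm w1) * W \<tau>"
    proof -
      have "norm (l \<tau>) \<le> norm w0 * 1 + norm w1 * \<bar>\<tau>\<bar>" unfolding l_def by (rule order_trans[OF norm_triangle_ineq]) (simp add: norm_mult)
      also have "\<dots> \<le> norm w0 * W \<tau> + norm w1 * W \<tau>" using W_ge_2[of \<tau>] W_ge_abs[of \<tau>] by (intro add_mono mult_left_mono) auto
      finally show ?thesis by (simp add: ring_distribs)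
    qed
    have "norm (f p \<tau>) = norm (fhat M (\<phi> m) k) * \<bar>kerB (of_int m) (of_int k / real M) y \<tau>\<bar> * norm (l \<tau>)"
      by (simp add: f_def kerT_def mk norm_mult y_def)
    also have "\<dots> \<le> (real M * B) * (A p * (W \<tau> * exp (- (pi * y / (2 * (real M)\<^sup>2)) * W \<tau>))) * ((norm w0 + norm w1) * W \<tau>)"
      using fhat_bounded[of "\<phi> m" B M k, OF B] kerB_bound[OF mk(2,3) y0 M, of \<tau>] l B0
      by (intro mult_mono) (auto simp: A_def mk(1))
    also have "\<dots> = A p * h \<tau>" unfolding h_def power2_eq_square by (simp only: mult_ac)
    finally show ?thesis .
  qed
  have pt: "(\<lambda>p. norm (f p \<tau>)) summable_on pairs" for \<tau>
    by (rule Infinite_Sum.abs_summable_on_comparison_test'[OF summable_on_cmult_left[OF A] bd])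
  have int: "integrable lborel (f p)" if "p \<in> pairs" for p using fI[OF that] by (simp add: has_bochner_integral_iff)
  have s: "(\<lambda>p. integral\<^sup>L lborel (\<lambda>\<tau>. norm (f p \<tau>))) summable_on pairs"
  proof (rule summable_on_comparison_test[OF summable_on_cmult_left[OF A]])
    fix p assume p: "p \<in> pairs"
    have "integral\<^sup>L lborel (\<lambda>\<tau>. norm (f p \<tau>)) \<le> integral\<^sup>L lborel (\<lambda>\<tau>. A p * h \<tau>)"
      by (rule integral_mono) (use int[OF p] h bd[OF p] in auto)
    then show "integral\<^sup>L lborel (\<lambda>\<tau>. norm (f p \<tau>)) \<le> A p * integral\<^sup>L lborel h" by simp
  qed simp
  note ex = has_sum_lborel_integral[OF bij int pt s]
  define S where "S = integral\<^sup>L lborel (\<lambda>\<tau>. \<Sum>\<^sub>\<infinity>p\<in>pairs. f p \<tau>)"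
  have sum1: "((\<lambda>p. eis_term w0 w1 M \<phi> z p * (2 * of_real y / of_real pi / C)) has_sum S) pairs"
  proof -
    have "integral\<^sup>L lborel (f p) = eis_term w0 w1 M \<phi> z p * (2 * of_real y / of_real pi / C)" if "p \<in> pairs" for p
      using fI[OF that] by (simp only: has_bochner_integral_iff)
    from has_sum_cong[of pairs, OF this] show ?thesis using ex(1) unfolding S_def by (simp only:)
  qed
  have C0: "C \<noteq> 0" using M y0 by (simp add: C_def)
  define D where "D = of_real pi * C / (2 * complex_of_real y)"
  have "((\<lambda>p. eis_term w0 w1 M \<phi> z p * (2 * of_real y / of_real pi / C) * D) has_sum (S * D)) pairs"
    by (rule has_sum_cmult_left[OF sum1])
  moreover have "2 * of_real y / of_real pi / C * D = 1" using C0 y0 by (simp add: D_def)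
  ultimately have sum2: "(eis_term w0 w1 M \<phi> z has_sum (S * D)) pairs" by (simp only: mult.assoc mult_1_right)
  have int_eq: "of_real (exp \<tau>) * theta2 \<phi> z (exp \<tau>) * l \<tau> =
      of_real (exp \<tau>) * theta1 (\<phi> 0) (exp \<tau> / y) * l \<tau> + (C * (of_real (exp (\<tau> / 2)) * theta1 g (y * exp \<tau>) * l \<tau>) + C * (\<Sum>\<^sub>\<infinity>p\<in>pairs. f p \<tau>))" for \<tau>
  proof -
    have "(\<Sum>\<^sub>\<infinity>p\<in>pairs. f p \<tau>) = (\<Sum>\<^sub>\<infinity>p\<in>pairs. kerT M \<phi> z p \<tau>) * l \<tau>" unfolding f_def by (rule infsum_cmult_left')
    then show ?thesis unfolding theta2_split[where \<phi> = \<phi>, OF y M per B] g_def C_def y_def by (simp only: ring_distribs mult.assoc add.assoc)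
  qed
  have I3: "has_bochner_integral lborel (\<lambda>\<tau>. \<Sum>\<^sub>\<infinity>p\<in>pairs. f p \<tau>) S"
    using ex(2) by (simp add: has_bochner_integral_iff S_def)
  have "has_bochner_integral lborel (\<lambda>\<tau>. of_real (exp \<tau>) * theta2 \<phi> z (exp \<tau>) * l \<tau>)
     (of_real y * ((w0 + w1 * of_real (ln y)) * Lam (\<phi> 0) 1 + w1 * Lam' (\<phi> 0) 1) +
      (C * (of_real (1 / sqrt y) * ((w0 - w1 * of_real (ln y)) * Lam g (1 / 2) + w1 * Lam' g (1 / 2))) + C * S))"
    unfolding int_eq by (intro has_bochner_integral_add has_bochner_integral_mult_right I1 I2 I3)
  then have "eisI w0 w1 \<phi> z = of_real pi / (2 * of_real y) *
     (of_real y * ((w0 + w1 * of_real (ln y)) * Lam (\<phi> 0) 1 + w1 * Lam' (\<phi> 0) 1) +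
      (C * (of_real (1 / sqrt y) * ((w0 - w1 * of_real (ln y)) * Lam g (1 / 2) + w1 * Lam' g (1 / 2))) + C * S))"
    unfolding eisI_def y_def[symmetric] l_def by (simp add: has_bochner_integral_iff)
  moreover have "of_real pi / (2 * of_real y) * (of_real y * X + (C * (of_real (1 / sqrt y) * Y) + C * S)) =
      of_real pi / 2 * X - of_real pi * \<i> / (2 * of_nat M) * Y + S * D" for X Y
  proof -
    have a: "of_real pi / (2 * complex_of_real y) * of_real y = of_real pi / 2" using y0 by simp
    have b: "of_real pi / (2 * complex_of_real y) * (C * of_real (1 / sqrt y)) = - (of_real pi * \<i> / (2 * of_nat M))"
      using y0 M by (simp add: C_def field_simps)
    have c: "of_real pi / (2 * complex_of_real y) * C = D" by (simp add: D_def)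
    have "of_real pi / (2 * of_real y) * (of_real y * X + (C * (of_real (1 / sqrt y) * Y) + C * S)) =
      (of_real pi / (2 * complex_of_real y) * of_real y) * X + ((of_real pi / (2 * complex_of_real y) * (C * of_real (1 / sqrt y))) * Y + (of_real pi / (2 * complex_of_real y) * C) * S)"
      by (simp only: distrib_left mult.assoc)
    then show ?thesis unfolding a b c by (simp add: mult.commute)
  qed
  ultimately have "eisI w0 w1 \<phi> z - eis_const w0 w1 M \<phi> (Im z) = S * D"
    unfolding eis_const_def y_def[symmetric] g_def[symmetric] by simp
  then show ?thesis using sum2 by simp
qed

section \<open>Real-analyticity and derivatives of the expansions\<close>

lemma real_analytic_onE:
  assumes "real_analytic_on F U" "w \<in> U"
  obtains r a where "r > 0" "\<And>z. z \<in> ball w r \<Longrightarrow>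
        ((\<lambda>(j, k). a j k * of_real (Re z - Re w) ^ j * of_real (Im z - Im w) ^ k) has_sum F z) UNIV"
proof -
  from bspec[OF assms(1)[unfolded real_analytic_on_def] assms(2)]
  show ?thesis by (elim exE conjE) (rule that, assumption, erule bspec, assumption)
qed

lemma real_analytic_add:
  assumes "real_analytic_on F U" "real_analytic_on G U"
  shows "real_analytic_on (\<lambda>z. F z + G z) U"
  unfolding real_analytic_on_def
proof
  fix w assume w: "w \<in> U"
  obtain r1 a1 where 1: "r1 > 0" "\<And>z. z \<in> ball w r1 \<Longrightarrow>
        ((\<lambda>(j, k). a1 j k * of_real (Re z - Re w) ^ j * of_real (Im z - Im w) ^ k) has_sum F z) UNIV"
    by (rule real_analytic_onE[OF assms(1) w]) (rule that)
  obtain r2 a2 where 2: "r2 > 0" "\<And>z. z \<in> ball w r2 \<Longrightarrow>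
        ((\<lambda>(j, k). a2 j k * of_real (Re z - Re w) ^ j * of_real (Im z - Im w) ^ k) has_sum G z) UNIV"
    by (rule real_analytic_onE[OF assms(2) w]) (rule that)
  have "((\<lambda>(j, k). (a1 j k + a2 j k) * of_real (Re z - Re w) ^ j * of_real (Im z - Im w) ^ k) has_sum (F z + G z)) UNIV"
    if "z \<in> ball w (min r1 r2)" for z
    using has_sum_add[OF 1(2)[of z] 2(2)[of z]] that by (simp add: case_prod_unfold ring_distribs)
  then show "\<exists>r>0. \<exists>a. \<forall>z\<in>ball w r. ((\<lambda>(j, k). a j k * of_real (Re z - Re w) ^ j * of_real (Im z - Im w) ^ k) has_sum (F z + G z)) UNIV"
    using 1(1) 2(1) by (intro exI[of _ "min r1 r2"] conjI exI[of _ "\<lambda>j k. a1 j k + a2 j k"] ballI) auto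
qed

lemma exp_has_sum:
  fixes c :: complex shows "((\<lambda>j. c ^ j / fact j) has_sum exp c) (UNIV :: nat set)"
    and "((\<lambda>j. norm (c ^ j / fact j)) has_sum exp (norm c)) (UNIV :: nat set)"
proof -
  have s: "(\<lambda>j. norm c ^ j / fact j) sums exp (norm c)" using exp_converges[of "norm c"] by (simp add: divide_inverse mult.commute)
  have n: "norm (c ^ j / fact j) = norm c ^ j / fact j" for j by (simp add: norm_divide norm_power)
  have "(\<lambda>j. c ^ j / fact j) sums exp c" using exp_converges[of c] by (simp add: scaleR_conv_of_real divide_inverse mult.commute)
  then show "((\<lambda>j. c ^ j / fact j) has_sum exp c) UNIV"
    by (rule norm_summable_imp_has_sum[rotated]) (unfold n, rule sums_summable[OF s])
  show "((\<lambda>j. norm (c ^ j / fact j)) has_sum exp (norm c)) UNIV"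
    unfolding n by (rule norm_summable_imp_has_sum[OF _ s]) (use s sums_summable in auto)
qed

text \<open>The exponential is expanded in powers of Re z - Re w and each \<open>b n\<close> in
  powers of Im z - Im w. The triple series over n, j, k converges absolutely, so it may be summed
  over n first, and this gives the coefficients of one double power series.\<close>

lemma fourier_series_real_analytic:
  fixes freq :: "'i \<Rightarrow> real" and b :: "'i \<Rightarrow> complex \<Rightarrow> complex" and B :: "'i \<Rightarrow> real"
  assumes r: "r > 0" "2 * r < R"
    and hol: "\<And>n. b n holomorphic_on ball (of_real (Im w)) R"
    and bd: "\<And>n y. y \<in> ball (of_real (Im w)) R \<Longrightarrow> norm (b n y) \<le> B n"
    and s: "(\<lambda>n. B n * exp (\<bar>freq n\<bar> * r)) summable_on UNIV"
  shows "\<exists>a. \<forall>z\<in>ball w r. ((\<lambda>(j, k). a j k * of_real (Re z - Re w) ^ j * of_real (Im z - Im w) ^ k) has_sum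
      (\<Sum>\<^sub>\<infinity>n. exp (\<i> * of_real (freq n) * of_real (Re z)) * b n (of_real (Im z)))) UNIV"
proof -
  define y0 where "y0 = complex_of_real (Im w)"
  define \<beta> where "\<beta> n k = (deriv ^^ k) (b n) y0 / fact k" for n k
  have B0: "B n \<ge> 0" for n using order_trans[OF norm_ge_zero bd[of y0 n]] r by (simp add: y0_def)
  \<comment> \<open>Cauchy's estimate on a circle of radius 2r, twice the radius of the ball, makes
    the expansion in Im z - Im w geometric with ratio 1/2.\<close>
  have \<beta>: "norm (\<beta> n k) \<le> B n / (2 * r) ^ k" for n k
  proof -
    have "norm ((deriv ^^ k) (b n) y0) \<le> fact k * B n / (2 * r) ^ k"
    proof (rule Cauchy_inequality)
      show "b n holomorphic_on ball y0 (2 * r)" using hol[of n] r by (auto intro: holomorphic_on_subset simp: y0_def)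
      have "cball y0 (2 * r) \<subseteq> ball y0 R" using r by (auto simp: dist_norm)
      then show "continuous_on (cball y0 (2 * r)) (b n)"
        using hol[of n] holomorphic_on_imp_continuous_on continuous_on_subset unfolding y0_def by blast
      show "norm (b n x) \<le> B n" if "norm (y0 - x) = 2 * r" for x
        by (rule bd) (use that r in \<open>simp add: y0_def dist_norm\<close>)
    qed (use r in simp)
    then show ?thesis by (simp add: \<beta>_def norm_divide field_simps)
  qed
  define E where "E n = exp (\<i> * of_real (freq n) * of_real (Re w))" for n
  have nE: "norm (E n) = 1" for n by (simp add: E_def norm_exp_eq_Re)
  define a where "a j k = (\<Sum>\<^sub>\<infinity>n. E n * ((\<i> * of_real (freq n)) ^ j / fact j) * \<beta> n k)" for j k
  show ?thesis
  proof (intro exI[of _ a] ballI)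
    fix z assume z: "z \<in> ball w r"
    define X where "X = Re z - Re w"
    define Y where "Y = Im z - Im w"
    have XY: "\<bar>X\<bar> \<le> r" "\<bar>Y\<bar> \<le> r" "\<bar>Y\<bar> < R"
      using z r abs_Re_le_cmod[of "z - w"] abs_Im_le_cmod[of "z - w"] by (auto simp: X_def Y_def dist_norm norm_minus_commute)
    define g where "g = (\<lambda>(n, p). case p of (j, k) \<Rightarrow> E n * ((\<i> * of_real (freq n) * of_real X) ^ j / fact j) * (\<beta> n k * of_real Y ^ k))"
    have in1: "((\<lambda>(j, k). norm (g (n, (j, k)))) has_sum (exp (\<bar>freq n * X\<bar>) * (\<Sum>\<^sub>\<infinity>k. norm (\<beta> n k * of_real Y ^ k)))) (UNIV \<times> UNIV)"
      and kbd: "(\<Sum>\<^sub>\<infinity>k. norm (\<beta> n k * of_real Y ^ k)) \<le> 2 * B n"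
      and ks: "(\<lambda>k. norm (\<beta> n k * of_real Y ^ k)) summable_on UNIV" for n
    proof -
      have bk: "norm (\<beta> n k * of_real Y ^ k) \<le> B n * (1 / 2) ^ k" for k
      proof -
        have "norm (\<beta> n k * of_real Y ^ k) \<le> B n / (2 * r) ^ k * r ^ k"
          unfolding norm_mult norm_power using \<beta>[of n k] XY r B0[of n] by (intro mult_mono power_mono) auto
        also have "\<dots> = B n * (1 / 2) ^ k" using r by (simp add: power_mult_distrib power_divide)
        finally show ?thesis .
      qed
      have "((\<lambda>k. (1 / 2 :: real) ^ k) has_sum 2) UNIV"
        using geometric_sums[of "1 / 2 :: real"] by (intro norm_summable_imp_has_sum) (auto intro: summable_geometric)
      then have gs: "((\<lambda>k. B n * (1 / 2 :: real) ^ k) has_sum (B n * 2)) UNIV" by (rule has_sum_cmult_right)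
      show ks: "(\<lambda>k. norm (\<beta> n k * of_real Y ^ k)) summable_on UNIV"
        by (rule Infinite_Sum.abs_summable_on_comparison_test'[OF has_sum_imp_summable[OF gs] bk])
      show "(\<Sum>\<^sub>\<infinity>k. norm (\<beta> n k * of_real Y ^ k)) \<le> 2 * B n"
        using infsum_mono[OF ks has_sum_imp_summable[OF gs] bk] infsumI[OF gs] by (simp add: mult.commute)
      have e: "((\<lambda>j. norm ((\<i> * of_real (freq n) * of_real X) ^ j / fact j)) has_sum exp (\<bar>freq n * X\<bar>)) UNIV"
        using exp_has_sum(2)[of "\<i> * of_real (freq n) * of_real X"] by (simp add: norm_mult abs_mult)
      define V where "V = (\<Sum>\<^sub>\<infinity>k. norm (\<beta> n k * of_real Y ^ k))"
      have row: "((\<lambda>k. norm (g (n, (j, k)))) has_sum (norm ((\<i> * of_real (freq n) * of_real X) ^ j / fact j) * V)) UNIV" for j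
      proof -
        have "norm (g (n, (j, k))) = norm ((\<i> * of_real (freq n) * of_real X) ^ j / fact j) * norm (\<beta> n k * of_real Y ^ k)" for k
          unfolding g_def prod.case norm_mult[of "E n * _"] norm_mult[of "E n"] nE by simp
        then show ?thesis
          using has_sum_cmult_right[OF has_sum_infsum[OF ks], of "norm ((\<i> * of_real (freq n) * of_real X) ^ j / fact j)"]
          unfolding V_def by (simp only:)
      qed
      have tot: "((\<lambda>j. norm ((\<i> * of_real (freq n) * of_real X) ^ j / fact j) * V) has_sum (exp (\<bar>freq n * X\<bar>) * V)) UNIV"
        by (rule has_sum_cmult_left[OF e])
      show "((\<lambda>(j, k). norm (g (n, (j, k)))) has_sum (exp (\<bar>freq n * X\<bar>) * (\<Sum>\<^sub>\<infinity>k. norm (\<beta> n k * of_real Y ^ k)))) (UNIV \<times> UNIV)"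
        unfolding V_def[symmetric]
      proof (rule has_sum_SigmaI[OF _ tot])
        show "(\<lambda>(j, k). norm (g (n, (j, k)))) summable_on UNIV \<times> UNIV"
          by (rule summable_on_SigmaI[where g = "\<lambda>j. norm ((\<i> * of_real (freq n) * of_real X) ^ j / fact j) * V"])
             (use row tot in \<open>auto intro: has_sum_imp_summable\<close>)
      qed (use row in simp)
    qed
    have gsum: "(\<lambda>x. norm (g x)) summable_on (UNIV \<times> UNIV)"
    proof (rule summable_on_SigmaI)
      show "((\<lambda>p. norm (g (n, p))) has_sum (exp (\<bar>freq n * X\<bar>) * (\<Sum>\<^sub>\<infinity>k. norm (\<beta> n k * of_real Y ^ k)))) UNIV" for n
        using in1[of n] by (simp add: case_prod_unfold UNIV_Times_UNIV)
      show "(\<lambda>n. exp (\<bar>freq n * X\<bar>) * (\<Sum>\<^sub>\<infinity>k. norm (\<beta> n k * of_real Y ^ k))) summable_on UNIV"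
      proof (rule summable_on_comparison_test)
        show "(\<lambda>n. 2 * (B n * exp (\<bar>freq n\<bar> * r))) summable_on UNIV" by (rule summable_on_cmult_right[OF s])
        fix n
        have "\<bar>freq n * X\<bar> \<le> \<bar>freq n\<bar> * r" using XY by (simp add: abs_mult mult_left_mono)
        then have "exp (\<bar>freq n * X\<bar>) * (\<Sum>\<^sub>\<infinity>k. norm (\<beta> n k * of_real Y ^ k)) \<le> exp (\<bar>freq n\<bar> * r) * (2 * B n)"
          using kbd[of n] by (intro mult_mono) (auto intro: infsum_nonneg)
        then show "exp (\<bar>freq n * X\<bar>) * (\<Sum>\<^sub>\<infinity>k. norm (\<beta> n k * of_real Y ^ k)) \<le> 2 * (B n * exp (\<bar>freq n\<bar> * r))"
          by (simp add: mult_ac)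
        show "0 \<le> exp (\<bar>freq n * X\<bar>) * (\<Sum>\<^sub>\<infinity>k. norm (\<beta> n k * of_real Y ^ k))" by (simp add: infsum_nonneg)
      qed
    qed simp
    then have gS: "(g has_sum infsum g (UNIV \<times> UNIV)) (UNIV \<times> UNIV)"
      by (rule has_sum_infsum[OF Infinite_Sum.abs_summable_summable])
    define S where "S = infsum g (UNIV \<times> UNIV)"
    have byn: "((\<lambda>p. g (n, p)) has_sum (exp (\<i> * of_real (freq n) * of_real (Re z)) * b n (of_real (Im z)))) UNIV" for n
    proof -
      have "(\<lambda>k. \<beta> n k * of_real Y ^ k) sums b n (of_real (Im z))"
      proof -
        have "norm (complex_of_real (Im w) - of_real (Im z)) = \<bar>Y\<bar>"
          unfolding of_real_diff[symmetric] norm_of_real Y_def by (rule abs_minus_commute)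
        then have "of_real (Im z) \<in> ball (complex_of_real (Im w)) R" using XY by (simp add: dist_norm)
        from holomorphic_power_series[OF hol[of n] this] show ?thesis unfolding \<beta>_def y0_def Y_def of_real_diff .
      qed
      moreover have "summable (\<lambda>k. norm (\<beta> n k * of_real Y ^ k))" by (rule summable_on_imp_summable[OF ks])
      ultimately have kk: "((\<lambda>k. \<beta> n k * of_real Y ^ k) has_sum b n (of_real (Im z))) UNIV" by (rule norm_summable_imp_has_sum[rotated])
      have jj: "((\<lambda>j. E n * ((\<i> * of_real (freq n) * of_real X) ^ j / fact j)) has_sum (E n * exp (\<i> * of_real (freq n) * of_real X))) UNIV"
        by (rule has_sum_cmult_right[OF exp_has_sum(1)])
      have "E n * exp (\<i> * of_real (freq n) * of_real X) = exp (\<i> * of_real (freq n) * of_real (Re z))"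
        unfolding E_def exp_add[symmetric] by (rule arg_cong[of _ _ exp]) (simp add: X_def algebra_simps)
      moreover have "((\<lambda>(j, k). g (n, (j, k))) has_sum (E n * exp (\<i> * of_real (freq n) * of_real X) * b n (of_real (Im z)))) (UNIV \<times> UNIV)"
      proof (rule has_sum_SigmaI[OF _ has_sum_cmult_left[OF jj]])
        show "((\<lambda>k. case (j, k) of (j, k) \<Rightarrow> g (n, (j, k))) has_sum (E n * ((\<i> * of_real (freq n) * of_real X) ^ j / fact j) * b n (of_real (Im z)))) UNIV" for j
          using has_sum_cmult_right[OF kk, of "E n * ((\<i> * of_real (freq n) * of_real X) ^ j / fact j)"] by (simp only: g_def prod.case)
        have "(\<lambda>(j, k). norm (g (n, (j, k)))) summable_on (UNIV \<times> UNIV)" by (rule has_sum_imp_summable[OF in1])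
        then show "(\<lambda>(j, k). g (n, (j, k))) summable_on (UNIV \<times> UNIV)"
          by (intro Infinite_Sum.abs_summable_summable[of "\<lambda>(j, k). g (n, (j, k))"]) (simp add: case_prod_unfold)
      qed
      ultimately show ?thesis by (simp add: case_prod_unfold UNIV_Times_UNIV)
    qed
    have sn: "((\<lambda>n. exp (\<i> * of_real (freq n) * of_real (Re z)) * b n (of_real (Im z))) has_sum S) UNIV"
      by (rule has_sum_SigmaD[OF gS[folded S_def]]) (use byn in simp)
    \<comment> \<open>From here n is the inner variable; its sum at fixed (j, k) is the coefficient
      \<open>a j k\<close> times the monomial.\<close>
    have gS': "((\<lambda>(p, n). g (n, p)) has_sum S) (UNIV \<times> UNIV)" using gS unfolding S_def by (subst (asm) has_sum_swap)
    have sp: "((\<lambda>p. \<Sum>\<^sub>\<infinity>n. g (n, p)) has_sum S) UNIV"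
    proof (rule has_sum_SigmaD[OF gS'])
      fix p
      have "(\<lambda>(p, n). norm (g (n, p))) summable_on (UNIV \<times> UNIV)"
        using gsum by (subst summable_on_swap[symmetric]) (simp add: case_prod_unfold)
      then have "(\<lambda>n. norm (g (n, p))) summable_on UNIV"
        by (rule summable_on_SigmaD1[where f = "\<lambda>p n. norm (g (n, p))"]) simp
      then have "((\<lambda>n. g (n, p)) has_sum (\<Sum>\<^sub>\<infinity>n. g (n, p))) UNIV"
        by (rule has_sum_infsum[OF Infinite_Sum.abs_summable_summable])
      then show "((\<lambda>y. case (p, y) of (p, n) \<Rightarrow> g (n, p)) has_sum (\<Sum>\<^sub>\<infinity>n. g (n, p))) UNIV" by simp
    qed
    have ajk: "(\<Sum>\<^sub>\<infinity>n. g (n, (j, k))) = a j k * of_real X ^ j * of_real Y ^ k" for j k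
    proof -
      have "(\<Sum>\<^sub>\<infinity>n. g (n, (j, k))) = (\<Sum>\<^sub>\<infinity>n. (E n * ((\<i> * of_real (freq n)) ^ j / fact j) * \<beta> n k) * (of_real X ^ j * of_real Y ^ k))"
        by (rule infsum_cong) (simp add: g_def power_mult_distrib mult_ac)
      also have "\<dots> = a j k * (of_real X ^ j * of_real Y ^ k)" unfolding a_def by (rule infsum_cmult_left')
      finally show ?thesis by simp
    qed
    have "(\<lambda>p. \<Sum>\<^sub>\<infinity>n. g (n, p)) = (\<lambda>(j, k). a j k * of_real X ^ j * of_real Y ^ k)"
    proof
      fix p :: "nat \<times> nat"
      obtain j k where p: "p = (j, k)" by (cases p)
      show "(\<Sum>\<^sub>\<infinity>n. g (n, p)) = (case p of (j, k) \<Rightarrow> a j k * of_real X ^ j * of_real Y ^ k)"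
        unfolding p prod.case by (rule ajk)
    qed
    then have "((\<lambda>(j, k). a j k * of_real X ^ j * of_real Y ^ k) has_sum S) UNIV"
      using sp by (simp only:)
    moreover have "S = (\<Sum>\<^sub>\<infinity>n. exp (\<i> * of_real (freq n) * of_real (Re z)) * b n (of_real (Im z)))"
      using infsumI[OF sn] by simp
    ultimately show "((\<lambda>(j, k). a j k * of_real (Re z - Re w) ^ j * of_real (Im z - Im w) ^ k) has_sum
      (\<Sum>\<^sub>\<infinity>n. exp (\<i> * of_real (freq n) * of_real (Re z)) * b n (of_real (Im z)))) UNIV"
      by (simp add: X_def Y_def)
  qed
qed

section \<open>The exponential integral as an analytic function\<close>

lemma e1int_has_integral: "v > 0 \<Longrightarrow> ((\<lambda>u. exp (- 4 * pi * u) / u) has_integral e1int v) {v..}"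
  by (rule has_bochner_integral_log_kernel(2))

text \<open>Near v the function is a constant minus a proper integral from the base point v/2, to
  which the fundamental theorem applies.\<close>

lemma e1int_has_derivative:
  assumes v: "v > 0" shows "(e1int has_field_derivative - exp (- 4 * pi * v) / v) (at v)"
proof -
  define f where "f u = exp (- 4 * pi * u) / u" for u :: real
  have cf: "continuous_on {v / 2..b} f" for b unfolding f_def using v by (intro continuous_intros) auto
  have e: "e1int x = e1int (v / 2) - integral {v / 2..x} f" if x: "x > v / 2" for x
  proof -
    have "(f has_integral (integral {v / 2..x} f + e1int x)) ({v / 2..x} \<union> {x..})"
    proof (rule has_integral_Un)
      show "(f has_integral integral {v / 2..x} f) {v / 2..x}" using integrable_continuous_real[OF cf] by blast
      show "(f has_integral e1int x) {x..}" unfolding f_def by (rule e1int_has_integral) (use x v in linarith)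
      have "{v / 2..x} \<inter> {x..} = {x}" using x by auto
      then show "negligible ({v / 2..x} \<inter> {x..})" by simp
    qed
    moreover have "{v / 2..x} \<union> {x..} = {v / 2..}" using x by auto
    moreover have "(f has_integral e1int (v / 2)) {v / 2..}" unfolding f_def by (rule e1int_has_integral) (use v in simp)
    ultimately have "integral {v / 2..x} f + e1int x = e1int (v / 2)" using has_integral_unique by metis
    then show ?thesis by linarith
  qed
  have "((\<lambda>x. integral {v / 2..x} f) has_real_derivative f v) (at v within {v / 2..2 * v})"
    by (rule integral_has_real_derivative[OF cf]) (use v in auto)
  then have "((\<lambda>x. integral {v / 2..x} f) has_real_derivative f v) (at v)"
    using v by (simp add: at_within_Icc_at)
  then have "((\<lambda>x. e1int (v / 2) - integral {v / 2..x} f) has_real_derivative - f v) (at v)"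
    by (auto intro!: derivative_eq_intros)
  then have "(e1int has_real_derivative - f v) (at v)"
    by (rule has_field_derivative_transform_within_open[of _ _ _ "{v / 2<..}"]) (use v e in auto)
  then show ?thesis by (simp add: f_def)
qed

lemma e1int_bounds:
  assumes "v > 0" shows "0 \<le> e1int v" "e1int v \<le> exp (- 4 * pi * v) / (4 * pi * v)"
proof -
  note i = e1int_has_integral[OF assms]
  show "0 \<le> e1int v" by (rule has_integral_nonneg[OF i]) (use assms in auto)
  have "((\<lambda>u. exp (- (4 * pi) * u) * (1 / v)) has_integral (exp (- (4 * pi) * v) / (4 * pi) * (1 / v))) {v..}"
    by (intro has_integral_mult_left has_integral_exp_minus_to_infinity) simp
  from has_integral_le[OF i this] have "e1int v \<le> exp (- (4 * pi) * v) / (4 * pi) * (1 / v)"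
    using assms by (simp add: frac_le)
  then show "e1int v \<le> exp (- 4 * pi * v) / (4 * pi * v)" by simp
qed

text \<open>A primitive on the right half-plane, normalised at 1, extends \<open>e1int\<close>
  holomorphically; Cauchy estimates and termwise differentiation in y need such an extension. The
  bound is obtained along the vertical line through w, where |exp(-4 pi u)| is constant.\<close>

lemma e1int_complex_extension:
  obtains E where "\<And>w. Re w > 0 \<Longrightarrow> (E has_field_derivative - exp (- 4 * of_real pi * w) / w) (at w)"
    "\<And>v. v > 0 \<Longrightarrow> E (of_real v) = of_real (e1int v)"
    "\<And>w. Re w > 0 \<Longrightarrow> norm (E w) \<le> exp (- 4 * pi * Re w) * (1 / (4 * pi * Re w) + \<bar>Im w\<bar> / Re w)"
proof -
  define S where "S = {w :: complex. Re w > 0}"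
  have S: "open S" "convex S" by (simp_all add: S_def open_halfspace_Re_gt convex_halfspace_Re_gt)
  define f where "f w = - exp (- 4 * of_real pi * w) / w" for w :: complex
  have "f holomorphic_on S" unfolding f_def by (intro holomorphic_intros) (auto simp: S_def)
  then obtain P where P: "\<And>w. w \<in> S \<Longrightarrow> (P has_field_derivative f w) (at w within S)"
    using holomorphic_convex_primitive'[OF S(2,1)] by metis
  then have P': "(P has_field_derivative f w) (at w)" if "w \<in> S" for w
    using P[OF that] at_within_open[OF that S(1)] by simp
  define E where "E w = P w - P 1 + of_real (e1int 1)" for w
  have E: "(E has_field_derivative f w) (at w)" if "w \<in> S" for w
    unfolding E_def using DERIV_add[OF DERIV_diff[OF P'[OF that] DERIV_const] DERIV_const] by simp
  have fv: "f (of_real v) = of_real (- exp (- 4 * pi * v) / v)" for v :: real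
    by (simp add: f_def exp_of_real[symmetric])
  have Ev: "E (of_real v) = of_real (e1int v)" if v: "v > 0" for v
  proof -
    define h where "h x = E (of_real x) - of_real (e1int x)" for x :: real
    have d: "(h has_vector_derivative 0) (at x)" if "x > 0" for x
    proof -
      have "((\<lambda>x. E (of_real x)) has_vector_derivative f (of_real x)) (at x)"
        by (rule has_vector_derivative_real_field[OF E]) (use that in \<open>simp add: S_def\<close>)
      moreover have "((\<lambda>x. complex_of_real (e1int x)) has_vector_derivative f (of_real x)) (at x)"
        unfolding fv by (rule has_vector_derivative_of_real)
          (use e1int_has_derivative[OF that] in \<open>simp add: has_real_derivative_iff_has_vector_derivative\<close>)
      ultimately show ?thesis unfolding h_def using has_vector_derivative_diff by fastforce
    qed
    have "\<exists>c. \<forall>x\<in>{0<..}. h x = c"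
      by (rule has_derivative_zero_constant[of "{0<..}" h])
         (use d in \<open>auto simp: has_vector_derivative_def intro: has_derivative_at_withinI\<close>)
    then have "h v = h 1" using v by auto
    then show ?thesis by (simp add: h_def E_def)
  qed
  show ?thesis
  proof (rule that[of E])
    show "(E has_field_derivative - exp (- 4 * of_real pi * w) / w) (at w)" if "Re w > 0" for w
      using E[of w] that by (simp add: S_def f_def)
    show "E (of_real v) = of_real (e1int v)" if "v > 0" for v by (rule Ev[OF that])
    show "norm (E w) \<le> exp (- 4 * pi * Re w) * (1 / (4 * pi * Re w) + \<bar>Im w\<bar> / Re w)" if w: "Re w > 0" for w
    proof -
      define v where "v = Re w"
      have v: "v > 0" using w by (simp add: v_def)
      define L where "L = {u :: complex. Re u = v}"
      have "norm (E w - E (of_real v)) \<le> (exp (- 4 * pi * v) / v) * norm (w - of_real v)"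
      proof (rule field_differentiable_bound[of L])
        show "convex L" unfolding L_def convex_def by (auto simp flip: distrib_right)
        fix u assume u: "u \<in> L"
        then have "u \<in> S" using v by (simp add: L_def S_def)
        then show "(E has_field_derivative f u) (at u within L)" by (rule has_field_derivative_at_within[OF E])
        have "v \<le> norm u" using u complex_Re_le_cmod[of u] by (simp add: L_def)
        then have "exp (- 4 * pi * v) / norm u \<le> exp (- 4 * pi * v) / v" using v by (intro divide_left_mono mult_pos_pos) auto
        then show "norm (f u) \<le> exp (- 4 * pi * v) / v" using u by (simp add: f_def norm_divide norm_exp_eq_Re L_def)
      qed (auto simp: L_def v_def)
      also have "norm (w - of_real v) = \<bar>Im w\<bar>"
      proof -
        have "w - of_real v = \<i> * of_real (Im w)" by (simp add: complex_eq_iff v_def)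
        then show ?thesis by (simp add: norm_mult)
      qed
      finally have "norm (E w) \<le> norm (E (of_real v)) + (exp (- 4 * pi * v) / v) * \<bar>Im w\<bar>"
        using norm_triangle_sub[of "E w" "E (of_real v)"] by linarith
      also have "norm (E (of_real v)) \<le> exp (- 4 * pi * v) / (4 * pi * v)"
        unfolding Ev[OF v] using e1int_bounds[OF v] by simp
      finally show ?thesis by (simp add: v_def ring_distribs)
    qed
  qed
qed

text \<open>The condition \<open>a 0 = 0\<close> is included because the junk value of \<open>e1int\<close> at 0 must not enter \<open>nser\<close>.\<close>

definition poly_seq :: "(nat \<Rightarrow> complex) \<Rightarrow> bool" where
  "poly_seq a \<longleftrightarrow> a 0 = 0 \<and> (\<exists>C k. \<forall>n. norm (a n) \<le> C * real n ^ k)"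

definition hser :: "(nat \<Rightarrow> complex) \<Rightarrow> complex \<Rightarrow> complex" where
  "hser a z = (\<Sum>\<^sub>\<infinity>n. a n * qpow (int n) z)"

definition nser :: "(nat \<Rightarrow> complex) \<Rightarrow> complex \<Rightarrow> complex" where
  "nser b z = (\<Sum>\<^sub>\<infinity>n. b n * of_real (e1int (real n * Im z)) * qpow (- int n) z)"

text \<open>The antiholomorphic series with terms \<open>b n\<close> times the conjugate of q^n. It
  arises because differentiating the exponential integral in y leaves exp(-4 pi n y), and exp(-4 pi
  n y) q^(-n) is the conjugate of q^n.\<close>

definition hbar :: "(nat \<Rightarrow> complex) \<Rightarrow> complex \<Rightarrow> complex" where
  "hbar b z = cnj (hser (\<lambda>n. cnj (b n)) z)"

section \<open>Convergence and termwise differentiation of the two series\<close>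

lemma poly_seq_mult_of_nat:
  assumes "poly_seq a" shows "poly_seq (\<lambda>n. c * of_nat n * a n)"
proof -
  obtain C k where C: "a 0 = 0" "\<And>n. norm (a n) \<le> C * real n ^ k" using assms unfolding poly_seq_def by blast
  have "norm (c * of_nat n * a n) \<le> (norm c * C) * real n ^ (k + 1)" for n
    using mult_left_mono[OF C(2)[of n], of "norm c * real n"] by (simp add: norm_mult mult_ac)
  then show ?thesis using C(1) unfolding poly_seq_def by (intro conjI exI[of _ "norm c * C"] exI[of _ "k + 1"]) auto
qed

lemma poly_seq_cnj: "poly_seq a \<Longrightarrow> poly_seq (\<lambda>n. cnj (a n))"
  unfolding poly_seq_def by simp

lemma poly_seq_summable:
  assumes "poly_seq a" "c > 0" shows "summable (\<lambda>n. norm (a n) * (K * exp (- c * real n)))"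
proof -
  obtain C k where C: "\<And>n. norm (a n) \<le> C * real n ^ k" using assms unfolding poly_seq_def by blast
  show ?thesis
  proof (rule summable_comparison_test')
    show "summable (\<lambda>n. (C * \<bar>K\<bar>) * (real n ^ k * exp (- c * real n)))"
      by (intro summable_mult summable_nat_poly_exp assms)
    fix n
    have "norm (a n) * \<bar>K\<bar> * exp (- c * real n) \<le> (C * real n ^ k) * \<bar>K\<bar> * exp (- c * real n)"
      using C[of n] by (intro mult_right_mono) auto
    then show "norm (norm (a n) * (K * exp (- c * real n))) \<le> (C * \<bar>K\<bar>) * (real n ^ k * exp (- c * real n))"
      by (simp add: abs_mult mult_ac)
  qed
qed

lemma infsum_nat_eq_suminf:
  fixes f :: "nat \<Rightarrow> complex"
  assumes "summable (\<lambda>n. norm (f n))" shows "(f has_sum (\<Sum>n. f n)) UNIV" "infsum f UNIV = (\<Sum>n. f n)"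
proof -
  show h: "(f has_sum (\<Sum>n. f n)) UNIV"
    by (rule norm_summable_imp_has_sum[OF assms]) (rule summable_sums[OF summable_norm_cancel[OF assms]])
  show "infsum f UNIV = (\<Sum>n. f n)" by (rule infsumI[OF h])
qed

lemma norm_qpow: "norm (qpow n z) = exp (- 2 * pi * of_int n * Im z)"
  by (simp add: qpow_def norm_exp_eq_Re)

lemma hser_norm_summable:
  assumes "poly_seq a" "Im z > 0" shows "summable (\<lambda>n. norm (a n * qpow (int n) z))"
  using poly_seq_summable[OF assms(1), of "2 * pi * Im z" 1] assms(2)
  by (simp add: norm_mult norm_qpow mult_ac)

lemma hser_has_sum:
  assumes "poly_seq a" "Im z > 0" shows "((\<lambda>n. a n * qpow (int n) z) has_sum hser a z) UNIV"
  using infsum_nat_eq_suminf[OF hser_norm_summable[OF assms]] by (simp add: hser_def)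

lemma e1int_qpow_bound:
  assumes "n \<ge> 1" "y > 0" shows "e1int (real n * y) \<le> exp (- 4 * pi * (real n * y)) / (4 * pi * y)"
proof -
  have "real n * y > 0" using assms by simp
  from e1int_bounds(2)[OF this]
  have "e1int (real n * y) \<le> exp (- 4 * pi * (real n * y)) / (4 * pi * (real n * y))" .
  also have "\<dots> \<le> exp (- 4 * pi * (real n * y)) / (4 * pi * (1 * y))"
    using assms by (intro divide_left_mono mult_left_mono mult_right_mono mult_pos_pos) auto
  finally show ?thesis by simp
qed

text \<open>The decay exp(-4 pi n y) of the exponential integral outweighs the growth exp(2 pi n y)
  of q^(-n), so the nonholomorphic terms decay at the rate of q^n.\<close>

lemma nser_term_bound:
  assumes b0: "b 0 = 0" and y: "Im z > 0"
  shows "norm (b n * of_real (e1int (real n * Im z)) * qpow (- int n) z) \<le> norm (b n) * (1 / (4 * pi * Im z) * exp (- (2 * pi * Im z) * real n))"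
proof (cases "n = 0")
  case False
  then have n: "n \<ge> 1" by simp
  have e0: "e1int (real n * Im z) \<ge> 0" by (rule e1int_bounds(1)) (use n y in simp)
  have "e1int (real n * Im z) * exp (2 * pi * real n * Im z) \<le> exp (- 4 * pi * (real n * Im z)) / (4 * pi * Im z) * exp (2 * pi * real n * Im z)"
    by (rule mult_right_mono[OF e1int_qpow_bound[OF n y]]) simp
  also have "\<dots> = 1 / (4 * pi * Im z) * exp (- (2 * pi * Im z) * real n)"
    by (simp add: exp_add[symmetric] mult_ac)
  finally have "norm (b n) * (e1int (real n * Im z) * exp (2 * pi * real n * Im z)) \<le> norm (b n) * (1 / (4 * pi * Im z) * exp (- (2 * pi * Im z) * real n))"
    by (rule mult_left_mono) simp
  then show ?thesis using e0 by (simp add: norm_mult norm_qpow mult.assoc)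
qed (simp add: b0)

lemma nser_has_sum:
  assumes "poly_seq b" "Im z > 0"
  shows "((\<lambda>n. b n * of_real (e1int (real n * Im z)) * qpow (- int n) z) has_sum nser b z) UNIV"
    and "summable (\<lambda>n. norm (b n * of_real (e1int (real n * Im z)) * qpow (- int n) z))"
proof -
  show s: "summable (\<lambda>n. norm (b n * of_real (e1int (real n * Im z)) * qpow (- int n) z))"
    by (rule summable_comparison_test'[OF poly_seq_summable[OF assms(1), of "2 * pi * Im z" "1 / (4 * pi * Im z)"]])
       (use nser_term_bound[of b z] assms in \<open>auto simp: poly_seq_def\<close>)
  show "((\<lambda>n. b n * of_real (e1int (real n * Im z)) * qpow (- int n) z) has_sum nser b z) UNIV"
    using infsum_nat_eq_suminf[OF s] by (simp add: nser_def)
qed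

lemma hser_has_field_derivative:
  assumes a: "poly_seq a" and y: "Im z > 0"
  shows "(hser a has_field_derivative hser (\<lambda>n. 2 * of_real pi * \<i> * of_nat n * a n) z) (at z)"
proof -
  define S where "S = {w :: complex. Im w > Im z / 2}"
  have S: "convex S" "open S" "z \<in> S"
    unfolding S_def by (rule convex_halfspace_Im_gt, rule open_halfspace_Im_gt) (use y in simp)
  have int: "z \<in> interior S" using S by (simp add: interior_open)
  define a' where "a' n = 2 * of_real pi * \<i> * of_nat n * a n" for n
  have a': "poly_seq a'" unfolding a'_def by (rule poly_seq_mult_of_nat[OF a])
  have der: "((\<lambda>z. a n * qpow (int n) z) has_field_derivative (a' n * qpow (int n) x)) (at x within S)" for n x
    unfolding qpow_def a'_def by (auto intro!: derivative_eq_intros)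
  have uc: "uniformly_convergent_on S (\<lambda>n x. \<Sum>i<n. a' i * qpow (int i) x)"
  proof (rule Weierstrass_m_test')
    show "norm (a' n * qpow (int n) x) \<le> norm (a' n) * (1 * exp (- (pi * Im z) * real n))" if "x \<in> S" for n x
    proof -
      have "pi * real n * Im z \<le> pi * real n * (2 * Im x)" using that by (intro mult_left_mono) (auto simp: S_def)
      then have "exp (- 2 * pi * of_int (int n) * Im x) \<le> exp (- (pi * Im z) * real n)" by (simp add: mult_ac)
      then show ?thesis by (simp add: norm_mult norm_qpow mult_left_mono)
    qed
    show "summable (\<lambda>n. norm (a' n) * (1 * exp (- (pi * Im z) * real n)))"
      by (rule poly_seq_summable[OF a']) (use y in simp)
  qed
  note ser = has_field_derivative_series'[OF S(1) der uc S(3) summable_norm_cancel[OF hser_norm_summable[OF a y]] int]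
  have eq: "(\<Sum>n. a n * qpow (int n) w) = hser a w" if "w \<in> S" for w
    using infsum_nat_eq_suminf(2)[OF hser_norm_summable[OF a, of w]] that y by (simp add: hser_def S_def)
  have eq': "(\<Sum>n. a' n * qpow (int n) z) = hser a' z"
    using infsum_nat_eq_suminf(2)[OF hser_norm_summable[OF a' y]] by (simp add: hser_def)
  have "((\<lambda>x. \<Sum>n. a n * qpow (int n) x) has_field_derivative hser a' z) (at z)" using ser(2) unfolding eq' .
  then have "(hser a has_field_derivative hser a' z) (at z)"
    by (rule has_field_derivative_transform_within_open[OF _ S(2,3) eq])
  then show ?thesis unfolding a'_def .
qed

lemma has_vector_derivative_Complex:
  assumes "(F has_field_derivative D) (at z)"
  shows "((\<lambda>x. F (Complex x (Im z))) has_vector_derivative D) (at (Re z))"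
    and "((\<lambda>y. F (Complex (Re z) y)) has_vector_derivative (\<i> * D)) (at (Im z))"
proof -
  have z: "of_real (Re z) + \<i> * of_real (Im z) = z" by (simp add: complex_eq_iff)
  have "((\<lambda>w. F (w + \<i> * of_real (Im z))) has_field_derivative D * 1) (at (of_real (Re z)))"
    by (rule DERIV_chain2[of F]) (use assms z in \<open>auto intro!: derivative_eq_intros\<close>)
  from has_vector_derivative_real_field[OF this]
  show "((\<lambda>x. F (Complex x (Im z))) has_vector_derivative D) (at (Re z))" by (simp add: Complex_eq)
  have "((\<lambda>w. F (of_real (Re z) + \<i> * w)) has_field_derivative D * \<i>) (at (of_real (Im z)))"
    by (rule DERIV_chain2[of F]) (use assms z in \<open>auto intro!: derivative_eq_intros\<close>)
  from has_vector_derivative_real_field[OF this]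
  show "((\<lambda>y. F (Complex (Re z) y)) has_vector_derivative (\<i> * D)) (at (Im z))" by (simp add: Complex_eq mult.commute)
qed

text \<open>The variable x is complexified: on Im w < y/2 the factor q^(-n) grows at most like exp(3
  pi n y), still beaten by exp(-4 pi n y), so complex termwise differentiation applies.\<close>

lemma nser_derivative_x:
  assumes b: "poly_seq b" and y: "Im z > 0"
  shows "((\<lambda>x. nser b (Complex x (Im z))) has_vector_derivative nser (\<lambda>n. (- 2 * of_real pi * \<i>) * of_nat n * b n) z) (at (Re z))"
proof -
  define y where "y = Im z"
  have y0: "y > 0" using y by (simp add: y_def)
  define b' where "b' n = (- 2 * of_real pi * \<i>) * of_nat n * b n" for n
  have b': "poly_seq b'" unfolding b'_def by (rule poly_seq_mult_of_nat[OF b])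
  define S where "S = {w :: complex. Im w < y / 2}"
  have S: "convex S" "open S" "of_real (Re z) \<in> S"
    unfolding S_def by (rule convex_halfspace_Im_lt, rule open_halfspace_Im_lt) (use y0 in simp)
  have int: "of_real (Re z) \<in> interior S" using S by (simp add: interior_open)
  define e where "e n w = of_real (e1int (real n * y)) * qpow (- int n) (w + \<i> * of_real y)" for n w
  have der: "((\<lambda>w. b n * e n w) has_field_derivative (b' n * e n w)) (at w within S)" for n w
    unfolding qpow_def b'_def e_def by (auto intro!: derivative_eq_intros)
  have e_eq: "b n * e n (of_real x) = b n * of_real (e1int (real n * Im (Complex x y))) * qpow (- int n) (Complex x y)" for n x and b :: "nat \<Rightarrow> complex"
    by (simp add: e_def Complex_eq mult.assoc)
  have uc: "uniformly_convergent_on S (\<lambda>n w. \<Sum>i<n. b' i * e i w)"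
  proof (rule Weierstrass_m_test')
    show "norm (b' n * e n w) \<le> norm (b' n) * (1 / (4 * pi * y) * exp (- (pi * y) * real n))" if w: "w \<in> S" for n w
    proof (cases "n = 0")
      case False
      then have n: "n \<ge> 1" by simp
      have e0: "e1int (real n * y) \<ge> 0" by (rule e1int_bounds(1)) (use n y0 in simp)
      have q: "norm (qpow (- int n) (w + \<i> * of_real y)) \<le> exp (3 * pi * y * real n)"
      proof -
        have "2 * pi * real n * (Im w + y) \<le> 2 * pi * real n * (3 / 2 * y)" using w by (intro mult_left_mono) (auto simp: S_def)
        then show ?thesis by (simp add: norm_qpow mult_ac)
      qed
      have "norm (e n w) \<le> exp (- 4 * pi * (real n * y)) / (4 * pi * y) * exp (3 * pi * y * real n)"
        unfolding e_def norm_mult norm_of_real using q e0 e1int_qpow_bound[OF n y0] y0 by (intro mult_mono) auto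
      also have "\<dots> = 1 / (4 * pi * y) * exp (- (pi * y) * real n)" by (simp add: exp_add[symmetric] algebra_simps)
      finally show ?thesis unfolding norm_mult by (rule mult_left_mono) simp
    qed (simp add: b'_def)
    show "summable (\<lambda>n. norm (b' n) * (1 / (4 * pi * y) * exp (- (pi * y) * real n)))"
      by (rule poly_seq_summable[OF b']) (use y0 in simp)
  qed
  have sm: "summable (\<lambda>n. b n * e n (of_real (Re z)))"
    using summable_norm_cancel[OF nser_has_sum(2)[OF b y]] unfolding e_eq by (simp add: y_def)
  note ser = has_field_derivative_series'[OF S(1) der uc S(3) sm int]
  have eq: "(\<Sum>n. b n * e n (of_real x)) = nser b (Complex x y)" if "poly_seq b" for x b
    unfolding e_eq using infsum_nat_eq_suminf(2)[OF nser_has_sum(2)[OF that, of "Complex x y"]] y0 by (simp add: nser_def)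
  from has_vector_derivative_real_field[OF ser(2), of UNIV]
  show ?thesis unfolding eq[OF b] eq[OF b'] unfolding b'_def y_def complex_surj .
qed

text \<open>In the region given by the two bounds on w the ratio |Im w|/Re w is at most 1, so the
  complex extension keeps the decay of the real exponential integral up to a constant.\<close>

lemma e1_extension_bound:
  fixes E :: "complex \<Rightarrow> complex"
  assumes E: "\<And>w. Re w > 0 \<Longrightarrow> norm (E w) \<le> exp (- 4 * pi * Re w) * (1 / (4 * pi * Re w) + \<bar>Im w\<bar> / Re w)"
    and nq: "norm q = exp (2 * pi * real n * Re w)"
    and w: "Re w \<ge> y / 2" "\<bar>Im w\<bar> \<le> y / 2" and y0: "y > 0" and n: "n \<noteq> 0"
  shows "norm (E (of_nat n * w) * q) \<le> (1 / (2 * pi * y) + 1) * exp (- (pi * y) * real n)"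
proof -
  define K where "K = 1 / (2 * pi * y) + 1"
  define v where "v = Re w"
  have v: "v \<ge> y / 2" "v > 0" using w(1) y0 by (auto simp: v_def)
  have rn: "Re (of_nat n * w) = real n * v" by (simp add: v_def)
  have "norm (E (of_nat n * w)) \<le> exp (- 4 * pi * (real n * v)) * (1 / (4 * pi * (real n * v)) + \<bar>Im (of_nat n * w)\<bar> / (real n * v))"
    using E[of "of_nat n * w"] v n unfolding rn by simp
  also have "\<dots> \<le> exp (- 4 * pi * (real n * v)) * K"
  proof (rule mult_left_mono)
    have "2 * pi * y \<le> 4 * pi * (real n * v)"
    proof -
      have "1 * (y / 2) \<le> real n * v" using v n y0 by (intro mult_mono) auto
      then have "4 * pi * (1 * (y / 2)) \<le> 4 * pi * (real n * v)" by (intro mult_left_mono) auto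
      then show ?thesis by simp
    qed
    then have "1 / (4 * pi * (real n * v)) \<le> 1 / (2 * pi * y)" using y0 v n by (intro divide_left_mono mult_pos_pos) auto
    moreover have "\<bar>Im (of_nat n * w)\<bar> / (real n * v) \<le> 1"
    proof -
      have "\<bar>Im w\<bar> \<le> v" using w(2) v by linarith
      then show ?thesis using v n by (simp add: abs_mult divide_le_eq)
    qed
    ultimately show "1 / (4 * pi * (real n * v)) + \<bar>Im (of_nat n * w)\<bar> / (real n * v) \<le> K" unfolding K_def by linarith
  qed simp
  finally have "norm (E (of_nat n * w) * q) \<le> exp (- 4 * pi * (real n * v)) * K * exp (2 * pi * real n * v)"
    unfolding norm_mult nq v_def[symmetric] by (rule mult_right_mono) simp
  also have "\<dots> = K * exp (- (2 * pi * real n * v))" by (simp add: exp_add[symmetric] mult_ac)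
  also have "\<dots> \<le> K * exp (- (pi * y) * real n)"
  proof -
    have "2 * pi * real n * (y / 2) \<le> 2 * pi * real n * v" using v by (intro mult_left_mono) auto
    then show ?thesis using y0 by (intro mult_left_mono) (auto simp: K_def mult_ac)
  qed
  finally show ?thesis unfolding K_def .
qed

text \<open>The variable y is complexified on the disc of radius y/2 by means of the extension of
  \<open>e1int\<close>. Differentiating q^(-n) gives the factor 2 pi n; differentiating the
  exponential integral gives -1/y times the antiholomorphic series.\<close>

lemma nser_derivative_y:
  assumes b: "poly_seq b" and y: "Im z > 0"
  shows "((\<lambda>y. nser b (Complex (Re z) y)) has_vector_derivative (nser (\<lambda>n. (2 * of_real pi) * of_nat n * b n) z - hbar b z / of_real (Im z))) (at (Im z))"
proof -
  obtain E where E: "\<And>w. Re w > 0 \<Longrightarrow> (E has_field_derivative - exp (- 4 * of_real pi * w) / w) (at w)"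
    "\<And>v. v > 0 \<Longrightarrow> E (of_real v) = of_real (e1int v)"
    "\<And>w. Re w > 0 \<Longrightarrow> norm (E w) \<le> exp (- 4 * pi * Re w) * (1 / (4 * pi * Re w) + \<bar>Im w\<bar> / Re w)"
    using e1int_complex_extension by metis
  define x where "x = Re z"
  define y where "y = Im z"
  have y0: "y > 0" using y by (simp add: y_def)
  have b0: "b 0 = 0" using b by (simp add: poly_seq_def)
  define b' where "b' n = (2 * of_real pi) * of_nat n * b n" for n
  have b': "poly_seq b'" unfolding b'_def by (rule poly_seq_mult_of_nat[OF b])
  define S where "S = ball (complex_of_real y) (y / 2)"
  have S: "convex S" "open S" "of_real y \<in> S" using y0 by (auto simp: S_def)
  have int: "of_real y \<in> interior S" using S by (simp add: interior_open)
  have Sw: "Re w \<ge> y / 2" "\<bar>Im w\<bar> \<le> y / 2" "w \<noteq> 0" if "w \<in> S" for w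
    using that abs_Re_le_cmod[of "of_real y - w"] abs_Im_le_cmod[of "of_real y - w"] y0 by (auto simp: S_def dist_norm)
  define q where "q n w = exp (- 2 * of_real pi * \<i> * of_nat n * of_real x + 2 * of_real pi * of_nat n * w)" for n :: nat and w :: complex
  define h where "h n w = exp (- 2 * of_real pi * \<i> * of_nat n * of_real x - 2 * of_real pi * of_nat n * w)" for n :: nat and w :: complex
  have nq: "norm (q n w) = exp (2 * pi * real n * Re w)" for n w by (simp add: q_def norm_exp_eq_Re)
  have nh: "norm (h n w) = exp (- 2 * pi * real n * Re w)" for n w by (simp add: h_def norm_exp_eq_Re)
  have q_eq: "q n (of_real v) = qpow (- int n) (Complex x v)" for n v
    by (simp add: q_def qpow_def Complex_eq algebra_simps)
  have h_eq: "h n (of_real v) = cnj (qpow (int n) (Complex x v))" for n v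
    by (simp add: h_def qpow_def Complex_eq exp_cnj algebra_simps)
  define f where "f n w = b n * (E (of_nat n * w) * q n w)" for n w
  define f' where "f' n w = b' n * (E (of_nat n * w) * q n w) - b n * h n w / w" for n w
  have der: "(f n has_field_derivative f' n w) (at w within S)" if w: "w \<in> S" for n w
  proof (cases "n = 0")
    \<comment> \<open>At n = 0 the argument of E would be 0, outside its half-plane;
      \<open>b 0 = 0\<close> removes the term.\<close>
    case True
    have "f n = (\<lambda>w. 0)" "f' n w = 0" by (simp_all add: fun_eq_iff f_def f'_def True b0 b'_def)
    then show ?thesis by simp
  next
    case False
    have "Re (of_nat n * w) > 0" using Sw(1)[OF w] y0 False by simp
    then have dE: "((\<lambda>w. E (of_nat n * w)) has_field_derivative - exp (- 4 * of_real pi * (of_nat n * w)) / (of_nat n * w) * of_nat n) (at w within S)"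
      by (intro DERIV_chain2[where f = E and g = "\<lambda>w. of_nat n * w", OF E(1)]) (auto intro!: derivative_eq_intros)
    have dq: "(q n has_field_derivative q n w * (2 * of_real pi * of_nat n)) (at w within S)"
      unfolding q_def by (auto intro!: derivative_eq_intros)
    \<comment> \<open>The complexified form of the identity between exp(-4 pi n y) q^(-n) and the
      conjugate of q^n.\<close>
    have hq: "exp (- 4 * of_real pi * (of_nat n * w)) * q n w = h n w"
      unfolding q_def h_def exp_add[symmetric] by (rule arg_cong[of _ _ exp]) (simp add: algebra_simps)
    have "(f n has_field_derivative b n * ((- exp (- 4 * of_real pi * (of_nat n * w)) / (of_nat n * w) * of_nat n) * q n w + (q n w * (2 * of_real pi * of_nat n)) * E (of_nat n * w))) (at w within S)"
      unfolding f_def by (rule DERIV_cmult[OF DERIV_mult[OF dE dq]])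
    moreover have "b n * ((- exp (- 4 * of_real pi * (of_nat n * w)) / (of_nat n * w) * of_nat n) * q n w + (q n w * (2 * of_real pi * of_nat n)) * E (of_nat n * w)) = f' n w"
      unfolding f'_def b'_def hq[symmetric] using False Sw(3)[OF w] by (simp add: field_simps)
    ultimately show ?thesis by simp
  qed
  define K where "K = 1 / (2 * pi * y) + 1"
  have Eq: "norm (E (of_nat n * w) * q n w) \<le> K * exp (- (pi * y) * real n)" if w: "w \<in> S" and n: "n \<noteq> 0" for w n
    unfolding K_def by (rule e1_extension_bound[OF E(3) nq Sw(1,2)[OF w] y0 n])
  have hb: "norm (b n * h n w / w) \<le> norm (b n) * (2 / y * exp (- (pi * y) * real n))" if w: "w \<in> S" for w n
  proof -
    have "y / 2 \<le> norm w" using Sw(1)[OF w] complex_Re_le_cmod[of w] by linarith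
    then have i: "1 / norm w \<le> 2 / y" using y0 frac_le[of 1 1 "y / 2" "norm w"] by simp
    have "2 * pi * real n * (y / 2) \<le> 2 * pi * real n * Re w" using Sw(1)[OF w] by (intro mult_left_mono) auto
    then have "exp (- 2 * pi * real n * Re w) \<le> exp (- (pi * y) * real n)" by (simp add: mult_ac)
    then have "1 / norm w * exp (- 2 * pi * real n * Re w) \<le> 2 / y * exp (- (pi * y) * real n)" using i y0 by (intro mult_mono) auto
    then have "norm (b n) * (1 / norm w * exp (- 2 * pi * real n * Re w)) \<le> norm (b n) * (2 / y * exp (- (pi * y) * real n))" by (rule mult_left_mono) simp
    then show ?thesis by (simp add: norm_mult norm_divide nh)
  qed
  have s1: "summable (\<lambda>n. norm (b' n) * (K * exp (- (pi * y) * real n)))" by (rule poly_seq_summable[OF b']) (use y0 in simp)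
  have s2: "summable (\<lambda>n. norm (b n) * (2 / y * exp (- (pi * y) * real n)))" by (rule poly_seq_summable[OF b]) (use y0 in simp)
  have uc: "uniformly_convergent_on S (\<lambda>n w. \<Sum>i<n. f' i w)"
  proof (rule Weierstrass_m_test'[OF _ summable_add[OF s1 s2]])
    fix n w assume w: "w \<in> S"
    have "norm (b' n * (E (of_nat n * w) * q n w)) \<le> norm (b' n) * (K * exp (- (pi * y) * real n))"
    proof (cases "n = 0")
      case False
      then show ?thesis unfolding norm_mult[of "b' n"] by (intro mult_left_mono Eq[OF w]) auto
    qed (simp add: b'_def)
    then show "norm (f' n w) \<le> norm (b' n) * (K * exp (- (pi * y) * real n)) + norm (b n) * (2 / y * exp (- (pi * y) * real n))"
      unfolding f'_def using norm_triangle_ineq4[of "b' n * (E (of_nat n * w) * q n w)" "b n * h n w / w"] hb[OF w, of n] by linarith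
  qed
  have f_eq: "c n * (E (of_nat n * of_real v) * q n (of_real v)) = c n * of_real (e1int (real n * Im (Complex x v))) * qpow (- int n) (Complex x v)"
    if "v > 0" "c 0 = 0" for n v and c :: "nat \<Rightarrow> complex"
  proof (cases "n = 0")
    case False
    then have "E (of_real (real n * v)) = of_real (e1int (real n * v))" using that by (intro E(2)) simp
    then show ?thesis by (simp add: q_eq mult.assoc)
  qed (simp add: that)
  have z: "Complex x y = z" by (simp add: x_def y_def)
  have sm: "summable (\<lambda>n. f n (of_real y))"
    unfolding f_def f_eq[where c = b, OF y0 b0] z using summable_norm_cancel[OF nser_has_sum(2)[OF b y]] .
  note ser = has_field_derivative_series'[OF S(1) der uc S(3) sm int]
  have eq: "(\<Sum>n. f n (of_real v)) = nser b (Complex x v)" if "v > 0" for v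
    unfolding f_def f_eq[where c = b, OF that b0] using infsum_nat_eq_suminf(2)[OF nser_has_sum(2)[OF b, of "Complex x v"]] that by (simp add: nser_def)
  have b'0: "b' 0 = 0" by (simp add: b'_def)
  have eq': "(\<Sum>n. f' n (of_real y)) = nser b' z - hbar b z / of_real y"
  proof -
    have "(\<lambda>n. b' n * (E (of_nat n * of_real y) * q n (of_real y))) sums nser b' z"
      unfolding f_eq[where c = b', OF y0 b'0] z using nser_has_sum(1)[OF b' y] by (rule has_sum_imp_sums)
    moreover have "(\<lambda>n. b n * h n (of_real y)) sums hbar b z"
    proof -
      have "((\<lambda>n. cnj (cnj (b n) * qpow (int n) z)) has_sum hbar b z) UNIV"
        unfolding hbar_def has_sum_cnj_iff by (rule hser_has_sum[OF poly_seq_cnj[OF b] y])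
      from has_sum_imp_sums[OF this] show ?thesis unfolding h_eq z by simp
    qed
    ultimately have "(\<lambda>n. f' n (of_real y)) sums (nser b' z - hbar b z / of_real y)"
      unfolding f'_def by (intro sums_diff sums_divide)
    then show ?thesis by (rule sums_unique[symmetric])
  qed
  have "((\<lambda>v. \<Sum>n. f n (of_real v)) has_vector_derivative (nser b' z - hbar b z / of_real y)) (at y)"
    using has_vector_derivative_real_field[OF ser(2)] unfolding eq' .
  then have "((\<lambda>v. nser b (Complex x v)) has_vector_derivative (nser b' z - hbar b z / of_real y)) (at y)"
    by (rule has_vector_derivative_transform_within_open[of _ _ _ "{0<..}"]) (use y0 eq in auto)
  then show ?thesis unfolding b'_def x_def y_def .
qed

text \<open>On the complex disc of radius y/2 around y = Im w the terms decay like exp(-pi n y), and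
  the ball of radius y/8 costs only exp(pi n y/4) through the frequency 2 pi n.\<close>

lemma hser_real_analytic:
  assumes a: "poly_seq a" shows "real_analytic_on (hser a) upper_half_plane"
  unfolding real_analytic_on_def
proof
  fix w assume "w \<in> upper_half_plane"
  then have y: "Im w > 0" by (simp add: upper_half_plane_def)
  define r where "r = Im w / 8"
  define b where "b n v = a n * exp (- 2 * of_real pi * of_nat n * v)" for n v
  define B where "B n = norm (a n) * exp (- pi * real n * Im w)" for n
  have "\<exists>c. \<forall>z\<in>ball w r. ((\<lambda>(j, k). c j k * of_real (Re z - Re w) ^ j * of_real (Im z - Im w) ^ k) has_sum
      (\<Sum>\<^sub>\<infinity>n. exp (\<i> * of_real (2 * pi * real n) * of_real (Re z)) * b n (of_real (Im z)))) UNIV"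
  proof (rule fourier_series_real_analytic[where R = "Im w / 2" and B = B])
    show "r > 0" "2 * r < Im w / 2" using y by (auto simp: r_def)
    show "b n holomorphic_on ball (of_real (Im w)) (Im w / 2)" for n
      unfolding b_def by (intro holomorphic_intros)
    show "norm (b n v) \<le> B n" if "v \<in> ball (of_real (Im w)) (Im w / 2)" for n v
    proof -
      have "Re v \<ge> Im w / 2" using that abs_Re_le_cmod[of "of_real (Im w) - v"] by (auto simp: dist_norm)
      then have "2 * pi * real n * (Im w / 2) \<le> 2 * pi * real n * Re v" by (intro mult_left_mono) auto
      then show ?thesis unfolding b_def B_def norm_mult by (intro mult_left_mono) (auto simp: norm_exp_eq_Re mult_ac)
    qed
    have "(\<lambda>n. B n * exp (\<bar>2 * pi * real n\<bar> * r)) = (\<lambda>n. norm (a n) * (1 * exp (- (3 / 4 * pi * Im w) * real n)))"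
      unfolding B_def r_def by (simp add: fun_eq_iff mult.assoc exp_add[symmetric])
    moreover have "summable (\<lambda>n. norm (a n) * (1 * exp (- (3 / 4 * pi * Im w) * real n)))"
      by (rule poly_seq_summable[OF a]) (use y in simp)
    ultimately show "(\<lambda>n. B n * exp (\<bar>2 * pi * real n\<bar> * r)) summable_on UNIV"
      by (subst summable_on_UNIV_nonneg_real_iff) (auto simp: B_def)
  qed
  moreover have "(\<Sum>\<^sub>\<infinity>n. exp (\<i> * of_real (2 * pi * real n) * of_real (Re z)) * b n (of_real (Im z))) = hser a z" for z
  proof -
    have "exp (\<i> * of_real (2 * pi * real n) * of_real (Re z)) * b n (of_real (Im z)) = a n * qpow (int n) z" for n
    proof -
      have "\<i> * of_real (2 * pi * real n) * of_real (Re z) + - 2 * of_real pi * of_nat n * of_real (Im z) = 2 * of_real pi * \<i> * of_nat n * z"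
        by (simp add: complex_eq_iff)
      then show ?thesis unfolding b_def qpow_def by (simp add: exp_add[symmetric])
    qed
    then show ?thesis by (simp add: hser_def)
  qed
  ultimately show "\<exists>r>0. \<exists>a'. \<forall>z\<in>ball w r. ((\<lambda>(j, k). a' j k * of_real (Re z - Re w) ^ j * of_real (Im z - Im w) ^ k) has_sum hser a z) UNIV"
    using y by (intro exI[of _ r]) (simp add: r_def)
qed

text \<open>The same frequencies with opposite sign; the terms are holomorphic in the complexified y
  because the exponential integral extends, with decay exp(-pi n y) on the disc of radius
  y/2.\<close>

lemma nser_real_analytic:
  assumes b: "poly_seq b" shows "real_analytic_on (nser b) upper_half_plane"
  unfolding real_analytic_on_def
proof
  fix w assume "w \<in> upper_half_plane"
  then have y: "Im w > 0" by (simp add: upper_half_plane_def)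
  obtain E where E: "\<And>w. Re w > 0 \<Longrightarrow> (E has_field_derivative - exp (- 4 * of_real pi * w) / w) (at w)"
    "\<And>v. v > 0 \<Longrightarrow> E (of_real v) = of_real (e1int v)"
    "\<And>w. Re w > 0 \<Longrightarrow> norm (E w) \<le> exp (- 4 * pi * Re w) * (1 / (4 * pi * Re w) + \<bar>Im w\<bar> / Re w)"
    using e1int_complex_extension by metis
  have holE: "E holomorphic_on {w. Re w > 0}"
    using E(1) by (auto simp: holomorphic_on_open open_halfspace_Re_gt)
  have b0: "b 0 = 0" using b by (simp add: poly_seq_def)
  define r where "r = Im w / 8"
  define K where "K = 1 / (2 * pi * Im w) + 1"
  define q where "q n v = exp (2 * of_real pi * of_nat n * v)" for n :: nat and v :: complex
  define c where "c n v = b n * (E (of_nat n * v) * q n v)" for n v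
  define B where "B n = norm (b n) * (K * exp (- (pi * Im w) * real n))" for n
  have Sw: "Re v \<ge> Im w / 2" "\<bar>Im v\<bar> \<le> Im w / 2" "Re v > 0" if "v \<in> ball (of_real (Im w)) (Im w / 2)" for v
    using that abs_Re_le_cmod[of "of_real (Im w) - v"] abs_Im_le_cmod[of "of_real (Im w) - v"] y by (auto simp: dist_norm)
  have "\<exists>d. \<forall>z\<in>ball w r. ((\<lambda>(j, k). d j k * of_real (Re z - Re w) ^ j * of_real (Im z - Im w) ^ k) has_sum
      (\<Sum>\<^sub>\<infinity>n. exp (\<i> * of_real (- 2 * pi * real n) * of_real (Re z)) * c n (of_real (Im z)))) UNIV"
  proof (rule fourier_series_real_analytic[where R = "Im w / 2" and B = B])
    show "r > 0" "2 * r < Im w / 2" using y by (auto simp: r_def)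
    show "c n holomorphic_on ball (of_real (Im w)) (Im w / 2)" for n
    proof (cases "n = 0")
      case True
      then show ?thesis by (simp add: c_def[abs_def] b0)
    next
      case False
      have "(E \<circ> (\<lambda>v. of_nat n * v)) holomorphic_on ball (of_real (Im w)) (Im w / 2)"
        by (rule holomorphic_on_compose_gen[OF _ holE]) (use Sw(3) False in \<open>auto intro!: holomorphic_intros\<close>)
      then show ?thesis unfolding c_def q_def comp_def by (intro holomorphic_intros)
    qed
    show "norm (c n v) \<le> B n" if v: "v \<in> ball (of_real (Im w)) (Im w / 2)" for n v
    proof (cases "n = 0")
      case False
      have "norm (q n v) = exp (2 * pi * real n * Re v)" by (simp add: q_def norm_exp_eq_Re)
      from e1_extension_bound[OF E(3) this Sw(1,2)[OF v] y False]
      show ?thesis unfolding c_def B_def norm_mult[of "b n"] K_def by (intro mult_left_mono) auto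
    qed (simp add: c_def b0 B_def)
    have "(\<lambda>n. B n * exp (\<bar>- 2 * pi * real n\<bar> * r)) = (\<lambda>n. norm (b n) * (K * exp (- (3 / 4 * pi * Im w) * real n)))"
      unfolding B_def r_def by (simp add: fun_eq_iff mult.assoc exp_add[symmetric] abs_mult)
    moreover have "summable (\<lambda>n. norm (b n) * (K * exp (- (3 / 4 * pi * Im w) * real n)))"
      by (rule poly_seq_summable[OF b]) (use y in simp)
    ultimately show "(\<lambda>n. B n * exp (\<bar>- 2 * pi * real n\<bar> * r)) summable_on UNIV"
      by (subst summable_on_UNIV_nonneg_real_iff) (use y in \<open>auto simp: B_def K_def\<close>)
  qed
  moreover have "(\<Sum>\<^sub>\<infinity>n. exp (\<i> * of_real (- 2 * pi * real n) * of_real (Re z)) * c n (of_real (Im z))) = nser b z" if z: "z \<in> ball w r" for z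
  proof -
    have "Im z > 0" using z abs_Im_le_cmod[of "w - z"] y by (auto simp: dist_norm r_def)
    have "exp (\<i> * of_real (- 2 * pi * real n) * of_real (Re z)) * c n (of_real (Im z)) = b n * of_real (e1int (real n * Im z)) * qpow (- int n) z" for n
    proof (cases "n = 0")
      case False
      have e: "E (of_nat n * of_real (Im z)) = of_real (e1int (real n * Im z))"
        using E(2)[of "real n * Im z"] False \<open>Im z > 0\<close> by simp
      have "\<i> * of_real (- 2 * pi * real n) * of_real (Re z) + 2 * of_real pi * of_nat n * of_real (Im z) = 2 * of_real pi * \<i> * of_int (- int n) * z"
        by (simp add: complex_eq_iff)
      then have "qpow (- int n) z = exp (\<i> * of_real (- 2 * pi * real n) * of_real (Re z)) * q n (of_real (Im z))"
        unfolding qpow_def q_def exp_add[symmetric] by simp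
      then show ?thesis unfolding c_def e by (simp add: mult_ac)
    qed (simp add: c_def b0)
    then show ?thesis by (simp add: nser_def)
  qed
  ultimately show "\<exists>r>0. \<exists>a'. \<forall>z\<in>ball w r. ((\<lambda>(j, k). a' j k * of_real (Re z - Re w) ^ j * of_real (Im z - Im w) ^ k) has_sum nser b z) UNIV"
    using y by (intro exI[of _ r]) (simp add: r_def)
qed

lemma ln_Im_real_analytic: "real_analytic_on (\<lambda>z. c0 + d0 * of_real (ln (Im z))) upper_half_plane"
  unfolding real_analytic_on_def
proof
  fix w assume "w \<in> upper_half_plane"
  then have y: "Im w > 0" by (simp add: upper_half_plane_def)
  define r where "r = Im w / 8"
  define f where "f v = c0 + d0 * Ln v" for v
  have Rv: "Re v > 0" if "v \<in> cball (of_real (Im w)) (Im w / 2)" for v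
    using that abs_Re_le_cmod[of "of_real (Im w) - v"] y by (auto simp: dist_norm)
  have hol: "f holomorphic_on cball (of_real (Im w)) (Im w / 2)"
    unfolding f_def by (intro holomorphic_intros) (use Rv in \<open>force simp: complex_nonpos_Reals_iff simp del: mem_cball\<close>)
  from compact_imp_bounded[OF compact_continuous_image[OF holomorphic_on_imp_continuous_on[OF hol] compact_cball]]
  obtain B where B: "\<And>v. v \<in> cball (of_real (Im w)) (Im w / 2) \<Longrightarrow> norm (f v) \<le> B"
    unfolding bounded_iff by blast
  \<comment> \<open>A Fourier series with a single term of frequency 0, indexed by
    \<open>unit\<close>; the complex logarithm provides the holomorphic function of y.\<close>
  have "\<exists>d. \<forall>z\<in>ball w r. ((\<lambda>(j, k). d j k * of_real (Re z - Re w) ^ j * of_real (Im z - Im w) ^ k) has_sum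
      (\<Sum>\<^sub>\<infinity>n::unit. exp (\<i> * of_real 0 * of_real (Re z)) * f (of_real (Im z)))) UNIV"
  proof (rule fourier_series_real_analytic[where R = "Im w / 2" and B = "\<lambda>_. B"])
    show "r > 0" "2 * r < Im w / 2" using y by (auto simp: r_def)
    show "f holomorphic_on ball (of_real (Im w)) (Im w / 2)" by (rule holomorphic_on_subset[OF hol]) auto
    show "norm (f v) \<le> B" if "v \<in> ball (of_real (Im w)) (Im w / 2)" for v by (rule B) (use that in auto)
  qed simp
  moreover have "(\<Sum>\<^sub>\<infinity>n::unit. exp (\<i> * of_real 0 * of_real (Re z)) * f (of_real (Im z))) = c0 + d0 * of_real (ln (Im z))" if z: "z \<in> ball w r" for z
  proof -
    have "Im z > 0" using z abs_Im_le_cmod[of "w - z"] y by (auto simp: dist_norm r_def)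
    then show ?thesis by (simp add: UNIV_unit f_def Ln_of_real)
  qed
  ultimately show "\<exists>r>0. \<exists>a'. \<forall>z\<in>ball w r. ((\<lambda>(j, k). a' j k * of_real (Re z - Re w) ^ j * of_real (Im z - Im w) ^ k) has_sum
      (c0 + d0 * of_real (ln (Im z)))) UNIV"
    using y by (intro exI[of _ r]) (simp add: r_def)
qed

section \<open>Harmonicity and shadow of a Maass expansion\<close>

definition maass_series :: "complex \<Rightarrow> complex \<Rightarrow> (nat \<Rightarrow> complex) \<Rightarrow> (nat \<Rightarrow> complex) \<Rightarrow> complex \<Rightarrow> complex" where
  "maass_series c0 d0 a b z = c0 + d0 * of_real (ln (Im z)) + hser a z + nser b z"

lemma maass_series_real_analytic:
  assumes "poly_seq a" "poly_seq b" shows "real_analytic_on (maass_series c0 d0 a b) upper_half_plane"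
  unfolding maass_series_def[abs_def]
  by (intro real_analytic_add ln_Im_real_analytic hser_real_analytic nser_real_analytic assms)

lemma hser_cmult: "hser (\<lambda>n. c * a n) z = c * hser a z"
  by (simp add: hser_def mult.assoc infsum_cmult_right')

lemma nser_cmult: "nser (\<lambda>n. c * b n) z = c * nser b z"
  by (simp add: nser_def mult.assoc infsum_cmult_right')

lemma partial_x_eqI:
  "((\<lambda>x. F (Complex x (Im z))) has_vector_derivative D) (at (Re z)) \<Longrightarrow> partial_x F z = D"
  unfolding partial_x_def by (rule vector_derivative_at)

lemma partial_y_eqI:
  "((\<lambda>y. F (Complex (Re z) y)) has_vector_derivative D) (at (Im z)) \<Longrightarrow> partial_y F z = D"
  unfolding partial_y_def by (rule vector_derivative_at)

lemma hbar_derivative_y: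
  assumes b: "poly_seq b" and y: "Im z > 0"
  shows "((\<lambda>y. hbar b (Complex (Re z) y)) has_vector_derivative (- 2 * of_real pi * hbar (\<lambda>n. of_nat n * b n) z)) (at (Im z))"
proof -
  define D where "D = hser (\<lambda>n. 2 * of_real pi * \<i> * of_nat n * cnj (b n)) z"
  have e: "(\<lambda>n. 2 * of_real pi * \<i> * of_nat n * cnj (b n)) = (\<lambda>n. (2 * of_real pi * \<i>) * (of_nat n * cnj (b n)))"
    by (rule ext) (rule mult.assoc)
  have D2: "D = 2 * of_real pi * \<i> * hser (\<lambda>n. of_nat n * cnj (b n)) z"
    unfolding D_def e by (rule hser_cmult)
  have e2: "(\<lambda>n. cnj (of_nat n * b n)) = (\<lambda>n. of_nat n * cnj (b n))"
    by (rule ext) (simp only: complex_cnj_mult complex_cnj_of_nat)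
  have cc: "cnj (\<i> * (2 * of_real pi * \<i> * u)) = - 2 * of_real pi * cnj u" for u by simp
  have D: "cnj (\<i> * D) = - 2 * of_real pi * hbar (\<lambda>n. of_nat n * b n) z"
    unfolding D2 cc hbar_def e2 ..
  have "(hser (\<lambda>n. cnj (b n)) has_field_derivative D) (at z)"
    unfolding D_def by (rule hser_has_field_derivative[OF poly_seq_cnj[OF b] y])
  from bounded_linear.has_vector_derivative[OF bounded_linear_cnj has_vector_derivative_Complex(2)[OF this]]
  show ?thesis unfolding D hbar_def .
qed

lemma has_vector_derivative_of_real_comp:
  assumes "(f has_real_derivative d) (at y)"
  shows "((\<lambda>y. of_real (f y)) has_vector_derivative (of_real d :: complex)) (at y)"
  using bounded_linear.has_vector_derivative[OF bounded_linear_of_real assms[unfolded has_real_derivative_iff_has_vector_derivative]] .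

lemma has_vector_derivative_of_real_inverse:
  assumes "(y::real) > 0"
  shows "((\<lambda>y. c * of_real (ln y)) has_vector_derivative (c / of_real y :: complex)) (at y)"
    and "((\<lambda>y. c / of_real y) has_vector_derivative (- c / of_real y ^ 2 :: complex)) (at y)"
proof -
  have ln: "(ln has_real_derivative 1 / y) (at y)" using assms by (auto intro!: derivative_eq_intros)
  have inv: "((\<lambda>y. 1 / y) has_real_derivative - 1 / y ^ 2) (at y)"
    using assms by (auto intro!: derivative_eq_intros simp: power2_eq_square)
  show "((\<lambda>y. c * of_real (ln y)) has_vector_derivative (c / of_real y :: complex)) (at y)"
    using has_vector_derivative_mult_right[OF has_vector_derivative_of_real_comp[OF ln], of c] by simp
  show "((\<lambda>y. c / of_real y) has_vector_derivative (- c / of_real y ^ 2 :: complex)) (at y)"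
    using has_vector_derivative_mult_right[OF has_vector_derivative_of_real_comp[OF inv], of c] by simp
qed

lemma maass_series_partial_derivatives:
  assumes a: "poly_seq a" and b: "poly_seq b" and y: "Im z > 0"
  shows "partial_x (maass_series c0 d0 a b) z =
      2 * of_real pi * \<i> * hser (\<lambda>n. of_nat n * a n) z - 2 * of_real pi * \<i> * nser (\<lambda>n. of_nat n * b n) z"
    and "partial_y (maass_series c0 d0 a b) z =
      (d0 - hbar b z) / of_real (Im z) - 2 * of_real pi * hser (\<lambda>n. of_nat n * a n) z + 2 * of_real pi * nser (\<lambda>n. of_nat n * b n) z"
proof -
  have h: "hser (\<lambda>n. 2 * of_real pi * \<i> * of_nat n * a n) z = 2 * of_real pi * \<i> * hser (\<lambda>n. of_nat n * a n) z"
    unfolding mult.assoc[of _ "of_nat _" "a _"] by (rule hser_cmult)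
  have n: "nser (\<lambda>n. c * of_nat n * b n) z = c * nser (\<lambda>n. of_nat n * b n) z" for c
    unfolding mult.assoc[of _ "of_nat _" "b _"] by (rule nser_cmult)
  have "((\<lambda>x. c0 + d0 * of_real (ln (Im (Complex x (Im z)))) + hser a (Complex x (Im z)) + nser b (Complex x (Im z))) has_vector_derivative
     (0 + 2 * of_real pi * \<i> * hser (\<lambda>n. of_nat n * a n) z + (- 2 * of_real pi * \<i>) * nser (\<lambda>n. of_nat n * b n) z)) (at (Re z))"
    unfolding h[symmetric] n[symmetric]
    by (rule has_vector_derivative_add[OF has_vector_derivative_add[OF _ has_vector_derivative_Complex(1)[OF hser_has_field_derivative[OF a y]]] nser_derivative_x[OF b y]]) simp
  from partial_x_eqI[of "maass_series c0 d0 a b", unfolded maass_series_def, OF this]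
  show "partial_x (maass_series c0 d0 a b) z =
      2 * of_real pi * \<i> * hser (\<lambda>n. of_nat n * a n) z - 2 * of_real pi * \<i> * nser (\<lambda>n. of_nat n * b n) z"
    by (simp add: maass_series_def[abs_def])
  have "((\<lambda>v. c0 + d0 * of_real (ln v) + hser a (Complex (Re z) v) + nser b (Complex (Re z) v)) has_vector_derivative
     (0 + d0 / of_real (Im z) + \<i> * hser (\<lambda>n. 2 * of_real pi * \<i> * of_nat n * a n) z + (nser (\<lambda>n. (2 * of_real pi) * of_nat n * b n) z - hbar b z / of_real (Im z)))) (at (Im z))"
    by (rule has_vector_derivative_add[OF has_vector_derivative_add[OF has_vector_derivative_add[OF has_vector_derivative_const has_vector_derivative_of_real_inverse(1)[OF y]]
        has_vector_derivative_Complex(2)[OF hser_has_field_derivative[OF a y]]] nser_derivative_y[OF b y]])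
  then have "((\<lambda>v. maass_series c0 d0 a b (Complex (Re z) v)) has_vector_derivative
     (0 + d0 / of_real (Im z) + \<i> * hser (\<lambda>n. 2 * of_real pi * \<i> * of_nat n * a n) z + (nser (\<lambda>n. (2 * of_real pi) * of_nat n * b n) z - hbar b z / of_real (Im z)))) (at (Im z))"
    by (simp add: maass_series_def)
  from partial_y_eqI[OF this]
  show "partial_y (maass_series c0 d0 a b) z =
      (d0 - hbar b z) / of_real (Im z) - 2 * of_real pi * hser (\<lambda>n. of_nat n * a n) z + 2 * of_real pi * nser (\<lambda>n. of_nat n * b n) z"
    unfolding h n by (simp add: diff_divide_distrib algebra_simps)
qed

text \<open>In the zbar-derivative the contributions of q^n and of q^(-n) cancel. Only the
  derivatives of log y and of the exponential integrals survive, over the denominator y, which the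
  factor y of \<open>xi1\<close> clears.\<close>

lemma maass_series_xi1:
  assumes "poly_seq a" "poly_seq b" "Im z > 0"
  shows "xi1 (maass_series c0 d0 a b) z = cnj d0 - hser (\<lambda>n. cnj (b n)) z"
  unfolding xi1_def partial_zbar_def maass_series_partial_derivatives[OF assms]
  using assms(3) by (simp add: hbar_def field_simps)

text \<open>All terms with factors n or n^2 cancel in the Laplacian, leaving
  (\<open>hbar b z\<close> - d0)/y^2; multiplied by y^2 this is the negative of what the first-order
  part of \<open>Delta1\<close> contributes.\<close>

lemma maass_series_Delta1:
  assumes a: "poly_seq a" and b: "poly_seq b" and y: "Im z > 0"
  shows "Delta1 (maass_series c0 d0 a b) z = 0"
proof -
  define F where "F = maass_series c0 d0 a b"
  define a1 where "a1 n = of_nat n * a n" for n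
  define b1 where "b1 n = of_nat n * b n" for n
  have a1: "poly_seq a1" and b1: "poly_seq b1"
    unfolding a1_def b1_def using poly_seq_mult_of_nat[OF a, of 1] poly_seq_mult_of_nat[OF b, of 1] by simp_all
  note d = maass_series_partial_derivatives[OF a b, of _ c0 d0, folded F_def a1_def b1_def]
  define h where "h = hser (\<lambda>n. of_nat n * a1 n) z"
  define k where "k = nser (\<lambda>n. of_nat n * b1 n) z"
  have ha: "hser (\<lambda>n. 2 * of_real pi * \<i> * of_nat n * a1 n) z = 2 * of_real pi * \<i> * h"
    unfolding h_def mult.assoc[of _ "of_nat _" "a1 _"] by (rule hser_cmult)
  have nb: "nser (\<lambda>n. c * of_nat n * b1 n) z = c * k" for c
    unfolding k_def mult.assoc[of _ "of_nat _" "b1 _"] by (rule nser_cmult)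
  have XX: "partial_x (partial_x F) z = 2 * of_real pi * \<i> * (2 * of_real pi * \<i> * h) - 2 * of_real pi * \<i> * ((- 2 * of_real pi * \<i>) * k)"
  proof (rule partial_x_eqI)
    have "((\<lambda>x. 2 * of_real pi * \<i> * hser a1 (Complex x (Im z)) - 2 * of_real pi * \<i> * nser b1 (Complex x (Im z))) has_vector_derivative
       (2 * of_real pi * \<i> * (2 * of_real pi * \<i> * h) - 2 * of_real pi * \<i> * ((- 2 * of_real pi * \<i>) * k))) (at (Re z))"
      unfolding ha[symmetric] nb[symmetric]
      by (rule has_vector_derivative_diff[OF has_vector_derivative_mult_right[OF has_vector_derivative_Complex(1)[OF hser_has_field_derivative[OF a1 y]]] has_vector_derivative_mult_right[OF nser_derivative_x[OF b1 y]]])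
    then show "((\<lambda>x. partial_x F (Complex x (Im z))) has_vector_derivative
       (2 * of_real pi * \<i> * (2 * of_real pi * \<i> * h) - 2 * of_real pi * \<i> * ((- 2 * of_real pi * \<i>) * k))) (at (Re z))"
      using y by (simp add: d(1))
  qed
  define D where "D = (- d0 / of_real (Im z) ^ 2 - ((hbar b z) * (- 1 / of_real (Im z) ^ 2) + (- 2 * of_real pi * hbar b1 z) * (1 / of_real (Im z))))
      - 2 * of_real pi * (\<i> * (2 * of_real pi * \<i> * h)) + 2 * of_real pi * ((2 * of_real pi) * k - hbar b1 z / of_real (Im z))"
  have YY: "partial_y (partial_y F) z = D"
  proof (rule partial_y_eqI)
    have "((\<lambda>v. (d0 / of_real v - hbar b (Complex (Re z) v) * (1 / of_real v)) - 2 * of_real pi * hser a1 (Complex (Re z) v) + 2 * of_real pi * nser b1 (Complex (Re z) v)) has_vector_derivative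
       ((- d0 / of_real (Im z) ^ 2 - (hbar b (Complex (Re z) (Im z)) * (- 1 / of_real (Im z) ^ 2) + (- 2 * of_real pi * hbar b1 z) * (1 / of_real (Im z))))
      - 2 * of_real pi * (\<i> * (2 * of_real pi * \<i> * h)) + 2 * of_real pi * ((2 * of_real pi) * k - hbar b1 z / of_real (Im z)))) (at (Im z))"
      unfolding ha[symmetric] nb[symmetric] b1_def
      by (intro has_vector_derivative_add has_vector_derivative_diff has_vector_derivative_mult_right)
         (rule has_vector_derivative_of_real_inverse[OF y]
             has_vector_derivative_mult[OF hbar_derivative_y[OF b y] has_vector_derivative_of_real_inverse(2)[OF y]]
             has_vector_derivative_Complex(2)[OF hser_has_field_derivative[OF a1 y]] nser_derivative_y[OF b1[unfolded b1_def] y])+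
    then have "((\<lambda>v. (d0 / of_real v - hbar b (Complex (Re z) v) * (1 / of_real v)) - 2 * of_real pi * hser a1 (Complex (Re z) v) + 2 * of_real pi * nser b1 (Complex (Re z) v)) has_vector_derivative D) (at (Im z))"
      by (simp add: D_def)
    then show "((\<lambda>v. partial_y F (Complex (Re z) v)) has_vector_derivative D) (at (Im z))"
      by (rule has_vector_derivative_transform_within_open[of _ _ _ "{0<..}"]) (use y d(2) in \<open>auto simp: diff_divide_distrib\<close>)
  qed
  define p where "p = 1 / complex_of_real (Im z)"
  have p: "u / of_real (Im z) = u * p" "u / of_real (Im z) ^ 2 = u * p ^ 2" for u by (simp_all add: p_def power_divide)
  have Yp: "of_real (Im z) * p = 1" using y by (simp add: p_def)
  have ii: "\<i> * (\<i> * u) = - u" for u by (simp add: mult.assoc[symmetric])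
  have 1: "partial_x (partial_x F) z + partial_y (partial_y F) z = (hbar b z - d0) * p ^ 2"
    unfolding XX YY D_def p by (simp add: algebra_simps ii)
  have 2: "partial_x F z + \<i> * partial_y F z = \<i> * ((d0 - hbar b z) * p)"
    unfolding d[OF y] p by (simp add: algebra_simps)
  have "Delta1 F z = (of_real (Im z) * p) ^ 2 * (hbar b z - d0) - (\<i> * \<i>) * (of_real (Im z) * p) * (d0 - hbar b z)"
    unfolding Delta1_def 1 2 power_mult_distrib by (simp only: mult_ac)
  then show ?thesis unfolding F_def Yp by simp
qed

lemma beta1_0: "beta1 0 y = - ln y"
  by (simp add: beta1_def)

text \<open>By the substitution of nu for u; n = 0 is the logarithmic case of \<open>beta1\<close>
  and stays separate.\<close>

lemma beta1_eq_e1int: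
  assumes "n \<ge> 1" "y > 0" shows "beta1 n y = e1int (real n * y)"
proof -
  define f where "f u = exp (- 4 * pi * u) / u" for u :: real
  have n: "real n > 0" using assms by simp
  have e: "(f has_integral e1int (real n * y)) {real n * y..}"
    unfolding f_def by (rule e1int_has_integral) (use assms in simp)
  have pos: "real n * y > 0" using assms by simp
  have im: "(\<lambda>u. real n * u) ` {y..} = {real n * y..}"
  proof
    show "{real n * y..} \<subseteq> (\<lambda>u. real n * u) ` {y..}"
    proof
      fix v assume "v \<in> {real n * y..}"
      then have "v = real n * (v / real n)" "v / real n \<in> {y..}" using n by (auto simp: field_simps)
      then show "v \<in> (\<lambda>u. real n * u) ` {y..}" by (rule image_eqI)
    qed
    show "(\<lambda>u. real n * u) ` {y..} \<subseteq> {real n * y..}" using n by auto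
  qed
  have "f absolutely_integrable_on {real n * y..}"
  proof (rule nonnegative_absolutely_integrable_1)
    show "f integrable_on {real n * y..}" using e by (rule has_integral_integrable)
    show "0 \<le> f x" if "x \<in> {real n * y..}" for x using that pos by (simp add: f_def)
  qed
  moreover have "integral {real n * y..} f = e1int (real n * y)" using e by (rule integral_unique)
  moreover have "((\<lambda>x. \<bar>real n\<bar> * f (real n * x)) absolutely_integrable_on {y..} \<and>
      integral {y..} (\<lambda>x. \<bar>real n\<bar> * f (real n * x)) = e1int (real n * y)) \<longleftrightarrow>
      (f absolutely_integrable_on (\<lambda>u. real n * u) ` {y..} \<and> integral ((\<lambda>u. real n * u) ` {y..}) f = e1int (real n * y))"
    by (rule has_absolute_integral_change_of_variables_1') (use n in \<open>auto intro!: derivative_eq_intros inj_onI\<close>)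
  ultimately have "integral {y..} (\<lambda>x. \<bar>real n\<bar> * f (real n * x)) = e1int (real n * y)" unfolding im by blast
  moreover have "\<bar>real n\<bar> * f (real n * x) = exp (- 4 * pi * real n * x) / x" for x
    using n by (simp add: f_def mult.assoc)
  ultimately have "integral {y..} (\<lambda>x. exp (- 4 * pi * real n * x) / x) = e1int (real n * y)" by (simp only:)
  then show ?thesis using assms(1) by (simp add: beta1_def)
qed

section \<open>Fourier expansions of the Eisenstein integrals\<close>

text \<open>The four sign patterns of \<open>(m, k)\<close> with \<open>|mk| = n\<close> are collected in one divisor sum: equal signs contribute to
  \<open>q^n\<close>, opposite signs to the nonholomorphic term at \<open>q^{-n}\<close>.\<close>

lemma has_sum_pairs_product:
  fixes f :: "int \<times> int \<Rightarrow> complex"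
  assumes "(f has_sum S) pairs"
  shows "((\<lambda>n. \<Sum>c | c dvd n. f (int (n div c), int c) + f (- int (n div c), - int c) + f (int (n div c), - int c) + f (- int (n div c), int c)) has_sum S) {1..}"
proof -
  define Sg :: "(int \<times> int) set" where "Sg = {(1,1), (-1,-1), (1,-1), (-1,1)}"
  \<comment> \<open>A nonzero pair is encoded by n = |mk|, c = |k| and the two signs.\<close>
  define h where "h = (\<lambda>(n::nat, c::nat, s1::int, s2::int). (s1 * int (n div c), s2 * int c))"
  have h1: "h (n, c, s1, s2) \<in> pairs \<and> (\<lambda>(m, k). (nat \<bar>m * k\<bar>, nat \<bar>k\<bar>, sgn m, sgn k)) (h (n, c, s1, s2)) = (n, c, s1, s2)"
    if n: "n \<ge> 1" and c: "c dvd n" and s: "(s1, s2) \<in> Sg" for n c s1 s2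
  proof -
    obtain j where j: "n = c * j" using c by blast
    have jc: "j \<noteq> 0" "c \<noteq> 0" using n j by auto
    have d: "n div c = j" using jc by (simp add: j)
    show ?thesis using s jc unfolding h_def d j by (auto simp: Sg_def pairs_def nat_mult_distrib mult.commute)
  qed
  have h2: "(nat \<bar>m * k\<bar>, nat \<bar>k\<bar>, sgn m, sgn k) \<in> Sigma {1..} (\<lambda>n. {c. c dvd n} \<times> Sg) \<and> h (nat \<bar>m * k\<bar>, nat \<bar>k\<bar>, sgn m, sgn k) = (m, k)"
    if mk: "m \<noteq> 0" "k \<noteq> 0" for m k
  proof -
    have n: "nat \<bar>m * k\<bar> = nat \<bar>m\<bar> * nat \<bar>k\<bar>" by (simp add: abs_mult nat_mult_distrib)
    have "nat \<bar>m\<bar> * nat \<bar>k\<bar> \<ge> 1" using mk by (simp add: Suc_le_eq)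
    moreover have "(sgn m, sgn k) \<in> Sg" using mk by (auto simp: Sg_def sgn_if)
    ultimately show ?thesis unfolding n using mk by (simp add: h_def sgn_mult_abs)
  qed
  define g where "g = (\<lambda>(m, k). (nat \<bar>m * k\<bar>, nat \<bar>k\<bar>, sgn m, sgn k :: int))"
  have bij: "bij_betw h (Sigma {1..} (\<lambda>n. {c. c dvd n} \<times> Sg)) pairs"
  proof (rule bij_betwI[where g = g])
    have 1: "h x \<in> pairs \<and> g (h x) = x" if "x \<in> Sigma {1..} (\<lambda>n. {c. c dvd n} \<times> Sg)" for x
    proof -
      obtain n c s1 s2 where x: "x = (n, c, s1, s2)" by (cases x) blast
      have "n \<ge> 1" "c dvd n" "(s1, s2) \<in> Sg" using that unfolding x by blast+
      from h1[OF this] show ?thesis unfolding x g_def .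
    qed
    have 2: "g p \<in> Sigma {1..} (\<lambda>n. {c. c dvd n} \<times> Sg) \<and> h (g p) = p" if "p \<in> pairs" for p
    proof -
      obtain m k where p: "p = (m, k)" by (cases p) blast
      have "m \<noteq> 0" "k \<noteq> 0" using that unfolding p pairs_def by blast+
      from h2[OF this] show ?thesis unfolding p g_def split .
    qed
    show "h \<in> Sigma {1..} (\<lambda>n. {c. c dvd n} \<times> Sg) \<rightarrow> pairs" using 1 by blast
    show "g \<in> pairs \<rightarrow> Sigma {1..} (\<lambda>n. {c. c dvd n} \<times> Sg)" using 2 by blast
    show "g (h x) = x" if "x \<in> Sigma {1..} (\<lambda>n. {c. c dvd n} \<times> Sg)" for x using 1[OF that] by blast
    show "h (g p) = p" if "p \<in> pairs" for p using 2[OF that] by blast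
  qed
  have "((\<lambda>x. f (h x)) has_sum S) (Sigma {1..} (\<lambda>n. {c. c dvd n} \<times> Sg))"
    using has_sum_reindex_bij_betw[OF bij, of f S] assms by blast
  then show ?thesis
  proof (rule has_sum_SigmaD)
    fix n :: nat assume n: "n \<in> {1..}"
    have fin: "finite ({c. c dvd n} \<times> Sg)" using n by (auto simp: Sg_def)
    have "(\<Sum>y\<in>{c. c dvd n} \<times> Sg. f (h (n, y))) = (\<Sum>c | c dvd n. \<Sum>s\<in>Sg. f (h (n, c, s)))"
      by (simp only: sum.cartesian_product case_prod_unfold prod.collapse)
    also have "\<dots> = (\<Sum>c | c dvd n. f (int (n div c), int c) + f (- int (n div c), - int c) + f (int (n div c), - int c) + f (- int (n div c), int c))"
      by (rule sum.cong[OF refl]) (simp add: Sg_def h_def add.assoc)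
    finally have e: "(\<Sum>y\<in>{c. c dvd n} \<times> Sg. f (h (n, y))) = (\<Sum>c | c dvd n. f (int (n div c), int c) + f (- int (n div c), - int c) + f (int (n div c), - int c) + f (- int (n div c), int c))" .
    show "((\<lambda>y. f (h (n, y))) has_sum (\<Sum>c | c dvd n. f (int (n div c), int c) + f (- int (n div c), - int c) + f (int (n div c), - int c) + f (- int (n div c), int c))) ({c. c dvd n} \<times> Sg)"
      by (rule has_sum_finiteI[OF fin e[symmetric]])
  qed
qed

text \<open>Coefficient of exp(2 pi i n z/M), as the dual frequencies are k/M; c stands for |k| and
  n/c for |m|.\<close>

definition eis_a :: "complex \<Rightarrow> complex \<Rightarrow> nat \<Rightarrow> (int \<Rightarrow> int \<Rightarrow> complex) \<Rightarrow> nat \<Rightarrow> complex" where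
  "eis_a w0 w1 M \<phi> n = - (of_real pi * \<i> / of_nat M) * (\<Sum>c | c dvd n.
     (fhat M (\<phi> (int (n div c))) (int c) - fhat M (\<phi> (- int (n div c))) (- int c)) * (w0 + w1 * of_real (ln (real c / (real M * real (n div c))))))"

definition eis_b :: "complex \<Rightarrow> nat \<Rightarrow> (int \<Rightarrow> int \<Rightarrow> complex) \<Rightarrow> nat \<Rightarrow> complex" where
  "eis_b w1 M \<phi> n = - (of_real pi * \<i> / of_nat M) * (\<Sum>c | c dvd n.
     (fhat M (\<phi> (int (n div c))) (- int c) - fhat M (\<phi> (- int (n div c))) (int c)) * w1)"

text \<open>\<open>eis_const\<close> is separated into a part free of log y and, in
  \<open>eis_d0\<close>, the coefficient of log y; the latter comes from the derivative moment alone
  and so carries the factor w1.\<close>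

definition eis_c0 :: "complex \<Rightarrow> complex \<Rightarrow> nat \<Rightarrow> (int \<Rightarrow> int \<Rightarrow> complex) \<Rightarrow> complex" where
  "eis_c0 w0 w1 M \<phi> = of_real pi / 2 * (w0 * Lam (\<phi> 0) 1 + w1 * Lam' (\<phi> 0) 1)
     - of_real pi * \<i> / (2 * of_nat M) * (w0 * Lam (\<lambda>m. fhat M (\<phi> m) 0) (1 / 2) + w1 * Lam' (\<lambda>m. fhat M (\<phi> m) 0) (1 / 2))"

definition eis_d0 :: "complex \<Rightarrow> nat \<Rightarrow> (int \<Rightarrow> int \<Rightarrow> complex) \<Rightarrow> complex" where
  "eis_d0 w1 M \<phi> = w1 * (of_real pi / 2 * Lam (\<phi> 0) 1 + of_real pi * \<i> / (2 * of_nat M) * Lam (\<lambda>m. fhat M (\<phi> m) 0) (1 / 2))"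

lemma eis_const_eq: "eis_const w0 w1 M \<phi> y = eis_c0 w0 w1 M \<phi> + eis_d0 w1 M \<phi> * of_real (ln y)"
  by (simp add: eis_const_def eis_c0_def eis_d0_def algebra_simps)

lemma qpow_ee:
  "qpow (int n) (z / of_nat M) = ee (real n * Re z / real M) * of_real (exp (- 2 * pi * Im z * (real n / real M)))"
  "qpow (- int n) (z / of_nat M) = ee (- (real n * Re z / real M)) * of_real (exp (2 * pi * Im z * (real n / real M)))"
proof -
  have z: "z / of_nat M = of_real (Re z / real M) + \<i> * of_real (Im z / real M)" by (simp add: complex_eq_iff)
  show "qpow (int n) (z / of_nat M) = ee (real n * Re z / real M) * of_real (exp (- 2 * pi * Im z * (real n / real M)))"
    unfolding qpow_def z ee_exp exp_of_real[symmetric] exp_add[symmetric] by (rule arg_cong[of _ _ exp]) (simp add: complex_eq_iff)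
  show "qpow (- int n) (z / of_nat M) = ee (- (real n * Re z / real M)) * of_real (exp (2 * pi * Im z * (real n / real M)))"
    unfolding qpow_def z ee_exp exp_of_real[symmetric] exp_add[symmetric] by (rule arg_cong[of _ _ exp]) (simp add: complex_eq_iff)
qed

text \<open>Of sgn m + sgn k and sgn m - sgn k one is 0 and the other 2 or -2, so each sign pattern
  keeps one of the two contributions.\<close>

lemma eis_term_signs:
  fixes a c :: nat
  assumes "a \<noteq> 0" "c \<noteq> 0"
  shows "eis_term w0 w1 M \<phi> z (int a, int c) + eis_term w0 w1 M \<phi> z (- int a, - int c)
       + eis_term w0 w1 M \<phi> z (int a, - int c) + eis_term w0 w1 M \<phi> z (- int a, int c)
     = - (of_real pi * \<i> / of_nat M) * ((fhat M (\<phi> (int a)) (int c) - fhat M (\<phi> (- int a)) (- int c)) * (w0 + w1 * of_real (ln (real c / (real M * real a)))))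
          * qpow (int (a * c)) (z / of_nat M)
       + - (of_real pi * \<i> / of_nat M) * ((fhat M (\<phi> (int a)) (- int c) - fhat M (\<phi> (- int a)) (int c)) * w1)
          * of_real (e1int (real (a * c) * Im (z / of_nat M))) * qpow (- int (a * c)) (z / of_nat M)"
proof -
  have s: "sgn (int a) = 1" "sgn (int c) = 1" "sgn (- int a) = - 1" "sgn (- int c) = - 1" using assms by auto
  define C where "C = - (of_real pi * \<i> / (2 * complex_of_nat M))"
  have C: "- (of_real pi * \<i> / of_nat M) = 2 * C" by (simp add: C_def)
  define q where "q = ee (real (a * c) * Re z / real M)"
  define q' where "q' = ee (- (real (a * c) * Re z / real M))"
  define X where "X = complex_of_real (exp (- 2 * pi * Im z * (real (a * c) / real M)))"
  define Y where "Y = complex_of_real (exp (2 * pi * Im z * (real (a * c) / real M)))"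
  define V where "V = e1int (Im z * (real (a * c) / real M))"
  define l where "l = w0 + w1 * complex_of_real (ln (real c / (real M * real a)))"
  have ab: "\<bar>real_of_int (int a)\<bar> = real a" "\<bar>real_of_int (- int a)\<bar> = real a" "\<bar>real_of_int (int c)\<bar> = real c" "\<bar>real_of_int (- int c)\<bar> = real c"
    "\<bar>real_of_int (int a) * real_of_int (int c)\<bar> = real (a * c)" "\<bar>real_of_int (- int a) * real_of_int (- int c)\<bar> = real (a * c)"
    "\<bar>real_of_int (int a) * real_of_int (- int c)\<bar> = real (a * c)" "\<bar>real_of_int (- int a) * real_of_int (int c)\<bar> = real (a * c)"
    by (simp_all add: abs_mult)
  have q: "ee (real_of_int (int c) * (real_of_int (int a) * Re z) / real M) = q" "ee (real_of_int (- int c) * (real_of_int (- int a) * Re z) / real M) = q"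
    "ee (real_of_int (- int c) * (real_of_int (int a) * Re z) / real M) = q'" "ee (real_of_int (int c) * (real_of_int (- int a) * Re z) / real M) = q'"
    by (simp_all add: q_def q'_def mult_ac)
  have V: "e1int (real (a * c) * Im (z / of_nat M)) = V" by (simp add: V_def mult_ac)
  have t1: "eis_term w0 w1 M \<phi> z (int a, int c) = C * fhat M (\<phi> (int a)) (int c) * q * (2 * l * X)"
    unfolding eis_term_def split s ab q C_def[symmetric] X_def[symmetric] l_def[symmetric] by simp
  have t2: "eis_term w0 w1 M \<phi> z (- int a, - int c) = C * fhat M (\<phi> (- int a)) (- int c) * q * (- 2 * l * X)"
    unfolding eis_term_def split s ab q C_def[symmetric] X_def[symmetric] l_def[symmetric] by simp
  have t3: "eis_term w0 w1 M \<phi> z (int a, - int c) = C * fhat M (\<phi> (int a)) (- int c) * q' * (2 * w1 * (Y * of_real V))"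
    unfolding eis_term_def split s ab q C_def[symmetric] of_real_mult Y_def[symmetric] V_def[symmetric] by simp
  have t4: "eis_term w0 w1 M \<phi> z (- int a, int c) = C * fhat M (\<phi> (- int a)) (int c) * q' * (- 2 * w1 * (Y * of_real V))"
    unfolding eis_term_def split s ab q C_def[symmetric] of_real_mult Y_def[symmetric] V_def[symmetric] by simp
  show ?thesis
    unfolding t1 t2 t3 t4 qpow_ee C V q_def[symmetric] q'_def[symmetric] X_def[symmetric] Y_def[symmetric] l_def[symmetric]
    by (simp add: algebra_simps)
qed

lemma biperiodic_bounded:
  fixes \<phi> :: "int \<Rightarrow> int \<Rightarrow> complex"
  assumes M: "M \<ge> 1" and K: "K \<ge> 1"
    and per: "\<And>m n. \<phi> m (n + int M) = \<phi> m n" and perK: "\<And>m n. \<phi> (m + int K) n = \<phi> m n"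
  obtains B where "B \<ge> 0" "\<And>m n. norm (\<phi> m n) \<le> B"
proof (rule that)
  define B where "B = (\<Sum>m\<in>{0..<int K}. \<Sum>n\<in>{0..<int M}. norm (\<phi> m n))"
  show "B \<ge> 0" unfolding B_def by (intro sum_nonneg) simp
  fix m n
  have "\<phi> m n = \<phi> m (n mod int M)"
    by (rule periodic_cong[of "\<phi> m" M, OF per]) (simp add: cong_def)
  also have "\<dots> = \<phi> (m mod int K) (n mod int M)"
    by (rule periodic_cong[of "\<lambda>m. \<phi> m (n mod int M)" K, OF perK]) (simp add: cong_def)
  finally have e: "norm (\<phi> m n) = norm (\<phi> (m mod int K) (n mod int M))" by simp
  have "norm (\<phi> (m mod int K) (n mod int M)) \<le> (\<Sum>n\<in>{0..<int M}. norm (\<phi> (m mod int K) n))"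
    using M by (intro member_le_sum[of "n mod int M"]) auto
  also have "\<dots> \<le> B" unfolding B_def
    using K by (intro member_le_sum[of "m mod int K" _ "\<lambda>m. \<Sum>n\<in>{0..<int M}. norm (\<phi> m n)"]) (auto intro: sum_nonneg)
  finally show "norm (\<phi> m n) \<le> B" unfolding e .
qed

lemma abs_ln_le: assumes "(x::real) > 0" shows "\<bar>ln x\<bar> \<le> x + 1 / x"
proof -
  have i: "1 / x > 0" and "ln (1 / x) = - ln x" using assms by (simp_all add: ln_div)
  then show ?thesis using ln_le_minus_one[OF assms] ln_le_minus_one[OF i] assms by linarith
qed

text \<open>Crude but sufficient: n has at most n divisors. For n = 0 the divisors form an infinite
  set, so the sum is 0 by convention, which is the condition at 0 in
  \<open>poly_seq\<close>.\<close>

lemma poly_seq_divisor_sum: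
  assumes B: "B \<ge> 0" "\<And>n c. n \<ge> 1 \<Longrightarrow> c dvd n \<Longrightarrow> norm (f n c) \<le> B * real n"
  shows "poly_seq (\<lambda>n. K * (\<Sum>c | c dvd n. f n c))"
  unfolding poly_seq_def
proof (intro conjI exI allI)
  have "infinite (UNIV :: nat set)" by simp
  then show "K * (\<Sum>c | c dvd 0. f 0 c) = 0" by simp
  fix n :: nat
  show "norm (K * (\<Sum>c | c dvd n. f n c)) \<le> (norm K * B) * real n ^ 2"
  proof (cases "n = 0")
    case False
    have "norm (\<Sum>c | c dvd n. f n c) \<le> (\<Sum>c | c dvd n. B * real n)"
      by (rule order_trans[OF norm_sum sum_mono]) (use B(2) False in auto)
    also have "\<dots> = real (card {c. c dvd n}) * (B * real n)" by simp
    also have "\<dots> \<le> real n * (B * real n)"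
    proof (intro mult_right_mono)
      have "card {c. c dvd n} \<le> card {1..n}"
        by (rule card_mono) (use False dvd_imp_le in \<open>auto simp: Suc_le_eq intro: Nat.gr0I\<close>)
      then show "real (card {c. c dvd n}) \<le> real n" by simp
    qed (use B in auto)
    finally have "norm (\<Sum>c | c dvd n. f n c) \<le> B * real n ^ 2" by (simp add: power2_eq_square mult_ac)
    then show ?thesis unfolding norm_mult by (simp add: mult_left_mono mult.assoc)
  qed simp
qed

context
  fixes M K :: nat and \<phi> :: "int \<Rightarrow> int \<Rightarrow> complex"
  assumes M: "M \<ge> 1" and K: "K \<ge> 1"
    and per: "\<And>m n. \<phi> m (n + int M) = \<phi> m n" and perK: "\<And>m n. \<phi> (m + int K) n = \<phi> m n"
begin

lemma poly_seq_eis: "poly_seq (eis_a w0 w1 M \<phi>)" "poly_seq (eis_b w1 M \<phi>)"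
proof -
  obtain B where B: "B \<ge> 0" "\<And>m n. norm (\<phi> m n) \<le> B"
    using biperiodic_bounded[where \<phi> = \<phi>, OF M K per perK] by metis
  have f: "norm (fhat M (\<phi> m) k - fhat M (\<phi> m') k') \<le> 2 * (real M * B)" for m k m' k'
    using fhat_bounded[of "\<phi> m" B M k, OF B(2)] fhat_bounded[of "\<phi> m'" B M k', OF B(2)] norm_triangle_ineq4[of "fhat M (\<phi> m) k" "fhat M (\<phi> m') k'"]
    by linarith
  have l: "norm (w0 + w1 * of_real (ln (real c / (real M * real (n div c))))) \<le> (norm w0 + norm w1 * (1 + real M)) * real n"
    if n: "n \<ge> 1" "c dvd n" for n c
  proof -
    obtain j where j: "n = c * j" using n by blast
    have jc: "j \<ge> 1" "c \<ge> 1" using n j by (auto simp: Suc_le_eq intro: Nat.gr0I)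
    have d: "n div c = j" using jc by (simp add: j)
    \<comment> \<open>The quotient lies between 1/(Mn) and n, so its logarithm is bounded by a
      linear function of n.\<close>
    have 1: "real c / (real M * real j) \<le> real n"
    proof -
      have "1 * 1 \<le> real M * real j" using jc M by (intro mult_mono) auto
      then have "real c / (real M * real j) \<le> real c / 1" by (intro divide_left_mono) auto
      also have "\<dots> \<le> real n" using n by (simp add: dvd_imp_le)
      finally show ?thesis .
    qed
    have 2: "1 / (real c / (real M * real j)) \<le> real M * real n"
    proof -
      have "real M * real j / real c \<le> real M * real j / 1" using jc by (intro divide_left_mono) auto
      also have "\<dots> \<le> real M * real n" using n j jc by (intro order.trans[OF eq_refl mult_left_mono]) auto
      finally show ?thesis by simp
    qed
    have "\<bar>ln (real c / (real M * real j))\<bar> \<le> real n + real M * real n"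
      using abs_ln_le[of "real c / (real M * real j)"] 1 2 jc M by simp
    then have "norm (w1 * complex_of_real (ln (real c / (real M * real j)))) \<le> norm w1 * (real n + real M * real n)"
      by (simp add: norm_mult mult_left_mono)
    moreover have "norm w0 * 1 \<le> norm w0 * real n" using n by (intro mult_left_mono) auto
    ultimately show ?thesis unfolding d using norm_triangle_ineq[of w0 "w1 * complex_of_real (ln (real c / (real M * real j)))"]
      by (simp add: algebra_simps)
  qed
  show "poly_seq (eis_a w0 w1 M \<phi>)"
    unfolding eis_a_def[abs_def]
  proof (rule poly_seq_divisor_sum)
    show "2 * (real M * B) * (norm w0 + norm w1 * (1 + real M)) \<ge> 0" using B by simp
    fix n c :: nat assume n: "n \<ge> 1" "c dvd n"
    show "norm ((fhat M (\<phi> (int (n div c))) (int c) - fhat M (\<phi> (- int (n div c))) (- int c)) * (w0 + w1 * of_real (ln (real c / (real M * real (n div c)))))) \<le> 2 * (real M * B) * (norm w0 + norm w1 * (1 + real M)) * real n"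
      unfolding norm_mult mult.assoc[of "2 * (real M * B)"] by (rule mult_mono[OF f l[OF n]]) (use B in auto)
  qed
  show "poly_seq (eis_b w1 M \<phi>)"
    unfolding eis_b_def[abs_def]
  proof (rule poly_seq_divisor_sum)
    show "2 * (real M * B) * norm w1 \<ge> 0" using B by simp
    fix n c :: nat assume n: "n \<ge> 1" "c dvd n"
    have "norm ((fhat M (\<phi> (int (n div c))) (- int c) - fhat M (\<phi> (- int (n div c))) (int c)) * w1) \<le> 2 * (real M * B) * norm w1"
      unfolding norm_mult by (rule mult_right_mono[OF f]) simp
    also have "\<dots> * 1 \<le> \<dots> * real n" using n B by (intro mult_left_mono) auto
    finally show "norm ((fhat M (\<phi> (int (n div c))) (- int c) - fhat M (\<phi> (- int (n div c))) (int c)) * w1) \<le> 2 * (real M * B) * norm w1 * real n" by simp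
  qed
qed

text \<open>The Fourier expansion over nonzero pairs, grouped by n = |mk|; the group sums are the
  divisor sums in \<open>eis_a\<close> and \<open>eis_b\<close>.\<close>

lemma eisI_expansion:
  assumes z: "Im z > 0"
  shows "eisI w0 w1 \<phi> z = eis_c0 w0 w1 M \<phi> + eis_d0 w1 M \<phi> * of_real (ln (Im z))
     + hser (eis_a w0 w1 M \<phi>) (z / of_nat M) + nser (eis_b w1 M \<phi>) (z / of_nat M)"
proof -
  define \<zeta> where "\<zeta> = z / of_nat M"
  have \<zeta>: "Im \<zeta> > 0" using z M by (simp add: \<zeta>_def)
  define s where "s n = eis_a w0 w1 M \<phi> n * qpow (int n) \<zeta> + eis_b w1 M \<phi> n * of_real (e1int (real n * Im \<zeta>)) * qpow (- int n) \<zeta>" for n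
  have "(s has_sum (eisI w0 w1 \<phi> z - eis_const w0 w1 M \<phi> (Im z))) {1..}"
  proof (rule has_sum_cong[THEN iffD1, OF _ has_sum_pairs_product[OF eisI_fourier[where \<phi> = \<phi>, OF z M K per perK]]])
    fix n :: nat assume n: "n \<in> {1..}"
    define C where "C = - (of_real pi * \<i> / complex_of_nat M)"
    have "eis_term w0 w1 M \<phi> z (int (n div c), int c) + eis_term w0 w1 M \<phi> z (- int (n div c), - int c)
       + eis_term w0 w1 M \<phi> z (int (n div c), - int c) + eis_term w0 w1 M \<phi> z (- int (n div c), int c)
      = C * ((fhat M (\<phi> (int (n div c))) (int c) - fhat M (\<phi> (- int (n div c))) (- int c)) * (w0 + w1 * of_real (ln (real c / (real M * real (n div c)))))) * qpow (int n) \<zeta>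
       + C * ((fhat M (\<phi> (int (n div c))) (- int c) - fhat M (\<phi> (- int (n div c))) (int c)) * w1) * (of_real (e1int (real n * Im \<zeta>)) * qpow (- int n) \<zeta>)"
      if cn: "c dvd n" for c
    proof -
      obtain j where j: "n = c * j" using cn by blast
      have jc: "j \<noteq> 0" "c \<noteq> 0" using n j by auto
      have d: "n div c = j" using jc by (simp add: j)
      have n: "n = j * c" using j by simp
      show ?thesis unfolding d \<zeta>_def C_def eis_term_signs[OF jc] n[symmetric] by (simp only: mult.assoc)
    qed
    then have "(\<Sum>c | c dvd n. eis_term w0 w1 M \<phi> z (int (n div c), int c) + eis_term w0 w1 M \<phi> z (- int (n div c), - int c)
       + eis_term w0 w1 M \<phi> z (int (n div c), - int c) + eis_term w0 w1 M \<phi> z (- int (n div c), int c))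
      = (\<Sum>c | c dvd n. C * ((fhat M (\<phi> (int (n div c))) (int c) - fhat M (\<phi> (- int (n div c))) (- int c)) * (w0 + w1 * of_real (ln (real c / (real M * real (n div c)))))) * qpow (int n) \<zeta>
       + C * ((fhat M (\<phi> (int (n div c))) (- int c) - fhat M (\<phi> (- int (n div c))) (int c)) * w1) * (of_real (e1int (real n * Im \<zeta>)) * qpow (- int n) \<zeta>))"
      by (intro sum.cong) auto
    also have "\<dots> = s n"
      unfolding sum.distrib s_def eis_a_def eis_b_def C_def[symmetric] sum_distrib_left[symmetric] sum_distrib_right[symmetric] by (simp only: mult.assoc)
    finally show "(\<Sum>c | c dvd n. eis_term w0 w1 M \<phi> z (int (n div c), int c) + eis_term w0 w1 M \<phi> z (- int (n div c), - int c)
       + eis_term w0 w1 M \<phi> z (int (n div c), - int c) + eis_term w0 w1 M \<phi> z (- int (n div c), int c)) = s n" .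
  qed
  moreover have "(s has_sum (hser (eis_a w0 w1 M \<phi>) \<zeta> + nser (eis_b w1 M \<phi>) \<zeta>)) UNIV"
    unfolding s_def by (intro has_sum_add hser_has_sum nser_has_sum(1) poly_seq_eis \<zeta>)
  then have "(s has_sum (hser (eis_a w0 w1 M \<phi>) \<zeta> + nser (eis_b w1 M \<phi>) \<zeta>)) {1..}"
  proof (rule has_sum_cong_neutral[THEN iffD1, rotated -1])
    fix n :: nat assume "n \<in> UNIV - {1..}"
    then have "n = 0" by auto
    then show "s n = 0" using poly_seq_eis(1)[of w0 w1] poly_seq_eis(2)[of w1] by (simp add: s_def poly_seq_def)
  qed auto
  ultimately have "eisI w0 w1 \<phi> z - eis_const w0 w1 M \<phi> (Im z) = hser (eis_a w0 w1 M \<phi>) \<zeta> + nser (eis_b w1 M \<phi>) \<zeta>"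
    by (rule has_sum_unique)
  then show ?thesis unfolding eis_const_eq \<zeta>_def by (simp add: algebra_simps)
qed

end

section \<open>Growth and holomorphy at the cusps\<close>

lemma hser_bounded:
  assumes a: "poly_seq a" and d: "\<delta> > 0"
  obtains H where "\<And>z. Im z \<ge> \<delta> \<Longrightarrow> norm (hser a z) \<le> H"
proof (rule that)
  fix z assume z: "Im z \<ge> \<delta>"
  then have y: "Im z > 0" using d by simp
  have s: "summable (\<lambda>n. norm (a n) * (1 * exp (- (2 * pi * \<delta>) * real n)))"
    by (rule poly_seq_summable[OF a]) (use d in simp)
  have "norm (hser a z) = norm (\<Sum>n. a n * qpow (int n) z)"
    unfolding hser_def by (simp add: infsum_nat_eq_suminf(2)[OF hser_norm_summable[OF a y]])
  also have "\<dots> \<le> (\<Sum>n. norm (a n * qpow (int n) z))" by (rule summable_norm[OF hser_norm_summable[OF a y]])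
  also have "\<dots> \<le> (\<Sum>n. norm (a n) * (1 * exp (- (2 * pi * \<delta>) * real n)))"
  proof (rule suminf_le[OF _ hser_norm_summable[OF a y] s])
    fix n
    have "2 * pi * real n * \<delta> \<le> 2 * pi * real n * Im z" using z by (intro mult_left_mono) auto
    then show "norm (a n * qpow (int n) z) \<le> norm (a n) * (1 * exp (- (2 * pi * \<delta>) * real n))"
      unfolding norm_mult norm_qpow by (intro mult_left_mono) (auto simp: mult_ac)
  qed
  finally show "norm (hser a z) \<le> (\<Sum>n. norm (a n) * (1 * exp (- (2 * pi * \<delta>) * real n)))" .
qed

lemma nser_bounded:
  assumes b: "poly_seq b" and d: "\<delta> > 0"
  obtains H where "\<And>z. Im z \<ge> \<delta> \<Longrightarrow> norm (nser b z) \<le> H"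
proof (rule that)
  fix z assume z: "Im z \<ge> \<delta>"
  then have y: "Im z > 0" using d by simp
  have s: "summable (\<lambda>n. norm (b n) * (1 / (4 * pi * \<delta>) * exp (- (2 * pi * \<delta>) * real n)))"
    by (rule poly_seq_summable[OF b]) (use d in simp)
  note s' = nser_has_sum(2)[OF b y]
  have "norm (nser b z) = norm (\<Sum>n. b n * of_real (e1int (real n * Im z)) * qpow (- int n) z)"
    unfolding nser_def by (simp only: infsum_nat_eq_suminf(2)[OF s'])
  also have "\<dots> \<le> (\<Sum>n. norm (b n * of_real (e1int (real n * Im z)) * qpow (- int n) z))" by (rule summable_norm[OF s'])
  also have "\<dots> \<le> (\<Sum>n. norm (b n) * (1 / (4 * pi * \<delta>) * exp (- (2 * pi * \<delta>) * real n)))"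
  proof (rule suminf_le[OF _ s' s])
    fix n
    have "b 0 = 0" using b by (simp add: poly_seq_def)
    have "2 * pi * real n * \<delta> \<le> 2 * pi * real n * Im z" using z by (intro mult_left_mono) auto
    then have "1 / (4 * pi * Im z) * exp (- (2 * pi * Im z) * real n) \<le> 1 / (4 * pi * \<delta>) * exp (- (2 * pi * \<delta>) * real n)"
      using z d y by (intro mult_mono divide_left_mono) (auto simp: mult_ac)
    then have "norm (b n) * (1 / (4 * pi * Im z) * exp (- (2 * pi * Im z) * real n)) \<le> norm (b n) * (1 / (4 * pi * \<delta>) * exp (- (2 * pi * \<delta>) * real n))"
      by (rule mult_left_mono) simp
    with nser_term_bound[where b = b and n = n, OF \<open>b 0 = 0\<close> y]
    show "norm (b n * of_real (e1int (real n * Im z)) * qpow (- int n) z) \<le> norm (b n) * (1 / (4 * pi * \<delta>) * exp (- (2 * pi * \<delta>) * real n))"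
      by (rule order_trans)
  qed
  finally show "norm (nser b z) \<le> (\<Sum>n. norm (b n) * (1 / (4 * pi * \<delta>) * exp (- (2 * pi * \<delta>) * real n)))" .
qed

text \<open>For Im z at least 1 both series are bounded, and constants and log y are at most
  multiples of exp(Im z).\<close>

lemma eisI_growth:
  assumes M: "M \<ge> 1" and K: "K \<ge> 1"
    and per: "\<And>m n. \<phi> m (n + int M) = \<phi> m n" and perK: "\<And>m n. \<phi> (m + int K) n = \<phi> m n"
  shows "\<exists>A B y0 :: real. \<forall>z\<in>upper_half_plane. Im z \<ge> y0 \<longrightarrow> norm (eisI w0 w1 \<phi> z) \<le> A * exp (B * Im z)"
proof -
  note ex = eisI_expansion[where \<phi> = \<phi>, OF M K per perK]
  note ps = poly_seq_eis[where \<phi> = \<phi>, OF M K per perK]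
  have M0: "1 / real M > 0" using M by simp
  obtain H1 where H1: "\<And>z. Im z \<ge> 1 / real M \<Longrightarrow> norm (hser (eis_a w0 w1 M \<phi>) z) \<le> H1"
    using hser_bounded[OF ps(1) M0] by metis
  obtain H2 where H2: "\<And>z. Im z \<ge> 1 / real M \<Longrightarrow> norm (nser (eis_b w1 M \<phi>) z) \<le> H2"
    using nser_bounded[OF ps(2) M0] by metis
  define c where "c = norm (eis_c0 w0 w1 M \<phi>)"
  define d where "d = norm (eis_d0 w1 M \<phi>)"
  have "norm (eisI w0 w1 \<phi> z) \<le> (c + d + \<bar>H1\<bar> + \<bar>H2\<bar>) * exp (1 * Im z)" if z: "Im z \<ge> 1" for z
  proof -
    have zM: "Im (z / of_nat M) \<ge> 1 / real M" using z M by (simp add: divide_right_mono)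
    have e1: "1 \<le> exp (Im z)" using z by simp
    have l: "\<bar>ln (Im z)\<bar> \<le> exp (Im z)" using z ln_le_minus_one[of "Im z"] exp_ge_add_one_self[of "Im z"] ln_ge_zero[of "Im z"] by linarith
    have z0: "Im z > 0" using z by simp
    have "norm (eisI w0 w1 \<phi> z) \<le> c + d * \<bar>ln (Im z)\<bar> + H1 + H2"
      unfolding ex[OF z0] c_def d_def
      by (intro norm_triangle_le add_mono H1[OF zM] H2[OF zM]) (simp_all add: norm_mult)
    also have "\<dots> \<le> c * exp (Im z) + d * exp (Im z) + \<bar>H1\<bar> * exp (Im z) + \<bar>H2\<bar> * exp (Im z)"
    proof (intro add_mono)
      show "c \<le> c * exp (Im z)" using mult_left_mono[OF e1, of c] by (simp add: c_def)
      show "d * \<bar>ln (Im z)\<bar> \<le> d * exp (Im z)" using mult_left_mono[OF l, of d] by (simp add: d_def)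
      show "H1 \<le> \<bar>H1\<bar> * exp (Im z)" using mult_left_mono[OF e1, of "\<bar>H1\<bar>"] by simp
      show "H2 \<le> \<bar>H2\<bar> * exp (Im z)" using mult_left_mono[OF e1, of "\<bar>H2\<bar>"] by simp
    qed
    finally show ?thesis by (simp add: algebra_simps)
  qed
  then show ?thesis by blast
qed

text \<open>w1 = 0 kills both the log y term and the nonholomorphic series, and what remains is a
  power series in exp(2 pi i z/M).\<close>

lemma eisI_holomorphic_expansion:
  assumes M: "M \<ge> 1" and K: "K \<ge> 1"
    and per: "\<And>m n. \<phi> m (n + int M) = \<phi> m n" and perK: "\<And>m n. \<phi> (m + int K) n = \<phi> m n"
  shows "\<exists>h::nat. h > 0 \<and> (\<exists>\<alpha> :: nat \<Rightarrow> complex. \<forall>z\<in>upper_half_plane.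
           ((\<lambda>n. \<alpha> n * exp (2 * of_real pi * \<i> * of_nat n * z / of_nat h)) has_sum eisI w0 0 \<phi> z) UNIV)"
proof -
  note ex = eisI_expansion[where \<phi> = \<phi>, OF M K per perK]
  note ps = poly_seq_eis[where \<phi> = \<phi>, OF M K per perK]
  have b: "eis_b 0 M \<phi> = (\<lambda>n. 0)" by (simp add: fun_eq_iff eis_b_def)
  have "((\<lambda>n. (eis_a w0 0 M \<phi> n + (if n = 0 then eis_c0 w0 0 M \<phi> else 0)) * exp (2 * of_real pi * \<i> * of_nat n * z / of_nat M)) has_sum eisI w0 0 \<phi> z) UNIV"
    if z: "z \<in> upper_half_plane" for z
  proof -
    have z0: "Im z > 0" "Im (z / of_nat M) > 0" using z M by (auto simp: upper_half_plane_def)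
    have "((\<lambda>n. eis_a w0 0 M \<phi> n * qpow (int n) (z / of_nat M) + (if n = 0 then eis_c0 w0 0 M \<phi> else 0)) has_sum
       (hser (eis_a w0 0 M \<phi>) (z / of_nat M) + eis_c0 w0 0 M \<phi>)) UNIV"
    proof (intro has_sum_add hser_has_sum ps z0)
      have "((\<lambda>n::nat. if n = 0 then eis_c0 w0 0 M \<phi> else 0) has_sum eis_c0 w0 0 M \<phi>) {0}"
        by (rule has_sum_finiteI) simp_all
      then show "((\<lambda>n::nat. if n = 0 then eis_c0 w0 0 M \<phi> else 0) has_sum eis_c0 w0 0 M \<phi>) UNIV"
        by (rule has_sum_cong_neutral[THEN iffD1, rotated -1]) auto
    qed
    moreover have "eisI w0 0 \<phi> z = hser (eis_a w0 0 M \<phi>) (z / of_nat M) + eis_c0 w0 0 M \<phi>"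
      unfolding ex[OF z0(1)] b by (simp add: nser_def eis_d0_def)
    moreover have "eis_a w0 0 M \<phi> n * qpow (int n) (z / of_nat M) + (if n = 0 then eis_c0 w0 0 M \<phi> else 0)
       = (eis_a w0 0 M \<phi> n + (if n = 0 then eis_c0 w0 0 M \<phi> else 0)) * exp (2 * of_real pi * \<i> * of_nat n * z / of_nat M)" for n
      by (simp add: qpow_def distrib_right)
    ultimately show ?thesis by (simp only:)
  qed
  then show ?thesis using M
    by (intro exI[of _ M] conjI exI[of _ "\<lambda>n. eis_a w0 0 M \<phi> n + (if n = 0 then eis_c0 w0 0 M \<phi> else 0)"] ballI) auto
qed

lemma eisI_cmult: "eisI w0 w1 (\<lambda>m n. s * \<phi> m n) z = s * eisI w0 w1 \<phi> z"
proof -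
  have t: "theta2 (\<lambda>m n. s * \<phi> m n) z t = s * theta2 \<phi> z t" for t
    unfolding theta2_def infsum_cmult_right'[symmetric] by (rule infsum_cong) (auto simp: mult_ac)
  have "integral\<^sup>L lborel (\<lambda>x. of_real (exp x) * theta2 (\<lambda>m n. s * \<phi> m n) z (exp x) * (w0 + w1 * of_real x))
     = integral\<^sup>L lborel (\<lambda>x. s * (of_real (exp x) * theta2 \<phi> z (exp x) * (w0 + w1 * of_real x)))"
    by (rule Bochner_Integration.integral_cong) (simp_all add: t mult_ac)
  then show ?thesis unfolding eisI_def by (simp add: mult_ac)
qed

text \<open>Slashing by a matrix of determinant 1 gives an integral of the same kind, for the
  lattice function composed with the inverse substitution. Every cusp is thereby reduced to
  infinity.\<close>

lemma eisI_slash: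
  assumes det: "a * d - b * c = 1" and z: "Im z > 0"
  shows "slash1 a b c d (eisI w0 w1 \<phi>) z = eisI w0 w1 (\<lambda>m n. \<phi> (d * m - c * n) (a * n - b * m)) z"
proof -
  define j where "j = of_int c * z + of_int d"
  have j: "j \<noteq> 0"
  proof
    assume "j = 0"
    then have "Im j = 0" "Re j = 0" by simp_all
    then have "c = 0" "d = 0" using z by (auto simp: j_def)
    then show False using det by simp
  qed
  have 1: "d * (m * a + n * c) - c * (m * b + n * d) = m" for m n
  proof -
    have "d * (m * a + n * c) - c * (m * b + n * d) = m * (a * d - b * c)" by (simp add: algebra_simps)
    then show ?thesis by (simp add: det)
  qed
  have 2: "a * (m * b + n * d) - b * (m * a + n * c) = n" for m n
  proof -
    have "a * (m * b + n * d) - b * (m * a + n * c) = n * (a * d - b * c)" by (simp add: algebra_simps)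
    then show ?thesis by (simp add: det)
  qed
  have "eisI w0 w1 \<phi> ((of_int a * z + of_int b) / j) = j * eisI w0 w1 (\<lambda>m n. \<phi> (d * m - c * n) (a * n - b * m)) z"
    unfolding j_def by (rule eisI_transform[OF det z]) (simp only: 1 2)
  then show ?thesis using j by (simp add: slash1_def j_def[symmetric])
qed

text \<open>A common period of both variables survives integral substitutions, so the slashed
  functions have expansions of the same type.\<close>

lemma slash_biperiodic:
  fixes \<phi> :: "int \<Rightarrow> int \<Rightarrow> complex"
  assumes per: "\<And>m n. \<phi> m (n + int N) = \<phi> m n" and perN: "\<And>m n. \<phi> (m + int N) n = \<phi> m n"
  shows "\<phi> (d * (m + int N) - c * n) (a * n - b * (m + int N)) = \<phi> (d * m - c * n) (a * n - b * m)"
    and "\<phi> (d * m - c * (n + int N)) (a * (n + int N) - b * m) = \<phi> (d * m - c * n) (a * n - b * m)"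
proof -
  have p: "\<phi> (m + int N * k) (n + int N * l) = \<phi> m n" for m n k l
    using periodic_int_multiple[where f = "\<lambda>m. \<phi> m (n + int N * l)", OF perN] periodic_int_multiple[where f = "\<phi> m", OF per] by simp
  show "\<phi> (d * (m + int N) - c * n) (a * n - b * (m + int N)) = \<phi> (d * m - c * n) (a * n - b * m)"
    using p[of "d * m - c * n" d "a * n - b * m" "- b"] by (simp add: algebra_simps)
  show "\<phi> (d * m - c * (n + int N)) (a * (n + int N) - b * m) = \<phi> (d * m - c * n) (a * n - b * m)"
    using p[of "d * m - c * n" "- c" "a * n - b * m" a] by (simp add: algebra_simps)
qed

lemma eisI_linear_exponential_growth:
  assumes "N \<ge> 1" "\<And>m n. \<phi> m (n + int N) = \<phi> m n" "\<And>m n. \<phi> (m + int N) n = \<phi> m n"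
  shows "linear_exponential_growth_at_cusps (eisI w0 w1 \<phi>)"
  unfolding linear_exponential_growth_at_cusps_def
proof (intro allI impI)
  fix a b c d :: int assume det: "a * d - b * c = 1"
  have "\<exists>A B y0 :: real. \<forall>z\<in>upper_half_plane. Im z \<ge> y0 \<longrightarrow>
      norm (eisI w0 w1 (\<lambda>m n. \<phi> (d * m - c * n) (a * n - b * m)) z) \<le> A * exp (B * Im z)"
    by (rule eisI_growth[OF assms(1,1)]) (rule slash_biperiodic[where \<phi> = \<phi>, OF assms(2,3)])+
  then show "\<exists>A B y0 :: real. \<forall>z\<in>upper_half_plane. Im z \<ge> y0 \<longrightarrow> norm (slash1 a b c d (eisI w0 w1 \<phi>) z) \<le> A * exp (B * Im z)"
    by (simp add: eisI_slash[OF det] upper_half_plane_def)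
qed

lemma eisI_holomorphic_at_cusps:
  assumes "N \<ge> 1" "\<And>m n. \<phi> m (n + int N) = \<phi> m n" "\<And>m n. \<phi> (m + int N) n = \<phi> m n"
  shows "holomorphic_at_cusps (eisI w0 0 \<phi>)"
  unfolding holomorphic_at_cusps_def
proof (intro allI impI)
  fix a b c d :: int assume det: "a * d - b * c = 1"
  have "\<exists>h::nat. h > 0 \<and> (\<exists>\<alpha> :: nat \<Rightarrow> complex. \<forall>z\<in>upper_half_plane.
           ((\<lambda>n. \<alpha> n * exp (2 * of_real pi * \<i> * of_nat n * z / of_nat h)) has_sum eisI w0 0 (\<lambda>m n. \<phi> (d * m - c * n) (a * n - b * m)) z) UNIV)"
    by (rule eisI_holomorphic_expansion[OF assms(1,1)]) (rule slash_biperiodic[where \<phi> = \<phi>, OF assms(2,3)])+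
  then show "\<exists>h::nat. h > 0 \<and> (\<exists>\<alpha> :: nat \<Rightarrow> complex. \<forall>z\<in>upper_half_plane.
           ((\<lambda>n. \<alpha> n * exp (2 * of_real pi * \<i> * of_nat n * z / of_nat h)) has_sum slash1 a b c d (eisI w0 0 \<phi>) z) UNIV)"
    by (simp add: eisI_slash[OF det] upper_half_plane_def)
qed

lemma moebius_upper_half_plane:
  assumes det: "a * d - b * c = (1::int)" and z: "z \<in> upper_half_plane"
  shows "(of_int a * z + of_int b) / (of_int c * z + of_int d) \<in> upper_half_plane"
proof -
  define j where "j = of_int c * z + of_int d"
  have y: "Im z > 0" using z by (simp add: upper_half_plane_def)
  have j: "j \<noteq> 0"
  proof
    assume "j = 0"
    then have "Im j = 0" "Re j = 0" by simp_all
    then have "c = 0" "d = 0" using y by (auto simp: j_def)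
    then show False using det by simp
  qed
  have "Im ((of_int a * z + of_int b) * cnj j) = of_int (a * d - b * c) * Im z"
    by (simp add: j_def algebra_simps)
  then have "Im ((of_int a * z + of_int b) / j) = Im z / (norm j)\<^sup>2"
    by (simp add: complex_div_cnj[of _ j] det Im_divide_of_real del: of_real_power)
  then show ?thesis using y j unfolding j_def[symmetric] by (simp add: upper_half_plane_def)
qed

lemma holomorphic_at_cusps_cong:
  assumes "holomorphic_at_cusps f" "\<And>z. z \<in> upper_half_plane \<Longrightarrow> f z = g z"
  shows "holomorphic_at_cusps g"
  using assms unfolding holomorphic_at_cusps_def slash1_def
  by (simp add: moebius_upper_half_plane)

lemma linear_exponential_growth_at_cusps_cong:
  assumes "linear_exponential_growth_at_cusps f" "\<And>z. z \<in> upper_half_plane \<Longrightarrow> f z = g z"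
  shows "linear_exponential_growth_at_cusps g"
  using assms unfolding linear_exponential_growth_at_cusps_def slash1_def
  by (simp add: moebius_upper_half_plane)

lemma hser_dilate:
  assumes t: "t \<ge> 1" and 0: "\<And>n. \<not> t dvd n \<Longrightarrow> a n = 0"
  shows "hser (\<lambda>n. a (t * n)) (of_nat t * z) = hser a z"
proof -
  have 0: "a n = 0" if "n \<notin> range (\<lambda>n. t * n)" for n by (rule 0) (use that in \<open>auto elim!: dvdE\<close>)
  have "hser a z = (\<Sum>\<^sub>\<infinity>n\<in>range (\<lambda>n. t * n). a n * qpow (int n) z)"
    unfolding hser_def by (rule infsum_cong_neutral) (use 0 in auto)
  also have "\<dots> = (\<Sum>\<^sub>\<infinity>n. a (t * n) * qpow (int (t * n)) z)"
    by (subst infsum_reindex) (use t in \<open>auto simp: inj_on_def comp_def\<close>)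
  also have "\<dots> = hser (\<lambda>n. a (t * n)) (of_nat t * z)"
    unfolding hser_def by (rule infsum_cong) (simp add: qpow_def mult_ac)
  finally show ?thesis by simp
qed

lemma nser_dilate:
  assumes t: "t \<ge> 1" and 0: "\<And>n. \<not> t dvd n \<Longrightarrow> b n = 0"
  shows "nser (\<lambda>n. b (t * n)) (of_nat t * z) = nser b z"
proof -
  have 0: "b n = 0" if "n \<notin> range (\<lambda>n. t * n)" for n by (rule 0) (use that in \<open>auto elim!: dvdE\<close>)
  have "nser b z = (\<Sum>\<^sub>\<infinity>n\<in>range (\<lambda>n. t * n). b n * of_real (e1int (real n * Im z)) * qpow (- int n) z)"
    unfolding nser_def by (rule infsum_cong_neutral) (use 0 in auto)
  also have "\<dots> = (\<Sum>\<^sub>\<infinity>n. b (t * n) * of_real (e1int (real (t * n) * Im z)) * qpow (- int (t * n)) z)"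
    by (subst infsum_reindex) (use t in \<open>auto simp: inj_on_def comp_def\<close>)
  also have "\<dots> = nser (\<lambda>n. b (t * n)) (of_nat t * z)"
    unfolding nser_def by (rule infsum_cong) (simp add: qpow_def mult_ac)
  finally show ?thesis by simp
qed

lemma poly_seq_dilate: assumes "poly_seq a" shows "poly_seq (\<lambda>n. a (t * n))"
proof -
  obtain C k where C: "a 0 = 0" "\<And>n. norm (a n) \<le> C * real n ^ k" using assms unfolding poly_seq_def by blast
  have "norm (a (t * n)) \<le> (C * real t ^ k) * real n ^ k" for n
    using C(2)[of "t * n"] by (simp add: power_mult_distrib mult_ac)
  then show ?thesis using C(1) unfolding poly_seq_def by auto
qed

section \<open>Conjugation and dilation\<close>

lemma theta1_cnj: "theta1 (\<lambda>n. cnj (f n)) t = cnj (theta1 f t)"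
  unfolding theta1_def infsum_cnj[symmetric] by (rule infsum_cong) simp

lemma Lam_cnj: assumes "cnj u = u" shows "Lam (\<lambda>n. cnj (f n)) u = cnj (Lam f u)"
proof -
  have "Lam (\<lambda>n. cnj (f n)) u = integral\<^sup>L lborel (\<lambda>x. cnj (theta1 f (exp x) * exp (u * of_real x)))"
    unfolding Lam_def theta1_cnj by (simp add: exp_cnj assms)
  also have "\<dots> = cnj (Lam f u)" unfolding Lam_def by (rule Bochner_Integration.integral_cnj)
  finally show ?thesis .
qed

lemma theta1_cmult: "theta1 (\<lambda>n. s * f n) t = s * theta1 f t"
  by (simp add: theta1_def mult.assoc infsum_cmult_right')

lemma Lam_cmult: "Lam (\<lambda>n. s * f n) u = s * Lam f u" "Lam' (\<lambda>n. s * f n) u = s * Lam' f u"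
  by (simp_all add: Lam_def Lam'_def theta1_cmult mult.assoc)

definition dilate :: "nat \<Rightarrow> (int \<Rightarrow> complex) \<Rightarrow> int \<Rightarrow> complex" where
  "dilate T f m = (if int T dvd m then f (m div int T) else 0)"

lemma theta1_dilate:
  assumes "T \<ge> 1" shows "theta1 (dilate T f) x = of_nat T * theta1 f (real T ^ 2 * x)"
proof -
  have "theta1 (dilate T f) x = (\<Sum>\<^sub>\<infinity>n\<in>range (\<lambda>n. int T * n). dilate T f n * of_int n * of_real (exp (- pi * x * (of_int n)\<^sup>2)))"
    unfolding theta1_def by (rule infsum_cong_neutral) (auto simp: dilate_def elim!: dvdE)
  also have "\<dots> = (\<Sum>\<^sub>\<infinity>n. dilate T f (int T * n) * of_int (int T * n) * of_real (exp (- pi * x * (of_int (int T * n))\<^sup>2)))"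
    by (subst infsum_reindex) (use assms in \<open>auto simp: inj_on_def comp_def\<close>)
  also have "\<dots> = (\<Sum>\<^sub>\<infinity>n. of_nat T * (f n * of_int n * of_real (exp (- pi * (real T ^ 2 * x) * (of_int n)\<^sup>2))))"
    using assms by (intro infsum_cong) (simp add: dilate_def power_mult_distrib mult_ac)
  finally show ?thesis by (simp add: theta1_def infsum_cmult_right')
qed

text \<open>Dilation by T translates the logarithmic variable by 2 log T. At u = 1/2 this exactly
  compensates the factor T of the linear coefficient, so the value is unchanged and the derivative
  acquires -2 log T; with T = tM this becomes log(tM) in the constant term.\<close>

lemma Lam_dilate:
  assumes T: "T \<ge> 1" and L: "L \<ge> 1" and per: "\<And>n. f (n + int L) = f n"
  shows "Lam (dilate T f) (1 / 2) = Lam f (1 / 2)"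
    and "Lam' (dilate T f) (1 / 2) = Lam' f (1 / 2) - 2 * of_real (ln (real T)) * Lam f (1 / 2)"
proof -
  define G where "G c0 c1 x = theta1 f (exp x) * exp (1 / 2 * of_real x) * (c0 + c1 * of_real x)" for c0 c1 :: complex and x :: real
  have G: "has_bochner_integral lborel (\<lambda>x. G c0 c1 (x + 2 * ln (real T))) (c0 * Lam f (1 / 2) + c1 * Lam' f (1 / 2))" for c0 c1
  proof -
    have "has_bochner_integral lborel (G c0 c1) (c0 * Lam f (1 / 2) + c1 * Lam' f (1 / 2))"
      unfolding G_def by (rule Lam_linear[where f = f, OF L per])
    then show ?thesis by (rule has_bochner_integral_shift_iff[THEN iffD2])
  qed
  have sh: "G c0 c1 (x + 2 * ln (real T)) = theta1 (dilate T f) (exp x) * exp (1 / 2 * of_real x) * (c0 + c1 * (of_real x + 2 * of_real (ln (real T))))" for c0 c1 x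
  proof -
    have T0: "real T > 0" using T by simp
    have "exp (2 * ln (real T)) = exp (ln (real T)) ^ 2" by (simp add: power2_eq_square exp_add[symmetric])
    then have 1: "exp (x + 2 * ln (real T)) = real T ^ 2 * exp x" using T0 by (simp add: exp_add mult.commute)
    have "exp (complex_of_real (ln (real T))) = of_nat T" using T0 by (simp add: exp_of_real)
    then have 2: "exp (1 / 2 * complex_of_real (x + 2 * ln (real T))) = of_nat T * exp (1 / 2 * of_real x)"
      by (simp add: ring_distribs exp_add mult.commute)
    show ?thesis unfolding G_def 1 2 theta1_dilate[OF T] by (simp add: mult_ac)
  qed
  show "Lam (dilate T f) (1 / 2) = Lam f (1 / 2)"
    using has_bochner_integral_integral_eq[OF G[of 1 0]] unfolding sh Lam_def[of "dilate T f"] by simp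
  show "Lam' (dilate T f) (1 / 2) = Lam' f (1 / 2) - 2 * of_real (ln (real T)) * Lam f (1 / 2)"
    using has_bochner_integral_integral_eq[OF G[of "- 2 * of_real (ln (real T))" 1]] unfolding sh Lam'_def[of "dilate T f"] by (simp add: mult_ac)
qed

lemma fhat_cmult: "fhat M (\<lambda>n. s * f n) k = s * fhat M f k"
  by (simp add: fhat_def sum_distrib_left mult.assoc)

lemma cnj_fhat: "cnj (fhat M f k) = fhat M (\<lambda>n. cnj (f n)) (- k)"
  unfolding fhat_def cnj_sum by (rule sum.cong) (simp_all add: ee_uminus[symmetric])

text \<open>By the substitution of -b for b.\<close>

lemma fhat_minus:
  assumes d: "dirichlet_character M \<beta>" and M: "M \<ge> 1"
  shows "fhat M \<beta> (- k) = \<beta> (- 1) * fhat M \<beta> k"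
proof -
  define f where "f b = \<beta> b * ee (of_int (- k * b) / of_nat M)" for b
  have "f (a + int M) = f a" for a
  proof -
    have "ee (of_int (- k * (a + int M)) / real M) = ee (of_int (- k * a) / real M)"
      by (rule ee_frac_cong[OF _ M]) (simp add: cong_iff_dvd_diff algebra_simps)
    then show ?thesis by (simp add: f_def dchar_periodic[OF d])
  qed
  from sum_residues_mult[where f = f and k = "- 1", OF this M]
  have "(\<Sum>b\<in>{0..<int M}. f (- 1 * b)) = (\<Sum>b\<in>{0..<int M}. f b)" by simp
  moreover have f1: "f (- 1 * b) = \<beta> (- 1) * (\<beta> b * ee (of_int (k * b) / of_nat M))" for b
    unfolding f_def dchar_mult[OF d, of "- 1" b] by simp
  have "(\<Sum>b\<in>{0..<int M}. f (- 1 * b)) = \<beta> (- 1) * fhat M \<beta> k"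
    unfolding fhat_def sum_distrib_left by (rule sum.cong[OF refl f1])
  moreover have "fhat M \<beta> (- k) = (\<Sum>b\<in>{0..<int M}. f b)" unfolding fhat_def f_def ..
  ultimately show ?thesis by (simp only:)
qed

text \<open>Conjugation sends i to -i and \<open>fhat\<close> at k to \<open>fhat\<close> of the
  conjugate function at -k. So the nonholomorphic part of the derivative moment is, up to sign and
  conjugation, the holomorphic part of the value moment for the conjugate function: the relation
  between Maass form and shadow.\<close>

lemma eis_conjugate:
  shows "- cnj (eis_b 1 M \<phi> n) = eis_a 1 0 M (\<lambda>m n. cnj (\<phi> m n)) n"
    and "cnj (eis_d0 1 M \<phi>) = eis_c0 1 0 M (\<lambda>m n. cnj (\<phi> m n))"
proof -
  have "cnj (fhat M (\<phi> a) (- k) - fhat M (\<phi> a') k) = fhat M (\<lambda>n. cnj (\<phi> a n)) k - fhat M (\<lambda>n. cnj (\<phi> a' n)) (- k)" for a a' k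
    by (simp add: cnj_fhat)
  then show "- cnj (eis_b 1 M \<phi> n) = eis_a 1 0 M (\<lambda>m n. cnj (\<phi> m n)) n"
    unfolding eis_b_def eis_a_def by (simp add: sum_divide_distrib)
  show "cnj (eis_d0 1 M \<phi>) = eis_c0 1 0 M (\<lambda>m n. cnj (\<phi> m n))"
    unfolding eis_d0_def eis_c0_def using Lam_cnj[of 1 "\<phi> 0"] Lam_cnj[of "1 / 2" "\<lambda>m. fhat M (\<phi> m) 0"]
    by (simp add: cnj_fhat)
qed

section \<open>The functions attached to a pair of characters\<close>

text \<open>A pair of characters as a function on the lattice, supported where T divides m. For T =
  tM the support makes the function an eigenvector of the matrices whose lower left entry is
  divisible by tLM, and turns powers of q^(1/M) into powers of q^t.\<close>

definition twist :: "nat \<Rightarrow> (int \<Rightarrow> complex) \<Rightarrow> (int \<Rightarrow> complex) \<Rightarrow> int \<Rightarrow> int \<Rightarrow> complex" where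
  "twist T \<alpha> \<beta> m n = dilate T \<alpha> m * \<beta> n"

lemma fhat_twist: "fhat M (twist T \<alpha> \<beta> m) k = dilate T \<alpha> m * fhat M \<beta> k"
  unfolding twist_def[abs_def] by (rule fhat_cmult)

text \<open>0 is a unit only modulo 1. This is the origin of the case of a trivial character modulo
  1 in the constant terms.\<close>

lemma dchar_at_0:
  assumes "dirichlet_character L \<alpha>" "L \<ge> 1"
  shows "\<alpha> 0 = (if \<alpha> = trivial_character 1 then 1 else 0)"
proof (cases "L = 1")
  case True
  have "\<alpha> a = trivial_character 1 a" for a
    using periodic_cong[of \<alpha> 1 a 1] dchar_periodic[OF assms(1)] dchar_1[OF assms(1)] True by (simp add: trivial_character_def)
  then have "\<alpha> = trivial_character 1" by (rule ext)
  then show ?thesis by (simp add: trivial_character_def)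
next
  case False
  then have "\<alpha> 0 = 0" using dchar_eq_0[OF assms(1), of 0] by simp
  moreover have "trivial_character 1 0 = 1" by (simp add: trivial_character_def)
  ultimately show ?thesis by auto
qed

text \<open>The divisors c of n for which T divides n/c are the divisors of n/T.\<close>

lemma sum_divisors_dilate:
  fixes g :: "nat \<Rightarrow> nat \<Rightarrow> complex"
  assumes n: "n \<ge> 1" and T: "T \<ge> 1"
  shows "(\<Sum>c | c dvd n. if T dvd n div c then g c (n div c div T) else 0)
       = (if T dvd n then \<Sum>c | c dvd n div T. g c (n div T div c) else 0)"
proof (cases "T dvd n")
  case True
  then obtain q where q: "n = T * q" by blast
  have q0: "q \<ge> 1" using n q by (cases "q = 0") auto
  have nT: "n div T = q" using q T by simp
  have nc: "n div c = T * (q div c)" if "c dvd q" for c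
    using that unfolding q by (rule div_mult_swap[symmetric])
  have "(\<Sum>c | c dvd q. g c (q div c)) = (\<Sum>c | c dvd n. if T dvd n div c then g c (n div c div T) else 0)"
  proof (rule sum.mono_neutral_cong_left)
    show "finite {c. c dvd n}" using n by simp
    show "{c. c dvd q} \<subseteq> {c. c dvd n}" unfolding q by auto
    show "\<forall>c\<in>{c. c dvd n} - {c. c dvd q}. (if T dvd n div c then g c (n div c div T) else 0) = 0"
    proof
      fix c assume c: "c \<in> {c. c dvd n} - {c. c dvd q}"
      have "\<not> T dvd n div c"
      proof
        assume "T dvd n div c"
        then obtain r where r: "n div c = T * r" by blast
        have "n = c * (T * r)" using c r by (metis DiffD1 dvd_mult_div_cancel mem_Collect_eq)
        then have "T * q = T * (c * r)" unfolding q by (simp only: mult_ac)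
        then have "q = c * r" using T by auto
        then show False using c by simp
      qed
      then show "(if T dvd n div c then g c (n div c div T) else 0) = 0" by simp
    qed
    show "g c (q div c) = (if T dvd n div c then g c (n div c div T) else 0)" if "c \<in> {c. c dvd q}" for c
      using nc[of c] that T by simp
  qed
  then show ?thesis using True nT by simp
next
  case False
  have "\<not> T dvd n div c" if "c dvd n" for c
    using False that by (metis dvd_div_mult_self dvd_mult2)
  then show ?thesis using False by (simp add: sum.neutral)
qed

context
  fixes L M t :: nat and \<alpha> \<beta> :: "int \<Rightarrow> complex"
  assumes L: "L \<ge> 1" and M: "M \<ge> 1" and t: "t \<ge> 1"
    and \<alpha>: "dirichlet_character L \<alpha>" and \<beta>: "dirichlet_character M \<beta>"
    and odd: "\<alpha> (-1) * \<beta> (-1) = -1"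
begin

lemma twist_periodic: "twist T \<alpha> \<beta> m (n + int M) = twist T \<alpha> \<beta> m n"
  by (simp add: twist_def dchar_periodic[OF \<beta>])

lemma twist_periodic_level:
  "twist (t * M) \<alpha> \<beta> m (n + int (t * L * M)) = twist (t * M) \<alpha> \<beta> m n"
  "twist (t * M) \<alpha> \<beta> (m + int (t * L * M)) n = twist (t * M) \<alpha> \<beta> m n"
proof -
  show "twist (t * M) \<alpha> \<beta> m (n + int (t * L * M)) = twist (t * M) \<alpha> \<beta> m n"
    using periodic_int_multiple[where f = "twist (t * M) \<alpha> \<beta> m", OF twist_periodic, of n "int (t * L)"] by (simp add: mult_ac)
  have e: "int (t * L * M) = int (t * M) * int L" by simp
  have T: "int (t * M) \<noteq> 0" using t M by simp
  have "dilate (t * M) \<alpha> (m + int (t * L * M)) = dilate (t * M) \<alpha> m"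
    unfolding dilate_def e using dchar_periodic[OF \<alpha>] T by (simp add: dvd_add_left_iff del: of_nat_mult)
  then show "twist (t * M) \<alpha> \<beta> (m + int (t * L * M)) n = twist (t * M) \<alpha> \<beta> m n" by (simp add: twist_def)
qed

text \<open>Write m = Tq with T = tM. As c is divisible by TL, the new first coordinate is T times a
  number congruent to qa modulo L; the new second coordinate is nd modulo M because M divides
  m.\<close>

lemma twist_transform:
  assumes det: "a * d - b * c = 1" and N: "int (t * L * M) dvd c"
  shows "twist (t * M) \<alpha> \<beta> (m * a + n * c) (m * b + n * d) = \<alpha> a * \<beta> d * twist (t * M) \<alpha> \<beta> m n"
proof -
  define T where "T = int (t * M)"
  have T0: "T \<noteq> 0" using t M by (simp add: T_def)
  have D: "dilate (t * M) \<alpha> k = (if T dvd k then \<alpha> (k div T) else 0)" for k by (simp only: dilate_def T_def)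
  obtain e where "c = int (t * L * M) * e" using N by blast
  then have e: "c = T * (int L * e)" by (simp add: T_def mult_ac)
  \<comment> \<open>The determinant condition makes a prime to T, so the substitution neither
    creates nor destroys divisibility of the first coordinate by T.\<close>
  have cop: "coprime T a"
  proof (rule coprimeI)
    fix x assume x: "x dvd T" "x dvd a"
    then have "x dvd a * d - b * c" unfolding e by (intro dvd_diff dvd_mult2 dvd_mult) auto
    then show "is_unit x" using det by simp
  qed
  have dv: "T dvd m * a + n * c \<longleftrightarrow> T dvd m"
  proof -
    have "T dvd n * c" unfolding e by simp
    then have "T dvd m * a + n * c \<longleftrightarrow> T dvd m * a" by (rule dvd_add_left_iff)
    then show ?thesis using coprime_dvd_mult_left_iff[OF cop] by simp
  qed
  show ?thesis
  proof (cases "T dvd m")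
    case True
    then obtain q where q: "m = T * q" by blast
    have "m * a + n * c = T * (q * a + int L * (n * e))" unfolding q e by (simp add: algebra_simps)
    then have "(m * a + n * c) div T = q * a + int L * (n * e)" using T0 by simp
    moreover have "\<alpha> (q * a + int L * (n * e)) = \<alpha> (q * a)"
      by (rule periodic_int_multiple) (rule dchar_periodic[OF \<alpha>])
    ultimately have 1: "dilate (t * M) \<alpha> (m * a + n * c) = \<alpha> q * \<alpha> a"
      unfolding D using dv True dchar_mult[OF \<alpha>, of q a] by simp
    have 2: "dilate (t * M) \<alpha> m = \<alpha> q" unfolding D using T0 by (simp add: q)
    have "\<beta> (m * b + n * d) = \<beta> (n * d)"
      using periodic_int_multiple[where f = \<beta>, OF dchar_periodic[OF \<beta>], of "n * d" "int t * q * b"]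
      by (simp add: q T_def algebra_simps)
    then show ?thesis unfolding twist_def 1 2 dchar_mult[OF \<beta>, of n d] by (simp only: mult_ac)
  next
    case False
    then show ?thesis using dv by (simp add: twist_def D)
  qed
qed

text \<open>\<open>\<alpha> a\<close> is inverse to \<open>\<alpha> d\<close> since ad = 1 modulo L,
  and \<open>\<beta> d\<close> is inverse to its conjugate because d is prime to M. Moving both to
  the other side gives the multiplier.\<close>

lemma eisI_twist_transform:
  assumes det: "a * d - b * c = 1" and N: "int (t * L * M) dvd c" and z: "Im z > 0"
  shows "eisI w0 w1 (twist (t * M) \<alpha> \<beta>) ((of_int a * z + of_int b) / (of_int c * z + of_int d))
     = \<alpha> d * cnj (\<beta> d) * (of_int c * z + of_int d) * eisI w0 w1 (twist (t * M) \<alpha> \<beta>) z"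
proof -
  have c: "int L dvd c" "int M dvd c" using N by (auto intro: dvd_trans[rotated])
  have "[a * d = 1] (mod int L)"
    using c(1) det by (metis cong_iff_dvd_diff diff_add_cancel add_diff_cancel_left' dvd_mult mult.commute diff_diff_eq2)
  then have ad: "\<alpha> a * \<alpha> d = 1"
    using dchar_cong[OF \<alpha>, of "a * d" 1] dchar_1[OF \<alpha>] dchar_mult[OF \<alpha>] by simp
  have "coprime d (int M)"
  proof (rule coprimeI)
    fix x assume "x dvd d" "x dvd int M"
    then have "x dvd a * d - b * c" using c(2) by (meson dvd_diff dvd_mult dvd_trans)
    then show "is_unit x" using det by simp
  qed
  then have bd: "\<beta> d * cnj (\<beta> d) = 1" by (rule dchar_mult_cnj[OF \<beta> M])
  define s where "s = \<alpha> d * cnj (\<beta> d)"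
  have s: "s * (\<alpha> a * \<beta> d) = 1"
    using arg_cong2[OF ad bd, of "(*)"] by (simp add: s_def mult_ac)
  have "s * twist (t * M) \<alpha> \<beta> (m * a + n * c) (m * b + n * d) = twist (t * M) \<alpha> \<beta> m n" for m n
    unfolding twist_transform[OF det N] mult.assoc[symmetric] using s by (simp add: mult.assoc)
  from eisI_transform[OF det z, where \<phi>' = "\<lambda>m n. s * twist (t * M) \<alpha> \<beta> m n", OF this]
  show ?thesis unfolding eisI_cmult by (simp add: s_def mult_ac)
qed

lemma dilate_minus: "dilate T \<alpha> (- m) = \<alpha> (- 1) * dilate T \<alpha> m"
proof (cases "int T dvd m")
  case True
  then show ?thesis using dchar_mult[OF \<alpha>, of "- 1" "m div int T"] by (simp add: dilate_def dvd_neg_div)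
qed (simp add: dilate_def)

text \<open>The product of the characters is odd, so the pairs (m, k) and (-m, -k) contribute
  equally and the differences double.\<close>

lemma twist_terms:
  "fhat M (twist T \<alpha> \<beta> a) c - fhat M (twist T \<alpha> \<beta> (- a)) (- c) = 2 * (dilate T \<alpha> a * fhat M \<beta> c)"
  "fhat M (twist T \<alpha> \<beta> a) (- c) - fhat M (twist T \<alpha> \<beta> (- a)) c = 2 * \<beta> (- 1) * (dilate T \<alpha> a * fhat M \<beta> c)"
proof -
  have bb: "\<beta> (- 1) * \<beta> (- 1) = 1" using dchar_mult[OF \<beta>, of "- 1" "- 1"] dchar_1[OF \<beta>] by simp
  have "\<alpha> (- 1) * (\<beta> (- 1) * \<beta> (- 1)) = - \<beta> (- 1)" using odd by (simp add: mult.assoc[symmetric])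
  then have a1: "\<alpha> (- 1) = - \<beta> (- 1)" using bb by simp
  have "fhat M (twist T \<alpha> \<beta> a) c - fhat M (twist T \<alpha> \<beta> (- a)) (- c) = (1 + \<beta> (- 1) * \<beta> (- 1)) * (dilate T \<alpha> a * fhat M \<beta> c)"
    unfolding fhat_twist dilate_minus fhat_minus[OF \<beta> M] a1 by (simp add: algebra_simps)
  then show "fhat M (twist T \<alpha> \<beta> a) c - fhat M (twist T \<alpha> \<beta> (- a)) (- c) = 2 * (dilate T \<alpha> a * fhat M \<beta> c)" by (simp add: bb)
  show "fhat M (twist T \<alpha> \<beta> a) (- c) - fhat M (twist T \<alpha> \<beta> (- a)) c = 2 * \<beta> (- 1) * (dilate T \<alpha> a * fhat M \<beta> c)"
    unfolding fhat_twist dilate_minus fhat_minus[OF \<beta> M] a1 by (simp add: algebra_simps)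
qed

lemma eis_a_twist:
  assumes T: "T \<ge> 1" and n: "n \<ge> 1"
  shows "eis_a w0 w1 M (twist T \<alpha> \<beta>) n = - (2 * of_real pi * \<i> / of_nat M) *
     (if T dvd n then \<Sum>c | c dvd n div T. \<alpha> (int (n div T div c)) * fhat M \<beta> (int c) *
        (w0 + w1 * of_real (ln (real c / (real M * real (T * (n div T div c)))))) else 0)"
proof -
  have d: "dilate T \<alpha> (int k) = (if T dvd k then \<alpha> (int (k div T)) else 0)" for k
    by (simp add: dilate_def zdiv_int)
  have "eis_a w0 w1 M (twist T \<alpha> \<beta>) n = - (2 * of_real pi * \<i> / of_nat M) * (\<Sum>c | c dvd n. if T dvd n div c then
      \<alpha> (int (n div c div T)) * fhat M \<beta> (int c) * (w0 + w1 * of_real (ln (real c / (real M * real (T * (n div c div T)))))) else 0)"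
    unfolding eis_a_def twist_terms d sum_distrib_left by (intro sum.cong refl) (simp add: mult_ac)
  then show ?thesis
    unfolding sum_divisors_dilate[OF n T, of "\<lambda>c r. \<alpha> (int r) * fhat M \<beta> (int c) * (w0 + w1 * of_real (ln (real c / (real M * real (T * r)))))"] .
qed

text \<open>Only m divisible by tM occur, hence M divides n = |mk| and the expansion is one in
  integral powers of q.\<close>

lemma eis_twist_support:
  assumes "\<not> M dvd n" shows "eis_a w0 w1 M (twist (t * M) \<alpha> \<beta>) n = 0" "eis_b w1 M (twist (t * M) \<alpha> \<beta>) n = 0"
proof -
  have "\<not> int (t * M) dvd int (n div c)" if "c dvd n" for c
  proof
    assume "int (t * M) dvd int (n div c)"
    then have "M dvd n div c" by (simp only: int_dvd_int_iff) (erule dvd_mult_right)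
    then show False using assms that by (metis dvd_div_mult_self dvd_mult2)
  qed
  then have d: "dilate (t * M) \<alpha> (int (n div c)) = 0" if "c dvd n" for c using that by (simp add: dilate_def)
  show "eis_a w0 w1 M (twist (t * M) \<alpha> \<beta>) n = 0" "eis_b w1 M (twist (t * M) \<alpha> \<beta>) n = 0"
    unfolding eis_a_def eis_b_def twist_terms using d by (simp_all add: sum.neutral)
qed

lemma eisI_twist_expansion:
  assumes z: "Im z > 0"
  shows "eisI w0 w1 (twist (t * M) \<alpha> \<beta>) z = maass_series (eis_c0 w0 w1 M (twist (t * M) \<alpha> \<beta>)) (eis_d0 w1 M (twist (t * M) \<alpha> \<beta>))
      (\<lambda>n. eis_a w0 w1 M (twist (t * M) \<alpha> \<beta>) (M * n)) (\<lambda>n. eis_b w1 M (twist (t * M) \<alpha> \<beta>) (M * n)) z"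
proof -
  have K: "t * L * M \<ge> 1" using t L M by (simp add: Suc_le_eq)
  have z': "of_nat M * (z / of_nat M) = z" using M by simp
  have h: "hser (\<lambda>n. eis_a w0 w1 M (twist (t * M) \<alpha> \<beta>) (M * n)) z = hser (eis_a w0 w1 M (twist (t * M) \<alpha> \<beta>)) (z / of_nat M)"
    using hser_dilate[where a = "eis_a w0 w1 M (twist (t * M) \<alpha> \<beta>)" and z = "z / of_nat M", OF M eis_twist_support(1)] unfolding z' .
  have n: "nser (\<lambda>n. eis_b w1 M (twist (t * M) \<alpha> \<beta>) (M * n)) z = nser (eis_b w1 M (twist (t * M) \<alpha> \<beta>)) (z / of_nat M)"
    using nser_dilate[where b = "eis_b w1 M (twist (t * M) \<alpha> \<beta>)" and z = "z / of_nat M", OF M eis_twist_support(2)] unfolding z' .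
  show ?thesis
    unfolding maass_series_def h n by (rule eisI_expansion[where \<phi> = "twist (t * M) \<alpha> \<beta>", OF M K twist_periodic twist_periodic_level(2) z])
qed

lemma poly_seq_twist:
  "poly_seq (\<lambda>n. eis_a w0 w1 M (twist (t * M) \<alpha> \<beta>) (M * n))" "poly_seq (\<lambda>n. eis_b w1 M (twist (t * M) \<alpha> \<beta>) (M * n))"
proof -
  have K: "t * L * M \<ge> 1" using t L M by (simp add: Suc_le_eq)
  note p = poly_seq_eis[where \<phi> = "twist (t * M) \<alpha> \<beta>", OF M K twist_periodic twist_periodic_level(2)]
  show "poly_seq (\<lambda>n. eis_a w0 w1 M (twist (t * M) \<alpha> \<beta>) (M * n))" by (rule poly_seq_dilate[OF p(1)])
  show "poly_seq (\<lambda>n. eis_b w1 M (twist (t * M) \<alpha> \<beta>) (M * n))" by (rule poly_seq_dilate[OF p(2)])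
qed

text \<open>The row m = 0 contributes \<open>\<alpha> 0\<close> times moments of \<beta> at u = 1.
  Frequency 0 contributes the residue sum of \<beta> times moments of the dilated \<alpha> at u =
  1/2.\<close>

lemma eis_c0_twist:
  "eis_c0 w0 w1 M (twist (t * M) \<alpha> \<beta>) = of_real pi / 2 * (\<alpha> 0 * (w0 * Lam \<beta> 1 + w1 * Lam' \<beta> 1))
     - of_real pi * \<i> / (2 * of_nat M) * (fhat M \<beta> 0 * (w0 * Lam \<alpha> (1 / 2)
        + w1 * (Lam' \<alpha> (1 / 2) - 2 * of_real (ln (real (t * M))) * Lam \<alpha> (1 / 2))))"
proof -
  have T: "t * M \<ge> 1" using t M by (simp add: Suc_le_eq)
  have 0: "twist (t * M) \<alpha> \<beta> 0 = (\<lambda>n. \<alpha> 0 * \<beta> n)" by (simp add: fun_eq_iff twist_def dilate_def)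
  have g: "(\<lambda>m. fhat M (twist (t * M) \<alpha> \<beta> m) 0) = (\<lambda>m. fhat M \<beta> 0 * dilate (t * M) \<alpha> m)"
    by (simp add: fun_eq_iff fhat_twist mult.commute)
  show ?thesis
    unfolding eis_c0_def 0 g Lam_cmult Lam_dilate[where f = \<alpha>, OF T L dchar_periodic[OF \<alpha>]] by (simp add: algebra_simps)
qed

text \<open>The two sources are nonzero only for \<alpha> trivial modulo 1 and for \<beta> trivial
  modulo M, respectively. Oddness excludes both at once, so the cases do not overlap. With the
  weights log pi + gamma and 1 the moments combine into derivatives of L-functions.\<close>

lemma eis_c0_twist_cases:
  shows "\<alpha> = trivial_character 1 \<Longrightarrow> eis_c0 (of_real (ln pi + euler_mascheroni)) 1 M (twist (t * M) \<alpha> \<beta>) = 2 * deriv (dirichlet_L \<beta>) 1"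
    and "\<alpha> = trivial_character 1 \<Longrightarrow> eis_c0 1 0 M (twist (t * M) \<alpha> \<beta>) = dirichlet_L \<beta> 1"
    and "\<alpha> \<noteq> trivial_character 1 \<Longrightarrow> \<beta> = trivial_character M \<Longrightarrow> eis_c0 (of_real (ln pi + euler_mascheroni)) 1 M (twist (t * M) \<alpha> \<beta>)
       = 2 * of_real pi * \<i> * (of_real (ln (2 * real t * real M)) * dirichlet_L \<alpha> 0 - deriv (dirichlet_L \<alpha>) 0) * euler_product_at M"
    and "\<alpha> \<noteq> trivial_character 1 \<Longrightarrow> \<beta> = trivial_character M \<Longrightarrow> eis_c0 1 0 M (twist (t * M) \<alpha> \<beta>)
       = - of_real pi * \<i> * dirichlet_L \<alpha> 0 * euler_product_at M"
    and "\<alpha> \<noteq> trivial_character 1 \<Longrightarrow> \<beta> \<noteq> trivial_character M \<Longrightarrow> eis_c0 w0 w1 M (twist (t * M) \<alpha> \<beta>) = 0"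
    and "\<not> (\<alpha> = trivial_character 1 \<and> \<beta> = trivial_character M)"
proof -
  have tr: "trivial_character N (- 1) = 1" for N by (simp add: trivial_character_def)
  show nb: "\<not> (\<alpha> = trivial_character 1 \<and> \<beta> = trivial_character M)"
    using odd tr[of 1] tr[of M] by (metis mult_1 one_neq_neg_one)
  note a0 = dchar_at_0[OF \<alpha> L] and b0 = fhat_0[OF \<beta> M]
  {
    assume a: "\<alpha> = trivial_character 1"
    have "\<beta> (- 1) = - 1" using odd tr[of 1] by (simp add: a)
    then have o: "\<beta> (- n) = - \<beta> n" for n using dchar_mult[OF \<beta>, of "- 1" n] by simp
    note v = odd_L_values[where f = \<beta>, OF M dchar_periodic[OF \<beta>] o]
    have f0: "fhat M \<beta> 0 = 0" using nb a b0 by simp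
    have a1: "\<alpha> 0 = 1" using a0 a by simp
    show "eis_c0 (of_real (ln pi + euler_mascheroni)) 1 M (twist (t * M) \<alpha> \<beta>) = 2 * deriv (dirichlet_L \<beta>) 1"
      unfolding eis_c0_twist f0 a1 v by (simp add: algebra_simps)
    show "eis_c0 1 0 M (twist (t * M) \<alpha> \<beta>) = dirichlet_L \<beta> 1"
      unfolding eis_c0_twist f0 a1 v by simp
  }
  {
    assume a: "\<alpha> \<noteq> trivial_character 1"
    have a1: "\<alpha> 0 = 0" using a0 a by simp
    show "eis_c0 w0 w1 M (twist (t * M) \<alpha> \<beta>) = 0" if "\<beta> \<noteq> trivial_character M"
      unfolding eis_c0_twist a1 using b0 that by simp
    assume b: "\<beta> = trivial_character M"
    have "\<alpha> (- 1) = - 1" using odd tr[of M] by (simp add: b)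
    then have o: "\<alpha> (- n) = - \<alpha> n" for n using dchar_mult[OF \<alpha>, of "- 1" n] by simp
    note v = odd_L_values[where f = \<alpha>, OF L dchar_periodic[OF \<alpha>] o]
    have f0: "fhat M \<beta> 0 = of_nat M * euler_product_at M" using b b0 by simp
    have M0: "complex_of_nat M \<noteq> 0" using M by simp
    \<comment> \<open>The two summands have different origins: log 2 from Digamma(1/2), log(tM) from
      the dilation.\<close>
    have l: "ln (2 * real t * real M) = ln 2 + ln (real (t * M))" using t M by (simp add: ln_mult)
    define P where "P = euler_product_at M"
    define A where "A = Lam \<alpha> (1 / 2)"
    define B where "B = Lam' \<alpha> (1 / 2)"
    have c: "of_real pi * \<i> / (2 * of_nat M) * (of_nat M * P * u) = of_real pi * \<i> / 2 * P * u" for u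
      using M0 by simp
    show "eis_c0 (of_real (ln pi + euler_mascheroni)) 1 M (twist (t * M) \<alpha> \<beta>)
       = 2 * of_real pi * \<i> * (of_real (ln (2 * real t * real M)) * dirichlet_L \<alpha> 0 - deriv (dirichlet_L \<alpha>) 0) * euler_product_at M"
      unfolding eis_c0_twist a1 f0 v l P_def[symmetric] A_def[symmetric] B_def[symmetric] c of_real_add of_real_mult by (simp add: field_simps)
    show "eis_c0 1 0 M (twist (t * M) \<alpha> \<beta>) = - of_real pi * \<i> * dirichlet_L \<alpha> 0 * euler_product_at M"
      unfolding eis_c0_twist a1 f0 v P_def[symmetric] A_def[symmetric] B_def[symmetric] c by simp
  }
qed

end

lemma divisor_gcd_set: "{d. d dvd l \<and> int d dvd int c} = {d. d dvd gcd l c}"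
  by auto

text \<open>The Gauss sum in front merges with the inner divisor sum into \<open>fhat\<close>, the
  form in which Poisson summation delivers the coefficients.\<close>

lemma sigma0_fhat:
  assumes \<beta>: "dirichlet_character M \<beta>" and M: "M \<ge> 1"
  shows "gauss_sum (conductor M \<beta>) (inducing_primitive M \<beta>) * sigma0 \<alpha> M (conj_character \<beta>) n
     = (\<Sum>c | c dvd n. \<alpha> (int (n div c)) * fhat M \<beta> (int c))"
  unfolding sigma0_def Let_def sum_distrib_left fhat_induced[OF \<beta> M] divisor_gcd_set inducing_primitive_conj[OF \<beta> M]
    conductor_index_def conductor_conj
  by (intro sum.cong refl) (simp add: sum_distrib_left sum_distrib_right conj_character_def zdiv_int mult_ac)

lemma sigma0_log_fhat:
  assumes \<beta>: "dirichlet_character M \<beta>" and M: "M \<ge> 1"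
  shows "gauss_sum (conductor M \<beta>) (inducing_primitive M \<beta>) * sigma0_log \<psi> M \<beta> n
     = (\<Sum>c | c dvd n. conj_character \<psi> (int (n div c)) * of_real (ln (real c)) * fhat M \<beta> (int c))"
  unfolding sigma0_log_def Let_def sum_distrib_left fhat_induced[OF \<beta> M] divisor_gcd_set
    conductor_index_def
  by (intro sum.cong refl) (simp add: sum_distrib_left sum_distrib_right conj_character_def zdiv_int mult_ac)

section \<open>The harmonic Maass form\<close>

lemma trivial_conj_iff: "conj_character f = trivial_character N \<longleftrightarrow> f = trivial_character N"
proof -
  have c: "conj_character (trivial_character N) = trivial_character N"
    by (simp add: fun_eq_iff conj_character_def trivial_character_def)
  show ?thesis
  proof
    assume "conj_character f = trivial_character N"
    then have "conj_character (conj_character f) = conj_character (trivial_character N)" by (simp only:)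
    then show "f = trivial_character N" by (simp add: c)
  qed (simp add: c)
qed

lemma has_sum_add_const_term:
  fixes f :: "nat \<Rightarrow> complex"
  assumes "(f has_sum S) UNIV" "f 0 = 0"
  shows "((\<lambda>n. if n = 0 then c else f n) has_sum (c + S)) UNIV"
proof -
  have "((\<lambda>n::nat. if n = 0 then c else 0) has_sum c) {0}" by (rule has_sum_finiteI) simp_all
  then have "((\<lambda>n::nat. if n = 0 then c else 0) has_sum c) UNIV"
    by (rule has_sum_cong_neutral[THEN iffD1, rotated -1]) auto
  from has_sum_add[OF this assms(1)] show ?thesis
    by (rule has_sum_cong[THEN iffD1, rotated]) (use assms(2) in auto)
qed

context
  fixes L M t :: nat and \<psi> \<rho> :: "int \<Rightarrow> complex"
  assumes L: "L \<ge> 1" and M: "M \<ge> 1" and t: "t \<ge> 1"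
    and \<psi>: "dirichlet_character L \<psi>" and \<rho>: "dirichlet_character M \<rho>"
    and odd: "\<psi> (-1) * \<rho> (-1) = -1"
begin

text \<open>Values at -1 are signs, hence unchanged by conjugation.\<close>

lemma conj_odd: "conj_character \<psi> (-1) * \<rho> (-1) = -1" "\<psi> (-1) * conj_character \<rho> (-1) = -1"
proof -
  have 1: "f (-1) = 1 \<or> f (-1) = -1" if "dirichlet_character N f" for N f
  proof -
    have "f (-1) * f (-1) = 1" using dchar_mult[OF that, of "-1" "-1"] dchar_1[OF that] by simp
    then show ?thesis by (simp add: square_eq_1_iff)
  qed
  show "conj_character \<psi> (-1) * \<rho> (-1) = -1" "\<psi> (-1) * conj_character \<rho> (-1) = -1"
    using 1[OF \<psi>] 1[OF \<rho>] odd by (auto simp: conj_character_def)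
qed

text \<open>The conjugate of \<psi> is paired with \<rho> itself: since the second character enters
  the multiplier conjugated, the derivative moment gets the conjugate of the product as its
  character, and conjugating the function gives the pair that belongs to \<open>E1t\<close>.\<close>

definition \<Phi> :: "int \<Rightarrow> int \<Rightarrow> complex" where "\<Phi> = twist (t * M) (conj_character \<psi>) \<rho>"

lemma cnj_\<Phi>: "(\<lambda>m n. cnj (\<Phi> m n)) = twist (t * M) \<psi> (conj_character \<rho>)"
  by (simp add: fun_eq_iff \<Phi>_def twist_def dilate_def conj_character_def)

lemmas mock_facts = L M t dchar_conj[OF \<psi>] \<rho> conj_odd(1)
lemmas shadow_facts = L M t \<psi> dchar_conj[OF \<rho>] conj_odd(2)

lemma mock_constant: "eis_c0 (of_real (ln pi + euler_mascheroni)) 1 M \<Phi> = c1_plus 0 t \<psi> M \<rho>"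
proof -
  note c = eis_c0_twist_cases[OF mock_facts, folded \<Phi>_def, unfolded trivial_conj_iff]
  show ?thesis unfolding c1_plus_def using c(1) c(3) c(5) by auto
qed

lemma shadow_constant: "eis_c0 1 0 M (twist (t * M) \<psi> (conj_character \<rho>)) = eis_C1 \<psi> \<rho> + eis_D \<psi> M \<rho>"
proof -
  note c = eis_c0_twist_cases[OF shadow_facts, unfolded trivial_conj_iff]
  show ?thesis unfolding eis_C1_def eis_D_def using c(2) c(4) c(5) c(6) by auto
qed

text \<open>With n = tcr the logarithm of c/(M tM r) equals 2 log c - 2 log M - log n. Together with
  log pi + gamma this separates the multiple of log(pi/M^2) + gamma - log n from the sum with 2 log
  c.\<close>

lemma mock_coefficient:
  assumes n: "n \<ge> 1"
  shows "eis_a (of_real (ln pi + euler_mascheroni)) 1 M \<Phi> (M * n) = c1_plus n t \<psi> M \<rho>"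
proof -
  define W where "W = gauss_sum (conductor M \<rho>) (inducing_primitive M \<rho>)"
  have T: "t * M \<ge> 1" "M * n \<ge> 1" using t M n by (simp_all add: Suc_le_eq)
  have M0: "M \<noteq> 0" "t \<noteq> 0" using M t by auto
  have dv: "t * M dvd M * n \<longleftrightarrow> t dvd n" using M0 by (simp add: mult.commute[of t])
  have dq: "M * n div (t * M) = n div t" using M0 by (simp add: mult.commute[of t])
  define l where "l = complex_of_real (ln (pi / real M ^ 2) + euler_mascheroni - ln (real n))"
  show ?thesis
  proof (cases "t dvd n")
    case True
    define q where "q = n div t"
    have q: "n = t * q" using True by (simp add: q_def)
    have q0: "q \<ge> 1" using n q by (cases "q = 0") auto
    have tm: "conj_character \<psi> (int (q div c)) * fhat M \<rho> (int c) *
        (of_real (ln pi + euler_mascheroni) + 1 * of_real (ln (real c / (real M * real (t * M * (q div c))))))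
      = conj_character \<psi> (int (q div c)) * fhat M \<rho> (int c) * l + 2 * (conj_character \<psi> (int (q div c)) * of_real (ln (real c)) * fhat M \<rho> (int c))"
      if c: "c dvd q" for c
    proof -
      obtain r where r: "q = c * r" using c by blast
      have rc: "r \<noteq> 0" "c \<noteq> 0" using q0 r by auto
      have d: "q div c = r" using rc by (simp add: r)
      have ln1: "ln (real c / (real M * real (t * M * r))) = ln (real c) - (2 * ln (real M) + ln (real t) + ln (real r))"
        using M0 rc by (simp add: ln_div ln_mult)
      have ln2: "ln (pi / real M ^ 2) + euler_mascheroni - ln (real n) = ln pi - 2 * ln (real M) + euler_mascheroni - (ln (real t) + (ln (real c) + ln (real r)))"
        using M0 rc by (simp add: ln_div ln_mult ln_realpow q r)
      have "of_real (ln pi + euler_mascheroni) + 1 * of_real (ln (real c / (real M * real (t * M * r)))) = l + 2 * complex_of_real (ln (real c))"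
        unfolding l_def ln1 ln2 by simp
      then show ?thesis unfolding d by (simp only:) (simp add: algebra_simps)
    qed
    have "eis_a (of_real (ln pi + euler_mascheroni)) 1 M \<Phi> (M * n) = - (2 * of_real pi * \<i> / of_nat M) *
      (\<Sum>c | c dvd q. conj_character \<psi> (int (q div c)) * fhat M \<rho> (int c) * l + 2 * (conj_character \<psi> (int (q div c)) * of_real (ln (real c)) * fhat M \<rho> (int c)))"
      unfolding \<Phi>_def eis_a_twist[OF mock_facts T] dv dq q_def[symmetric] using True tm by (simp add: mult.assoc)
    also have "\<dots> = - (2 * of_real pi * \<i> / of_nat M) * ((W * sigma0 (conj_character \<psi>) M (conj_character \<rho>) q) * l + 2 * (W * sigma0_log \<psi> M \<rho> q))"
      unfolding W_def sigma0_fhat[OF \<rho> M] sigma0_log_fhat[OF \<rho> M] sum.distrib sum_distrib_left sum_distrib_right ..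
    also have "\<dots> = c1_plus n t \<psi> M \<rho>"
      unfolding c1_plus_def at_quotient_def W_def[symmetric] l_def[symmetric] using True n by (simp add: q_def[symmetric] algebra_simps)
    finally show ?thesis .
  next
    case False
    then show ?thesis
      unfolding \<Phi>_def eis_a_twist[OF mock_facts T] dv using n by (simp add: c1_plus_def at_quotient_def)
  qed
qed

lemma shadow_coefficient:
  "eis_a 1 0 M (twist (t * M) \<psi> (conj_character \<rho>)) (M * (t * n)) = - (2 * of_real pi * \<i> / of_nat M) *
     (gauss_sum (conductor M \<rho>) (conj_character (inducing_primitive M \<rho>)) * sigma0 \<psi> M \<rho> n)"
proof (cases "n = 0")
  case True
  \<comment> \<open>At n = 0 both divisor sums range over an infinite set and are 0 by
    convention.\<close>
  have "infinite (UNIV :: nat set)" by simp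
  then show ?thesis unfolding True by (simp add: eis_a_def sigma0_def)
next
  case False
  have T: "t * M \<ge> 1" "M * (t * n) \<ge> 1" using t M False by (simp_all add: Suc_le_eq)
  have dv: "t * M dvd M * (t * n)" "M * (t * n) div (t * M) = n"
    using t M by (auto simp: mult.assoc[symmetric] mult.commute[of t])
  show ?thesis
    unfolding eis_a_twist[OF shadow_facts T] using sigma0_fhat[OF dchar_conj[OF \<rho>] M, of \<psi> n] dv
    by (simp add: inducing_primitive_conj[OF \<rho> M] conductor_conj)
qed

lemma shadow_support:
  assumes "\<not> t dvd n" shows "eis_a 1 0 M (twist (t * M) \<psi> (conj_character \<rho>)) (M * n) = 0"
proof -
  have n: "n \<ge> 1" using assms by (cases "n = 0") auto
  have T: "t * M \<ge> 1" "M * n \<ge> 1" using t M n by (simp_all add: Suc_le_eq)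
  have "\<not> t * M dvd M * n" using assms M by (simp add: mult.commute[of t])
  then show ?thesis unfolding eis_a_twist[OF shadow_facts T] by simp
qed

text \<open>Both sides are compared through their q-expansions; the support on multiples of t turns
  the series in z into one in tz.\<close>

lemma E1t_eq_eisI:
  assumes z: "Im z > 0" shows "E1t t \<psi> M \<rho> z = eisI 1 0 (twist (t * M) \<psi> (conj_character \<rho>)) z"
proof -
  define \<phi> where "\<phi> = twist (t * M) \<psi> (conj_character \<rho>)"
  define a where "a n = eis_a 1 0 M \<phi> (M * n)" for n
  define C where "C = - (2 * of_real pi * \<i> / of_nat M) * gauss_sum (conductor M \<rho>) (conj_character (inducing_primitive M \<rho>))"
  have tz: "Im (of_nat t * z) > 0" using z t by simp
  have "poly_seq a" using poly_seq_twist(1)[OF shadow_facts, of 1 0] by (simp add: a_def[abs_def] \<phi>_def)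
  then have p: "poly_seq (\<lambda>n. a (t * n))" by (rule poly_seq_dilate)
  have at: "a (t * n) = C * sigma0 \<psi> M \<rho> n" for n
    unfolding a_def \<phi>_def C_def shadow_coefficient by (simp only: mult.assoc)
  have a0: "a (t * 0) = 0" using p unfolding poly_seq_def by blast
  have sm: "summable (\<lambda>n. a (t * n) * qpow (int n) (of_nat t * z))"
    by (rule summable_norm_cancel[OF hser_norm_summable[OF p tz]])
  have "hser a z = hser (\<lambda>n. a (t * n)) (of_nat t * z)"
    by (rule hser_dilate[OF t, symmetric]) (simp add: a_def \<phi>_def shadow_support)
  also have "\<dots> = (\<Sum>n. a (t * n) * qpow (int n) (of_nat t * z))"
    unfolding hser_def by (rule infsum_nat_eq_suminf(2)[OF hser_norm_summable[OF p tz]])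
  also have "\<dots> = (\<Sum>n. a (t * Suc n) * qpow (int (Suc n)) (of_nat t * z))"
    using suminf_split_head[OF sm] a0 by simp
  also have "\<dots> = (\<Sum>n. C * (sigma0 \<psi> M \<rho> (Suc n) * qpow (int (Suc n)) (of_nat t * z)))"
    unfolding at by (simp only: mult.assoc)
  also have "\<dots> = C * (\<Sum>n. sigma0 \<psi> M \<rho> (Suc n) * qpow (int (Suc n)) (of_nat t * z))"
  \<comment> \<open>For nonzero C the convergence of the scaled series is divided by C; for C = 0
    both sides are 0.\<close>
  proof (cases "C = 0")
    case False
    have "summable (\<lambda>n. a (t * Suc n) * qpow (int (Suc n)) (of_nat t * z))"
      using sm by (subst summable_Suc_iff)
    then have "summable (\<lambda>n. C * (sigma0 \<psi> M \<rho> (Suc n) * qpow (int (Suc n)) (of_nat t * z)))"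
      unfolding at by (simp only: mult.assoc)
    then have "summable (\<lambda>n. sigma0 \<psi> M \<rho> (Suc n) * qpow (int (Suc n)) (of_nat t * z))"
      using False by (simp only: summable_cmult_iff) simp
    then show ?thesis by (rule suminf_mult)
  qed simp
  finally have h: "hser a z = C * (\<Sum>n. sigma0 \<psi> M \<rho> (Suc n) * qpow (int (Suc n)) (of_nat t * z))" .
  have "eisI 1 0 \<phi> z = eis_c0 1 0 M \<phi> + hser a z"
    unfolding \<phi>_def eisI_twist_expansion[OF shadow_facts z] maass_series_def a_def[abs_def]
    by (simp add: eis_d0_def eis_b_def nser_def)
  then show ?thesis unfolding E1t_def E1_def h \<phi>_def shadow_constant C_def by simp
qed

text \<open>Defined by its expansion, from which analyticity, harmonicity and shadow are read off;
  its equality with \<open>eisI\<close> on the upper half-plane brings modularity and growth at the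
  cusps.\<close>

definition maass_form :: "complex \<Rightarrow> complex" where
  "maass_form = maass_series (c1_plus 0 t \<psi> M \<rho>) (eis_d0 1 M \<Phi>)
     (\<lambda>n. eis_a (of_real (ln pi + euler_mascheroni)) 1 M \<Phi> (M * n)) (\<lambda>n. eis_b 1 M \<Phi> (M * n))"

lemmas maass_form_poly_seq = poly_seq_twist[OF mock_facts, folded \<Phi>_def]

lemma maass_form_eq_eisI:
  "Im z > 0 \<Longrightarrow> maass_form z = eisI (of_real (ln pi + euler_mascheroni)) 1 \<Phi> z"
  unfolding maass_form_def mock_constant[symmetric] \<Phi>_def by (rule eisI_twist_expansion[OF mock_facts, symmetric])

text \<open>Two descriptions serve two purposes: the series gives the coefficients asked for by
  \<open>holomorphic_part\<close>, the Mellin moment gives holomorphy at all cusps and the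
  comparison with the Eisenstein series.\<close>

lemma maass_form_xi1:
  assumes z: "Im z > 0"
  shows "xi1 maass_form z = cnj (eis_d0 1 M \<Phi>) - hser (\<lambda>n. cnj (eis_b 1 M \<Phi> (M * n))) z"
    and "xi1 maass_form z = eisI 1 0 (twist (t * M) \<psi> (conj_character \<rho>)) z"
proof -
  show 1: "xi1 maass_form z = cnj (eis_d0 1 M \<Phi>) - hser (\<lambda>n. cnj (eis_b 1 M \<Phi> (M * n))) z"
    unfolding maass_form_def by (rule maass_series_xi1[OF maass_form_poly_seq z])
  have "hser (\<lambda>n. - 1 * cnj (eis_b 1 M \<Phi> (M * n))) z = - 1 * hser (\<lambda>n. cnj (eis_b 1 M \<Phi> (M * n))) z" by (rule hser_cmult)
  then have "- hser (\<lambda>n. cnj (eis_b 1 M \<Phi> (M * n))) z = hser (\<lambda>n. eis_a 1 0 M (twist (t * M) \<psi> (conj_character \<rho>)) (M * n)) z"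
    by (simp add: eis_conjugate(1) cnj_\<Phi>)
  moreover have "eisI 1 0 (twist (t * M) \<psi> (conj_character \<rho>)) z = eis_c0 1 0 M (twist (t * M) \<psi> (conj_character \<rho>))
      + hser (\<lambda>n. eis_a 1 0 M (twist (t * M) \<psi> (conj_character \<rho>)) (M * n)) z"
    unfolding eisI_twist_expansion[OF shadow_facts z] maass_series_def by (simp add: eis_d0_def eis_b_def nser_def)
  ultimately show "xi1 maass_form z = eisI 1 0 (twist (t * M) \<psi> (conj_character \<rho>)) z"
    unfolding 1 eis_conjugate(2) cnj_\<Phi> by (simp only: diff_conv_add_uminus)
qed

lemma level_pos: "t * L * M \<ge> 1"
  using t L M by (simp add: Suc_le_eq)

lemma maass_form_H1: "maass_form \<in> H1 (t * L * M) (conj_character (\<lambda>a. \<psi> a * \<rho> a))"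
  unfolding H1_def
proof (intro CollectI conjI ballI)
  show "real_analytic_on maass_form upper_half_plane"
    unfolding maass_form_def by (rule maass_series_real_analytic[OF maass_form_poly_seq])
  show "Delta1 maass_form z = 0" if "z \<in> upper_half_plane" for z
    unfolding maass_form_def by (rule maass_series_Delta1[OF maass_form_poly_seq]) (use that in \<open>simp add: upper_half_plane_def\<close>)
  show "transforms_weight1 (t * L * M) (conj_character (\<lambda>a. \<psi> a * \<rho> a)) maass_form"
    unfolding transforms_weight1_def
  proof (intro allI impI ballI)
    fix a b c d :: int and z assume h: "a * d - b * c = 1 \<and> int (t * L * M) dvd c" and z: "z \<in> upper_half_plane"
    have y: "Im z > 0" using z by (simp add: upper_half_plane_def)
    have y': "Im ((of_int a * z + of_int b) / (of_int c * z + of_int d)) > 0"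
      using moebius_upper_half_plane[of a d b c z] h z by (simp add: upper_half_plane_def)
    show "maass_form ((of_int a * z + of_int b) / (of_int c * z + of_int d)) =
       conj_character (\<lambda>a. \<psi> a * \<rho> a) d * (of_int c * z + of_int d) * maass_form z"
      unfolding maass_form_eq_eisI[OF y] maass_form_eq_eisI[OF y'] \<Phi>_def
        eisI_twist_transform[OF mock_facts conjunct1[OF h] conjunct2[OF h] y] by (simp add: conj_character_def)
  qed
  show "linear_exponential_growth_at_cusps maass_form"
    by (rule linear_exponential_growth_at_cusps_cong[OF eisI_linear_exponential_growth[where \<phi> = "twist (t * M) (conj_character \<psi>) \<rho>", OF level_pos twist_periodic_level[OF mock_facts], folded \<Phi>_def]])
       (simp add: maass_form_eq_eisI upper_half_plane_def)
  show "holomorphic_at_cusps (xi1 maass_form)"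
    by (rule holomorphic_at_cusps_cong[OF eisI_holomorphic_at_cusps[where \<phi> = "twist (t * M) \<psi> (conj_character \<rho>)", OF level_pos twist_periodic_level[OF shadow_facts]]])
       (simp add: maass_form_xi1(2) upper_half_plane_def)
qed

lemma maass_form_holomorphic_part: "holomorphic_part maass_form (G1 t \<psi> M \<rho>)"
  unfolding holomorphic_part_def
proof (intro exI conjI ballI)
  fix z assume "z \<in> upper_half_plane"
  then have z: "Im z > 0" by (simp add: upper_half_plane_def)
  define a where "a n = eis_a (of_real (ln pi + euler_mascheroni)) 1 M \<Phi> (M * n)" for n
  define b where "b n = eis_b 1 M \<Phi> (M * n)" for n
  have pa: "poly_seq a" and pb: "poly_seq b" using maass_form_poly_seq by (simp_all add: a_def[abs_def] b_def[abs_def])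
  have a0: "a 0 = 0" and b0: "b 0 = 0" using pa pb by (simp_all add: poly_seq_def)
  \<comment> \<open>The nonholomorphic series of the definition is subtracted, while
    \<open>maass_series\<close> adds \<open>nser\<close>, hence the minus sign for positive n. At n
    = 0, \<open>beta1\<close> is -log y and the two signs cancel.\<close>
  define c where "c n = (if n = 0 then cnj (eis_d0 1 M \<Phi>) else - cnj (b n))" for n
  have "((\<lambda>n. if n = 0 then c1_plus 0 t \<psi> M \<rho> else a n * qpow (int n) z) has_sum (c1_plus 0 t \<psi> M \<rho> + hser a z)) UNIV"
    by (rule has_sum_add_const_term[OF hser_has_sum[OF pa z]]) (simp add: a0)
  moreover have "(if n = 0 then c1_plus 0 t \<psi> M \<rho> else a n * qpow (int n) z) = c1_plus n t \<psi> M \<rho> * qpow (int n) z" for n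
    using mock_coefficient[of n] by (simp add: a_def qpow_def Suc_le_eq)
  ultimately have G: "((\<lambda>n. c1_plus n t \<psi> M \<rho> * qpow (int n) z) has_sum (c1_plus 0 t \<psi> M \<rho> + hser a z)) UNIV" by (simp only:)
  then have G1: "G1 t \<psi> M \<rho> z = c1_plus 0 t \<psi> M \<rho> + hser a z"
    unfolding G1_def by (rule sums_unique[OF has_sum_imp_sums, symmetric])
  have "(((\<lambda>n. c1_plus (nat n) t \<psi> M \<rho> * qpow n z) \<circ> int) has_sum G1 t \<psi> M \<rho> z) UNIV"
    using G unfolding G1 comp_def by simp
  then have "((\<lambda>n. c1_plus (nat n) t \<psi> M \<rho> * qpow n z) has_sum G1 t \<psi> M \<rho> z) (range int)"
    by (subst has_sum_reindex) auto
  moreover have "range int = {0..}"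
  proof
    show "{0..} \<subseteq> range int"
    proof
      fix x :: int assume "x \<in> {0..}"
      then have "x = int (nat x)" by simp
      then show "x \<in> range int" by (rule range_eqI)
    qed
  qed auto
  ultimately show "((\<lambda>n. c1_plus (nat n) t \<psi> M \<rho> * qpow n z) has_sum G1 t \<psi> M \<rho> z) {0..}" by simp
  have F: "maass_form z = G1 t \<psi> M \<rho> z + eis_d0 1 M \<Phi> * of_real (ln (Im z)) + nser b z"
    unfolding maass_form_def maass_series_def G1 a_def[abs_def] b_def[abs_def] by simp
  have "((\<lambda>n. - (b n * of_real (e1int (real n * Im z)) * qpow (- int n) z)) has_sum (- nser b z)) UNIV"
    using nser_has_sum(1)[OF pb z] by (simp only: has_sum_uminus minus_minus)
  from has_sum_add_const_term[OF this, of "- eis_d0 1 M \<Phi> * of_real (ln (Im z))"]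
  have "((\<lambda>n. if n = 0 then - eis_d0 1 M \<Phi> * of_real (ln (Im z)) else - (b n * of_real (e1int (real n * Im z)) * qpow (- int n) z)) has_sum (G1 t \<psi> M \<rho> z - maass_form z)) UNIV"
    by (simp add: F b0)
  moreover have "(if n = 0 then - eis_d0 1 M \<Phi> * of_real (ln (Im z)) else - (b n * of_real (e1int (real n * Im z)) * qpow (- int n) z)) = cnj (c n) * of_real (beta1 n (Im z)) * qpow (- int n) z" for n
    using beta1_eq_e1int[of n "Im z"] z by (simp add: c_def beta1_0 qpow_def Suc_le_eq)
  ultimately show "((\<lambda>n. cnj (if n = 0 then cnj (eis_d0 1 M \<Phi>) else - cnj (eis_b 1 M \<Phi> (M * n))) * of_real (beta1 n (Im z)) * qpow (- int n) z) has_sum (G1 t \<psi> M \<rho> z - maass_form z)) UNIV"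
    by (simp only: c_def b_def)
  have hs: "((\<lambda>n. - (cnj (b n) * qpow (int n) z)) has_sum (- hser (\<lambda>n. cnj (b n)) z)) UNIV"
    using hser_has_sum[OF poly_seq_cnj[OF pb] z] by (simp only: has_sum_uminus minus_minus)
  have bb: "(\<lambda>n. cnj (eis_b 1 M \<Phi> (M * n))) = (\<lambda>n. cnj (b n))" by (simp add: b_def)
  from has_sum_add_const_term[OF hs, of "cnj (eis_d0 1 M \<Phi>)"]
  have "((\<lambda>n. if n = 0 then cnj (eis_d0 1 M \<Phi>) else - (cnj (b n) * qpow (int n) z)) has_sum xi1 maass_form z) UNIV"
    unfolding maass_form_xi1(1)[OF z] bb by (simp add: b0)
  moreover have "(if n = 0 then cnj (eis_d0 1 M \<Phi>) else - (cnj (b n) * qpow (int n) z)) = c n * qpow (int n) z" for n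
    by (simp add: c_def qpow_def)
  ultimately show "((\<lambda>n. (if n = 0 then cnj (eis_d0 1 M \<Phi>) else - cnj (eis_b 1 M \<Phi> (M * n))) * qpow (int n) z) has_sum xi1 maass_form z) UNIV"
    by (simp only: c_def b_def)
qed

lemma mock_modular_form1_G1:
  "mock_modular_form1 (t * L * M) (conj_character (\<lambda>a. \<psi> a * \<rho> a)) (E1t t \<psi> M \<rho>) (G1 t \<psi> M \<rho>)"
  unfolding mock_modular_form1_def
proof (intro bexI[OF _ maass_form_H1] conjI ballI maass_form_holomorphic_part)
  fix z assume "z \<in> upper_half_plane"
  then have "Im z > 0" by (simp add: upper_half_plane_def)
  then show "xi1 maass_form z = E1t t \<psi> M \<rho> z" by (simp add: maass_form_xi1(2) E1t_eq_eisI)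
qed

end

theorem theorem1p3:
  fixes L M t :: nat and \<psi> \<rho> :: "int \<Rightarrow> complex"
  assumes "L \<ge> 1" and "M \<ge> 1" and "t \<ge> 1"
    and "dirichlet_character L \<psi>" and "dirichlet_character M \<rho>"
    and "\<psi> (-1) * \<rho> (-1) = -1"
  shows "mock_modular_form1 (t * L * M) (conj_character (\<lambda>a. \<psi> a * \<rho> a))
           (E1t t \<psi> M \<rho>) (G1 t \<psi> M \<rho>)"
  using assms by (rule mock_modular_form1_G1)

end
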